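(* Let $\mathcal A$ be a linear homogeneous first-order differential operator with constant coefficients satisfying the constant rank property and property (ZL). A weak$*$ measurable map $\nu:T_N\to\mathcal M(\mathbb R^d)$ is an $\mathcal A$-$\infty$-Young measure if and only if $\nu_x\ge0$ for a.e. $x$ and there exist a compact $K\subset\mathbb R^d$ and $u\in L^\infty(T_N,\mathbb R^d)\cap\ker\mathcal A$ with (i) $\mathrm{spt}\,\nu_x\subset K$ for a.e. $x\in T_N$; (ii) $\langle\nu_x,\mathrm{id}\rangle=u(x)$ for a.e. $x\in T_N$; (iii) $\langle\nu_x,f\rangle\ge f(\langle\nu_x,\mathrm{id}\rangle)$ for a.e. $x\in T_N$ and all continuous $\mathcal A$-quasiconvex $f:\mathbb R^d\to\mathbb R$.
   Context: $\mathcal A u=\sum_{k=1}^N A_k\partial_k u$ for $u:\mathbb R^N\to\mathbb R^d$, $A_k:\mathbb R^d\to\mathbb R^l$ linear. Constant rank property: $\dim\ker(\sum_k\xi_kA_k)$ is constant in $\xi\in S^{N-1}$. $T_N=\mathbb R^N/\mathbb Z^N$; $u\in\ker\mathcal A$ means $\mathcal Au=0$ in the sense of distributions. Property (ZL): there is $C=C(\mathcal A)$ such that for every sequence $u_n\in L^1(T_N,\mathbb R^d)\cap\ker\mathcal A$ for which some $L>0$ satisfies $\int_{\{|u_n|>L\}}|u_n|\to0$, there exist $v_n\in L^1(T_N,\mathbb R^d)\cap\ker\mathcal A$ with $\|v_n\|_{L^\infty}\le CL$ and $\|v_n-u_n\|_{L^1}\to0$. A continuous $f:\mathbb R^d\to\mathbb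 R$ is $\mathcal A$-quasiconvex if $f(x)\le\int_{T_N}f(x+\phi)$ for all $x$ and all $\phi\in C^\infty(T_N,\mathbb R^d)$ with $\int_{T_N}\phi=0$, $\mathcal A\phi=0$. $\mathcal M(\mathbb R^d)$ is the space of finite signed Radon measures, $\langle\mu,f\rangle=\int f\,d\mu$, $\mathrm{id}$ the identity map. $\nu:T_N\to\mathcal M(\mathbb R^d)$ is weak$*$ measurable if $x\mapsto\langle\nu_x,f\rangle$ is measurable for all $f\in C_c(\mathbb R^d)$; it is generated by $v_j:T_N\to\mathbb R^d$ if $f(v_j)\overset{*}{\rightharpoonup}\langle\nu_x,f\rangle$ in $L^\infty(T_N)$ for all $f\in C_0(\mathbb R^d)$; it is an $\mathcal A$-$\infty$-Young measure if it is generated by a bounded sequence $(v_j)$ in $L^\infty(T_N,\mathbb R^d)$ with $\mathcal Av_j=0$. *)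

theory Defs
  imports "HOL-Analysis.Analysis"
begin

text \<open>Functions on T_N = R^N / Z^N are represented as Z^N-periodic functions on
  real^'n; the Haar (Lebesgue) measure of T_N is Lebesgue measure on the unit cube.\<close>

definition TN :: "(real^'n::finite) measure" where
  "TN = lebesgue_on (cbox 0 1)"

definition periodic :: "(real^'n::finite \<Rightarrow> 'b) \<Rightarrow> bool" where
  "periodic f \<longleftrightarrow> (\<forall>x i. f (x + axis i 1) = f x)"

definition L1T :: "(real^'n::finite \<Rightarrow> 'b::{banach,second_countable_topology}) \<Rightarrow> bool" where
  "L1T u \<longleftrightarrow> periodic u \<and> integrable TN u"

definition LinfT :: "(real^'n::finite \<Rightarrow> 'b::real_normed_vector) \<Rightarrow> bool" where
  "LinfT u \<longleftrightarrow> periodic u \<and> u \<in> borel_measurable TN \<and> (\<exists>M. AE x in TN. norm (u x) \<le> M)"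

definition partial :: "'n::finite \<Rightarrow> (real^'n \<Rightarrow> 'b::real_normed_vector) \<Rightarrow> real^'n \<Rightarrow> 'b" where
  "partial k f x = frechet_derivative f (at x) (axis k 1)"

fun iter_partial :: "'n::finite list \<Rightarrow> (real^'n \<Rightarrow> 'b::real_normed_vector) \<Rightarrow> real^'n \<Rightarrow> 'b" where
  "iter_partial [] f = f"
| "iter_partial (k # ks) f = partial k (iter_partial ks f)"

definition smooth :: "(real^'n::finite \<Rightarrow> 'b::real_normed_vector) \<Rightarrow> bool" where
  "smooth f \<longleftrightarrow> (\<forall>ks x. iter_partial ks f differentiable (at x))"

section \<open>The operator A u = sum_k A_k partial_k u\<close>

text \<open>A_k : R^d \<rightarrow> R^l is represented by the matrix A k.\<close>

definition constant_rank :: "('n::finite \<Rightarrow> real^'d::finite^'l::finite) \<Rightarrow> bool" where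
  "constant_rank A \<longleftrightarrow>
     (\<exists>r. \<forall>\<xi>::real^'n. norm \<xi> = 1 \<longrightarrow>
        dim {v::real^'d. (\<Sum>k\<in>UNIV. \<xi> $ k *\<^sub>R A k) *v v = 0} = r)"

text \<open>A u = 0 in the sense of distributions on T_N (tested with smooth periodic
  test functions).\<close>
definition kerA :: "('n::finite \<Rightarrow> real^'d::finite^'l::finite) \<Rightarrow> (real^'n \<Rightarrow> real^'d) \<Rightarrow> bool" where
  "kerA A u \<longleftrightarrow>
     (\<forall>\<phi>::real^'n \<Rightarrow> real^'l. smooth \<phi> \<and> periodic \<phi> \<longrightarrow>
        integral\<^sup>L TN (\<lambda>x. \<Sum>k\<in>UNIV. (A k *v u x) \<bullet> partial k \<phi> x) = 0)"

definition property_ZL :: "('n::finite \<Rightarrow> real^'d::finite^'l::finite) \<Rightarrow> bool" where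
  "property_ZL A \<longleftrightarrow>
     (\<exists>C::real. \<forall>(u::nat \<Rightarrow> real^'n \<Rightarrow> real^'d) (L::real).
        (\<forall>n. L1T (u n) \<and> kerA A (u n)) \<and> L > 0 \<and>
        (\<lambda>n. integral\<^sup>L TN (\<lambda>x. if norm (u n x) > L then norm (u n x) else 0))
           \<longlonglongrightarrow> 0
        \<longrightarrow> (\<exists>v::nat \<Rightarrow> real^'n \<Rightarrow> real^'d.
               (\<forall>n. L1T (v n) \<and> kerA A (v n) \<and> (AE x in TN. norm (v n x) \<le> C * L)) \<and>
               (\<lambda>n. integral\<^sup>L TN (\<lambda>x. norm (v n x - u n x))) \<longlonglongrightarrow> 0))"

definition A_quasiconvex :: "('n::finite \<Rightarrow> real^'d::finite^'l::finite) \<Rightarrow> (real^'d \<Rightarrow> real) \<Rightarrow> bool" where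
  "A_quasiconvex A f \<longleftrightarrow> continuous_on UNIV f \<and>
     (\<forall>(x::real^'d) (\<phi>::real^'n \<Rightarrow> real^'d).
        smooth \<phi> \<and> periodic \<phi> \<and> integral\<^sup>L TN \<phi> = 0 \<and>
        (\<forall>y. (\<Sum>k\<in>UNIV. A k *v partial k \<phi> y) = 0)
        \<longrightarrow> f x \<le> integral\<^sup>L TN (\<lambda>y. f (x + \<phi> y)))"

text \<open>A finite signed (Radon) measure is represented by its Jordan decomposition:
  a pair of mutually singular finite Borel measures (on R^d every finite Borel
  measure is Radon).\<close>

type_synonym 'a smeasure = "'a measure \<times> 'a measure"

definition valid_sm :: "('a::euclidean_space) smeasure \<Rightarrow> bool" where
  "valid_sm \<mu> \<longleftrightarrow> sets (fst \<mu>) = sets borel \<and> sets (snd \<mu>) = sets borel \<and>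
     finite_measure (fst \<mu>) \<and> finite_measure (snd \<mu>) \<and>
     (\<exists>S\<in>sets borel. emeasure (fst \<mu>) (UNIV - S) = 0 \<and> emeasure (snd \<mu>) S = 0)"

definition sm_val :: "'a smeasure \<Rightarrow> 'a set \<Rightarrow> real" where
  "sm_val \<mu> B = measure (fst \<mu>) B - measure (snd \<mu>) B"

definition sm_int :: "'a smeasure \<Rightarrow> ('a \<Rightarrow> 'b::{banach,second_countable_topology}) \<Rightarrow> 'b" where
  "sm_int \<mu> f = integral\<^sup>L (fst \<mu>) f - integral\<^sup>L (snd \<mu>) f"

definition sm_nonneg :: "('a::euclidean_space) smeasure \<Rightarrow> bool" where
  "sm_nonneg \<mu> \<longleftrightarrow> (\<forall>B\<in>sets borel. sm_val \<mu> B \<ge> 0)"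

definition sm_support :: "('a::euclidean_space) smeasure \<Rightarrow> 'a set" where
  "sm_support \<mu> = UNIV - \<Union>{U. open U \<and> emeasure (fst \<mu>) U = 0 \<and> emeasure (snd \<mu>) U = 0}"

definition Cc :: "('a::euclidean_space \<Rightarrow> real) \<Rightarrow> bool" where
  "Cc f \<longleftrightarrow> continuous_on UNIV f \<and> (\<exists>K. compact K \<and> (\<forall>y. y \<notin> K \<longrightarrow> f y = 0))"

definition C0 :: "('a::euclidean_space \<Rightarrow> real) \<Rightarrow> bool" where
  "C0 f \<longleftrightarrow> continuous_on UNIV f \<and> (f \<longlongrightarrow> 0) at_infinity"

definition wstar_measurable :: "(real^'n::finite \<Rightarrow> (real^'d::finite) smeasure) \<Rightarrow> bool" where
  "wstar_measurable \<nu> \<longleftrightarrow> periodic \<nu> \<and> (\<forall>x. valid_sm (\<nu> x)) \<and>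
     (\<forall>f. Cc f \<longrightarrow> (\<lambda>x. sm_int (\<nu> x) f) \<in> borel_measurable TN)"

definition weakstar_Linf :: "(nat \<Rightarrow> real^'n::finite \<Rightarrow> real) \<Rightarrow> (real^'n \<Rightarrow> real) \<Rightarrow> bool" where
  "weakstar_Linf h g \<longleftrightarrow> LinfT g \<and>
     (\<forall>\<psi>::real^'n \<Rightarrow> real. L1T \<psi> \<longrightarrow>
        (\<lambda>j. integral\<^sup>L TN (\<lambda>x. h j x * \<psi> x)) \<longlonglongrightarrow> integral\<^sup>L TN (\<lambda>x. g x * \<psi> x))"

definition generates :: "(real^'n::finite \<Rightarrow> (real^'d::finite) smeasure) \<Rightarrow> (nat \<Rightarrow> real^'n \<Rightarrow> real^'d) \<Rightarrow> bool" where
  "generates \<nu> v \<longleftrightarrow>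
     (\<forall>f::real^'d \<Rightarrow> real. C0 f \<longrightarrow> weakstar_Linf (\<lambda>j x. f (v j x)) (\<lambda>x. sm_int (\<nu> x) f))"

definition A_infty_YM :: "('n::finite \<Rightarrow> real^'d::finite^'l::finite) \<Rightarrow> (real^'n \<Rightarrow> (real^'d) smeasure) \<Rightarrow> bool" where
  "A_infty_YM A \<nu> \<longleftrightarrow>
     (\<exists>v::nat \<Rightarrow> real^'n \<Rightarrow> real^'d.
        (\<forall>j. LinfT (v j) \<and> kerA A (v j)) \<and>
        (\<exists>M. \<forall>j. AE x in TN. norm (v j x) \<le> M) \<and>
        generates \<nu> v)"

end

theory Submission
  imports Defs
begin

text \<open>
  Necessity. A bounded field \<open>v j - u\<close> is cut off by a trigonometric approximation of an
  indicator function. The operator applied to the product stays bounded, and its low frequencies vanish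
  in the limit, so the constant rank property, which makes the symbol uniformly invertible
  off its kernel, forces the \<open>L\<^sup>2\<close> distance to the A-free trigonometric polynomials to tend to zero.
  Property (ZL) truncates, a positive trigonometric kernel smooths, and quasiconvexity applied to
  the resulting test fields is Jensen's inequality averaged over an arbitrary measurable set.

  Sufficiency. For Lipschitz \<open>f\<close> the infimum of the averages of \<open>f (x + \<phi>)\<close> over admissible \<open>\<phi>\<close> is
  Lipschitz and quasiconvex, because rapidly oscillating fields can be glued. Separation in finite
  dimensions then shows that averages of \<open>\<nu>\<close> over small pieces are approximated by averages of a
  constant plus admissible fields. One glues again, and takes the distance to a ball as one of the
  test functions, so that (ZL) turns the glued fields into a bounded generating sequence.
\<close>

text \<open>All fields are reduced to real trigonometric polynomials, for which Fourier expansion,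
  convolution and averaging of rapid oscillations are finite identities provable by induction;
  convergence of Fourier series never enters. A cut-off destroys the differential constraint and
  only an L^2 projection restores it, so fields are always compared in L^1. This is why the test
  functions are Lipschitz (gluing) or are given an affine modulus of continuity on a ball (Jensen).
  The positive kernel preserves sup bounds and the constraint at once, and so leads from bounded
  distributional solutions back to smooth test fields. The second obstacle is the order of
  quantifiers in (iii): one null set has to serve all quasiconvex functions. Null sets are therefore
  collected over countable families, among them a choice of one quasiconvex function near each
  member of a countable dense family. The total mass of the measures is not prescribed in the
  sufficiency part; it equals one because the constants 1 and -1 are quasiconvex.\<close>

lemma space_TN [simp]: "space TN = cbox 0 1"
  by (simp add: TN_def)

lemma finite_measure_TN: "finite_measure TN"
  unfolding TN_def by (rule finite_measure_lebesgue_on) auto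

interpretation TN: finite_measure TN
  by (rule finite_measure_TN)

lemma measure_TN [simp]: "measure TN (cbox 0 (1::real^'n::finite)) = 1"
proof -
  have "measure TN (cbox 0 (1::real^'n)) = measure lebesgue (cbox 0 (1::real^'n))"
    unfolding TN_def by (intro measure_restrict_space) auto
  also have "\<dots> = measure lborel (cbox 0 (1::real^'n))" by simp
  also have "\<dots> = 1"
    by (subst content_cbox_cart) (auto simp: interval_ne_empty_cart)
  finally show ?thesis .
qed

lemma continuous_borel_measurable_TN:
  fixes f :: "real^'n::finite \<Rightarrow> 'b::{second_countable_topology,real_normed_vector}"
  assumes "continuous_on UNIV f"
  shows "f \<in> borel_measurable TN"
proof -
  have "f \<in> borel_measurable borel" using assms by (rule borel_measurable_continuous_onI)
  then have "f \<in> borel_measurable lebesgue" by (simp add: measurable_completion)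
  then show ?thesis unfolding TN_def by (rule measurable_restrict_space1)
qed

lemma integrable_TN_bounded:
  fixes f :: "real^'n::finite \<Rightarrow> 'b::{second_countable_topology,banach}"
  assumes "f \<in> borel_measurable TN" "AE x in TN. norm (f x) \<le> M"
  shows "integrable TN f"
  using TN.integrable_const_bound[OF assms(2,1)] .

lemma integrable_TN_continuous:
  fixes f :: "real^'n::finite \<Rightarrow> 'b::{second_countable_topology,banach}"
  assumes f: "continuous_on UNIV f"
  shows "integrable TN f"
proof -
  have "compact (f ` cbox 0 1)"
    by (rule compact_continuous_image[OF continuous_on_subset[OF f]]) auto
  then obtain M where "\<forall>y\<in>f ` cbox 0 1. norm y \<le> M"
    using compact_imp_bounded bounded_iff by blast
  then show ?thesis
    by (intro integrable_TN_bounded[where M=M] continuous_borel_measurable_TN f AE_I2) auto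
qed

lemma integral_TN_const [simp]:
  "integral\<^sup>L TN (\<lambda>x::real^'n::finite. c::'b::{second_countable_topology,banach}) = c"
  by (subst lebesgue_integral_const) simp

section \<open>Integration by parts on the torus\<close>

lemma integral_TN_eq_integral:
  fixes f :: "real^'n::finite \<Rightarrow> 'b::euclidean_space"
  assumes "continuous_on UNIV f"
  shows "integral\<^sup>L TN f = integral (cbox 0 1) f"
  using integrable_TN_continuous[OF assms] unfolding TN_def
  by (intro lebesgue_integral_eq_integral) auto

text \<open>The cube lengthened by \<open>t\<close> in direction \<open>k\<close> is cut in two
  ways, at height 1 and at height \<open>t\<close>. Up to an integer translation both cuts split off
  the same slab, so the two remaining unit cubes carry equal integrals.\<close>

lemma integral_shift_axis:
  fixes h :: "real^'n::finite \<Rightarrow> real"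
  assumes h: "continuous_on UNIV h" "periodic h" and t: "0 \<le> t" "t \<le> 1"
  shows "integral (cbox 0 1) (\<lambda>x. h (x + t *\<^sub>R axis k 1)) = integral (cbox 0 1) h"
proof -
  let ?e = "axis k 1 :: real^'n"
  define b where "b = (1 + t *\<^sub>R ?e)"
  \<comment> \<open>\<open>B\<close> is the slab of thickness \<open>t\<close> at the bottom: it is
    the piece below height \<open>t\<close> and, moved up by one period, the piece above height
    1.\<close>
  define B where "B = cbox 0 (1 + (t - 1) *\<^sub>R ?e)"
  have ek: "?e \<in> Basis" by (simp add: axis_in_Basis_iff)
  have ix: "x \<bullet> ?e = x $ k" for x :: "real^'n" by (simp add: inner_axis)
  have e: "?e $ i = (if i = k then 1 else 0)" for i by (simp add: axis_def)
  have int: "h integrable_on cbox a c" for a c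
    by (intro integrable_continuous continuous_on_subset[OF h(1)]) auto
  have split: "integral (cbox 0 b) h = integral (cbox 0 b \<inter> {x. x \<bullet> ?e \<le> c}) h
       + integral (cbox 0 b \<inter> {x. x \<bullet> ?e \<ge> c}) h" for c
  proof -
    have "(h has_integral integral (cbox 0 b \<inter> {x. x \<bullet> ?e \<le> c}) h
       + integral (cbox 0 b \<inter> {x. x \<bullet> ?e \<ge> c}) h) (cbox 0 b)"
      by (rule has_integral_split[where c=c and k="?e"])
         (auto intro!: integrable_integral int simp: interval_split ek)
    then show ?thesis by (rule integral_unique)
  qed
  have s1: "cbox 0 b \<inter> {x. x \<bullet> ?e \<le> 1} = cbox 0 1"
    using t unfolding b_def B_def set_eq_iff
    by (auto simp: mem_box_cart ix e all_conj_distrib split: if_splits)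
       (smt (verit, best))+
  have s2: "cbox 0 b \<inter> {x. x \<bullet> ?e \<ge> 1} = cbox (0 + ?e) (1 + (t - 1) *\<^sub>R ?e + ?e)"
    using t unfolding b_def B_def set_eq_iff
    by (auto simp: mem_box_cart ix e all_conj_distrib split: if_splits)
       (smt (verit, best))+
  have s3: "cbox 0 b \<inter> {x. x \<bullet> ?e \<le> t} = B"
    using t unfolding b_def B_def set_eq_iff
    by (auto simp: mem_box_cart ix e all_conj_distrib split: if_splits)
  have s4: "cbox 0 b \<inter> {x. x \<bullet> ?e \<ge> t} = cbox (0 + t *\<^sub>R ?e) (1 + t *\<^sub>R ?e)"
    using t unfolding b_def B_def set_eq_iff
    by (auto simp: mem_box_cart ix e all_conj_distrib split: if_splits)
       (smt (verit, best))+
  have "integral (cbox (0 + ?e) (1 + (t - 1) *\<^sub>R ?e + ?e)) h = integral B (h \<circ> (+) ?e)"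
    unfolding B_def by (rule integral_shift_cbox_plus[symmetric])
  also have "h \<circ> (+) ?e = h"
    using h(2) by (auto simp: periodic_def fun_eq_iff add.commute)
  finally have sh: "integral (cbox (0 + ?e) (1 + (t - 1) *\<^sub>R ?e + ?e)) h = integral B h" .
  have "integral (cbox 0 1) h = integral (cbox (0 + t *\<^sub>R ?e) (1 + t *\<^sub>R ?e)) h"
    using split[of 1] split[of t] s1 s2 s3 s4 sh by simp
  also have "\<dots> = integral (cbox 0 1) (h \<circ> (+) (t *\<^sub>R ?e))"
    by (rule integral_shift_cbox_plus[symmetric])
  also have "h \<circ> (+) (t *\<^sub>R ?e) = (\<lambda>x. h (x + t *\<^sub>R ?e))"
    by (auto simp: fun_eq_iff add.commute)
  finally show ?thesis by simp
qed

text \<open>Differentiation under the integral sign of the map sending \<open>t\<close> to the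
  integral of \<open>g (x + t e)\<close>, which is constant by periodicity. Later integrations by
  parts apply this to products.\<close>

lemma integral_partial_eq_0:
  fixes g :: "real^'n::finite \<Rightarrow> real"
  assumes per: "periodic g" and d: "\<And>x. g differentiable (at x)"
    and c: "continuous_on UNIV (partial k g)"
  shows "integral\<^sup>L TN (partial k g) = 0"
proof -
  let ?e = "axis k 1 :: real^'n"
  have cg: "continuous_on UNIV g"
    using d differentiable_imp_continuous_within continuous_at_imp_continuous_on by blast
  have der: "((\<lambda>t. g (x + t *\<^sub>R ?e)) has_vector_derivative partial k g (x + t *\<^sub>R ?e)) (at t within {0..1})" for x t
  proof -
    have "(g has_derivative frechet_derivative g (at (x + t *\<^sub>R ?e))) (at (x + t *\<^sub>R ?e))"
      using d frechet_derivative_works by blast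
    moreover have "((\<lambda>t. x + t *\<^sub>R ?e) has_derivative (\<lambda>s. s *\<^sub>R ?e)) (at t)"
      by (auto intro!: derivative_eq_intros)
    ultimately have "((\<lambda>t. g (x + t *\<^sub>R ?e)) has_derivative
        (\<lambda>s. frechet_derivative g (at (x + t *\<^sub>R ?e)) (s *\<^sub>R ?e))) (at t)"
      using diff_chain_at[of "\<lambda>t. x + t *\<^sub>R ?e"] by (simp add: o_def)
    moreover have "frechet_derivative g (at (x + t *\<^sub>R ?e)) (s *\<^sub>R ?e) = s *\<^sub>R partial k g (x + t *\<^sub>R ?e)" for s
      unfolding partial_def
      using linear_frechet_derivative[OF d] linear_cmul by blast
    ultimately show ?thesis
      unfolding has_vector_derivative_def by (simp add: has_derivative_at_withinI)
  qed
  have "((\<lambda>t. integral (cbox 0 1) (\<lambda>x. g (x + t *\<^sub>R ?e))) has_vector_derivative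
        integral (cbox 0 1) (\<lambda>x. partial k g (x + 0 *\<^sub>R ?e))) (at 0 within {0..1})"
  proof (rule leibniz_rule_vector_derivative)
    show "(\<lambda>x. g (x + t *\<^sub>R ?e)) integrable_on cbox 0 1" for t
      by (intro integrable_continuous continuous_on_compose2[OF cg]) (auto intro!: continuous_intros)
    show "continuous_on ({0..1} \<times> cbox 0 1) (\<lambda>(t, x). partial k g (x + t *\<^sub>R ?e))"
      unfolding case_prod_beta
      by (intro continuous_on_compose2[OF c]) (auto intro!: continuous_intros)
  qed (use der in auto)
  moreover have "((\<lambda>t. integral (cbox 0 1) (\<lambda>x. g (x + t *\<^sub>R ?e))) has_vector_derivative 0) (at 0 within {0..1})"
  proof (rule has_vector_derivative_transform[where f="\<lambda>t. integral (cbox 0 1) g"])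
    show "integral (cbox 0 1) (\<lambda>x. g (x + t *\<^sub>R ?e)) = integral (cbox 0 1) g" if "t \<in> {0..1}" for t
      using that by (intro integral_shift_axis cg per) auto
  qed auto
  ultimately have "integral (cbox 0 1) (\<lambda>x. partial k g (x + 0 *\<^sub>R ?e)) = 0"
    by (metis vector_derivative_unique_within_closed_interval[of 0 1 0] atLeastAtMost_iff cbox_interval order_refl zero_le_one zero_less_one)
  then show ?thesis
    using integral_TN_eq_integral[OF c] by simp
qed

section \<open>Real characters of the torus\<close>

definition rv :: "int^'n::finite \<Rightarrow> real^'n" where
  "rv k = (\<chi> i. of_int (k $ i))"

lemma rv_nth [simp]: "rv k $ i = of_int (k $ i)"
  by (simp add: rv_def)

lemma rv_add: "rv (k + l) = rv k + rv l"
  by (simp add: vec_eq_iff)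

lemma rv_diff: "rv (k - l) = rv k - rv l"
  by (simp add: vec_eq_iff)

lemma rv_minus: "rv (- k) = - rv k"
  by (simp add: vec_eq_iff)

lemma rv_scale: "rv (int j *s k) = real j *\<^sub>R rv k"
  by (simp add: vec_eq_iff)

lemma rv_0 [simp]: "rv 0 = 0"
  by (simp add: vec_eq_iff)

lemma rv_eq_0_iff [simp]: "rv k = 0 \<longleftrightarrow> k = 0"
  by (simp add: vec_eq_iff)

text \<open>Real part of the character \<open>exp (2 pi i k x)\<close>; \<open>tsin\<close> is the
  imaginary part. Staying real lets the coefficients lie in any real vector space; in exchange,
  \<open>k\<close> and \<open>- k\<close> describe the same pair of functions up to a sign.\<close>

definition tcos :: "int^'n::finite \<Rightarrow> real^'n \<Rightarrow> real" where
  "tcos k x = cos (2 * pi * (rv k \<bullet> x))"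

definition tsin :: "int^'n::finite \<Rightarrow> real^'n \<Rightarrow> real" where
  "tsin k x = sin (2 * pi * (rv k \<bullet> x))"

lemma tcos_0 [simp]: "tcos 0 x = 1" and tsin_0 [simp]: "tsin 0 x = 0"
  by (simp_all add: tcos_def tsin_def)

lemma tcos_minus [simp]: "tcos (- k) x = tcos k x" and tsin_minus [simp]: "tsin (- k) x = - tsin k x"
  by (simp_all add: tcos_def tsin_def rv_minus)

lemma abs_tcos_le [simp]: "\<bar>tcos k x\<bar> \<le> 1" and abs_tsin_le [simp]: "\<bar>tsin k x\<bar> \<le> 1"
  by (simp_all add: tcos_def tsin_def)

lemma continuous_on_tcos [continuous_intros]:
  fixes f :: "'a::t2_space \<Rightarrow> real^'n::finite"
  shows "continuous_on S f \<Longrightarrow> continuous_on S (\<lambda>x. tcos k (f x))"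
  and continuous_on_tsin [continuous_intros]:
  "continuous_on S f \<Longrightarrow> continuous_on S (\<lambda>x. tsin k (f x))"
  by (auto simp: tcos_def tsin_def intro!: continuous_intros)

lemma rv_axis: "rv k \<bullet> axis i 1 = of_int (k $ i)"
  by (simp add: inner_axis)

lemma tcos_axis: "tcos k (x + axis i 1) = tcos k x" and tsin_axis: "tsin k (x + axis i 1) = tsin k x"
proof -
  have *: "2 * pi * (rv k \<bullet> (x + axis i 1)) = 2 * pi * (rv k \<bullet> x) + 2 * pi * of_int (k $ i)"
    by (simp add: inner_add_right rv_axis algebra_simps)
  have "cos (2 * pi * of_int (k $ i)) = 1" "sin (2 * pi * of_int (k $ i)) = 0"
    using cos_int_2pin[of "k $ i"] sin_int_2pin[of "k $ i"] by (simp_all add: mult.commute mult.left_commute)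
  then show "tcos k (x + axis i 1) = tcos k x" "tsin k (x + axis i 1) = tsin k x"
    unfolding tcos_def tsin_def * by (simp_all add: cos_add sin_add)
qed

lemma periodic_tcos: "periodic (tcos k)" and periodic_tsin: "periodic (tsin k)"
  by (simp_all add: periodic_def tcos_axis tsin_axis)

lemma tcos_has_derivative:
  "(tcos k has_derivative (\<lambda>h. - (2 * pi * tsin k x) * (rv k \<bullet> h))) (at x)"
  unfolding tcos_def tsin_def
  by (auto intro!: derivative_eq_intros simp: algebra_simps)

lemma tsin_has_derivative:
  "(tsin k has_derivative (\<lambda>h. (2 * pi * tcos k x) * (rv k \<bullet> h))) (at x)"
  unfolding tcos_def tsin_def
  by (auto intro!: derivative_eq_intros simp: algebra_simps)

lemma partialI:
  assumes "(f has_derivative f') (at x)"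
  shows "partial i f x = f' (axis i 1)"
  unfolding partial_def using frechet_derivative_at[OF assms] by simp

lemma partial_tcos: "partial i (\<lambda>x. tcos k x *\<^sub>R a) = (\<lambda>x. tsin k x *\<^sub>R (- (2 * pi * of_int (k $ i)) *\<^sub>R a))"
  and partial_tsin: "partial i (\<lambda>x. tsin k x *\<^sub>R a) = (\<lambda>x. tcos k x *\<^sub>R ((2 * pi * of_int (k $ i)) *\<^sub>R a))"
  by (rule ext, subst partialI[OF has_derivative_scaleR_left[OF tcos_has_derivative]], simp add: rv_axis,
      rule ext, subst partialI[OF has_derivative_scaleR_left[OF tsin_has_derivative]], simp add: rv_axis)

lemma partial_tcos_real: "partial i (tcos k) = (\<lambda>x. - (2 * pi * of_int (k $ i)) * tsin k x)"
  and partial_tsin_real: "partial i (tsin k) = (\<lambda>x. (2 * pi * of_int (k $ i)) * tcos k x)"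
  using partial_tcos[of i k "1::real"] partial_tsin[of i k "1::real"] by (simp_all add: mult.commute)

text \<open>For \<open>k \<noteq> 0\<close> the function is, up to a nonzero factor, the derivative
  of \<open>tsin k\<close> in a direction where \<open>k\<close> has a nonzero entry.\<close>

lemma integral_tcos: "integral\<^sup>L TN (tcos k) = (if k = 0 then 1 else 0)"
proof (cases "k = 0")
  case True
  then have "tcos k = (\<lambda>x. 1)" by (simp add: fun_eq_iff)
  then show ?thesis using True by simp
next
  case False
  then obtain i where i: "k $ i \<noteq> 0" by (auto simp: vec_eq_iff)
  have "integral\<^sup>L TN (partial i (tsin k)) = 0"
  proof (rule integral_partial_eq_0)
    show "tsin k differentiable at x" for x
      using tsin_has_derivative differentiable_def by blast
  qed (auto simp: periodic_tsin partial_tsin_real intro!: continuous_intros)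
  then show ?thesis using i False by (simp add: partial_tsin_real)
qed

lemma integral_tsin: "integral\<^sup>L TN (tsin k) = 0"
proof (cases "k = 0")
  case True
  then have "tsin k = (\<lambda>x. 0)" by (simp add: fun_eq_iff)
  then show ?thesis by simp
next
  case False
  then obtain i where i: "k $ i \<noteq> 0" by (auto simp: vec_eq_iff)
  have "integral\<^sup>L TN (partial i (tcos k)) = 0"
  proof (rule integral_partial_eq_0)
    show "tcos k differentiable at x" for x
      using tcos_has_derivative differentiable_def by blast
  qed (auto simp: periodic_tcos partial_tcos_real intro!: continuous_intros)
  then show ?thesis using i False by (simp add: partial_tcos_real)
qed

lemma integrable_tcos [simp]: "integrable TN (tcos k)" and integrable_tsin [simp]: "integrable TN (tsin k)"
  by (auto intro!: integrable_TN_continuous continuous_intros)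

lemma tcos_tcos: "tcos k x * tcos l x = (tcos (k - l) x + tcos (k + l) x) / 2"
  and tsin_tsin: "tsin k x * tsin l x = (tcos (k - l) x - tcos (k + l) x) / 2"
  and tsin_tcos: "tsin k x * tcos l x = (tsin (k + l) x + tsin (k - l) x) / 2"
  and tcos_tsin: "tcos k x * tsin l x = (tsin (k + l) x - tsin (k - l) x) / 2"
  unfolding tcos_def tsin_def rv_add rv_diff inner_add_left inner_diff_left
    distrib_left right_diff_distrib cos_add sin_add cos_diff sin_diff by simp_all

section \<open>Trigonometric polynomials\<close>

text \<open>The frequency \<open>k\<close> may only occur with coefficients in \<open>V k\<close>. Trigonometric polynomials
  in the kernel of the operator are those with coefficients in the kernel of its symbol.\<close>

inductive trigV :: "(int^'n::finite \<Rightarrow> 'b::real_vector set) \<Rightarrow> (real^'n \<Rightarrow> 'b) \<Rightarrow> bool"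
  for V where
    cos: "a \<in> V k \<Longrightarrow> trigV V (\<lambda>x. tcos k x *\<^sub>R a)"
  | sin: "a \<in> V k \<Longrightarrow> trigV V (\<lambda>x. tsin k x *\<^sub>R a)"
  | add: "trigV V f \<Longrightarrow> trigV V g \<Longrightarrow> trigV V (\<lambda>x. f x + g x)"

abbreviation trig :: "(real^'n::finite \<Rightarrow> 'b::real_vector) \<Rightarrow> bool" where
  "trig \<equiv> trigV (\<lambda>_. UNIV)"

definition symb :: "('n::finite \<Rightarrow> real^'d::finite^'l::finite) \<Rightarrow> real^'n \<Rightarrow> real^'d^'l" where
  "symb A \<xi> = (\<Sum>k\<in>UNIV. \<xi> $ k *\<^sub>R A k)"

abbreviation afree :: "('n::finite \<Rightarrow> real^'d::finite^'l::finite) \<Rightarrow> (real^'n \<Rightarrow> real^'d) \<Rightarrow> bool" where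
  "afree A \<equiv> trigV (\<lambda>k. {a. symb A (rv k) *v a = 0})"

lemma trigV_mono: "trigV V f \<Longrightarrow> (\<And>k. V k \<subseteq> W k) \<Longrightarrow> trigV W f"
  by (induction rule: trigV.induct) (auto intro: trigV.intros)

lemma trigV_imp_trig: "trigV V f \<Longrightarrow> trig f"
  by (rule trigV_mono) auto

lemma trigV_const: "c \<in> V 0 \<Longrightarrow> trigV V (\<lambda>x. c)"
  using trigV.cos[of c V 0] by simp

lemma trigV_sum:
  assumes "\<And>i. i \<in> I \<Longrightarrow> trigV V (f i)" "0 \<in> V 0"
  shows "trigV V (\<lambda>x. \<Sum>i\<in>I. f i x)"
  using assms by (induction I rule: infinite_finite_induct) (auto intro: trigV.add trigV_const)

lemma trigV_scaleR:
  assumes "trigV V f" "\<And>k a. a \<in> V k \<Longrightarrow> c *\<^sub>R a \<in> W k"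
  shows "trigV W (\<lambda>x. c *\<^sub>R f x)"
  using assms(1)
proof induction
  case (cos a k)
  then show ?case using trigV.cos[of "c *\<^sub>R a" W k] assms(2) by (simp add: mult.commute)
next
  case (sin a k)
  then show ?case using trigV.sin[of "c *\<^sub>R a" W k] assms(2) by (simp add: mult.commute)
qed (simp add: scaleR_add_right trigV.add)

lemma trigV_linear:
  assumes "trigV V f" "linear L" "\<And>k a. a \<in> V k \<Longrightarrow> L a \<in> W k"
  shows "trigV W (\<lambda>x. L (f x))"
  using assms(1)
  by induction (auto simp: linear_cmul[OF assms(2)] linear_add[OF assms(2)] intro!: trigV.intros assms(3))

lemma trigV_minus:
  assumes "trigV V f" "trigV V g" "\<And>k a. a \<in> V k \<Longrightarrow> - a \<in> V k"
  shows "trigV V (\<lambda>x. f x - g x)"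
proof -
  have "trigV V (\<lambda>x. (-1) *\<^sub>R g x)" by (rule trigV_scaleR[OF assms(2)]) (auto intro: assms(3))
  from trigV.add[OF assms(1) this] show ?thesis by simp
qed

lemma trig_continuous:
  fixes f :: "real^'n::finite \<Rightarrow> 'b::real_normed_vector"
  shows "trig f \<Longrightarrow> continuous_on S f"
  by (induction rule: trigV.induct) (auto intro!: continuous_intros)

lemma trig_periodic: "trig f \<Longrightarrow> periodic f"
  by (induction rule: trigV.induct) (auto simp: periodic_def tcos_axis tsin_axis)

lemma trig_bounded:
  fixes f :: "real^'n::finite \<Rightarrow> 'b::real_normed_vector"
  shows "trig f \<Longrightarrow> \<exists>M\<ge>0. \<forall>x. norm (f x) \<le> M"
proof (induction rule: trigV.induct)
  case (cos a k)
  then show ?case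
    by (intro exI[of _ "norm a"]) (auto simp: mult_left_le_one_le)
next
  case (sin a k)
  then show ?case
    by (intro exI[of _ "norm a"]) (auto simp: mult_left_le_one_le)
next
  case (add f g)
  then obtain M N where "M \<ge> 0" "\<And>x. norm (f x) \<le> M" "N \<ge> 0" "\<And>x. norm (g x) \<le> N" by auto
  then show ?case by (intro exI[of _ "M + N"]) (auto intro!: norm_triangle_mono)
qed

lemma trig_integrable:
  fixes f :: "real^'n::finite \<Rightarrow> 'b::{second_countable_topology,banach}"
  shows "trig f \<Longrightarrow> integrable TN f"
  by (intro integrable_TN_continuous trig_continuous)

lemma trig_differentiable:
  fixes f :: "real^'n::finite \<Rightarrow> 'b::real_normed_vector"
  shows "trig f \<Longrightarrow> f differentiable at x"
proof (induction rule: trigV.induct)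
  case (cos a k)
  show ?case using has_derivative_scaleR_left[OF tcos_has_derivative] differentiable_def by blast
next
  case (sin a k)
  show ?case using has_derivative_scaleR_left[OF tsin_has_derivative] differentiable_def by blast
qed simp

lemma partial_add:
  assumes "\<And>x. f differentiable at x" "\<And>x. g differentiable at x"
  shows "partial i (\<lambda>x. f x + g x) = (\<lambda>x. partial i f x + partial i g x)"
  using assms
  by (auto simp: fun_eq_iff partial_def frechet_derivative_works intro!: partialI[unfolded partial_def] has_derivative_add)

lemma trig_partial:
  fixes f :: "real^'n::finite \<Rightarrow> 'b::real_normed_vector"
  shows "trig f \<Longrightarrow> trig (partial i f)"
  by (induction rule: trigV.induct)
     (auto simp: partial_tcos partial_tsin partial_add trig_differentiable
       simp del: scaleR_scaleR scaleR_minus_left intro!: trigV.intros)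

lemma trig_smooth:
  fixes f :: "real^'n::finite \<Rightarrow> 'b::real_normed_vector"
  assumes "trig f" shows "smooth f"
proof -
  have "trig (iter_partial ks f)" for ks
    by (induction ks) (auto simp: assms trig_partial)
  then show ?thesis by (auto simp: smooth_def trig_differentiable)
qed

lemma matrix_vector_mult_uminus: "M *v (- a) = - (M *v a)" for M :: "real^'d::finite^'l::finite"
  by (rule linear_neg[OF matrix_vector_mul_linear])

lemma symb_mult: "symb A \<xi> *v a = (\<Sum>i\<in>UNIV. \<xi> $ i *\<^sub>R (A i *v a))"
  unfolding symb_def
  by (simp add: vec_eq_iff matrix_vector_mult_def
      sum_distrib_left sum_distrib_right mult.assoc) (auto intro: sum.swap)

lemma afree_pointwise:
  assumes "afree A f"
  shows "(\<Sum>i\<in>UNIV. A i *v partial i f y) = 0"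
  using assms
proof (induction rule: trigV.induct)
  case (cos a k)
  have "(\<Sum>i\<in>UNIV. A i *v partial i (\<lambda>x. tcos k x *\<^sub>R a) y) = (- (2 * pi * tsin k y)) *\<^sub>R (symb A (rv k) *v a)"
    unfolding symb_mult partial_tcos scaleR_sum_right
    by (intro sum.cong) (auto simp: matrix_vector_mult_scaleR matrix_vector_mult_uminus mult_ac)
  then show ?case using cos by simp
next
  case (sin a k)
  have "(\<Sum>i\<in>UNIV. A i *v partial i (\<lambda>x. tsin k x *\<^sub>R a) y) = (2 * pi * tcos k y) *\<^sub>R (symb A (rv k) *v a)"
    unfolding symb_mult partial_tsin scaleR_sum_right
    by (intro sum.cong) (auto simp: matrix_vector_mult_scaleR matrix_vector_mult_uminus mult_ac)
  then show ?case using sin by simp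
next
  case (add f g)
  have "trig f" "trig g" using add trigV_imp_trig by blast+
  then show ?case
    by (simp add: partial_add trig_differentiable matrix_vector_right_distrib sum.distrib add)
qed

text \<open>The product-to-sum formulas shift frequencies, so any coupling between a coefficient and
  its frequency is lost. Hence the result is only \<open>trig\<close>: multiplication by a cut-off
  leaves the class \<open>afree\<close>, and a projection is needed to return to it.\<close>

lemma trig_mult_base:
  fixes f :: "real^'n::finite \<Rightarrow> 'b::real_vector"
  assumes "trig f"
  shows "trig (\<lambda>x. tcos k x *\<^sub>R f x)" "trig (\<lambda>x. tsin k x *\<^sub>R f x)"
proof -
  have half: "((p + q) / 2) *\<^sub>R a = p *\<^sub>R ((1/2) *\<^sub>R a) + q *\<^sub>R ((1/2) *\<^sub>R a)"
     "((p - q) / 2) *\<^sub>R a = p *\<^sub>R ((1/2) *\<^sub>R a) + q *\<^sub>R ((-1/2) *\<^sub>R a)" for p q and a :: 'b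
    by (simp_all add: scaleR_left_distrib[symmetric] field_simps)
  have "trig (\<lambda>x. tcos k x *\<^sub>R f x) \<and> trig (\<lambda>x. tsin k x *\<^sub>R f x)"
    using assms
  proof (induction rule: trigV.induct)
    case (cos a l)
    show ?case unfolding scaleR_scaleR tcos_tcos tsin_tcos unfolding half by (intro conjI trigV.intros UNIV_I)
  next
    case (sin a l)
    show ?case unfolding scaleR_scaleR tcos_tsin tsin_tsin unfolding half by (intro conjI trigV.intros UNIV_I)
  next
    case (add f g)
    then show ?case by (auto simp: scaleR_add_right intro: trigV.intros)
  qed
  then show "trig (\<lambda>x. tcos k x *\<^sub>R f x)" "trig (\<lambda>x. tsin k x *\<^sub>R f x)" by auto
qed

lemma trig_mult:
  fixes f :: "real^'n::finite \<Rightarrow> 'b::real_vector"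
  assumes "trig (h :: _ \<Rightarrow> real)" "trig f"
  shows "trig (\<lambda>x. h x *\<^sub>R f x)"
  using assms(1)
proof (induction rule: trigV.induct)
  case (cos a k)
  have "trig (\<lambda>x. a *\<^sub>R f x)" by (rule trigV_scaleR[OF assms(2)]) auto
  from trig_mult_base(1)[OF this] show ?case by simp
next
  case (sin a k)
  have "trig (\<lambda>x. a *\<^sub>R f x)" by (rule trigV_scaleR[OF assms(2)]) auto
  from trig_mult_base(2)[OF this] show ?case by simp
qed (simp add: scaleR_left_distrib trigV.add)

lemma tcos_scale: "tcos k (real j *\<^sub>R x) = tcos (int j *s k) x"
  and tsin_scale: "tsin k (real j *\<^sub>R x) = tsin (int j *s k) x"
  by (simp_all add: tcos_def tsin_def rv_scale)

lemma trigV_rescale: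
  assumes "trigV V f" "\<And>k. V k \<subseteq> V (int j *s k)"
  shows "trigV V (\<lambda>x. f (real j *\<^sub>R x))"
  using assms(1) by induction (use assms(2) in \<open>auto simp: tcos_scale tsin_scale intro!: trigV.intros\<close>)

lemma symb_scale: "symb A (c *\<^sub>R \<xi>) *v a = c *\<^sub>R (symb A \<xi> *v a)"
  by (simp add: symb_mult scaleR_sum_right)

text \<open>The symbol is homogeneous in the frequency, so its kernel at \<open>k\<close> is
  contained in its kernel at \<open>j k\<close>; for \<open>j = 0\<close> the latter is the whole
  space.\<close>

lemma afree_rescale: "afree A f \<Longrightarrow> afree A (\<lambda>x. f (real j *\<^sub>R x))"
  by (erule trigV_rescale) (auto simp: rv_scale symb_scale)

lemma afree_const: "afree A (\<lambda>x. c)"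
  by (rule trigV_const) (simp add: symb_def)

lemma afree_diff: "afree A f \<Longrightarrow> afree A g \<Longrightarrow> afree A (\<lambda>x. f x - g x)"
  by (rule trigV_minus) (simp_all add: matrix_vector_mult_uminus)

section \<open>Fourier coefficients and Bessel's inequality\<close>

definition cco :: "int^'n::finite \<Rightarrow> (real^'n \<Rightarrow> 'b::{second_countable_topology,banach}) \<Rightarrow> 'b" where
  "cco k f = integral\<^sup>L TN (\<lambda>x. tcos k x *\<^sub>R f x)"

definition sco :: "int^'n::finite \<Rightarrow> (real^'n \<Rightarrow> 'b::{second_countable_topology,banach}) \<Rightarrow> 'b" where
  "sco k f = integral\<^sup>L TN (\<lambda>x. tsin k x *\<^sub>R f x)"

lemma double_vec_eq_0_iff [simp]: "2 * l = 0 \<longleftrightarrow> l = 0" for l :: "int^'n::finite"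
  by (simp add: vec_eq_iff)

lemma integrable_bounded_scaleR:
  fixes f :: "real^'n::finite \<Rightarrow> 'b::{second_countable_topology,banach}"
  assumes "h \<in> borel_measurable TN" "\<And>x. \<bar>h x\<bar> \<le> M" "integrable TN f"
  shows "integrable TN (\<lambda>x. h x *\<^sub>R f x)"
proof (rule Bochner_Integration.integrable_bound)
  show "integrable TN (\<lambda>x. M *\<^sub>R f x)" using assms(3) by simp
  show "(\<lambda>x. h x *\<^sub>R f x) \<in> borel_measurable TN" using assms by simp
  have "M \<ge> 0" using assms(2)[of undefined] by linarith
  then show "AE x in TN. norm (h x *\<^sub>R f x) \<le> norm (M *\<^sub>R f x)"
    using assms(2) by (auto intro!: mult_right_mono)
qed

lemma measurable_trig:
  fixes f :: "real^'n::finite \<Rightarrow> 'b::{second_countable_topology,real_normed_vector}"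
  shows "trig f \<Longrightarrow> f \<in> borel_measurable TN"
  by (intro continuous_borel_measurable_TN trig_continuous)

lemma measurable_tcos [measurable]: "tcos k \<in> borel_measurable TN"
  and measurable_tsin [measurable]: "tsin k \<in> borel_measurable TN"
  by (auto intro!: continuous_borel_measurable_TN continuous_intros)

lemma integrable_tcos_scaleR: "integrable TN f \<Longrightarrow> integrable TN (\<lambda>x. tcos k x *\<^sub>R f x)"
  and integrable_tsin_scaleR: "integrable TN f \<Longrightarrow> integrable TN (\<lambda>x. tsin k x *\<^sub>R f x)"
  for f :: "real^'n::finite \<Rightarrow> 'b::{second_countable_topology,banach}"
  by (auto intro!: integrable_bounded_scaleR[where M=1])

lemma integral_tcos_tcos: "integral\<^sup>L TN (\<lambda>x. tcos k x * tcos l x) = ((if k = l then 1 else 0) + (if k = - l then 1 else 0)) / 2"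
  and integral_tsin_tsin: "integral\<^sup>L TN (\<lambda>x. tsin k x * tsin l x) = ((if k = l then 1 else 0) - (if k = - l then 1 else 0)) / 2"
  and integral_tsin_tcos: "integral\<^sup>L TN (\<lambda>x. tsin k x * tcos l x) = 0"
  and integral_tcos_tsin: "integral\<^sup>L TN (\<lambda>x. tcos k x * tsin l x) = 0"
  unfolding tcos_tcos tsin_tsin tsin_tcos tcos_tsin
  by (simp_all add: integral_tcos integral_tsin eq_neg_iff_add_eq_0)

lemma cco_add: "integrable TN f \<Longrightarrow> integrable TN g \<Longrightarrow> cco k (\<lambda>x. f x + g x) = cco k f + cco k g"
  and sco_add: "integrable TN f \<Longrightarrow> integrable TN g \<Longrightarrow> sco k (\<lambda>x. f x + g x) = sco k f + sco k g"
  unfolding cco_def sco_def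
  by (simp_all add: scaleR_add_right integrable_tcos_scaleR integrable_tsin_scaleR)

lemma cco_tcos: "cco k (\<lambda>x. tcos l x *\<^sub>R a) = (((if k = l then 1 else 0) + (if k = - l then 1 else 0)) / 2) *\<^sub>R a"
  and sco_tsin: "sco k (\<lambda>x. tsin l x *\<^sub>R a) = (((if k = l then 1 else 0) - (if k = - l then 1 else 0)) / 2) *\<^sub>R a"
  and sco_tcos: "sco k (\<lambda>x. tcos l x *\<^sub>R a) = 0"
  and cco_tsin: "cco k (\<lambda>x. tsin l x *\<^sub>R a) = 0"
  for a :: "'b::{second_countable_topology,banach}"
proof -
  have i: "integrable TN (\<lambda>x. tcos k x * tcos l x)" "integrable TN (\<lambda>x. tsin k x * tsin l x)"
    "integrable TN (\<lambda>x. tsin k x * tcos l x)" "integrable TN (\<lambda>x. tcos k x * tsin l x)"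
    by (auto intro!: integrable_TN_continuous continuous_intros)
  show "cco k (\<lambda>x. tcos l x *\<^sub>R a) = (((if k = l then 1 else 0) + (if k = - l then 1 else 0)) / 2) *\<^sub>R a"
    "sco k (\<lambda>x. tsin l x *\<^sub>R a) = (((if k = l then 1 else 0) - (if k = - l then 1 else 0)) / 2) *\<^sub>R a"
    "sco k (\<lambda>x. tcos l x *\<^sub>R a) = 0" "cco k (\<lambda>x. tsin l x *\<^sub>R a) = 0"
    unfolding cco_def sco_def scaleR_scaleR
    using i by (simp_all only: integral_scaleR_left integral_tcos_tcos integral_tsin_tsin integral_tsin_tcos integral_tcos_tsin scaleR_zero_left)
qed

text \<open>The coefficients carry no factor 2 because each nonzero frequency occurs twice in the
  sum, as \<open>k\<close> and as \<open>- k\<close>; frequency 0 then needs no separate treatment.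
  Allowing every large \<open>G\<close>, and not just one, lets the induction expand two summands
  over a common set.\<close>

lemma trig_fourier:
  fixes f :: "real^'n::finite \<Rightarrow> 'b::{second_countable_topology,banach}"
  assumes "trig f"
  shows "\<exists>F. finite F \<and> (\<forall>G. finite G \<and> F \<subseteq> G \<longrightarrow>
           (\<forall>x. f x = (\<Sum>k\<in>G. tcos k x *\<^sub>R cco k f + tsin k x *\<^sub>R sco k f)))"
  using assms
proof (induction rule: trigV.induct)
  case (cos a l)
  have half: "(1/2) *\<^sub>R v + (1/2) *\<^sub>R v = v" for v :: 'b
    by (subst scaleR_left_distrib[symmetric]) simp
  show ?case
  proof (intro exI[of _ "{l, - l}"] conjI allI impI)
    fix G :: "(int^'n) set" and x
    assume G: "finite G \<and> {l, - l} \<subseteq> G"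
    have e: "tcos k x *\<^sub>R ((((if k = l then 1 else 0) + (if k = - l then 1 else 0)) / 2) *\<^sub>R a)
        = (if k = l then tcos k x *\<^sub>R (1/2) *\<^sub>R a else 0) + (if k = - l then tcos k x *\<^sub>R (1/2) *\<^sub>R a else 0)" for k
      using half[of "tcos k x *\<^sub>R a"] by auto
    have "(\<Sum>k\<in>G. tcos k x *\<^sub>R cco k (\<lambda>x. tcos l x *\<^sub>R a) + tsin k x *\<^sub>R sco k (\<lambda>x. tcos l x *\<^sub>R a)) = tcos l x *\<^sub>R (1/2) *\<^sub>R a + tcos l x *\<^sub>R (1/2) *\<^sub>R a"
      unfolding cco_tcos sco_tcos e scaleR_zero_right add_0_right sum.distrib
      using G by (simp add: sum.delta')
    also have "\<dots> = (1/2) *\<^sub>R (tcos l x *\<^sub>R a) + (1/2) *\<^sub>R (tcos l x *\<^sub>R a)"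
      by simp
    finally show "tcos l x *\<^sub>R a = (\<Sum>k\<in>G. tcos k x *\<^sub>R cco k (\<lambda>x. tcos l x *\<^sub>R a) + tsin k x *\<^sub>R sco k (\<lambda>x. tcos l x *\<^sub>R a))"
      by (simp only: half)
  qed simp
next
  case (sin a l)
  have half: "(1/2) *\<^sub>R v + (1/2) *\<^sub>R v = v" for v :: 'b
    by (subst scaleR_left_distrib[symmetric]) simp
  show ?case
  proof (intro exI[of _ "{l, - l}"] conjI allI impI)
    fix G :: "(int^'n) set" and x
    assume G: "finite G \<and> {l, - l} \<subseteq> G"
    have e: "tsin k x *\<^sub>R ((((if k = l then 1 else 0) - (if k = - l then 1 else 0)) / 2) *\<^sub>R a)
        = (if k = l then tsin k x *\<^sub>R (1/2) *\<^sub>R a else 0) + (if k = - l then - (tsin k x *\<^sub>R (1/2) *\<^sub>R a) else 0)" for k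
      by auto
    have "(\<Sum>k\<in>G. tcos k x *\<^sub>R cco k (\<lambda>x. tsin l x *\<^sub>R a) + tsin k x *\<^sub>R sco k (\<lambda>x. tsin l x *\<^sub>R a)) = tsin l x *\<^sub>R (1/2) *\<^sub>R a + tsin l x *\<^sub>R (1/2) *\<^sub>R a"
      unfolding sco_tsin cco_tsin e scaleR_zero_right add_0_left sum.distrib
      using G by (simp add: sum.delta')
    also have "\<dots> = (1/2) *\<^sub>R (tsin l x *\<^sub>R a) + (1/2) *\<^sub>R (tsin l x *\<^sub>R a)"
      by simp
    finally show "tsin l x *\<^sub>R a = (\<Sum>k\<in>G. tcos k x *\<^sub>R cco k (\<lambda>x. tsin l x *\<^sub>R a) + tsin k x *\<^sub>R sco k (\<lambda>x. tsin l x *\<^sub>R a))"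
      by (simp only: half)
  qed simp
next
  case (add f g)
  from add.IH(1) obtain F where F: "finite F" "\<forall>G. finite G \<and> F \<subseteq> G \<longrightarrow>
      (\<forall>x. f x = (\<Sum>k\<in>G. tcos k x *\<^sub>R cco k f + tsin k x *\<^sub>R sco k f))"
    by (elim exE conjE)
  from add.IH(2) obtain F' where F': "finite F'" "\<forall>G. finite G \<and> F' \<subseteq> G \<longrightarrow>
      (\<forall>x. g x = (\<Sum>k\<in>G. tcos k x *\<^sub>R cco k g + tsin k x *\<^sub>R sco k g))"
    by (elim exE conjE)
  show ?case
  proof (intro exI[of _ "F \<union> F'"] conjI allI impI)
    fix G x assume G: "finite G \<and> F \<union> F' \<subseteq> G"
    have fx: "f x = (\<Sum>k\<in>G. tcos k x *\<^sub>R cco k f + tsin k x *\<^sub>R sco k f)"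
      and gx: "g x = (\<Sum>k\<in>G. tcos k x *\<^sub>R cco k g + tsin k x *\<^sub>R sco k g)"
      using G by (intro F(2)[rule_format] F'(2)[rule_format]; simp)+
    have "f x + g x = (\<Sum>k\<in>G. (tcos k x *\<^sub>R cco k f + tsin k x *\<^sub>R sco k f) + (tcos k x *\<^sub>R cco k g + tsin k x *\<^sub>R sco k g))"
      by (subst fx, subst gx, rule sum.distrib[symmetric])
    also have "\<dots> = (\<Sum>k\<in>G. tcos k x *\<^sub>R cco k (\<lambda>x. f x + g x) + tsin k x *\<^sub>R sco k (\<lambda>x. f x + g x))"
      by (intro sum.cong) (simp_all add: cco_add sco_add trig_integrable add.hyps scaleR_add_right)
    finally show "f x + g x = \<dots>" .
  qed (use F F' in auto)
qed

text \<open>The estimate becomes an identity once the square norm of the conjugate series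
  \<open>t\<close> is added on the left; no symmetry of the coefficients under \<open>k \<mapsto> - k\<close> is needed.\<close>

lemma integral_norm_trig_le:
  fixes \<alpha> \<beta> :: "int^'n::finite \<Rightarrow> 'b::euclidean_space"
  shows "integral\<^sup>L TN (\<lambda>x. (norm (\<Sum>k\<in>F. tcos k x *\<^sub>R \<alpha> k + tsin k x *\<^sub>R \<beta> k))\<^sup>2)
     \<le> (\<Sum>k\<in>F. (norm (\<alpha> k))\<^sup>2 + (norm (\<beta> k))\<^sup>2)"
proof (cases "finite F")
  case True
  define s where "s x = (\<Sum>k\<in>F. tcos k x *\<^sub>R \<alpha> k + tsin k x *\<^sub>R \<beta> k)" for x
  define t where "t x = (\<Sum>k\<in>F. tsin k x *\<^sub>R \<alpha> k - tcos k x *\<^sub>R \<beta> k)" for x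
  have c: "tcos (k - l) x = tcos k x * tcos l x + tsin k x * tsin l x"
    "tsin (k - l) x = tsin k x * tcos l x - tcos k x * tsin l x" for k l and x :: "real^'n"
    unfolding tcos_def tsin_def rv_diff inner_diff_left right_diff_distrib cos_diff sin_diff by simp_all
  \<comment> \<open>In complex notation \<open>s - i t\<close> is the series in
    \<open>exp (- 2 pi i k x)\<close> with coefficients \<open>\<alpha> k + i \<beta> k\<close>. Its
    squared modulus only involves the differences \<open>k - l\<close>, so the terms with
    \<open>k \<noteq> l\<close> integrate to zero.\<close>
  define T where "T k l x = tcos (k - l) x * (\<alpha> k \<bullet> \<alpha> l + \<beta> k \<bullet> \<beta> l)
        + tsin (l - k) x * (\<alpha> k \<bullet> \<beta> l) + tsin (k - l) x * (\<beta> k \<bullet> \<alpha> l)" for k l x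
  have iT: "integrable TN (T k l)" for k l
    unfolding T_def by (intro integrable_TN_continuous continuous_intros)
  have vT: "integral\<^sup>L TN (T k l) = (if k = l then \<alpha> k \<bullet> \<alpha> l + \<beta> k \<bullet> \<beta> l else 0)" for k l
    unfolding T_def by (simp add: integral_tcos integral_tsin)
  have eq: "(norm (s x))\<^sup>2 + (norm (t x))\<^sup>2 = (\<Sum>k\<in>F. \<Sum>l\<in>F. T k l x)" for x
    unfolding power2_norm_eq_inner s_def t_def inner_sum_left inner_sum_right sum.distrib[symmetric] T_def
    by (intro sum.cong refl) (simp add: c inner_simps algebra_simps inner_commute)
  have cont: "continuous_on UNIV s" "continuous_on UNIV t"
    unfolding s_def t_def by (intro continuous_intros)+
  have int: "integrable TN (\<lambda>x. (norm (s x))\<^sup>2)" "integrable TN (\<lambda>x. (norm (t x))\<^sup>2)"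
    by (intro integrable_TN_continuous continuous_intros cont)+
  have "integral\<^sup>L TN (\<lambda>x. (norm (s x))\<^sup>2) \<le> integral\<^sup>L TN (\<lambda>x. (norm (s x))\<^sup>2 + (norm (t x))\<^sup>2)"
    using int by (intro integral_mono) auto
  also have "\<dots> = (\<Sum>k\<in>F. \<Sum>l\<in>F. integral\<^sup>L TN (T k l))"
    unfolding eq using iT by (simp add: Bochner_Integration.integral_sum)
  also have "\<dots> = (\<Sum>k\<in>F. \<Sum>l\<in>F. (if k = l then \<alpha> k \<bullet> \<alpha> l + \<beta> k \<bullet> \<beta> l else 0))"
    by (simp only: vT)
  also have "\<dots> = (\<Sum>k\<in>F. (norm (\<alpha> k))\<^sup>2 + (norm (\<beta> k))\<^sup>2)"
    using True by (auto simp: power2_norm_eq_inner intro!: sum.cong)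
  finally show ?thesis by (simp add: s_def)
qed simp

text \<open>Expand the nonnegative integral of the squared norm of \<open>w - s\<close>, where
  \<open>s\<close> is the partial series over \<open>F\<close>. The mixed term equals the
  coefficient sum exactly, and the square term is at most that sum by the preceding estimate,
  whatever \<open>F\<close> is.\<close>

lemma trig_bessel:
  fixes w :: "real^'n::finite \<Rightarrow> 'b::euclidean_space"
  assumes "trig w"
  shows "(\<Sum>k\<in>F. (norm (cco k w))\<^sup>2 + (norm (sco k w))\<^sup>2) \<le> integral\<^sup>L TN (\<lambda>x. (norm (w x))\<^sup>2)"
proof (cases "finite F")
  case True
  define s where "s x = (\<Sum>k\<in>F. tcos k x *\<^sub>R cco k w + tsin k x *\<^sub>R sco k w)" for x
  let ?S = "\<Sum>k\<in>F. (norm (cco k w))\<^sup>2 + (norm (sco k w))\<^sup>2"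
  have cw: "continuous_on UNIV w" by (rule trig_continuous[OF assms])
  have cs: "continuous_on UNIV s" unfolding s_def by (intro continuous_intros)
  have ints: "integrable TN (\<lambda>x. tcos k x *\<^sub>R w x)" "integrable TN (\<lambda>x. tsin k x *\<^sub>R w x)" for k
    by (intro integrable_TN_continuous continuous_intros cw)+
  have "integral\<^sup>L TN (\<lambda>x. w x \<bullet> s x) = integral\<^sup>L TN (\<lambda>x. \<Sum>k\<in>F. (tcos k x *\<^sub>R w x) \<bullet> cco k w + (tsin k x *\<^sub>R w x) \<bullet> sco k w)"
    by (intro Bochner_Integration.integral_cong refl) (simp add: s_def inner_sum_right inner_add_right)
  also have "\<dots> = (\<Sum>k\<in>F. cco k w \<bullet> cco k w + sco k w \<bullet> sco k w)"
    by (subst Bochner_Integration.integral_sum)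
       (auto simp del: inner_scaleR_left simp: ints cco_def sco_def intro!: sum.cong)
  finally have ws: "integral\<^sup>L TN (\<lambda>x. w x \<bullet> s x) = ?S"
    by (simp add: power2_norm_eq_inner)
  have i: "integrable TN (\<lambda>x. w x \<bullet> w x)" "integrable TN (\<lambda>x. w x \<bullet> s x)" "integrable TN (\<lambda>x. s x \<bullet> s x)"
    by (intro integrable_TN_continuous continuous_intros cw cs)+
  have "0 \<le> integral\<^sup>L TN (\<lambda>x. (norm (w x - s x))\<^sup>2)" by simp
  also have "\<dots> = integral\<^sup>L TN (\<lambda>x. w x \<bullet> w x - 2 * (w x \<bullet> s x) + s x \<bullet> s x)"
    by (intro Bochner_Integration.integral_cong refl)
       (simp add: power2_norm_eq_inner inner_diff_left inner_diff_right inner_commute[of "s _" "w _"])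
  also have "\<dots> = integral\<^sup>L TN (\<lambda>x. w x \<bullet> w x) - 2 * ?S + integral\<^sup>L TN (\<lambda>x. s x \<bullet> s x)"
    using i by (simp add: ws)
  also have "integral\<^sup>L TN (\<lambda>x. s x \<bullet> s x) \<le> ?S"
    using integral_norm_trig_le[where F=F and \<alpha>="\<lambda>k. cco k w" and \<beta>="\<lambda>k. sco k w"]
    unfolding s_def[symmetric] power2_norm_eq_inner .
  finally show ?thesis by (simp add: power2_norm_eq_inner)
qed simp

section \<open>The operator and its symbol\<close>

definition Aop :: "('n::finite \<Rightarrow> real^'d::finite^'l::finite) \<Rightarrow> (real^'n \<Rightarrow> real^'d) \<Rightarrow> real^'n \<Rightarrow> real^'l" where
  "Aop A w x = (\<Sum>i\<in>UNIV. A i *v partial i w x)"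

lemma trig_Aop:
  assumes "trig w"
  shows "trig (Aop A w)"
proof -
  have "trig (\<lambda>x. A i *v partial i w x)" for i
    by (rule trigV_linear[OF trig_partial[OF assms] matrix_vector_mul_linear UNIV_I])
  then show ?thesis
    unfolding Aop_def by (rule trigV_sum) (rule UNIV_I)
qed

lemma Aop_add: "trig f \<Longrightarrow> trig g \<Longrightarrow> Aop A (\<lambda>x. f x + g x) = (\<lambda>x. Aop A f x + Aop A g x)"
  by (simp add: Aop_def fun_eq_iff partial_add trig_differentiable matrix_vector_right_distrib sum.distrib)

lemma Aop_tcos: "Aop A (\<lambda>x. tcos k x *\<^sub>R a) = (\<lambda>x. tsin k x *\<^sub>R (- (2 * pi)) *\<^sub>R (symb A (rv k) *v a))"
  and Aop_tsin: "Aop A (\<lambda>x. tsin k x *\<^sub>R a) = (\<lambda>x. tcos k x *\<^sub>R (2 * pi) *\<^sub>R (symb A (rv k) *v a))"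
  unfolding Aop_def symb_mult partial_tcos partial_tsin scaleR_sum_right
  by (auto simp: fun_eq_iff matrix_vector_mult_scaleR matrix_vector_mult_uminus mult_ac intro!: sum.cong)

lemma symb_0 [simp]: "symb A 0 = 0"
  by (simp add: symb_def)

lemma symb_minus: "symb A (- \<xi>) *v a = - (symb A \<xi> *v a)"
  using symb_scale[of A "-1" \<xi> a] by simp

text \<open>On the Fourier side the operator is multiplication by its symbol. Being of first order,
  it exchanges the cosine and sine coefficients, with a sign on one of them.\<close>

lemma coeff_Aop:
  assumes "trig w"
  shows "cco k (Aop A w) = (2 * pi) *\<^sub>R (symb A (rv k) *v sco k w) \<and>
    sco k (Aop A w) = (- (2 * pi)) *\<^sub>R (symb A (rv k) *v cco k w)"
  using assms
proof (induction rule: trigV.induct)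
  case (cos a l)
  show ?case
    unfolding Aop_tcos cco_tsin sco_tsin cco_tcos sco_tcos
    by (auto simp: matrix_vector_mult_scaleR rv_minus symb_minus symb_0)
next
  case (sin a l)
  show ?case
    unfolding Aop_tsin cco_tsin sco_tsin cco_tcos sco_tcos
    by (auto simp: matrix_vector_mult_scaleR rv_minus symb_minus)
next
  case (add f g)
  then show ?case
    by (simp add: Aop_add cco_add sco_add trig_integrable trig_Aop matrix_vector_right_distrib scaleR_add_right)
qed

lemma afree_Aop: "afree A f \<Longrightarrow> Aop A f y = 0"
  unfolding Aop_def by (rule afree_pointwise)

lemma smooth_differentiable: "smooth f \<Longrightarrow> f differentiable at x"
  and smooth_partial_continuous: "smooth f \<Longrightarrow> continuous_on UNIV (partial i f)"
proof -
  assume "smooth f"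
  then have "iter_partial [] f differentiable at x" "\<And>x. iter_partial [i] f differentiable at x"
    unfolding smooth_def by blast+
  then show "f differentiable at x" "continuous_on UNIV (partial i f)"
    by (auto intro!: continuous_at_imp_continuous_on differentiable_imp_continuous_within)
qed

lemma smooth_continuous: "smooth f \<Longrightarrow> continuous_on UNIV f"
  by (meson smooth_differentiable continuous_at_imp_continuous_on differentiable_imp_continuous_within)

text \<open>The function \<open>(A i *v z x) \<bullet> \<phi> x\<close> is periodic, so its
  \<open>i\<close>-th derivative has mean zero. Summing over \<open>i\<close>, the terms where the
  derivative falls on \<open>z\<close> cancel pointwise, and the rest is the distributional
  pairing.\<close>

lemma smooth_kerA:
  assumes sz: "smooth z" and pz: "periodic z" and Az: "\<And>y. (\<Sum>i\<in>UNIV. A i *v partial i z y) = 0"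
  shows "kerA A z"
  unfolding kerA_def
proof (intro allI impI)
  fix \<phi> :: "real^'a \<Rightarrow> real^'c" assume \<phi>: "smooth \<phi> \<and> periodic \<phi>"
  have cz: "continuous_on UNIV z" "continuous_on UNIV (partial i z)" for i
    using sz smooth_continuous smooth_partial_continuous by blast+
  define g where "g i x = (A i *v z x) \<bullet> \<phi> x" for i x
  have lin: "bounded_linear ((*v) (A i))" for i
    by (simp add: linear_linear)
  have der: "(g i has_derivative (\<lambda>h. (A i *v z x) \<bullet> frechet_derivative \<phi> (at x) h
       + (A i *v frechet_derivative z (at x) h) \<bullet> \<phi> x)) (at x)" for i x
    unfolding g_def
    using \<phi> smooth_differentiable[of \<phi>] smooth_differentiable[OF sz]
    by (intro has_derivative_inner bounded_linear.has_derivative[OF lin]) (auto simp: frechet_derivative_works)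
  have p: "partial i (g i) x = (A i *v z x) \<bullet> partial i \<phi> x + (A i *v partial i z x) \<bullet> \<phi> x" for i x
    using partialI[OF der] by (simp add: partial_def)
  have cA: "continuous_on UNIV (\<lambda>x. A i *v u x)" if "continuous_on UNIV u" for u :: "real^'a \<Rightarrow> real^'b" and i
    using that by (rule bounded_linear.continuous_on[OF lin])
  have c: "continuous_on UNIV (\<lambda>x. (A i *v z x) \<bullet> partial i \<phi> x)" "continuous_on UNIV (\<lambda>x. (A i *v partial i z x) \<bullet> \<phi> x)" for i
    using smooth_continuous[of \<phi>] smooth_partial_continuous[of \<phi>] \<phi>
    by (intro continuous_intros cA cz; blast)+
  have z: "integral\<^sup>L TN (partial i (g i)) = 0" for i
  proof (rule integral_partial_eq_0)
    show "periodic (g i)"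
      using \<phi> pz by (auto simp: periodic_def g_def)
    show "g i differentiable at x" for x using der differentiable_def by blast
    show "continuous_on UNIV (partial i (g i))"
      unfolding p by (intro continuous_on_add c)
  qed
  have "0 = (\<Sum>i\<in>UNIV. integral\<^sup>L TN (\<lambda>x. (A i *v z x) \<bullet> partial i \<phi> x + (A i *v partial i z x) \<bullet> \<phi> x))"
    using z by (simp add: p[abs_def])
  also have "\<dots> = integral\<^sup>L TN (\<lambda>x. (\<Sum>i\<in>UNIV. (A i *v z x) \<bullet> partial i \<phi> x) + (\<Sum>i\<in>UNIV. A i *v partial i z x) \<bullet> \<phi> x)"
    using integrable_TN_continuous[OF c(1)] integrable_TN_continuous[OF c(2)]
    by (subst Bochner_Integration.integral_sum[symmetric]) (auto simp: sum.distrib inner_sum_left)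
  also have "\<dots> = integral\<^sup>L TN (\<lambda>x. \<Sum>i\<in>UNIV. (A i *v z x) \<bullet> partial i \<phi> x)"
    by (simp add: Az)
  finally show "integral\<^sup>L TN (\<lambda>x. \<Sum>i\<in>UNIV. (A i *v z x) \<bullet> partial i \<phi> x) = 0" by simp
qed

lemma afree_kerA: "afree A z \<Longrightarrow> kerA A z"
  by (intro smooth_kerA trig_smooth trig_periodic afree_pointwise) (auto dest: trigV_imp_trig)

text \<open>If the bound failed along \<open>\<xi>\<^sub>n \<rightarrow> \<xi>\<close> with witnesses \<open>e\<^sub>n\<close>, then \<open>ker A(\<xi>\<^sub>n) \<oplus> span e\<^sub>n\<close>, on
  which \<open>A(\<xi>\<^sub>n)\<close> tends to zero, would for dimension reasons meet the orthogonal complement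
  of \<open>ker A(\<xi>)\<close>; a limit of unit vectors in the intersections contradicts injectivity there.\<close>

lemma symb_lower_bound:
  fixes A :: "'n::finite \<Rightarrow> real^'d::finite^'l::finite"
  assumes "constant_rank A"
  shows "\<exists>c>0. \<forall>\<xi> v. norm \<xi> = 1 \<longrightarrow> (\<forall>y. symb A \<xi> *v y = 0 \<longrightarrow> v \<bullet> y = 0) \<longrightarrow>
           c * norm v \<le> norm (symb A \<xi> *v v)"
proof (rule ccontr)
  assume neg: "\<not> ?thesis"
  define K where "K \<xi> = {v. symb A \<xi> *v v = 0}" for \<xi>
  obtain r where r: "\<And>\<xi>. norm \<xi> = 1 \<Longrightarrow> dim (K \<xi>) = r"
    using assms unfolding constant_rank_def K_def symb_def by blast
  have subK: "subspace (K \<xi>)" for \<xi>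
    unfolding K_def subspace_def by (simp add: matrix_vector_right_distrib matrix_vector_mult_scaleR)
  have "\<exists>\<xi> e. norm \<xi> = 1 \<and> (\<forall>y\<in>K \<xi>. e \<bullet> y = 0) \<and> norm e = 1 \<and> norm (symb A \<xi> *v e) \<le> 1 / real (Suc n)" for n
  proof -
    have "1 / real (Suc n) > 0" by simp
    with neg obtain \<xi> v where *: "norm \<xi> = 1" "\<forall>y. symb A \<xi> *v y = 0 \<longrightarrow> v \<bullet> y = 0"
      "\<not> 1 / real (Suc n) * norm v \<le> norm (symb A \<xi> *v v)"
      by blast
    then have v0: "norm v > 0"
      by (cases "v = 0") auto
    have "norm (symb A \<xi> *v ((1 / norm v) *\<^sub>R v)) \<le> 1 / real (Suc n)"
      using * v0 by (simp add: matrix_vector_mult_scaleR field_simps)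
    then show ?thesis using * v0
      by (intro exI[of _ \<xi>] exI[of _ "(1 / norm v) *\<^sub>R v"]) (auto simp: K_def)
  qed
  then obtain X e where X: "\<And>n. norm (X n) = 1" "\<And>n y. y \<in> K (X n) \<Longrightarrow> e n \<bullet> y = 0" "\<And>n. norm (e n) = 1"
    "\<And>n::nat. norm (symb A (X n) *v e n) \<le> 1 / real (Suc n)" by metis
  have "\<exists>l\<in>sphere 0 1. \<exists>s. strict_mono s \<and> (X \<circ> s) \<longlonglongrightarrow> l"
    using compact_sphere[of "0::real^'n" 1] X(1) unfolding compact_eq_seq_compact_metric seq_compact_def
    by (metis mem_sphere_0)
  then obtain \<xi> s where \<xi>: "norm \<xi> = 1" "strict_mono s" "(X \<circ> s) \<longlonglongrightarrow> \<xi>" by auto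
  define W where "W = {y. \<forall>x\<in>K \<xi>. orthogonal x y}"
  have subW: "subspace W" unfolding W_def by (rule subspace_orthogonal_to_vectors)
  have dW: "dim W + r = CARD('d)"
    using dim_subspace_orthogonal_to_vectors[OF subK subspace_UNIV, of \<xi>] r[OF \<xi>(1)] by (simp add: W_def)
  have "\<exists>x. x \<in> W \<and> norm x = 1 \<and> norm (symb A (X n) *v x) \<le> 1 / real (Suc n)" for n
  proof -
    define V where "V = span (insert (e n) (K (X n)))"
    have en: "e n \<notin> span (K (X n))"
    proof
      assume "e n \<in> span (K (X n))"
      then have "e n \<bullet> e n = 0" using X(2)[of "e n" n] subK by (simp add: span_eq_iff[THEN iffD2])
      then show False using X(3)[of n] by simp
    qed
    have "dim V = r + 1" unfolding V_def using en r[OF X(1)] by (simp add: dim_insert)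
    moreover have "dim {x + y |x y. x \<in> V \<and> y \<in> W} + dim (V \<inter> W) = dim V + dim W"
      by (rule dim_sums_Int) (auto simp: V_def subW)
    moreover have "dim {x + y |x y. x \<in> V \<and> y \<in> W} \<le> CARD('d)"
      using dim_subset_UNIV[of "{x + y |x y. x \<in> V \<and> y \<in> W}"] by simp
    ultimately have "dim (V \<inter> W) \<noteq> 0" using dW by linarith
    then have "\<not> V \<inter> W \<subseteq> {0}" by (simp add: dim_eq_0)
    then obtain x where x: "x \<in> V" "x \<in> W" "x \<noteq> 0" by auto
    \<comment> \<open>Modulo the kernel, \<open>x\<close> equals \<open>t *\<^sub>R e n\<close>.
      Orthogonality of \<open>e n\<close> to the kernel identifies \<open>t\<close> with
      \<open>e n \<bullet> x\<close>, so the smallness of the symbol on \<open>e n\<close> passes to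
      \<open>x\<close>.\<close>
    obtain t where t: "x - t *\<^sub>R e n \<in> K (X n)"
      using x(1) subK[of "X n"] unfolding V_def span_insert by (auto simp: span_eq_iff[THEN iffD2])
    then have "symb A (X n) *v (x - t *\<^sub>R e n) = 0" by (simp add: K_def)
    then have 1: "symb A (X n) *v x = t *\<^sub>R (symb A (X n) *v e n)"
      by (simp add: matrix_vector_mult_diff_distrib matrix_vector_mult_scaleR)
    have "e n \<bullet> x = t"
      using X(2)[OF t] X(3)[of n] by (simp add: inner_diff_right norm_eq_1)
    then have "\<bar>t\<bar> \<le> norm x" using Cauchy_Schwarz_ineq2[of "e n" x] X(3)[of n] by simp
    then have "norm (symb A (X n) *v x) \<le> norm x * (1 / real (Suc n))"
      unfolding 1 norm_scaleR by (intro mult_mono X(4)) auto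
    then show ?thesis using x
      by (intro exI[of _ "(1 / norm x) *\<^sub>R x"])
         (auto simp: matrix_vector_mult_scaleR subspace_scale[OF subW] field_simps)
  qed
  then obtain x where x: "\<And>n. x n \<in> W" "\<And>n. norm (x n) = 1" "\<And>n. norm (symb A (X n) *v x n) \<le> 1 / real (Suc n)"
    by metis
  have "\<exists>l\<in>sphere 0 1. \<exists>s'. strict_mono s' \<and> ((x \<circ> s) \<circ> s') \<longlonglongrightarrow> l"
    using compact_sphere[of "0::real^'d" 1] x(2) unfolding compact_eq_seq_compact_metric seq_compact_def
    by (metis mem_sphere_0 comp_apply)
  then obtain y s' where y: "norm y = 1" "strict_mono s'" "((x \<circ> s) \<circ> s') \<longlonglongrightarrow> y" by auto
  have yW: "y \<in> W"
    by (rule closed_sequentially[OF closed_subspace[OF subW] _ y(3)]) (simp add: x)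
  have X': "((X \<circ> s) \<circ> s') \<longlonglongrightarrow> \<xi>" by (rule LIMSEQ_subseq_LIMSEQ[OF \<xi>(3) y(2)])
  have "(\<lambda>n. symb A (((X \<circ> s) \<circ> s') n) *v (((x \<circ> s) \<circ> s') n)) \<longlonglongrightarrow> symb A \<xi> *v y"
    unfolding symb_mult
    by (intro tendsto_sum tendsto_scaleR tendsto_vec_nth X' bounded_linear.tendsto[OF _ y(3)]) (simp add: linear_linear)
  moreover have "(\<lambda>n. symb A (((X \<circ> s) \<circ> s') n) *v (((x \<circ> s) \<circ> s') n)) \<longlonglongrightarrow> 0"
  proof (rule Lim_null_comparison)
    show "\<forall>\<^sub>F n in sequentially. norm (symb A (((X \<circ> s) \<circ> s') n) *v (((x \<circ> s) \<circ> s') n)) \<le> 1 / real (Suc n)"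
    proof (intro always_eventually allI)
      fix n
      have "n \<le> (s \<circ> s') n" using \<xi>(2) y(2) by (intro seq_suble strict_mono_o)
      then have "1 / real (Suc ((s \<circ> s') n)) \<le> 1 / real (Suc n)" by (intro divide_left_mono) auto
      then show "norm (symb A (((X \<circ> s) \<circ> s') n) *v (((x \<circ> s) \<circ> s') n)) \<le> 1 / real (Suc n)"
        using x(3)[of "(s \<circ> s') n"] by simp
    qed
    show "(\<lambda>n. 1 / real (Suc n)) \<longlonglongrightarrow> 0" using LIMSEQ_inverse_real_of_nat by (simp add: inverse_eq_divide)
  qed
  ultimately have "symb A \<xi> *v y = 0" by (rule LIMSEQ_unique)
  then have "y \<in> K \<xi>" by (simp add: K_def)
  then have "y \<bullet> y = 0" using yW by (auto simp: W_def orthogonal_def)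
  then show False using y(1) by simp
qed

text \<open>\<open>a'\<close> is the orthogonal projection of \<open>a\<close> onto the kernel of
  the symbol, and homogeneity reduces the estimate to unit frequencies. The first bound serves the
  low frequencies; the second gains a factor \<open>1 / norm (rv k)\<close> and serves the high
  ones.\<close>

lemma symb_kernel_decomp:
  fixes A :: "'n::finite \<Rightarrow> real^'d::finite^'l::finite"
  assumes "constant_rank A"
  shows "\<exists>C\<ge>0. \<forall>k a. k \<noteq> 0 \<longrightarrow> (\<exists>a'. symb A (rv k) *v a' = 0 \<and> norm (a - a') \<le> norm a \<and>
            norm (a - a') \<le> C / norm (rv k) * norm (symb A (rv k) *v a))"
proof -
  obtain c where c: "c > 0" "\<forall>\<xi> v. norm \<xi> = 1 \<longrightarrow> (\<forall>y. symb A \<xi> *v y = 0 \<longrightarrow> v \<bullet> y = 0) \<longrightarrow>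
           c * norm v \<le> norm (symb A \<xi> *v v)"
    using symb_lower_bound[OF assms] by (elim exE conjE)
  show ?thesis
  proof (intro exI[of _ "1 / c"] conjI allI impI)
    fix k :: "int^'n" and a assume k: "k \<noteq> 0"
    define K where "K = {v. symb A (rv k) *v v = 0}"
    have subK: "subspace K"
      unfolding K_def subspace_def by (simp add: matrix_vector_right_distrib matrix_vector_mult_scaleR)
    obtain y z where yz: "y \<in> span K" "\<And>w. w \<in> span K \<Longrightarrow> orthogonal z w" "a = y + z"
      using orthogonal_subspace_decomp_exists[of K a] by metis
    have "y \<in> K" using yz(1) subK by (simp add: span_eq_iff[THEN iffD2])
    then have yK: "symb A (rv k) *v y = 0" by (simp add: K_def)
    have "(norm a)\<^sup>2 = (norm y)\<^sup>2 + (norm z)\<^sup>2"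
      using yz norm_add_Pythagorean[of y z] by (simp add: orthogonal_commute)
    then have "(norm z)\<^sup>2 \<le> (norm a)\<^sup>2" by simp
    then have na: "norm z \<le> norm a" by (rule power2_le_imp_le) simp
    have nk: "norm (rv k) > 0" using k by simp
    define \<xi> where "\<xi> = (1 / norm (rv k)) *\<^sub>R rv k"
    have sx: "symb A \<xi> *v v = (1 / norm (rv k)) *\<^sub>R (symb A (rv k) *v v)" for v
      by (simp add: \<xi>_def symb_scale)
    have "c * norm z \<le> norm (symb A \<xi> *v z)"
    proof (rule c(2)[rule_format])
      show "norm \<xi> = 1" using nk by (simp add: \<xi>_def)
      show "z \<bullet> y' = 0" if "symb A \<xi> *v y' = 0" for y'
      proof -
        have "y' \<in> K" using that nk by (simp add: sx K_def)
        then show ?thesis using yz(2)[OF span_base] by (simp add: orthogonal_def)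
      qed
    qed
    also have "\<dots> = norm (symb A (rv k) *v a) / norm (rv k)"
      unfolding sx yz(3) matrix_vector_right_distrib yK by simp
    finally have "norm z \<le> 1 / c / norm (rv k) * norm (symb A (rv k) *v a)"
      using c(1) nk by (simp add: field_simps)
    then show "\<exists>a'. symb A (rv k) *v a' = 0 \<and> norm (a - a') \<le> norm a \<and>
            norm (a - a') \<le> 1 / c / norm (rv k) * norm (symb A (rv k) *v a)"
      using yK na yz(3) by (intro exI[of _ y]) auto
  qed (use c in auto)
qed

section \<open>Projection onto A-free trigonometric polynomials\<close>

lemma finite_low_freq: "finite {k :: int^'n::finite. norm (rv k) \<le> D}"
proof -
  define N where "N = \<lceil>D\<rceil>"
  have "{k :: int^'n. norm (rv k) \<le> D} \<subseteq> (\<lambda>f. \<chi> i. f i) ` (PiE UNIV (\<lambda>_. {-N..N}))"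
  proof
    fix k :: "int^'n" assume "k \<in> {k. norm (rv k) \<le> D}"
    then have "\<bar>rv k $ i\<bar> \<le> D" for i using component_le_norm_cart[of "rv k" i] by simp
    then have "\<bar>of_int (k $ i)\<bar> \<le> D" for i by simp
    then have "\<bar>k $ i\<bar> \<le> N" for i
    proof -
      have "real_of_int \<bar>k $ i\<bar> \<le> of_int N"
        using \<open>\<bar>of_int (k $ i)\<bar> \<le> D\<close> le_of_int_ceiling[of D] unfolding N_def of_int_abs by linarith
      then show ?thesis by simp
    qed
    then have "(\<lambda>i. k $ i) \<in> PiE UNIV (\<lambda>_. {-N..N})" by (auto simp: abs_le_iff minus_le_iff)
    moreover have "k = (\<chi> i. k $ i)" by (simp add: vec_eq_iff)
    ultimately show "k \<in> (\<lambda>f. \<chi> i. f i) ` (PiE UNIV (\<lambda>_. {-N..N}))" by blast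
  qed
  then show ?thesis by (rule finite_subset) (auto intro!: finite_PiE)
qed

text \<open>Every Fourier coefficient is projected onto the kernel of the symbol at its frequency.
  Up to frequency \<open>D\<close> the error is bounded by the coefficients themselves; beyond
  \<open>D\<close> it is bounded by \<open>1 / D\<close> times the coefficients of
  \<open>Aop A w\<close>, which Bessel's inequality sums.\<close>

lemma afree_projection:
  fixes A :: "'n::finite \<Rightarrow> real^'d::finite^'l::finite"
  assumes "constant_rank A"
  shows "\<exists>C\<ge>0. \<forall>w D. trig w \<and> D > 0 \<longrightarrow> (\<exists>z. afree A z \<and> integral\<^sup>L TN z = 0 \<and>
     integral\<^sup>L TN (\<lambda>x. (norm (w x - z x))\<^sup>2) \<le>
       (\<Sum>k | norm (rv k) \<le> D. (norm (cco k w))\<^sup>2 + (norm (sco k w))\<^sup>2)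
       + C / D\<^sup>2 * integral\<^sup>L TN (\<lambda>x. (norm (Aop A w x))\<^sup>2))"
proof -
  obtain C where C: "C \<ge> 0" "\<forall>k a. k \<noteq> 0 \<longrightarrow> (\<exists>a'. symb A (rv k) *v a' = 0 \<and> norm (a - a') \<le> norm a \<and>
            norm (a - a') \<le> C / norm (rv k) * norm (symb A (rv k) *v a))"
    using symb_kernel_decomp[OF assms] by (elim exE conjE)
  \<comment> \<open>At frequency 0 every vector lies in the kernel, but the value 0 is chosen so
    that \<open>z\<close> has mean zero. The mean of \<open>w\<close> thereby becomes part of the
    low-frequency error.\<close>
  define P where "P k a = (if k = 0 then 0 else (SOME a'. symb A (rv k) *v a' = 0 \<and> norm (a - a') \<le> norm a \<and>
            norm (a - a') \<le> C / norm (rv k) * norm (symb A (rv k) *v a)))" for k a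
  have P: "symb A (rv k) *v P k a = 0 \<and> norm (a - P k a) \<le> norm a \<and>
            norm (a - P k a) \<le> C / norm (rv k) * norm (symb A (rv k) *v a)" if "k \<noteq> 0" for k a
    unfolding P_def if_not_P[OF that] by (rule someI_ex) (rule C(2)[rule_format, OF that])
  have P0: "P 0 a = 0" for a by (simp add: P_def)
  have Pk: "symb A (rv k) *v P k a = 0" "norm (a - P k a) \<le> norm a" for k a
    using P[of k a] P0[of a] by (cases "k = 0"; simp)+
  show ?thesis
  proof (intro exI[of _ "C\<^sup>2"] conjI allI impI; (elim conjE)?)
    fix w :: "real^'n \<Rightarrow> real^'d" and D :: real assume w: "trig w" and D: "D > 0"
    obtain F0 where F0: "finite F0" "\<forall>G. finite G \<and> F0 \<subseteq> G \<longrightarrow>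
           (\<forall>x. w x = (\<Sum>k\<in>G. tcos k x *\<^sub>R cco k w + tsin k x *\<^sub>R sco k w))"
      using trig_fourier[OF w] by (elim exE conjE)
    define F where "F = F0"
    have F: "finite F" "\<And>x. w x = (\<Sum>k\<in>F. tcos k x *\<^sub>R cco k w + tsin k x *\<^sub>R sco k w)"
      using F0(1) F0(2)[rule_format, of F0] by (simp_all add: F_def)
    define a where "a k = cco k w" for k
    define b where "b k = sco k w" for k
    define z where "z x = (\<Sum>k\<in>F. tcos k x *\<^sub>R P k (a k) + tsin k x *\<^sub>R P k (b k))" for x
    have az: "afree A z" unfolding z_def
      by (intro trigV_sum trigV.intros) (auto simp: Pk)
    have "integral\<^sup>L TN z = (\<Sum>k\<in>F. integral\<^sup>L TN (tcos k) *\<^sub>R P k (a k) + integral\<^sup>L TN (tsin k) *\<^sub>R P k (b k))"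
      unfolding z_def by (subst Bochner_Integration.integral_sum) auto
    also have "\<dots> = 0" by (intro sum.neutral) (auto simp: integral_tcos integral_tsin P0)
    finally have mz: "integral\<^sup>L TN z = 0" .
    define L where "L = {k. norm (rv k :: real^'n) \<le> D}"
    have fL: "finite L" unfolding L_def by (rule finite_low_freq)
    let ?I = "integral\<^sup>L TN (\<lambda>x. (norm (Aop A w x))\<^sup>2)"
    have wz: "w x - z x = (\<Sum>k\<in>F. tcos k x *\<^sub>R (a k - P k (a k)) + tsin k x *\<^sub>R (b k - P k (b k)))" for x
      unfolding z_def F(2)[of x] sum_subtractf[symmetric] a_def[symmetric] b_def[symmetric]
      by (intro sum.cong) (auto simp: algebra_simps)
    have "integral\<^sup>L TN (\<lambda>x. (norm (w x - z x))\<^sup>2) \<le> (\<Sum>k\<in>F. (norm (a k - P k (a k)))\<^sup>2 + (norm (b k - P k (b k)))\<^sup>2)"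
      unfolding wz by (rule integral_norm_trig_le)
    also have "\<dots> = (\<Sum>k\<in>F \<inter> L. (norm (a k - P k (a k)))\<^sup>2 + (norm (b k - P k (b k)))\<^sup>2)
        + (\<Sum>k\<in>F - L. (norm (a k - P k (a k)))\<^sup>2 + (norm (b k - P k (b k)))\<^sup>2)"
      using F(1) by (rule sum.Int_Diff)
    also have "\<dots> \<le> (\<Sum>k\<in>L. (norm (a k))\<^sup>2 + (norm (b k))\<^sup>2) + C\<^sup>2 / D\<^sup>2 * ?I"
    proof (rule add_mono)
      have "(\<Sum>k\<in>F \<inter> L. (norm (a k - P k (a k)))\<^sup>2 + (norm (b k - P k (b k)))\<^sup>2) \<le> (\<Sum>k\<in>F \<inter> L. (norm (a k))\<^sup>2 + (norm (b k))\<^sup>2)"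
        by (intro sum_mono add_mono power_mono Pk) auto
      also have "\<dots> \<le> (\<Sum>k\<in>L. (norm (a k))\<^sup>2 + (norm (b k))\<^sup>2)"
        using fL by (intro sum_mono2) auto
      finally show "(\<Sum>k\<in>F \<inter> L. (norm (a k - P k (a k)))\<^sup>2 + (norm (b k - P k (b k)))\<^sup>2) \<le> \<dots>" .
      have "(\<Sum>k\<in>F - L. (norm (a k - P k (a k)))\<^sup>2 + (norm (b k - P k (b k)))\<^sup>2)
         \<le> (\<Sum>k\<in>F - L. C\<^sup>2 / D\<^sup>2 * ((norm (cco k (Aop A w)))\<^sup>2 + (norm (sco k (Aop A w)))\<^sup>2))"
      proof (rule sum_mono)
        fix k assume "k \<in> F - L"
        then have k: "norm (rv k) > D" by (simp add: L_def)
        then have k0: "k \<noteq> 0" using D by auto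
        have *: "(norm (v - P k v))\<^sup>2 \<le> C\<^sup>2 / D\<^sup>2 * (2 * pi * norm (symb A (rv k) *v v))\<^sup>2" for v
        proof -
          have "norm (v - P k v) \<le> C / norm (rv k) * norm (symb A (rv k) *v v)" using P[OF k0] by blast
          \<comment> \<open>The factor \<open>2 * pi\<close>, which exceeds 1, is inserted so that
            the right-hand side becomes a coefficient of \<open>Aop A w\<close>.\<close>
          also have "\<dots> \<le> C / D * (2 * pi * norm (symb A (rv k) *v v))"
          proof (rule mult_mono)
            show "C / norm (rv k) \<le> C / D" using k D C(1) by (intro divide_left_mono mult_pos_pos) auto
            have "1 * norm (symb A (rv k) *v v) \<le> 2 * pi * norm (symb A (rv k) *v v)"
              using pi_ge_two by (intro mult_right_mono) auto
            then show "norm (symb A (rv k) *v v) \<le> 2 * pi * norm (symb A (rv k) *v v)" by simp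
          qed (use D C in auto)
          finally have "(norm (v - P k v))\<^sup>2 \<le> (C / D * (2 * pi * norm (symb A (rv k) *v v)))\<^sup>2"
            by (intro power_mono) auto
          then show ?thesis by (simp add: power_mult_distrib power_divide)
        qed
        have "(norm (a k - P k (a k)))\<^sup>2 + (norm (b k - P k (b k)))\<^sup>2
          \<le> C\<^sup>2 / D\<^sup>2 * (2 * pi * norm (symb A (rv k) *v a k))\<^sup>2 + C\<^sup>2 / D\<^sup>2 * (2 * pi * norm (symb A (rv k) *v b k))\<^sup>2"
          by (intro add_mono *)
        then show "(norm (a k - P k (a k)))\<^sup>2 + (norm (b k - P k (b k)))\<^sup>2
           \<le> C\<^sup>2 / D\<^sup>2 * ((norm (cco k (Aop A w)))\<^sup>2 + (norm (sco k (Aop A w)))\<^sup>2)"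
          using coeff_Aop[OF w, of k A] by (simp add: a_def b_def distrib_left add.commute)
      qed
      also have "\<dots> = C\<^sup>2 / D\<^sup>2 * (\<Sum>k\<in>F - L. (norm (cco k (Aop A w)))\<^sup>2 + (norm (sco k (Aop A w)))\<^sup>2)"
        by (simp add: sum_distrib_left)
      also have "\<dots> \<le> C\<^sup>2 / D\<^sup>2 * ?I"
        by (intro mult_left_mono trig_bessel trig_Aop w) auto
      finally show "(\<Sum>k\<in>F - L. (norm (a k - P k (a k)))\<^sup>2 + (norm (b k - P k (b k)))\<^sup>2) \<le> C\<^sup>2 / D\<^sup>2 * ?I" .
    qed
    finally have "integral\<^sup>L TN (\<lambda>x. (norm (w x - z x))\<^sup>2) \<le> (\<Sum>k\<in>L. (norm (cco k w))\<^sup>2 + (norm (sco k w))\<^sup>2) + C\<^sup>2 / D\<^sup>2 * ?I"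
      by (simp add: a_def b_def)
    then show "\<exists>z. afree A z \<and> integral\<^sup>L TN z = 0 \<and>
     integral\<^sup>L TN (\<lambda>x. (norm (w x - z x))\<^sup>2) \<le>
       (\<Sum>k | norm (rv k) \<le> D. (norm (cco k w))\<^sup>2 + (norm (sco k w))\<^sup>2) + C\<^sup>2 / D\<^sup>2 * ?I"
      using az mz unfolding L_def by blast
  qed simp
qed

section \<open>Separation of slow and fast frequencies\<close>

lemma freq_independent:
  fixes k l :: "int^'n::finite"
  assumes "(\<Sum>i\<in>UNIV. \<bar>k $ i\<bar>) < int j"
  shows "k + int j *s l = 0 \<longleftrightarrow> k = 0 \<and> l = 0" "k = int j *s l \<longleftrightarrow> k = 0 \<and> l = 0"
proof -
  \<comment> \<open>A nonzero entry of \<open>l\<close> would force an entry of \<open>k\<close> of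
    absolute value at least \<open>j\<close>, more than the sum of all of them.\<close>
  have *: "k = 0 \<and> l = 0" if "k = int j *s l" for l :: "int^'n"
  proof -
    have "l $ i = 0" for i
    proof (rule ccontr)
      assume "l $ i \<noteq> 0"
      then have "int j * 1 \<le> int j * \<bar>l $ i\<bar>" by (intro mult_left_mono) auto
      also have "\<dots> = \<bar>k $ i\<bar>" using that by (simp add: abs_mult)
      also have "\<dots> \<le> (\<Sum>i\<in>UNIV. \<bar>k $ i\<bar>)" by (rule member_le_sum) auto
      finally show False using assms by simp
    qed
    then show ?thesis using that by (simp add: vec_eq_iff)
  qed
  have "int j *s (- l) = - (int j *s l)" by (simp add: vec_eq_iff)
  then show "k + int j *s l = 0 \<longleftrightarrow> k = 0 \<and> l = 0" "k = int j *s l \<longleftrightarrow> k = 0 \<and> l = 0"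
    using *[of l] *[of "- l"] by (auto simp: eq_neg_iff_add_eq_0)
qed

lemma integral_trig_rescale_base:
  fixes \<gamma> :: "real^'n::finite \<Rightarrow> 'b::{second_countable_topology,banach}"
  assumes "trig \<gamma>" "(\<Sum>i\<in>UNIV. \<bar>k $ i\<bar>) < int j"
  shows "integral\<^sup>L TN (\<lambda>x. tcos k x *\<^sub>R \<gamma> (real j *\<^sub>R x)) = integral\<^sup>L TN (tcos k) *\<^sub>R integral\<^sup>L TN \<gamma> \<and>
         integral\<^sup>L TN (\<lambda>x. tsin k x *\<^sub>R \<gamma> (real j *\<^sub>R x)) = integral\<^sup>L TN (tsin k) *\<^sub>R integral\<^sup>L TN \<gamma>"
  using assms(1)
proof (induction rule: trigV.induct)
  case (cos a l)
  show ?case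
    unfolding tcos_scale scaleR_scaleR tcos_tcos tsin_tcos
    using freq_independent[OF assms(2), of l] by (simp add: integral_tcos integral_tsin)
next
  case (sin a l)
  show ?case
    unfolding tsin_scale scaleR_scaleR tcos_tsin tsin_tsin
    using freq_independent[OF assms(2), of l] by (simp add: integral_tcos integral_tsin)
next
  case (add f g)
  have c: "continuous_on UNIV (\<lambda>x. f (real j *\<^sub>R x))" "continuous_on UNIV (\<lambda>x. g (real j *\<^sub>R x))"
    using add.hyps by (auto intro!: trig_continuous trigV_rescale)
  then show ?case using add.IH
    by (simp add: scaleR_add_right integrable_tcos_scaleR integrable_tsin_scaleR integrable_TN_continuous trig_integrable add.hyps)
qed

text \<open>The functions \<open>\<gamma> (j x)\<close> converge weakly to their mean. Against a
  fixed trigonometric polynomial the limit is attained exactly once \<open>j\<close> exceeds all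
  frequencies of \<open>h\<close>, because slow and fast frequencies can then no longer
  cancel.\<close>

lemma integral_trig_rescale:
  fixes \<gamma> :: "real^'n::finite \<Rightarrow> 'b::{second_countable_topology,banach}"
  assumes "trig (h :: _ \<Rightarrow> real)" "trig \<gamma>"
  shows "\<exists>J. \<forall>j\<ge>J. integral\<^sup>L TN (\<lambda>x. h x *\<^sub>R \<gamma> (real j *\<^sub>R x)) = integral\<^sup>L TN h *\<^sub>R integral\<^sup>L TN \<gamma>"
  using assms(1)
proof (induction rule: trigV.induct)
  case (cos a k)
  have "integral\<^sup>L TN (\<lambda>x. (tcos k x *\<^sub>R a) *\<^sub>R \<gamma> (real j *\<^sub>R x)) = integral\<^sup>L TN (\<lambda>x. tcos k x *\<^sub>R a) *\<^sub>R integral\<^sup>L TN \<gamma>"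
    if "j \<ge> nat (\<Sum>i\<in>UNIV. \<bar>k $ i\<bar>) + 1" for j
  proof -
    have "integral\<^sup>L TN (\<lambda>x. (tcos k x *\<^sub>R a) *\<^sub>R \<gamma> (real j *\<^sub>R x)) = integral\<^sup>L TN (\<lambda>x. a *\<^sub>R (tcos k x *\<^sub>R \<gamma> (real j *\<^sub>R x)))"
      by (simp add: mult.commute)
    also have "\<dots> = a *\<^sub>R (integral\<^sup>L TN (tcos k) *\<^sub>R integral\<^sup>L TN \<gamma>)"
      unfolding integral_scaleR_right using integral_trig_rescale_base[OF assms(2), of k j] that by simp
    finally show ?thesis by (simp add: mult.commute)
  qed
  then show ?case by blast
next
  case (sin a k)
  have "integral\<^sup>L TN (\<lambda>x. (tsin k x *\<^sub>R a) *\<^sub>R \<gamma> (real j *\<^sub>R x)) = integral\<^sup>L TN (\<lambda>x. tsin k x *\<^sub>R a) *\<^sub>R integral\<^sup>L TN \<gamma>"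
    if "j \<ge> nat (\<Sum>i\<in>UNIV. \<bar>k $ i\<bar>) + 1" for j
  proof -
    have "integral\<^sup>L TN (\<lambda>x. (tsin k x *\<^sub>R a) *\<^sub>R \<gamma> (real j *\<^sub>R x)) = integral\<^sup>L TN (\<lambda>x. a *\<^sub>R (tsin k x *\<^sub>R \<gamma> (real j *\<^sub>R x)))"
      by (simp add: mult.commute)
    also have "\<dots> = a *\<^sub>R (integral\<^sup>L TN (tsin k) *\<^sub>R integral\<^sup>L TN \<gamma>)"
      unfolding integral_scaleR_right using integral_trig_rescale_base[OF assms(2), of k j] that by simp
    finally show ?thesis by (simp add: mult.commute)
  qed
  then show ?case by blast
next
  case (add f g)
  from add.IH(1) obtain J1 where J1: "\<forall>j\<ge>J1. integral\<^sup>L TN (\<lambda>x. f x *\<^sub>R \<gamma> (real j *\<^sub>R x)) = integral\<^sup>L TN f *\<^sub>R integral\<^sup>L TN \<gamma>"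
    by (elim exE)
  from add.IH(2) obtain J2 where J2: "\<forall>j\<ge>J2. integral\<^sup>L TN (\<lambda>x. g x *\<^sub>R \<gamma> (real j *\<^sub>R x)) = integral\<^sup>L TN g *\<^sub>R integral\<^sup>L TN \<gamma>"
    by (elim exE)
  have c: "continuous_on UNIV (\<lambda>x. \<gamma> (real j *\<^sub>R x))" for j
    using assms(2) by (auto intro!: trig_continuous trigV_rescale)
  have i: "integrable TN (\<lambda>x. f x *\<^sub>R \<gamma> (real j *\<^sub>R x))" "integrable TN (\<lambda>x. g x *\<^sub>R \<gamma> (real j *\<^sub>R x))" for j
    by (intro integrable_TN_continuous continuous_intros c trig_continuous add.hyps)+
  show ?case
    by (intro exI[of _ "max J1 J2"]) (auto simp: scaleR_left_distrib i J1 J2 trig_integrable add.hyps)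
qed

section \<open>Convolution with trigonometric polynomials\<close>

definition conv :: "(real^'n::finite \<Rightarrow> real) \<Rightarrow> (real^'n \<Rightarrow> 'b::{second_countable_topology,banach}) \<Rightarrow> real^'n \<Rightarrow> 'b" where
  "conv h f x = integral\<^sup>L TN (\<lambda>y. h (x - y) *\<^sub>R f y)"

lemma tcos_diff: "tcos k (x - y) = tcos k x * tcos k y + tsin k x * tsin k y"
  and tsin_diff: "tsin k (x - y) = tsin k x * tcos k y - tcos k x * tsin k y"
  unfolding tcos_def tsin_def inner_diff_right right_diff_distrib cos_diff sin_diff by simp_all

lemma integral_lincomb:
  fixes f g :: "'a \<Rightarrow> 'b::{second_countable_topology,banach}"
  assumes "integrable M f" "integrable M g"
  shows "integral\<^sup>L M (\<lambda>x. a *\<^sub>R f x + b *\<^sub>R g x) = a *\<^sub>R integral\<^sup>L M f + b *\<^sub>R integral\<^sup>L M g"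
  using assms by simp

lemma conv_tcos:
  assumes "integrable TN f"
  shows "conv (\<lambda>x. tcos k x *\<^sub>R a) f = (\<lambda>x. tcos k x *\<^sub>R (a *\<^sub>R cco k f) + tsin k x *\<^sub>R (a *\<^sub>R sco k f))"
proof
  fix x
  have "conv (\<lambda>x. tcos k x *\<^sub>R a) f x = integral\<^sup>L TN (\<lambda>y. (tcos k x * a) *\<^sub>R (tcos k y *\<^sub>R f y) + (tsin k x * a) *\<^sub>R (tsin k y *\<^sub>R f y))"
    unfolding conv_def by (intro Bochner_Integration.integral_cong refl) (simp only: tcos_diff scaleR_left_distrib[symmetric] scaleR_scaleR real_scaleR_def left_diff_distrib distrib_right, simp add: mult_ac)
  also have "\<dots> = (tcos k x * a) *\<^sub>R cco k f + (tsin k x * a) *\<^sub>R sco k f"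
    unfolding cco_def sco_def
    by (rule integral_lincomb[OF integrable_tcos_scaleR[OF assms] integrable_tsin_scaleR[OF assms]])
  finally show "conv (\<lambda>x. tcos k x *\<^sub>R a) f x = tcos k x *\<^sub>R (a *\<^sub>R cco k f) + tsin k x *\<^sub>R (a *\<^sub>R sco k f)"
    by simp
qed

lemma conv_tsin:
  assumes "integrable TN f"
  shows "conv (\<lambda>x. tsin k x *\<^sub>R a) f = (\<lambda>x. tsin k x *\<^sub>R (a *\<^sub>R cco k f) + tcos k x *\<^sub>R ((- a) *\<^sub>R sco k f))"
proof
  fix x
  have "conv (\<lambda>x. tsin k x *\<^sub>R a) f x = integral\<^sup>L TN (\<lambda>y. (tsin k x * a) *\<^sub>R (tcos k y *\<^sub>R f y) + (tcos k x * (- a)) *\<^sub>R (tsin k y *\<^sub>R f y))"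
    unfolding conv_def by (intro Bochner_Integration.integral_cong refl) (simp only: tsin_diff scaleR_left_distrib[symmetric] scaleR_scaleR real_scaleR_def left_diff_distrib distrib_right, simp add: mult_ac)
  also have "\<dots> = (tsin k x * a) *\<^sub>R cco k f + (tcos k x * (- a)) *\<^sub>R sco k f"
    unfolding cco_def sco_def
    by (rule integral_lincomb[OF integrable_tcos_scaleR[OF assms] integrable_tsin_scaleR[OF assms]])
  finally show "conv (\<lambda>x. tsin k x *\<^sub>R a) f x = tsin k x *\<^sub>R (a *\<^sub>R cco k f) + tcos k x *\<^sub>R ((- a) *\<^sub>R sco k f)"
    by simp
qed

lemma integrable_conv:
  fixes f :: "real^'n::finite \<Rightarrow> 'b::{second_countable_topology,banach}"
  assumes h: "trig h" and f: "integrable TN f"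
  shows "integrable TN (\<lambda>y. h (x - y) *\<^sub>R f y)"
proof -
  obtain M where M: "\<And>x. norm (h x) \<le> M" using trig_bounded[OF h] by auto
  have "continuous_on UNIV (\<lambda>y. h (x - y))"
    by (rule continuous_on_compose2[OF trig_continuous[OF h]]) (auto intro!: continuous_intros)
  then show ?thesis
    using M by (intro integrable_bounded_scaleR[OF _ _ f, of _ M] continuous_borel_measurable_TN) auto
qed

lemma conv_add:
  assumes "trig h" "trig g" "integrable TN f"
  shows "conv (\<lambda>x. h x + g x) f = (\<lambda>x. conv h f x + conv g f x)"
  unfolding conv_def using assms by (simp add: scaleR_left_distrib integrable_conv)

text \<open>By the addition theorems, convolution only multiplies the Fourier coefficients of
  \<open>f\<close> by scalars. Linear constraints on these coefficients, such as lying in the kernel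
  of the symbol, therefore survive.\<close>

lemma trigV_conv:
  fixes f :: "real^'n::finite \<Rightarrow> 'b::{second_countable_topology,banach}"
  assumes h: "trig h" and f: "integrable TN f"
    and V: "\<And>k c. c *\<^sub>R cco k f \<in> V k" "\<And>k c. c *\<^sub>R sco k f \<in> V k"
  shows "trigV V (conv h f)"
  using h
proof (induction rule: trigV.induct)
  case (cos a k)
  show ?case unfolding conv_tcos[OF f] by (intro trigV.intros V)
next
  case (sin a k)
  show ?case unfolding conv_tsin[OF f] by (intro trigV.intros V)
next
  case (add g h)
  then show ?case by (simp add: conv_add f trigV.add)
qed

lemma trig_conv: "trig h \<Longrightarrow> integrable TN f \<Longrightarrow> trig (conv h f)"
  by (rule trigV_conv) auto

text \<open>Since \<open>h (x - y)\<close> is a finite sum of products, no Fubini theorem is needed here.\<close>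

lemma integral_conv:
  fixes f :: "real^'n::finite \<Rightarrow> 'b::{second_countable_topology,banach}"
  assumes h: "trig h" and f: "integrable TN f"
  shows "integral\<^sup>L TN (conv h f) = integral\<^sup>L TN h *\<^sub>R integral\<^sup>L TN f"
  using h
proof (induction rule: trigV.induct)
  case (cos a k)
  show ?case unfolding conv_tcos[OF f]
    by (simp add: integral_tcos integral_tsin cco_def del: scaleR_scaleR)
next
  case (sin a k)
  show ?case unfolding conv_tsin[OF f]
    by (simp add: integral_tcos integral_tsin sco_def del: scaleR_scaleR scaleR_minus_left)
next
  case (add g h)
  then show ?case
    by (simp add: conv_add f trig_conv trig_integrable scaleR_left_distrib)
qed

lemma conv_const:
  assumes h: "trig h"
  shows "conv h (\<lambda>_. c) x = integral\<^sup>L TN h *\<^sub>R c"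
  using h
proof (induction rule: trigV.induct)
  case (cos a k)
  show ?case
    by (subst conv_tcos) (simp_all add: cco_def sco_def integral_tcos integral_tsin)
next
  case (sin a k)
  show ?case
    by (subst conv_tsin) (simp_all add: cco_def sco_def integral_tcos integral_tsin)
next
  case (add g h)
  then show ?case
    by (simp add: conv_add trig_integrable scaleR_left_distrib)
qed

text \<open>Testing the distributional equation with \<open>tsin k\<close> in a single coordinate
  produces the cosine coefficient, because the derivative of the test function is a multiple of
  \<open>tcos k\<close>; the other coefficient is obtained likewise.\<close>

lemma kerA_coeff:
  fixes A :: "'n::finite \<Rightarrow> real^'d::finite^'l::finite"
  assumes u: "kerA A u" and i: "integrable TN u"
  shows "symb A (rv k) *v cco k u = 0" "symb A (rv k) *v sco k u = 0"
proof -
  have lin: "bounded_linear ((*v) (symb A (rv k)))" by (simp add: linear_linear)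
  have "(symb A (rv k) *v cco k u) $ l = 0" for l
  proof -
    define \<phi> where "\<phi> x = tsin k x *\<^sub>R axis l (1::real)" for x
    have t: "trig \<phi>" unfolding \<phi>_def by (intro trigV.intros UNIV_I)
    have "0 = integral\<^sup>L TN (\<lambda>x. \<Sum>i\<in>UNIV. (A i *v u x) \<bullet> partial i \<phi> x)"
      by (rule u[unfolded kerA_def, rule_format, OF conjI[OF trig_smooth[OF t] trig_periodic[OF t]], symmetric])
    also have "\<dots> = integral\<^sup>L TN (\<lambda>x. (2 * pi) * ((symb A (rv k) *v (tcos k x *\<^sub>R u x)) \<bullet> axis l 1))"
      unfolding \<phi>_def partial_tsin matrix_vector_mult_scaleR symb_mult inner_sum_left
        sum_distrib_left scaleR_sum_right
      by (intro Bochner_Integration.integral_cong refl sum.cong) simp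
    also have "\<dots> = (2 * pi) * ((symb A (rv k) *v cco k u) \<bullet> axis l 1)"
      unfolding cco_def
      using integrable_tcos_scaleR[OF i, of k] integral_bounded_linear[OF lin, of TN "\<lambda>x. tcos k x *\<^sub>R u x"]
        integrable_bounded_linear[OF lin, of TN "\<lambda>x. tcos k x *\<^sub>R u x"]
      by simp
    finally show ?thesis by (simp add: inner_axis)
  qed
  then show "symb A (rv k) *v cco k u = 0" by (simp add: vec_eq_iff)
  have "(symb A (rv k) *v sco k u) $ l = 0" for l
  proof -
    define \<phi> where "\<phi> x = tcos k x *\<^sub>R axis l (1::real)" for x
    have t: "trig \<phi>" unfolding \<phi>_def by (intro trigV.intros UNIV_I)
    have "0 = integral\<^sup>L TN (\<lambda>x. \<Sum>i\<in>UNIV. (A i *v u x) \<bullet> partial i \<phi> x)"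
      by (rule u[unfolded kerA_def, rule_format, OF conjI[OF trig_smooth[OF t] trig_periodic[OF t]], symmetric])
    also have "\<dots> = integral\<^sup>L TN (\<lambda>x. (- (2 * pi)) * ((symb A (rv k) *v (tsin k x *\<^sub>R u x)) \<bullet> axis l 1))"
      unfolding \<phi>_def partial_tcos matrix_vector_mult_scaleR symb_mult inner_sum_left
        sum_distrib_left scaleR_sum_right
      by (intro Bochner_Integration.integral_cong refl sum.cong) simp
    also have "\<dots> = (- (2 * pi)) * ((symb A (rv k) *v sco k u) \<bullet> axis l 1)"
      unfolding sco_def
      using integrable_tsin_scaleR[OF i, of k] integral_bounded_linear[OF lin, of TN "\<lambda>x. tsin k x *\<^sub>R u x"]
        integrable_bounded_linear[OF lin, of TN "\<lambda>x. tsin k x *\<^sub>R u x"]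
      by simp
    finally show ?thesis by (simp add: inner_axis)
  qed
  then show "symb A (rv k) *v sco k u = 0" by (simp add: vec_eq_iff)
qed

lemma afree_conv:
  assumes "trig h" "kerA A u" "integrable TN u"
  shows "afree A (conv h u)"
  using assms by (intro trigV_conv) (simp_all add: kerA_coeff matrix_vector_mult_scaleR)

section \<open>An approximate identity of trigonometric polynomials\<close>

text \<open>Each factor is \<open>cos (pi * x $ i)\<close> squared, so the normalised powers are
  tensor products of de la Vallee Poussin kernels. They are at once nonnegative, which preserves sup
  bounds, and trigonometric polynomials, which preserves the differential constraint.\<close>

definition theta :: "real^'n::finite \<Rightarrow> real" where
  "theta x = (\<Prod>i\<in>UNIV. (1 + cos (2 * pi * x $ i)) / 2)"

definition tker :: "nat \<Rightarrow> real^'n::finite \<Rightarrow> real" where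
  "tker m x = theta x ^ m / integral\<^sup>L TN (\<lambda>x::real^'n. theta x ^ m)"

definition smth :: "nat \<Rightarrow> (real^'n::finite \<Rightarrow> 'b::{second_countable_topology,banach}) \<Rightarrow> real^'n \<Rightarrow> 'b" where
  "smth m f = conv (tker m) f"

lemma trig_prod:
  assumes "\<And>i. i \<in> I \<Longrightarrow> trig (f i :: real^'n::finite \<Rightarrow> real)"
  shows "trig (\<lambda>x. \<Prod>i\<in>I. f i x)"
  using assms
proof (induction I rule: infinite_finite_induct)
  case (insert i I)
  then show ?case using trig_mult[of "f i" "\<lambda>x. \<Prod>i\<in>I. f i x"] by simp
qed (auto intro: trigV_const)

lemma trig_theta: "trig (theta :: real^'n::finite \<Rightarrow> real)"
proof -
  have "trig (\<lambda>x::real^'n. (1 + cos (2 * pi * x $ i)) / 2)" for i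
  proof -
    have "rv (axis i 1) \<bullet> x = x $ i" for x :: "real^'n"
    proof -
      have "rv (axis i 1) = (axis i 1 :: real^'n)" by (simp add: vec_eq_iff axis_def)
      then show ?thesis by (simp add: inner_axis')
    qed
    then have "(\<lambda>x::real^'n. (1 + cos (2 * pi * x $ i)) / 2) = (\<lambda>x. 1/2 + tcos (axis i 1) x *\<^sub>R (1/2))"
      by (simp add: tcos_def fun_eq_iff)
    then show ?thesis
      using trigV.add[OF trigV_const[of "1/2 :: real" "\<lambda>_. UNIV"] trigV.cos[of "1/2 :: real" "\<lambda>_. UNIV" "axis i 1"]] by simp
  qed
  then show ?thesis unfolding theta_def by (rule trig_prod)
qed

lemma trig_power: "trig (f :: real^'n::finite \<Rightarrow> real) \<Longrightarrow> trig (\<lambda>x. f x ^ m)"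
proof (induction m)
  case (Suc m)
  then show ?case using trig_mult[of f "\<lambda>x. f x ^ m"] by simp
qed (auto intro: trigV_const)

lemma trig_tker: "trig (tker m :: real^'n::finite \<Rightarrow> real)"
proof -
  have "trig (\<lambda>x::real^'n. (1 / integral\<^sup>L TN (\<lambda>x::real^'n. theta x ^ m)) *\<^sub>R theta x ^ m)"
    by (rule trigV_scaleR[OF trig_power[OF trig_theta]]) simp
  then show ?thesis by (simp add: tker_def[abs_def])
qed

lemma cos_factor_bounds: "0 \<le> (1 + cos t) / 2" "(1 + cos t) / 2 \<le> 1" for t :: real
proof -
  have "0 \<le> (1 + c) / 2 \<and> (1 + c) / 2 \<le> 1" if "- 1 \<le> c" "c \<le> 1" for c :: real
    using that by simp
  then show "0 \<le> (1 + cos t) / 2" "(1 + cos t) / 2 \<le> 1"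
    using cos_ge_minus_one cos_le_one by blast+
qed

lemma theta_nonneg: "0 \<le> theta x" and theta_le_1: "theta x \<le> 1"
  unfolding theta_def by (auto intro!: prod_nonneg prod_le_1 cos_factor_bounds)

lemma theta_less_1:
  assumes "x $ i \<noteq> 0" "\<bar>x $ i\<bar> < 1"
  shows "theta x < 1"
proof -
  have "cos (2 * pi * x $ i) \<noteq> 1"
  proof
    assume "cos (2 * pi * x $ i) = 1"
    then obtain k :: int where "2 * pi * x $ i = of_int k * 2 * pi" using cos_one_2pi_int by blast
    then have "x $ i = of_int k" by simp
    with assms show False by simp
  qed
  then have 1: "(1 + cos (2 * pi * x $ i)) / 2 < 1" using cos_le_one[of "2 * pi * x $ i"] by argo
  have "theta x = (1 + cos (2 * pi * x $ i)) / 2 * (\<Prod>i\<in>UNIV - {i}. (1 + cos (2 * pi * x $ i)) / 2)"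
    unfolding theta_def by (simp add: prod.remove[of UNIV i])
  also have "\<dots> \<le> (1 + cos (2 * pi * x $ i)) / 2 * 1"
    by (intro mult_left_mono prod_le_1 conjI cos_factor_bounds)
  finally show ?thesis using 1 by simp
qed

text \<open>\<open>theta\<close> equals 1 at the origin, so it exceeds \<open>q\<close> on an open
  part of the cube; the measure of this part serves as \<open>\<mu>\<close> for all powers at
  once.\<close>

lemma integral_theta_lower:
  assumes q: "q < 1" "q \<ge> 0"
  shows "\<exists>\<mu>>0. \<forall>m. \<mu> * q ^ m \<le> integral\<^sup>L TN (\<lambda>x::real^'n::finite. theta x ^ m)"
proof -
  have th0: "theta (0::real^'n) = 1" by (simp add: theta_def)
  have cth: "continuous_on UNIV (theta :: real^'n \<Rightarrow> real)" by (rule trig_continuous[OF trig_theta])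
  define S where "S = {x::real^'n. theta x > q} \<inter> box 0 1"
  have opS: "open S" unfolding S_def
    by (intro open_Int open_Collect_less continuous_on_const cth open_box)
  \<comment> \<open>The maximum point 0 is a corner of the cube, so it is approached from the
    interior along the diagonal. Later \<open>n > 0\<close> excludes the opposite corner, which is
    the point for \<open>n = 0\<close>.\<close>
  have "(\<lambda>n. theta ((1 / real (Suc n)) *\<^sub>R (1::real^'n))) \<longlonglongrightarrow> theta (0 *\<^sub>R (1::real^'n))"
    using LIMSEQ_Suc[OF lim_1_over_n]
    by (intro continuous_on_tendsto_compose[OF cth] tendsto_intros) auto
  then have "(\<lambda>n. theta ((1 / real (Suc n)) *\<^sub>R (1::real^'n))) \<longlonglongrightarrow> 1" by (simp add: th0)
  then have "\<forall>\<^sub>F n in sequentially. theta ((1 / real (Suc n)) *\<^sub>R (1::real^'n)) > q"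
    using q by (intro order_tendstoD)
  then have "\<forall>\<^sub>F n in sequentially. theta ((1 / real (Suc n)) *\<^sub>R (1::real^'n)) > q \<and> n > 0"
    using eventually_gt_at_top[of "0::nat"] by eventually_elim simp
  then obtain n where n: "theta ((1 / real (Suc n)) *\<^sub>R (1::real^'n)) > q" "n > 0"
    using eventually_happens trivial_limit_sequentially by blast
  then have "(1 / real (Suc n)) *\<^sub>R (1::real^'n) \<in> S"
    unfolding S_def by (auto simp: mem_box_cart)
  then have "\<not> negligible S" using open_not_negligible[OF opS] by auto
  moreover have Slm: "S \<in> lmeasurable"
    by (rule lmeasurable_open[OF _ opS]) (auto simp: S_def intro: bounded_subset[OF bounded_box])
  ultimately have mS: "measure lebesgue S > 0"
    using negligible_iff_measure0[OF Slm] by (simp add: zero_less_measure_iff)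
  have SS: "S \<subseteq> cbox 0 1" unfolding S_def using box_subset_cbox by blast
  have St: "S \<in> sets TN" unfolding TN_def using Slm SS by (auto simp: sets_restrict_space_iff fmeasurable_def)
  have mTN: "measure TN S = measure lebesgue S"
    unfolding TN_def using SS by (intro measure_restrict_space) auto
  show ?thesis
  proof (intro exI[of _ "measure TN S"] conjI allI)
    fix m
    have "measure TN S * q ^ m = integral\<^sup>L TN (\<lambda>x. indicator S x * q ^ m)"
      using St SS by (simp add: Int_absorb2)
    also have "\<dots> \<le> integral\<^sup>L TN (\<lambda>x::real^'n. theta x ^ m)"
    proof (rule integral_mono)
      show "integrable TN (\<lambda>x. indicator S x * q ^ m)" using St by (auto intro!: integrable_real_indicator TN.emeasure_finite simp: less_top[symmetric])
      show "integrable TN (\<lambda>x::real^'n. theta x ^ m)" by (intro trig_integrable trig_power trig_theta)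
      show "indicator S x * q ^ m \<le> theta x ^ m" for x
        using q theta_nonneg[of x] by (auto simp: indicator_def S_def intro!: power_mono)
    qed
    finally show "measure TN S * q ^ m \<le> integral\<^sup>L TN (\<lambda>x::real^'n. theta x ^ m)" .
  qed (use mS mTN in simp)
qed

lemma integral_theta_pos: "integral\<^sup>L TN (\<lambda>x::real^'n::finite. theta x ^ m) > 0"
proof -
  obtain \<mu> where "\<mu> > 0" "\<mu> * (1/2) ^ m \<le> integral\<^sup>L TN (\<lambda>x::real^'n. theta x ^ m)"
    using integral_theta_lower[of "1/2"] by auto
  then show ?thesis by (smt (verit) mult_pos_pos zero_less_power half_gt_zero)
qed

lemma tker_nonneg: "tker m x \<ge> 0"
  unfolding tker_def by (intro divide_nonneg_pos zero_le_power theta_nonneg integral_theta_pos)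

lemma integral_tker [simp]: "integral\<^sup>L TN (tker m :: real^'n::finite \<Rightarrow> real) = 1"
  unfolding tker_def using integral_theta_pos[where 'n='n, of m] by simp

text \<open>Away from \<open>x\<close> the numerator is at most \<open>q0 ^ m\<close> with
  \<open>q0 < 1\<close>, while the normalising integral is at least of order \<open>q ^ m\<close>
  for every \<open>q < 1\<close>. Taking \<open>q\<close> between \<open>q0\<close> and 1 gives
  geometric decay. Since \<open>x\<close> is interior, the entries of \<open>x - y\<close> stay
  below 1 in modulus, so no other lattice point interferes.\<close>

lemma tker_concentrates:
  fixes x :: "real^'n::finite"
  assumes x: "x \<in> box 0 1" and \<delta>: "\<delta> > 0"
  shows "\<exists>r B. 0 \<le> r \<and> r < 1 \<and> (\<forall>m y. y \<in> cbox 0 1 \<longrightarrow> dist x y \<ge> \<delta> \<longrightarrow> tker m (x - y) \<le> B * r ^ m)"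
proof -
  define Y where "Y = cbox 0 1 - ball x \<delta>"
  have cY: "compact Y" unfolding Y_def by (intro compact_diff compact_cbox open_ball)
  have th: "theta (x - y) < 1" if "y \<in> Y" for y
  proof -
    have "x \<noteq> y" using that \<delta> by (auto simp: Y_def)
    then obtain i where i: "(x - y) $ i \<noteq> 0" by (auto simp: vec_eq_iff)
    have "\<bar>(x - y) $ i\<bar> < 1"
      using x that unfolding Y_def mem_box_cart Diff_iff
      by (smt (verit) vector_minus_component zero_index one_index)
    with i show ?thesis by (rule theta_less_1)
  qed
  obtain q0 where q0: "0 \<le> q0" "q0 < 1" "\<And>y. y \<in> Y \<Longrightarrow> theta (x - y) \<le> q0"
  proof (cases "Y = {}")
    case True
    then show ?thesis using that[of 0] by auto
  next
    case False
    have "continuous_on Y (\<lambda>y. theta (x - y))"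
      by (rule continuous_on_compose2[OF trig_continuous[OF trig_theta]]) (auto intro!: continuous_intros)
    then obtain y where "y \<in> Y" "\<And>z. z \<in> Y \<Longrightarrow> theta (x - z) \<le> theta (x - y)"
      using continuous_attains_sup[OF cY False] by blast
    then show ?thesis using that[of "theta (x - y)"] th theta_nonneg by blast
  qed
  define q where "q = (1 + q0) / 2"
  have q: "q > 0" "q < 1" "q0 < q" using q0 by (auto simp: q_def)
  obtain \<mu> where \<mu>: "\<mu> > 0" "\<And>m. \<mu> * q ^ m \<le> integral\<^sup>L TN (\<lambda>x::real^'n. theta x ^ m)"
    using integral_theta_lower[of q] q by auto
  have "tker m (x - y) \<le> 1 / \<mu> * (q0 / q) ^ m" if "y \<in> cbox 0 1" "dist x y \<ge> \<delta>" for m y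
  proof -
    have "y \<in> Y" using that by (auto simp: Y_def)
    then have "tker m (x - y) \<le> q0 ^ m / integral\<^sup>L TN (\<lambda>x::real^'n. theta x ^ m)"
      unfolding tker_def using integral_theta_pos[of m] q0(3) theta_nonneg
      by (intro divide_right_mono power_mono) auto
    also have "\<dots> \<le> q0 ^ m / (\<mu> * q ^ m)"
      using \<mu> q0(1) q integral_theta_pos[of m] by (intro divide_left_mono mult_pos_pos) auto
    finally show ?thesis by (simp add: power_divide)
  qed
  then show ?thesis using q q0 by (intro exI[of _ "q0 / q"] exI[of _ "1 / \<mu>"]) auto
qed

lemma trig_smth: "integrable TN f \<Longrightarrow> trig (smth m f)"
  unfolding smth_def by (rule trig_conv[OF trig_tker])

lemma afree_smth: "kerA A u \<Longrightarrow> integrable TN u \<Longrightarrow> afree A (smth m u)"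
  unfolding smth_def by (rule afree_conv[OF trig_tker])

lemma norm_smth_le:
  assumes "integrable TN f"
  shows "norm (smth m f x) \<le> smth m (\<lambda>y. norm (f y)) x"
proof -
  have "norm (smth m f x) \<le> integral\<^sup>L TN (\<lambda>y. norm (tker m (x - y) *\<^sub>R f y))"
    unfolding smth_def conv_def by (rule integral_norm_bound)
  then show ?thesis by (simp add: smth_def conv_def abs_of_nonneg tker_nonneg)
qed

text \<open>Positivity and unit mass turn smoothing into averaging, so the essential bound is kept
  without any loss and holds at every point.\<close>

lemma norm_smth_bound:
  assumes f: "integrable TN f" and M: "AE x in TN. norm (f x) \<le> M"
  shows "norm (smth m f x) \<le> M"
proof -
  have "norm (smth m f x) \<le> smth m (\<lambda>y. norm (f y)) x" by (rule norm_smth_le[OF f])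
  also have "\<dots> \<le> smth m (\<lambda>y. M) x"
    unfolding smth_def conv_def using M f
    by (intro integral_mono_AE integrable_conv[OF trig_tker]) (auto intro!: mult_left_mono tker_nonneg elim!: AE_mp)
  also have "\<dots> = M" unfolding smth_def by (simp add: conv_const[OF trig_tker])
  finally show ?thesis .
qed

lemma integral_norm_smth_le:
  assumes f: "integrable TN f"
  shows "integral\<^sup>L TN (\<lambda>x. norm (smth m f x)) \<le> integral\<^sup>L TN (\<lambda>x. norm (f x))"
proof -
  have "integral\<^sup>L TN (\<lambda>x. norm (smth m f x)) \<le> integral\<^sup>L TN (smth m (\<lambda>y. norm (f y)))"
    by (intro integral_mono norm_smth_le[OF f] integrable_norm trig_integrable[OF trig_smth] f)
  also have "\<dots> = integral\<^sup>L TN (\<lambda>x. norm (f x))"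
    unfolding smth_def using integral_conv[OF trig_tker integrable_norm[OF f]] by simp
  finally show ?thesis .
qed

lemma AE_TN_box: "AE x in TN. x \<in> box 0 (1::real^'n::finite)"
proof -
  have "negligible (cbox 0 1 - box 0 (1::real^'n))" by (rule negligible_frontier_interval)
  then have "cbox 0 1 - box 0 (1::real^'n) \<in> null_sets lebesgue" by (simp add: negligible_iff_null_sets)
  then have "AE x in lebesgue. x \<notin> cbox 0 1 - box 0 (1::real^'n)" by (rule AE_not_in)
  then show ?thesis unfolding TN_def by (subst AE_restrict_space_iff) auto
qed

lemma TN_bounded_limit:
  fixes f :: "real^'n::finite \<Rightarrow> 'b::{second_countable_topology,banach}"
  assumes "f \<in> borel_measurable TN" "\<And>m. g m \<in> borel_measurable TN"
    and "AE x in TN. (\<lambda>m. g m x) \<longlonglongrightarrow> f x"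
    and "\<And>m. AE x in TN. norm (g m x) \<le> M" "AE x in TN. norm (f x) \<le> M"
  shows "(\<lambda>m. integral\<^sup>L TN (\<lambda>x. norm (g m x - f x))) \<longlonglongrightarrow> 0"
proof -
  have "(\<lambda>m. integral\<^sup>L TN (\<lambda>x. norm (g m x - f x))) \<longlonglongrightarrow> integral\<^sup>L TN (\<lambda>x::real^'n. 0::real)"
  proof (rule integral_dominated_convergence[where w="\<lambda>_. 2 * M"])
    show "AE x in TN. (\<lambda>m. norm (g m x - f x)) \<longlonglongrightarrow> 0"
      using assms(3) by eventually_elim (simp add: LIM_zero tendsto_norm_zero)
    show "AE x in TN. norm (norm (g m x - f x)) \<le> 2 * M" for m
      using assms(4)[of m] assms(5)
    proof eventually_elim
      case (elim x)
      then show ?case using norm_triangle_ineq4[of "g m x" "f x"] by simp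
    qed
  qed (use assms in auto)
  then show ?thesis by simp
qed

text \<open>Measurability provides continuous functions converging almost everywhere. Composition
  with the nearest-point map onto the ball of radius \<open>M\<close> bounds them without disturbing
  the limit, so bounded convergence applies.\<close>

lemma bounded_approx_continuous:
  fixes f :: "real^'n::finite \<Rightarrow> 'b::euclidean_space"
  assumes f: "f \<in> borel_measurable TN" and M: "AE x in TN. norm (f x) \<le> M" and M0: "M \<ge> 0" and e: "e > 0"
  shows "\<exists>g. continuous_on UNIV g \<and> (\<forall>x. norm (g x) \<le> M) \<and> integral\<^sup>L TN (\<lambda>x. norm (f x - g x)) < e"
proof -
  have "f measurable_on cbox 0 1"
    using f unfolding TN_def by (subst measurable_on_iff_borel_measurable) auto
  then obtain N g where N: "negligible N" and g: "\<And>n. continuous_on UNIV (g n :: _ \<Rightarrow> 'b)"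
    and lim: "\<And>x. x \<notin> N \<Longrightarrow> (\<lambda>n. g n x) \<longlonglongrightarrow> (if x \<in> cbox 0 1 then f x else 0)"
    unfolding measurable_on_def by blast
  define p where "p = closest_point (cball (0::'b) M)"
  have cp: "continuous_on UNIV p"
    unfolding p_def using M0 by (intro continuous_on_closest_point) auto
  have pb: "norm (p y) \<le> M" for y
    unfolding p_def using closest_point_in_set[of "cball (0::'b) M" y] M0 by auto
  have pid: "p y = y" if "norm y \<le> M" for y
    unfolding p_def using that by (intro closest_point_self) auto
  have cg: "continuous_on UNIV (\<lambda>x. p (g n x))" for n
    by (rule continuous_on_compose2[OF cp g]) auto
  have AN: "AE x in TN. x \<notin> N"
  proof -
    have "AE x in lebesgue. x \<notin> N" using N by (intro AE_not_in) (simp add: negligible_iff_null_sets)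
    then show ?thesis unfolding TN_def by (subst AE_restrict_space_iff) auto
  qed
  have "(\<lambda>n. integral\<^sup>L TN (\<lambda>x. norm (p (g n x) - f x))) \<longlonglongrightarrow> 0"
  proof (rule TN_bounded_limit[OF f _ _ _ M])
    show "AE x in TN. (\<lambda>n. p (g n x)) \<longlonglongrightarrow> f x"
      using AN M AE_space
    proof eventually_elim
      case (elim x)
      then have "(\<lambda>n. g n x) \<longlonglongrightarrow> f x" using lim[of x] by simp
      then have "(\<lambda>n. p (g n x)) \<longlonglongrightarrow> p (f x)"
        by (rule continuous_on_tendsto_compose[OF cp]) auto
      then show ?case using elim pid by simp
    qed
  qed (auto simp: pb intro!: continuous_borel_measurable_TN cg)
  then have "\<forall>\<^sub>F n in sequentially. integral\<^sup>L TN (\<lambda>x. norm (p (g n x) - f x)) < e"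
    using e by (rule order_tendstoD)
  then obtain n where "integral\<^sup>L TN (\<lambda>x. norm (p (g n x) - f x)) < e"
    by (auto simp: eventually_sequentially)
  then show ?thesis
    using cg[of n] pb by (intro exI[of _ "\<lambda>x. p (g n x)"]) (simp add: norm_minus_commute)
qed

lemma smth_pointwise:
  fixes g :: "real^'n::finite \<Rightarrow> 'b::{second_countable_topology,banach}"
  assumes g: "continuous_on UNIV g" and M: "\<And>x. norm (g x) \<le> M" and x: "x \<in> box 0 1"
  shows "(\<lambda>m. smth m g x) \<longlonglongrightarrow> g x"
proof (rule LIMSEQ_I)
  fix e :: real assume e: "e > 0"
  have M0: "M \<ge> 0" using M[of 0] norm_ge_zero order_trans by blast
  have "isCont g x" using g by (simp add: continuous_on_eq_continuous_at)
  then obtain \<delta> where \<delta>: "\<delta> > 0" "\<And>y. dist x y < \<delta> \<Longrightarrow> norm (g y - g x) < e / 2"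
    using e unfolding continuous_at_eps_delta by (metis dist_commute dist_norm half_gt_zero)
  obtain r B where rB: "0 \<le> r" "r < 1" "\<And>m y. y \<in> cbox 0 1 \<Longrightarrow> dist x y \<ge> \<delta> \<Longrightarrow> tker m (x - y) \<le> B * r ^ m"
    using tker_concentrates[OF x \<delta>(1)] by auto
  have ig: "integrable TN g" by (rule integrable_TN_continuous[OF g])
  \<comment> \<open>Near \<open>x\<close> continuity and the unit mass of the kernel give
    \<open>e / 2\<close>; farther away the difference is at most \<open>2 * M\<close> and the kernel
    decays geometrically.\<close>
  have bound: "norm (smth m g x - g x) \<le> e / 2 + \<bar>B\<bar> * r ^ m * (2 * M)" for m
  proof -
    have i: "integrable TN (\<lambda>y. tker m (x - y) *\<^sub>R g y)" "integrable TN (\<lambda>y. tker m (x - y) *\<^sub>R g x)"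
      by (rule integrable_conv[OF trig_tker ig], rule integrable_conv[OF trig_tker]) simp
    have i1: "integrable TN (\<lambda>y. tker m (x - y) *\<^sub>R (e/2))"
      by (rule integrable_conv[OF trig_tker]) simp
    have "smth m g x - g x = conv (tker m) g x - conv (tker m) (\<lambda>_. g x) x"
      by (simp add: smth_def conv_const[OF trig_tker])
    also have "\<dots> = integral\<^sup>L TN (\<lambda>y. tker m (x - y) *\<^sub>R (g y - g x))"
      unfolding conv_def using i by (simp add: scaleR_diff_right)
    finally have "norm (smth m g x - g x) \<le> integral\<^sup>L TN (\<lambda>y. norm (tker m (x - y) *\<^sub>R (g y - g x)))"
      by (simp only: integral_norm_bound)
    also have "\<dots> \<le> integral\<^sup>L TN (\<lambda>y. tker m (x - y) *\<^sub>R (e/2) + \<bar>B\<bar> * r ^ m * (2 * M))"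
    proof (rule integral_mono)
      show "integrable TN (\<lambda>y. norm (tker m (x - y) *\<^sub>R (g y - g x)))"
        using i by (simp add: scaleR_diff_right)
      show "integrable TN (\<lambda>y. tker m (x - y) *\<^sub>R (e/2) + \<bar>B\<bar> * r ^ m * (2 * M))"
        using i1 by simp
      fix y :: "real^'n" assume "y \<in> space TN"
      then have y: "y \<in> cbox 0 1" by simp
      have "norm (tker m (x - y) *\<^sub>R (g y - g x)) = tker m (x - y) * norm (g y - g x)"
        by (simp add: abs_of_nonneg tker_nonneg)
      also have "\<dots> \<le> tker m (x - y) *\<^sub>R (e/2) + \<bar>B\<bar> * r ^ m * (2 * M)"
      proof (cases "dist x y < \<delta>")
        case True
        have "tker m (x - y) * norm (g y - g x) \<le> tker m (x - y) * (e/2)"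
          using \<delta>(2)[OF True] by (intro mult_left_mono tker_nonneg) auto
        moreover have "0 \<le> \<bar>B\<bar> * r ^ m * (2 * M)" using rB M0 by simp
        ultimately show ?thesis unfolding real_scaleR_def by linarith
      next
        case False
        have "tker m (x - y) \<le> B * r ^ m" using rB(3)[OF y] False by simp
        also have "\<dots> \<le> \<bar>B\<bar> * r ^ m" using rB(1) by (intro mult_right_mono) auto
        finally have "tker m (x - y) * norm (g y - g x) \<le> \<bar>B\<bar> * r ^ m * (2 * M)"
        proof (rule mult_mono)
          show "norm (g y - g x) \<le> 2 * M" using norm_triangle_ineq4[of "g y" "g x"] M[of x] M[of y] by linarith
        qed (use rB in auto)
        moreover have "0 \<le> tker m (x - y) *\<^sub>R (e/2)" using e tker_nonneg[of m "x - y"] by simp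
        ultimately show ?thesis unfolding real_scaleR_def by linarith
      qed
      finally show "norm (tker m (x - y) *\<^sub>R (g y - g x)) \<le> tker m (x - y) *\<^sub>R (e/2) + \<bar>B\<bar> * r ^ m * (2 * M)" .
    qed
    also have "\<dots> = integral\<^sup>L TN (\<lambda>y. tker m (x - y) *\<^sub>R (e/2)) + \<bar>B\<bar> * r ^ m * (2 * M)"
      using i1 by (subst Bochner_Integration.integral_add) auto
    also have "integral\<^sup>L TN (\<lambda>y. tker m (x - y) *\<^sub>R (e/2)) = e / 2"
      using conv_const[OF trig_tker, of m "e/2" x] unfolding conv_def by (simp only: integral_tker scaleR_one)
    finally show ?thesis .
  qed
  have "(\<lambda>m. \<bar>B\<bar> * r ^ m * (2 * M)) \<longlonglongrightarrow> \<bar>B\<bar> * 0 * (2 * M)"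
    using rB by (intro tendsto_intros LIMSEQ_realpow_zero) auto
  then have "\<forall>\<^sub>F m in sequentially. \<bar>B\<bar> * r ^ m * (2 * M) < e / 2"
    using e by (intro order_tendstoD(2)[where y=0]) auto
  then obtain m0 where m0: "\<And>m. m \<ge> m0 \<Longrightarrow> \<bar>B\<bar> * r ^ m * (2 * M) < e / 2"
    by (auto simp: eventually_sequentially)
  show "\<exists>no. \<forall>m\<ge>no. norm (smth m g x - g x) < e"
  proof (intro exI[of _ m0] allI impI)
    fix m assume "m \<ge> m0"
    from bound[of m] m0[OF this] show "norm (smth m g x - g x) < e" by argo
  qed
qed

lemma smth_diff:
  assumes "integrable TN f" "integrable TN g"
  shows "smth m (\<lambda>x. f x - g x) x = smth m f x - smth m g x"
  unfolding smth_def conv_def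
  using integrable_conv[OF trig_tker assms(1), of m x] integrable_conv[OF trig_tker assms(2), of m x]
  by (simp add: scaleR_diff_right)

text \<open>For a continuous approximation \<open>g\<close> the convergence is pointwise and
  bounded. Smoothing contracts the L^1 norm, so replacing \<open>f\<close> by \<open>g\<close> costs
  at most twice their distance, uniformly in \<open>m\<close>.\<close>

lemma smth_L1:
  fixes f :: "real^'n::finite \<Rightarrow> 'b::euclidean_space"
  assumes f: "f \<in> borel_measurable TN" and M: "AE x in TN. norm (f x) \<le> M"
  shows "(\<lambda>m. integral\<^sup>L TN (\<lambda>x. norm (smth m f x - f x))) \<longlonglongrightarrow> 0"
proof (rule LIMSEQ_I)
  fix e :: real assume e: "e > 0"
  have M': "AE x in TN. norm (f x) \<le> \<bar>M\<bar>" using M by eventually_elim simp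
  obtain g where g: "continuous_on UNIV g" "\<And>x. norm (g x) \<le> \<bar>M\<bar>" and fg: "integral\<^sup>L TN (\<lambda>x. norm (f x - g x)) < e / 3"
    using bounded_approx_continuous[OF f M', of "e / 3"] e by auto
  have ig: "integrable TN g" by (rule integrable_TN_continuous[OF g(1)])
  have if': "integrable TN f" by (rule integrable_TN_bounded[OF f M])
  note sm = trig_integrable[OF trig_smth[OF if']] trig_integrable[OF trig_smth[OF ig]]
  have "(\<lambda>m. integral\<^sup>L TN (\<lambda>x. norm (smth m g x - g x))) \<longlonglongrightarrow> 0"
  proof (rule TN_bounded_limit[where M="\<bar>M\<bar>"])
    show "AE x in TN. (\<lambda>m. smth m g x) \<longlonglongrightarrow> g x"
      using AE_TN_box by eventually_elim (rule smth_pointwise[OF g])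
    show "AE x in TN. norm (smth m g x) \<le> \<bar>M\<bar>" for m
      using norm_smth_bound[OF ig, of "\<bar>M\<bar>"] g(2) by simp
  qed (use g sm ig in \<open>auto intro!: borel_measurable_integrable\<close>)
  then have "\<forall>\<^sub>F m in sequentially. integral\<^sup>L TN (\<lambda>x. norm (smth m g x - g x)) < e / 3"
    using e by (intro order_tendstoD(2)[where y=0]) auto
  then obtain m0 where m0: "\<And>m. m \<ge> m0 \<Longrightarrow> integral\<^sup>L TN (\<lambda>x. norm (smth m g x - g x)) < e / 3"
    by (auto simp: eventually_sequentially)
  have "integral\<^sup>L TN (\<lambda>x. norm (smth m f x - f x)) < e" if "m \<ge> m0" for m
  proof -
    have "integral\<^sup>L TN (\<lambda>x. norm (smth m f x - f x)) \<le>
      integral\<^sup>L TN (\<lambda>x. norm (smth m (\<lambda>x. f x - g x) x) + norm (smth m g x - g x) + norm (f x - g x))"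
    proof (rule integral_mono)
      show "integrable TN (\<lambda>x. norm (smth m (\<lambda>x. f x - g x) x) + norm (smth m g x - g x) + norm (f x - g x))"
        using sm if' ig trig_integrable[OF trig_smth[OF Bochner_Integration.integrable_diff[OF if' ig]]] by simp
      show "norm (smth m f x - f x) \<le> norm (smth m (\<lambda>x. f x - g x) x) + norm (smth m g x - g x) + norm (f x - g x)" for x
        unfolding smth_diff[OF if' ig] by norm
    qed (use sm if' in simp)
    also have "\<dots> = integral\<^sup>L TN (\<lambda>x. norm (smth m (\<lambda>x. f x - g x) x)) + integral\<^sup>L TN (\<lambda>x. norm (smth m g x - g x)) + integral\<^sup>L TN (\<lambda>x. norm (f x - g x))"
      using sm if' ig trig_integrable[OF trig_smth[OF Bochner_Integration.integrable_diff[OF if' ig]]] by simp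
    also have "\<dots> < e"
      using integral_norm_smth_le[OF Bochner_Integration.integrable_diff[OF if' ig], of m] fg m0[OF that] by linarith
    finally show ?thesis .
  qed
  then show "\<exists>no. \<forall>m\<ge>no. norm (integral\<^sup>L TN (\<lambda>x. norm (smth m f x - f x)) - 0) < e"
    by (intro exI[of _ m0]) simp
qed

text \<open>Integrate the pointwise inequality \<open>t \<le> e / 2 + t^2 / (2 e)\<close>; the total
  mass is one.\<close>

lemma integral_norm_le_of_square:
  fixes g :: "real^'n::finite \<Rightarrow> 'b::{second_countable_topology,banach}"
  assumes "integrable TN g" "integrable TN (\<lambda>x. (norm (g x))\<^sup>2)"
    and "integral\<^sup>L TN (\<lambda>x. (norm (g x))\<^sup>2) \<le> e\<^sup>2" and e: "e > 0"
  shows "integral\<^sup>L TN (\<lambda>x. norm (g x)) \<le> e"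
proof -
  have "integral\<^sup>L TN (\<lambda>x. norm (g x)) \<le> integral\<^sup>L TN (\<lambda>x. e / 2 + (norm (g x))\<^sup>2 / (2 * e))"
  proof (rule integral_mono)
    show "norm (g x) \<le> e / 2 + (norm (g x))\<^sup>2 / (2 * e)" for x
    proof -
      have "0 \<le> (norm (g x) - e)\<^sup>2" by simp
      then have "2 * e * norm (g x) \<le> e\<^sup>2 + (norm (g x))\<^sup>2" by (simp add: power2_diff algebra_simps)
      then show ?thesis using e by (simp add: field_simps power2_eq_square)
    qed
  qed (use assms in auto)
  also have "\<dots> = e / 2 + integral\<^sup>L TN (\<lambda>x. (norm (g x))\<^sup>2) / (2 * e)"
    using assms by simp
  also have "\<dots> \<le> e / 2 + e\<^sup>2 / (2 * e)"
    using assms by (intro add_left_mono divide_right_mono) auto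
  also have "\<dots> = e" using e by (simp add: field_simps power2_eq_square)
  finally show ?thesis .
qed

text \<open>An affine modulus of continuity can be integrated: fields that are uniformly bounded and
  close in L^1 have close integrals of \<open>f\<close>. Uniform continuity handles points nearer
  than \<open>\<delta>\<close>, and boundedness of \<open>f\<close> absorbs the others into the
  slope.\<close>

lemma continuous_modulus:
  fixes f :: "'a::euclidean_space \<Rightarrow> real"
  assumes f: "continuous_on UNIV f" and e: "e > 0"
  shows "\<exists>C\<ge>0. \<forall>y\<in>cball 0 R. \<forall>z\<in>cball 0 R. \<bar>f y - f z\<bar> \<le> e + C * norm (y - z)"
proof -
  have cf: "continuous_on (cball 0 R) f" using f by (rule continuous_on_subset) auto
  have "uniformly_continuous_on (cball 0 R) f"
    by (rule compact_uniformly_continuous[OF cf]) auto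
  then obtain \<delta> where \<delta>: "\<delta> > 0" "\<And>y z. y \<in> cball 0 R \<Longrightarrow> z \<in> cball 0 R \<Longrightarrow> dist z y < \<delta> \<Longrightarrow> dist (f z) (f y) < e"
    using e unfolding uniformly_continuous_on_def by metis
  have "compact (f ` cball 0 R)" by (rule compact_continuous_image[OF cf]) auto
  then have "bounded (f ` cball 0 R)" by (rule compact_imp_bounded)
  then obtain B where B: "\<And>y. y \<in> cball 0 R \<Longrightarrow> \<bar>f y\<bar> \<le> B"
    unfolding bounded_iff by force
  show ?thesis
  proof (intro exI[of _ "2 * \<bar>B\<bar> / \<delta>"] conjI ballI)
    fix y z :: 'a assume yz: "y \<in> cball 0 R" "z \<in> cball 0 R"
    show "\<bar>f y - f z\<bar> \<le> e + 2 * \<bar>B\<bar> / \<delta> * norm (y - z)"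
    proof (cases "dist y z < \<delta>")
      case True
      then have "\<bar>f y - f z\<bar> < e" using \<delta>(2)[OF yz(2) yz(1)] by (simp add: dist_real_def)
      moreover have "0 \<le> 2 * \<bar>B\<bar> / \<delta> * norm (y - z)" using \<delta> by simp
      ultimately show ?thesis by linarith
    next
      case False
      have "\<bar>f y - f z\<bar> \<le> 2 * \<bar>B\<bar>" using B[OF yz(1)] B[OF yz(2)] by linarith
      also have "\<dots> = 2 * \<bar>B\<bar> / \<delta> * \<delta>" using \<delta> by simp
      also have "\<dots> \<le> 2 * \<bar>B\<bar> / \<delta> * norm (y - z)"
        using False \<delta> by (intro mult_left_mono) (auto simp: dist_norm)
      finally show ?thesis using e by linarith
    qed
  qed (use \<delta> in auto)
qed

section \<open>Averages of rapidly oscillating fields\<close>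

lemma trig_polynomial:
  fixes g :: "real^'n::finite \<Rightarrow> 'e::euclidean_space"
  assumes "real_polynomial_function p" "trig g"
  shows "trig (\<lambda>x. p (g x))"
  using assms(1)
proof induction
  case (linear f)
  then show ?case by (intro trigV_linear[OF assms(2) _ UNIV_I] bounded_linear.linear)
next
  case (const c)
  then show ?case by (intro trigV_const) simp
next
  case (add f h)
  then show ?case by (intro trigV.add)
next
  case (mult f h)
  then show ?case using trig_mult[of "\<lambda>x. f (g x)" "\<lambda>x. h (g x)"] by simp
qed

lemma integrable_indicator_mult:
  fixes g :: "real^'n::finite \<Rightarrow> real"
  assumes "E \<in> sets TN" "integrable TN g"
  shows "integrable TN (\<lambda>x. indicator E x * g x)"
  using integrable_bounded_scaleR[of "indicator E" 1 g] assms by (auto simp: indicator_def)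

lemma integrable_indicator_scaleR:
  fixes g :: "real^'n::finite \<Rightarrow> 'b::{second_countable_topology,banach}"
  assumes "E \<in> sets TN" "integrable TN g"
  shows "integrable TN (\<lambda>x. indicator E x *\<^sub>R g x)"
  using integrable_bounded_scaleR[of "indicator E" 1 g] assms by (auto simp: indicator_def)

lemma integral_indicator_TN:
  "E \<in> sets TN \<Longrightarrow> integral\<^sup>L TN (indicator E) = measure TN E"
  using sets.sets_into_space[of E TN] by (simp add: Int_absorb2)

lemma integral_abs_mono:
  fixes f g :: "'a \<Rightarrow> real"
  assumes "integrable M f" "integrable M g" "\<And>x. x \<in> space M \<Longrightarrow> \<bar>f x\<bar> \<le> g x"
  shows "\<bar>integral\<^sup>L M f\<bar> \<le> integral\<^sup>L M g"
proof -
  have "\<bar>integral\<^sup>L M f\<bar> \<le> integral\<^sup>L M (\<lambda>x. \<bar>f x\<bar>)" by (rule integral_abs_bound)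
  also have "\<dots> \<le> integral\<^sup>L M g" using assms by (intro integral_mono) auto
  finally show ?thesis .
qed

lemma indicator_approx:
  fixes E :: "(real^'n::finite) set" and e :: real
  assumes E: "E \<in> sets TN" and e: "e > 0"
  shows "\<exists>h::_ \<Rightarrow> real. trig h \<and> (\<forall>x. \<bar>h x\<bar> \<le> 1) \<and> integral\<^sup>L TN (\<lambda>x. \<bar>h x - indicator E x\<bar>) < e"
proof -
  have b: "AE x in TN. norm (indicator E x :: real) \<le> 1" by (auto simp: indicator_def)
  have m: "(indicator E :: _ \<Rightarrow> real) \<in> borel_measurable TN" using E by simp
  have i: "integrable TN (indicator E :: _ \<Rightarrow> real)" by (rule integrable_TN_bounded[OF m b])
  have "\<forall>\<^sub>F k in sequentially. integral\<^sup>L TN (\<lambda>x. norm (smth k (indicator E) x - (indicator E x :: real))) < e"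
    using smth_L1[OF m b] e by (rule order_tendstoD)
  then obtain k where "integral\<^sup>L TN (\<lambda>x. norm (smth k (indicator E) x - (indicator E x :: real))) < e"
    by (auto simp: eventually_sequentially)
  then show ?thesis
    using trig_smth[OF i, of k] norm_smth_bound[OF i b, of k]
    by (intro exI[of _ "smth k (indicator E)"]) auto
qed

text \<open>On a ball containing the range of \<open>a + \<phi>\<close>, the Weierstrass theorem
  replaces \<open>f\<close> by a polynomial, which makes the integrand trigonometric. The indicator
  is replaced by a trigonometric polynomial too, and then the averaging identity is exact for large
  \<open>j\<close>.\<close>

lemma riemann_lebesgue:
  fixes f :: "real^'d::finite \<Rightarrow> real" and \<phi> :: "real^'n::finite \<Rightarrow> real^'d"
  assumes f: "continuous_on UNIV f" and \<phi>: "trig \<phi>" and E: "E \<in> sets TN"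
  shows "(\<lambda>j. integral\<^sup>L TN (\<lambda>x. indicator E x * f (a + \<phi> (real j *\<^sub>R x))))
     \<longlonglongrightarrow> measure TN E * integral\<^sup>L TN (\<lambda>x. f (a + \<phi> x))"
proof (rule LIMSEQ_I)
  fix e :: real assume e: "e > 0"
  obtain M where M: "M \<ge> 0" "\<And>x. norm (\<phi> x) \<le> M" using trig_bounded[OF \<phi>] by auto
  have in_ball: "a + \<phi> x \<in> cball 0 (norm a + M)" for x
    using norm_triangle_ineq[of a "\<phi> x"] M(2)[of x] by simp
  have cfb: "continuous_on (cball 0 (norm a + M)) f" using f by (rule continuous_on_subset) simp
  have e8: "0 < e / 8" using e by simp
  obtain p where p: "real_polynomial_function p" "\<And>x. x \<in> cball 0 (norm a + M) \<Longrightarrow> \<bar>f x - p x\<bar> < e / 8"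
    by (rule Stone_Weierstrass_real_polynomial_function[OF compact_cball cfb e8]) blast
  define \<gamma> where "\<gamma> x = p (a + \<phi> x)" for x
  have t\<gamma>: "trig \<gamma>" unfolding \<gamma>_def
    by (rule trig_polynomial[OF p(1) trigV.add[OF trigV_const[OF UNIV_I] \<phi>]])
  have close: "\<bar>f (a + \<phi> x) - \<gamma> x\<bar> \<le> e / 8" for x using p(2)[OF in_ball[of x]] by (simp add: \<gamma>_def)
  obtain B where B: "B \<ge> 0" "\<And>x. \<bar>\<gamma> x\<bar> \<le> B" using trig_bounded[OF t\<gamma>] by auto
  \<comment> \<open>The tolerance contains \<open>B + 1\<close> because the error of
    \<open>h\<close> gets multiplied by the bound \<open>B\<close> of \<open>\<gamma>\<close>. Five
    errors of at most \<open>e / 8\<close> stay below \<open>e\<close>.\<close>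
  obtain h where h: "trig h" "\<And>x. \<bar>h x\<bar> \<le> 1" "integral\<^sup>L TN (\<lambda>x. \<bar>h x - indicator E x\<bar>) < e / (8 * (B + 1))"
    using indicator_approx[OF E, of "e / (8 * (B + 1))"] e B by auto
  have hB: "B * integral\<^sup>L TN (\<lambda>x. \<bar>h x - indicator E x\<bar>) \<le> e / 8"
  proof -
    have "B * integral\<^sup>L TN (\<lambda>x. \<bar>h x - indicator E x\<bar>) \<le> B * (e / (8 * (B + 1)))"
      using h(3) B by (intro mult_left_mono) auto
    also have "\<dots> \<le> e / 8" using B e by (simp add: field_simps)
    finally show ?thesis .
  qed
  obtain J where J: "\<And>j. j \<ge> J \<Longrightarrow> integral\<^sup>L TN (\<lambda>x. h x *\<^sub>R \<gamma> (real j *\<^sub>R x)) = integral\<^sup>L TN h *\<^sub>R integral\<^sup>L TN \<gamma>"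
    using integral_trig_rescale[OF h(1) t\<gamma>] by auto
  have iE: "integrable TN (indicator E :: _ \<Rightarrow> real)" using integrable_indicator_mult[OF E, of "\<lambda>_. 1"] by simp
  have ihE: "integrable TN (\<lambda>x. \<bar>h x - indicator E x\<bar>)" using iE trig_integrable[OF h(1)] by simp
  have cf: "continuous_on UNIV (\<lambda>x. f (a + \<phi> (c *\<^sub>R x)))" for c :: real
    by (intro continuous_on_compose2[OF f] continuous_on_add continuous_on_const
        continuous_on_compose2[OF trig_continuous[OF \<phi>]] continuous_on_scaleR continuous_on_id) auto
  have c\<gamma>: "continuous_on UNIV (\<lambda>x. \<gamma> (c *\<^sub>R x))" for c :: real
    by (intro continuous_on_compose2[OF trig_continuous[OF t\<gamma>]] continuous_on_scaleR continuous_on_const continuous_on_id) auto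
  note i1 = integrable_TN_continuous[OF cf] integrable_TN_continuous[OF c\<gamma>]
  have i2: "integrable TN (\<lambda>x. f (a + \<phi> x))" "integrable TN \<gamma>"
    using i1(1)[of 1] i1(2)[of 1] by simp_all
  show "\<exists>no. \<forall>j\<ge>no. norm (integral\<^sup>L TN (\<lambda>x. indicator E x * f (a + \<phi> (real j *\<^sub>R x))) -
        measure TN E * integral\<^sup>L TN (\<lambda>x. f (a + \<phi> x))) < e"
  proof (intro exI[of _ J] allI impI)
    fix j assume j: "j \<ge> J"
    have ih: "integrable TN (\<lambda>x. h x * \<gamma> (real j *\<^sub>R x))"
      by (intro integrable_TN_continuous continuous_on_mult trig_continuous h c\<gamma>)
    have A1: "\<bar>integral\<^sup>L TN (\<lambda>x. indicator E x * f (a + \<phi> (real j *\<^sub>R x))) - integral\<^sup>L TN (\<lambda>x. indicator E x * \<gamma> (real j *\<^sub>R x))\<bar> \<le> e / 8"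
    proof -
      have "\<bar>integral\<^sup>L TN (\<lambda>x. indicator E x * f (a + \<phi> (real j *\<^sub>R x)) - indicator E x * \<gamma> (real j *\<^sub>R x))\<bar> \<le> integral\<^sup>L TN (\<lambda>x::real^'n. e / 8)"
        using close e by (intro integral_abs_mono Bochner_Integration.integrable_diff integrable_indicator_mult[OF E] i1)
          (auto simp: indicator_def)
      then show ?thesis using integrable_indicator_mult[OF E i1(1)] integrable_indicator_mult[OF E i1(2)] by simp
    qed
    have A2: "\<bar>integral\<^sup>L TN (\<lambda>x. indicator E x * \<gamma> (real j *\<^sub>R x)) - integral\<^sup>L TN (\<lambda>x. h x * \<gamma> (real j *\<^sub>R x))\<bar> \<le> e / 8"
    proof -
      have "\<bar>integral\<^sup>L TN (\<lambda>x. indicator E x * \<gamma> (real j *\<^sub>R x) - h x * \<gamma> (real j *\<^sub>R x))\<bar> \<le> integral\<^sup>L TN (\<lambda>x. B * \<bar>h x - indicator E x\<bar>)"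
      proof (intro integral_abs_mono Bochner_Integration.integrable_diff integrable_indicator_mult[OF E] i1 ih)
        show "\<bar>indicator E x * \<gamma> (real j *\<^sub>R x) - h x * \<gamma> (real j *\<^sub>R x)\<bar> \<le> B * \<bar>h x - indicator E x\<bar>" for x
        proof -
          have "\<bar>indicator E x * \<gamma> (real j *\<^sub>R x) - h x * \<gamma> (real j *\<^sub>R x)\<bar> = \<bar>\<gamma> (real j *\<^sub>R x)\<bar> * \<bar>h x - indicator E x\<bar>"
            by (simp add: abs_mult[symmetric] abs_minus_commute algebra_simps)
          also have "\<dots> \<le> B * \<bar>h x - indicator E x\<bar>" by (intro mult_right_mono B) auto
          finally show ?thesis .
        qed
      qed (use ihE in auto)
      then show ?thesis using integrable_indicator_mult[OF E i1(2)] ih hB by simp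
    qed
    have A3: "integral\<^sup>L TN (\<lambda>x. h x * \<gamma> (real j *\<^sub>R x)) = integral\<^sup>L TN h * integral\<^sup>L TN \<gamma>"
      using J[OF j] by simp
    have g\<gamma>: "\<bar>integral\<^sup>L TN \<gamma>\<bar> \<le> B"
      using integral_abs_mono[OF i2(2), of "\<lambda>_. B"] B by simp
    have A4: "\<bar>integral\<^sup>L TN h * integral\<^sup>L TN \<gamma> - measure TN E * integral\<^sup>L TN \<gamma>\<bar> \<le> e / 8"
    proof -
      have "\<bar>integral\<^sup>L TN h * integral\<^sup>L TN \<gamma> - measure TN E * integral\<^sup>L TN \<gamma>\<bar> = \<bar>integral\<^sup>L TN \<gamma>\<bar> * \<bar>integral\<^sup>L TN h - measure TN E\<bar>"
        by (simp add: abs_mult[symmetric] algebra_simps)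
      also have "\<dots> \<le> B * integral\<^sup>L TN (\<lambda>x. \<bar>h x - indicator E x\<bar>)"
      proof (rule mult_mono[OF g\<gamma>])
        have "integral\<^sup>L TN h - measure TN E = integral\<^sup>L TN (\<lambda>x. h x - indicator E x)"
          using trig_integrable[OF h(1)] iE integral_indicator_TN[OF E] by simp
        then show "\<bar>integral\<^sup>L TN h - measure TN E\<bar> \<le> integral\<^sup>L TN (\<lambda>x. \<bar>h x - indicator E x\<bar>)"
          by (simp only: integral_abs_bound)
      qed (use B in auto)
      finally show ?thesis using hB by linarith
    qed
    have A5: "\<bar>measure TN E * integral\<^sup>L TN \<gamma> - measure TN E * integral\<^sup>L TN (\<lambda>x. f (a + \<phi> x))\<bar> \<le> e / 8"
    proof -
      have "\<bar>integral\<^sup>L TN (\<lambda>x. \<gamma> x - f (a + \<phi> x))\<bar> \<le> integral\<^sup>L TN (\<lambda>x::real^'n. e / 8)"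
        using close by (intro integral_abs_mono Bochner_Integration.integrable_diff i2) (auto simp: abs_minus_commute)
      then have *: "\<bar>integral\<^sup>L TN \<gamma> - integral\<^sup>L TN (\<lambda>x. f (a + \<phi> x))\<bar> \<le> e / 8" using i2 by simp
      have mE: "measure TN E \<le> 1" using TN.bounded_measure[of E] by simp
      have "\<bar>measure TN E * integral\<^sup>L TN \<gamma> - measure TN E * integral\<^sup>L TN (\<lambda>x. f (a + \<phi> x))\<bar>
         = measure TN E * \<bar>integral\<^sup>L TN \<gamma> - integral\<^sup>L TN (\<lambda>x. f (a + \<phi> x))\<bar>"
        by (simp add: abs_mult right_diff_distrib[symmetric])
      also have "\<dots> \<le> 1 * (e / 8)" using * mE by (intro mult_mono) auto
      finally show ?thesis by simp
    qed
    show "norm (integral\<^sup>L TN (\<lambda>x. indicator E x * f (a + \<phi> (real j *\<^sub>R x))) -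
        measure TN E * integral\<^sup>L TN (\<lambda>x. f (a + \<phi> x))) < e"
      using A1 A2 A3 A4 A5 e unfolding real_norm_def by linarith
  qed
qed

section \<open>Gluing of oscillating A-free fields\<close>

lemma partial_scaleR:
  fixes h :: "real^'n::finite \<Rightarrow> real" and f :: "real^'n \<Rightarrow> 'b::real_normed_vector"
  assumes "h differentiable at x" "f differentiable at x"
  shows "partial i (\<lambda>x. h x *\<^sub>R f x) x = partial i h x *\<^sub>R f x + h x *\<^sub>R partial i f x"
  using partialI[OF has_derivative_scaleR[OF assms[unfolded frechet_derivative_works]], of i]
  by (simp add: partial_def add.commute)

text \<open>In the product rule only the derivative of \<open>h\<close> survives, since
  \<open>\<psi>\<close> is annihilated by the operator. The bound \<open>G\<close> thus depends on
  the size of \<open>\<psi>\<close> but not on its derivatives, however fast it oscillates.\<close>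

lemma Aop_mult_bound:
  fixes A :: "'n::finite \<Rightarrow> real^'d::finite^'l::finite"
  assumes h: "trig h" and b: "b \<ge> 0"
  shows "\<exists>G\<ge>0. \<forall>\<psi>. afree A \<psi> \<and> (\<forall>x. norm (\<psi> x) \<le> b) \<longrightarrow> (\<forall>x. norm (Aop A (\<lambda>x. h x *\<^sub>R \<psi> x) x) \<le> G)"
proof -
  have "\<exists>c\<ge>0. \<forall>x. norm (partial i h x) \<le> c" for i
    using trig_bounded[OF trig_partial[OF h]] by auto
  then obtain c where c: "\<And>i. c i \<ge> 0" "\<And>i x. norm (partial i h x) \<le> c i" by metis
  have lin: "bounded_linear ((*v) (A i))" for i by (simp add: linear_linear)
  define G where "G = (\<Sum>i\<in>UNIV. c i * (onorm ((*v) (A i)) * b))"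
  show ?thesis
  proof (intro exI[of _ G] conjI allI impI)
    show "G \<ge> 0" unfolding G_def using c b onorm_pos_le[OF lin] by (intro sum_nonneg mult_nonneg_nonneg) auto
    fix \<psi> :: "real^'n \<Rightarrow> real^'d" and x assume \<psi>: "afree A \<psi> \<and> (\<forall>x. norm (\<psi> x) \<le> b)"
    have t: "trig \<psi>" using \<psi> trigV_imp_trig by blast
    have "Aop A (\<lambda>x. h x *\<^sub>R \<psi> x) x = (\<Sum>i\<in>UNIV. partial i h x *\<^sub>R (A i *v \<psi> x)) + h x *\<^sub>R Aop A \<psi> x"
      unfolding Aop_def partial_scaleR[OF trig_differentiable[OF h] trig_differentiable[OF t]]
      by (simp add: matrix_vector_right_distrib matrix_vector_mult_scaleR sum.distrib scaleR_sum_right)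
    also have "\<dots> = (\<Sum>i\<in>UNIV. partial i h x *\<^sub>R (A i *v \<psi> x))" using \<psi> afree_Aop[of A \<psi> x] by simp
    finally have "norm (Aop A (\<lambda>x. h x *\<^sub>R \<psi> x) x) \<le> (\<Sum>i\<in>UNIV. norm (partial i h x *\<^sub>R (A i *v \<psi> x)))"
      by (simp only: norm_sum)
    also have "\<dots> \<le> G" unfolding G_def
    proof (rule sum_mono)
      fix i
      have "norm (A i *v \<psi> x) \<le> onorm ((*v) (A i)) * norm (\<psi> x)" by (rule onorm[OF lin])
      also have "\<dots> \<le> onorm ((*v) (A i)) * b" using \<psi> onorm_pos_le[OF lin] by (intro mult_left_mono) auto
      finally show "norm (partial i h x *\<^sub>R (A i *v \<psi> x)) \<le> c i * (onorm ((*v) (A i)) * b)"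
        unfolding norm_scaleR using c(1)[of i] c(2)[of i x] by (intro mult_mono) auto
    qed
    finally show "norm (Aop A (\<lambda>x. h x *\<^sub>R \<psi> x) x) \<le> G" .
  qed
qed

lemma Aop_sum:
  assumes "finite I" "\<And>i. i \<in> I \<Longrightarrow> trig (f i)"
  shows "Aop A (\<lambda>x. \<Sum>i\<in>I. f i x) = (\<lambda>x. \<Sum>i\<in>I. Aop A (f i) x)"
  using assms
proof (induction I)
  case empty
  have "Aop A (\<lambda>x. tcos 0 x *\<^sub>R 0) = (\<lambda>x. 0)" unfolding Aop_tcos by simp
  then show ?case by simp
next
  case (insert i I)
  then show ?case using trigV_sum[of I "\<lambda>_. UNIV" f] by (simp add: Aop_add)
qed

text \<open>A bounded image under the operator makes the high-frequency error small once
  \<open>D\<close> is large, uniformly in \<open>j\<close>. Only finitely many frequencies remain,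
  and their coefficients tend to zero by assumption.\<close>

lemma afree_projection_small:
  fixes A :: "'n::finite \<Rightarrow> real^'d::finite^'l::finite"
  assumes cr: "constant_rank A" and e: "e > 0" and w: "\<And>j::nat. trig (w j)"
    and G: "\<And>j x. norm (Aop A (w j) x) \<le> G"
    and low: "\<And>k. (\<lambda>j. cco k (w j)) \<longlonglongrightarrow> 0" "\<And>k. (\<lambda>j. sco k (w j)) \<longlonglongrightarrow> 0"
  shows "\<exists>J. \<forall>j\<ge>J. \<exists>z. afree A z \<and> integral\<^sup>L TN z = 0 \<and> integral\<^sup>L TN (\<lambda>x. norm (w j x - z x)) \<le> e"
proof -
  obtain C where C: "C \<ge> 0" "\<forall>w D. trig w \<and> D > 0 \<longrightarrow> (\<exists>z. afree A z \<and> integral\<^sup>L TN z = 0 \<and>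
     integral\<^sup>L TN (\<lambda>x. (norm (w x - z x))\<^sup>2) \<le>
       (\<Sum>k | norm (rv k) \<le> D. (norm (cco k w))\<^sup>2 + (norm (sco k w))\<^sup>2)
       + C / D\<^sup>2 * integral\<^sup>L TN (\<lambda>x. (norm (Aop A w x))\<^sup>2))"
    using afree_projection[OF cr] by (elim exE conjE)
  \<comment> \<open>Chosen so that \<open>D\<^sup>2\<close> is at least
    \<open>2 * C * G\<^sup>2 / e\<^sup>2\<close>, which bounds the high-frequency share by half of
    \<open>e\<^sup>2\<close>; adding 1 keeps \<open>D\<close> positive.\<close>
  define D where "D = sqrt (2 * C * G\<^sup>2 / e\<^sup>2) + 1"
  have sq: "sqrt (2 * C * G\<^sup>2 / e\<^sup>2) \<ge> 0" using C by simp
  have D: "D > 0" using sq unfolding D_def by linarith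
  have "2 * C * G\<^sup>2 / e\<^sup>2 = (sqrt (2 * C * G\<^sup>2 / e\<^sup>2))\<^sup>2" using C by simp
  also have "\<dots> \<le> D\<^sup>2" using sq by (intro power_mono) (auto simp: D_def)
  finally have D2: "C / D\<^sup>2 * G\<^sup>2 \<le> e\<^sup>2 / 2" using D e by (simp add: field_simps)
  have "(\<lambda>j. \<Sum>k | norm (rv k) \<le> D. (norm (cco k (w j)))\<^sup>2 + (norm (sco k (w j)))\<^sup>2) \<longlonglongrightarrow> (\<Sum>k | norm (rv k :: real^'n) \<le> D. (norm (0::real^'d))\<^sup>2 + (norm (0::real^'d))\<^sup>2)"
    by (intro tendsto_sum tendsto_add tendsto_power tendsto_norm low)
  then have "(\<lambda>j. \<Sum>k | norm (rv k) \<le> D. (norm (cco k (w j)))\<^sup>2 + (norm (sco k (w j)))\<^sup>2) \<longlonglongrightarrow> 0" by simp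
  then have "\<forall>\<^sub>F j in sequentially. (\<Sum>k | norm (rv k) \<le> D. (norm (cco k (w j)))\<^sup>2 + (norm (sco k (w j)))\<^sup>2) < e\<^sup>2 / 2"
    using e by (intro order_tendstoD(2)[where y=0]) auto
  then obtain J where J: "\<And>j. j \<ge> J \<Longrightarrow> (\<Sum>k | norm (rv k) \<le> D. (norm (cco k (w j)))\<^sup>2 + (norm (sco k (w j)))\<^sup>2) < e\<^sup>2 / 2"
    by (auto simp: eventually_sequentially)
  show ?thesis
  proof (intro exI[of _ J] allI impI)
    fix j assume j: "j \<ge> J"
    obtain z where z: "afree A z" "integral\<^sup>L TN z = 0" "integral\<^sup>L TN (\<lambda>x. (norm (w j x - z x))\<^sup>2) \<le>
       (\<Sum>k | norm (rv k) \<le> D. (norm (cco k (w j)))\<^sup>2 + (norm (sco k (w j)))\<^sup>2)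
       + C / D\<^sup>2 * integral\<^sup>L TN (\<lambda>x. (norm (Aop A (w j) x))\<^sup>2)"
      using C(2)[rule_format, OF conjI[OF w D]] by blast
    have cA: "continuous_on UNIV (Aop A (w j))" by (rule trig_continuous[OF trig_Aop[OF w]])
    have cwz: "continuous_on UNIV (\<lambda>x. w j x - z x)"
      by (intro continuous_on_diff trig_continuous w trigV_imp_trig[OF z(1)])
    have "integral\<^sup>L TN (\<lambda>x. (norm (Aop A (w j) x))\<^sup>2) \<le> integral\<^sup>L TN (\<lambda>x::real^'n. G\<^sup>2)"
      using G by (intro integral_mono integrable_TN_continuous continuous_intros cA power_mono) auto
    then have "C / D\<^sup>2 * integral\<^sup>L TN (\<lambda>x. (norm (Aop A (w j) x))\<^sup>2) \<le> C / D\<^sup>2 * G\<^sup>2"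
      using C by (intro mult_left_mono) auto
    with z(3) J[OF j] D2 have sqr: "integral\<^sup>L TN (\<lambda>x. (norm (w j x - z x))\<^sup>2) \<le> e\<^sup>2" by linarith
    have "integral\<^sup>L TN (\<lambda>x. norm (w j x - z x)) \<le> e"
      by (rule integral_norm_le_of_square[OF _ _ sqr e]) (intro integrable_TN_continuous continuous_intros cwz)+
    then show "\<exists>z. afree A z \<and> integral\<^sup>L TN z = 0 \<and> integral\<^sup>L TN (\<lambda>x. norm (w j x - z x)) \<le> e"
      using z by blast
  qed
qed

text \<open>The oscillating fields are cut off by trigonometric approximations of the indicators.
  The sum has a bounded image under the operator and, as the \<open>\<phi> i\<close> have mean zero,
  vanishing low frequencies for large \<open>j\<close>; hence it is close to an A-free
  field.\<close>

lemma gluing: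
  fixes A :: "'n::finite \<Rightarrow> real^'d::finite^'l::finite" and \<phi> :: "'i \<Rightarrow> real^'n \<Rightarrow> real^'d"
  assumes cr: "constant_rank A" and I: "finite I" and E: "\<And>i. i \<in> I \<Longrightarrow> E i \<in> sets TN"
    and \<phi>: "\<And>i. i \<in> I \<Longrightarrow> afree A (\<phi> i)" "\<And>i. i \<in> I \<Longrightarrow> integral\<^sup>L TN (\<phi> i) = 0" and e: "e > 0"
  shows "\<exists>J. \<forall>j\<ge>J. \<exists>z. afree A z \<and> integral\<^sup>L TN z = 0 \<and>
     integral\<^sup>L TN (\<lambda>x. norm (z x - (\<Sum>i\<in>I. indicator (E i) x *\<^sub>R \<phi> i (real j *\<^sub>R x)))) \<le> e"
proof -
  have t\<phi>: "trig (\<phi> i)" if "i \<in> I" for i using \<phi>(1)[OF that] by (rule trigV_imp_trig)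
  have "\<exists>b\<ge>0. i \<in> I \<longrightarrow> (\<forall>x. norm (\<phi> i x) \<le> b)" for i
    using trig_bounded[OF t\<phi>, of i] by (cases "i \<in> I") auto
  then obtain b where b: "\<And>i. b i \<ge> 0" "\<And>i x. i \<in> I \<Longrightarrow> norm (\<phi> i x) \<le> b i" by metis
  \<comment> \<open>The weights are such that replacing all indicators by the \<open>h i\<close>
    costs at most \<open>e / 2\<close> in total, after multiplication with the bounds
    \<open>b i\<close>.\<close>
  define e' where "e' i = e / (2 * (real (card I) + 1) * (b i + 1))" for i
  have e': "e' i > 0" for i using e b(1)[of i] by (auto simp: e'_def intro!: divide_pos_pos mult_pos_pos)
  have be': "b i * e' i \<le> e / (2 * (real (card I) + 1))" for i
  proof -
    have "b i * e' i = e / (2 * (real (card I) + 1)) * (b i / (b i + 1))" by (simp add: e'_def)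
    also have "\<dots> \<le> e / (2 * (real (card I) + 1)) * 1"
      using e b(1)[of i] by (intro mult_left_mono) (auto simp: divide_simps)
    finally show ?thesis by simp
  qed
  have "\<exists>h::real^'n \<Rightarrow> real. i \<in> I \<longrightarrow> trig h \<and> integral\<^sup>L TN (\<lambda>x. \<bar>h x - indicator (E i) x\<bar>) < e' i" for i
    using indicator_approx[OF E e', of i i] by (cases "i \<in> I") auto
  then obtain h :: "'i \<Rightarrow> real^'n \<Rightarrow> real" where
    h: "\<And>i. i \<in> I \<Longrightarrow> trig (h i)" "\<And>i. i \<in> I \<Longrightarrow> integral\<^sup>L TN (\<lambda>x. \<bar>h i x - indicator (E i) x\<bar>) < e' i" by metis
  define \<psi> where "\<psi> j i x = \<phi> i (real j *\<^sub>R x)" for j i x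
  have \<psi>: "afree A (\<psi> j i)" "trig (\<psi> j i)" if "i \<in> I" for i j
    unfolding \<psi>_def using afree_rescale[OF \<phi>(1)[OF that], of j] trigV_imp_trig by auto
  have b\<psi>: "norm (\<psi> j i x) \<le> b i" if "i \<in> I" for i j x unfolding \<psi>_def by (rule b(2)[OF that])
  define w where "w j x = (\<Sum>i\<in>I. h i x *\<^sub>R \<psi> j i x)" for j x
  have th: "trig (\<lambda>x. h i x *\<^sub>R \<psi> j i x)" if "i \<in> I" for i j by (rule trig_mult[OF h(1)[OF that] \<psi>(2)[OF that]])
  have tw: "trig (w j)" for j unfolding w_def by (rule trigV_sum[OF th UNIV_I])
  have "\<exists>G\<ge>0. i \<in> I \<longrightarrow> (\<forall>j x. norm (Aop A (\<lambda>x. h i x *\<^sub>R \<psi> j i x) x) \<le> G)" for i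
  proof (cases "i \<in> I")
    case True
    show ?thesis using Aop_mult_bound[OF h(1)[OF True] b(1)[of i], of A] \<psi>(1)[OF True] b\<psi>[OF True] by auto
  qed auto
  then obtain G where G: "\<And>i. G i \<ge> 0" "\<And>i j x. i \<in> I \<Longrightarrow> norm (Aop A (\<lambda>x. h i x *\<^sub>R \<psi> j i x) x) \<le> G i" by metis
  have Gw: "norm (Aop A (w j) x) \<le> (\<Sum>i\<in>I. G i)" for j x
  proof -
    have "Aop A (w j) = (\<lambda>x. \<Sum>i\<in>I. Aop A (\<lambda>x. h i x *\<^sub>R \<psi> j i x) x)"
      unfolding w_def by (rule Aop_sum[OF I th])
    then show ?thesis using G by (auto intro!: sum_norm_le)
  qed
  \<comment> \<open>Against a fixed trigonometric polynomial each summand integrates exactly to a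
    multiple of the mean of \<open>\<phi> i\<close>, which is zero.\<close>
  have zero: "\<forall>\<^sub>F j in sequentially. integral\<^sup>L TN (\<lambda>x. g x *\<^sub>R w j x) = 0" if g: "trig g" for g :: "real^'n \<Rightarrow> real"
  proof -
    have "\<forall>\<^sub>F j in sequentially. \<forall>i\<in>I. integral\<^sup>L TN (\<lambda>x. (g x *\<^sub>R h i x) *\<^sub>R \<psi> j i x) = 0"
    proof (intro eventually_ball_finite[OF I] ballI)
      fix i assume i: "i \<in> I"
      obtain J where "\<forall>j\<ge>J. integral\<^sup>L TN (\<lambda>x. (g x *\<^sub>R h i x) *\<^sub>R \<phi> i (real j *\<^sub>R x)) = integral\<^sup>L TN (\<lambda>x. g x *\<^sub>R h i x) *\<^sub>R integral\<^sup>L TN (\<phi> i)"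
        using integral_trig_rescale[OF trig_mult[OF g h(1)[OF i]] t\<phi>[OF i]] by (elim exE)
      then show "\<forall>\<^sub>F j in sequentially. integral\<^sup>L TN (\<lambda>x. (g x *\<^sub>R h i x) *\<^sub>R \<psi> j i x) = 0"
        unfolding \<psi>_def eventually_sequentially using \<phi>(2)[OF i] by auto
    qed
    then show ?thesis
    proof eventually_elim
      case (elim j)
      have "integral\<^sup>L TN (\<lambda>x. g x *\<^sub>R w j x) = integral\<^sup>L TN (\<lambda>x. \<Sum>i\<in>I. (g x *\<^sub>R h i x) *\<^sub>R \<psi> j i x)"
        by (simp add: w_def scaleR_sum_right)
      also have "\<dots> = (\<Sum>i\<in>I. integral\<^sup>L TN (\<lambda>x. (g x *\<^sub>R h i x) *\<^sub>R \<psi> j i x))"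
        by (intro Bochner_Integration.integral_sum trig_integrable trig_mult g h \<psi>)
      finally show ?case using elim by simp
    qed
  qed
  have low: "(\<lambda>j. cco k (w j)) \<longlonglongrightarrow> 0" "(\<lambda>j. sco k (w j)) \<longlonglongrightarrow> 0" for k
  proof -
    have "trig (\<lambda>x. tcos k x *\<^sub>R (1::real))" "trig (\<lambda>x. tsin k x *\<^sub>R (1::real))" by (intro trigV.intros UNIV_I)+
    then have t: "trig (tcos k)" "trig (tsin k)" by simp_all
    show "(\<lambda>j. cco k (w j)) \<longlonglongrightarrow> 0" unfolding cco_def by (rule tendsto_eventually[OF zero[OF t(1)]])
    show "(\<lambda>j. sco k (w j)) \<longlonglongrightarrow> 0" unfolding sco_def by (rule tendsto_eventually[OF zero[OF t(2)]])
  qed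
  obtain J where J: "\<forall>j\<ge>J. \<exists>z. afree A z \<and> integral\<^sup>L TN z = 0 \<and> integral\<^sup>L TN (\<lambda>x. norm (w j x - z x)) \<le> e / 2"
    using afree_projection_small[OF cr _ tw Gw low, of "e / 2"] e by auto
  show ?thesis
  proof (intro exI[of _ J] allI impI)
    fix j assume "j \<ge> J"
    then obtain z where z: "afree A z" "integral\<^sup>L TN z = 0" "integral\<^sup>L TN (\<lambda>x. norm (w j x - z x)) \<le> e / 2"
      using J by blast
    have iz: "integrable TN (\<lambda>x. norm (w j x - z x))"
      by (intro integrable_norm Bochner_Integration.integrable_diff trig_integrable tw trigV_imp_trig[OF z(1)])
    have ih: "integrable TN (\<lambda>x. b i * \<bar>h i x - indicator (E i) x\<bar>)" if "i \<in> I" for i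
      using trig_integrable[OF h(1)[OF that]] integrable_indicator_mult[OF E[OF that], of "\<lambda>_. 1"] by simp
    have iE: "integrable TN (\<lambda>x. indicator (E i) x *\<^sub>R \<psi> j i x)" if "i \<in> I" for i
      by (intro integrable_indicator_scaleR E that trig_integrable \<psi>)
    have "integral\<^sup>L TN (\<lambda>x. norm (z x - (\<Sum>i\<in>I. indicator (E i) x *\<^sub>R \<psi> j i x)))
      \<le> integral\<^sup>L TN (\<lambda>x. norm (w j x - z x) + (\<Sum>i\<in>I. b i * \<bar>h i x - indicator (E i) x\<bar>))"
    proof (rule integral_mono)
      show "integrable TN (\<lambda>x. norm (z x - (\<Sum>i\<in>I. indicator (E i) x *\<^sub>R \<psi> j i x)))"
        by (intro integrable_norm Bochner_Integration.integrable_diff Bochner_Integration.integrable_sum trig_integrable trigV_imp_trig[OF z(1)] iE)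
      show "integrable TN (\<lambda>x. norm (w j x - z x) + (\<Sum>i\<in>I. b i * \<bar>h i x - indicator (E i) x\<bar>))"
        by (intro Bochner_Integration.integrable_add Bochner_Integration.integrable_sum iz ih)
      fix x
      have "norm (z x - (\<Sum>i\<in>I. indicator (E i) x *\<^sub>R \<psi> j i x)) \<le> norm (w j x - z x) + norm (w j x - (\<Sum>i\<in>I. indicator (E i) x *\<^sub>R \<psi> j i x))"
        by norm
      also have "w j x - (\<Sum>i\<in>I. indicator (E i) x *\<^sub>R \<psi> j i x) = (\<Sum>i\<in>I. (h i x - indicator (E i) x) *\<^sub>R \<psi> j i x)"
        by (simp add: w_def sum_subtractf scaleR_left_diff_distrib)
      also have "norm \<dots> \<le> (\<Sum>i\<in>I. b i * \<bar>h i x - indicator (E i) x\<bar>)"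
        by (intro sum_norm_le) (use b\<psi> in \<open>auto simp: mult.commute intro!: mult_right_mono\<close>)
      finally show "norm (z x - (\<Sum>i\<in>I. indicator (E i) x *\<^sub>R \<psi> j i x)) \<le> norm (w j x - z x) + (\<Sum>i\<in>I. b i * \<bar>h i x - indicator (E i) x\<bar>)"
        by simp
    qed
    also have "\<dots> = integral\<^sup>L TN (\<lambda>x. norm (w j x - z x)) + (\<Sum>i\<in>I. b i * integral\<^sup>L TN (\<lambda>x. \<bar>h i x - indicator (E i) x\<bar>))"
      using iz ih by (simp add: Bochner_Integration.integral_sum Bochner_Integration.integrable_sum)
    also have "\<dots> \<le> e / 2 + (\<Sum>i\<in>I. e / (2 * (real (card I) + 1)))"
    proof (intro add_mono z sum_mono)
      fix i assume i: "i \<in> I"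
      have "b i * integral\<^sup>L TN (\<lambda>x. \<bar>h i x - indicator (E i) x\<bar>) \<le> b i * e' i"
        using h(2)[OF i] b(1)[of i] by (intro mult_left_mono) auto
      then show "b i * integral\<^sup>L TN (\<lambda>x. \<bar>h i x - indicator (E i) x\<bar>) \<le> e / (2 * (real (card I) + 1))"
        using be'[of i] by linarith
    qed
    also have "\<dots> \<le> e"
    proof -
      have "(\<Sum>i\<in>I. e / (2 * (real (card I) + 1))) = e / 2 * (real (card I) / (real (card I) + 1))" by simp
      also have "\<dots> \<le> e / 2 * 1" using e by (intro mult_left_mono) auto
      finally have "(\<Sum>i\<in>I. e / (2 * (real (card I) + 1))) \<le> e / 2" by (simp only: mult_1_right)
      then show ?thesis by linarith
    qed
    finally show "\<exists>z. afree A z \<and> integral\<^sup>L TN z = 0 \<and>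
     integral\<^sup>L TN (\<lambda>x. norm (z x - (\<Sum>i\<in>I. indicator (E i) x *\<^sub>R \<phi> i (real j *\<^sub>R x)))) \<le> e"
      using z unfolding \<psi>_def by blast
  qed
qed

section \<open>Partitions of the cube and averages of glued fields\<close>

definition TNpart :: "'i set \<Rightarrow> ('i \<Rightarrow> (real^'n::finite) set) \<Rightarrow> bool" where
  "TNpart I E \<longleftrightarrow> finite I \<and> (\<forall>i\<in>I. E i \<in> sets TN) \<and> disjoint_family_on E I \<and> (\<Union>i\<in>I. E i) = cbox 0 1"

lemma TNpart_sum:
  fixes g :: "'i \<Rightarrow> 'b::real_vector"
  assumes P: "TNpart I E" and i: "i \<in> I" "x \<in> E i"
  shows "(\<Sum>k\<in>I. indicator (E k) x *\<^sub>R g k) = g i"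
proof -
  have "indicator (E k) x *\<^sub>R g k = (if k = i then g i else 0)" if "k \<in> I" for k
  proof (cases "k = i")
    case False
    then have "E k \<inter> E i = {}" using P i(1) that unfolding TNpart_def disjoint_family_on_def by blast
    then show ?thesis using i(2) False by (auto simp: indicator_def)
  qed (use i in auto)
  then have "(\<Sum>k\<in>I. indicator (E k) x *\<^sub>R g k) = (\<Sum>k\<in>I. if k = i then g i else 0)" by (intro sum.cong) auto
  also have "\<dots> = g i" using P i(1) by (simp add: TNpart_def)
  finally show ?thesis .
qed

lemma TNpart_integral:
  fixes g :: "real^'n::finite \<Rightarrow> real"
  assumes P: "TNpart I E" and g: "integrable TN g"
  shows "integral\<^sup>L TN g = (\<Sum>i\<in>I. integral\<^sup>L TN (\<lambda>x. indicator (E i) x * g x))"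
proof -
  have "integral\<^sup>L TN g = integral\<^sup>L TN (\<lambda>x. \<Sum>i\<in>I. indicator (E i) x * g x)"
  proof (rule Bochner_Integration.integral_cong[OF refl])
    fix x :: "real^'n" assume "x \<in> space TN"
    then obtain i where i: "i \<in> I" "x \<in> E i" using P unfolding TNpart_def by auto
    show "g x = (\<Sum>i\<in>I. indicator (E i) x * g x)"
      using TNpart_sum[OF P i, of "\<lambda>_. g x"] by simp
  qed
  also have "\<dots> = (\<Sum>i\<in>I. integral\<^sup>L TN (\<lambda>x. indicator (E i) x * g x))"
    using P g by (intro Bochner_Integration.integral_sum integrable_indicator_mult) (auto simp: TNpart_def)
  finally show ?thesis .
qed

lemma lipschitz_continuous:
  fixes f :: "real^'d::finite \<Rightarrow> real"
  assumes "\<And>y z. \<bar>f y - f z\<bar> \<le> \<Lambda> * norm (y - z)"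
  shows "continuous_on UNIV f"
proof -
  have "\<bar>f y - f z\<bar> \<le> \<bar>\<Lambda>\<bar> * norm (y - z)" for y z
    by (rule order_trans[OF assms mult_right_mono]) auto
  then have "\<bar>\<Lambda>\<bar>-lipschitz_on UNIV f" by (intro lipschitz_onI) (auto simp: dist_norm)
  then show ?thesis by (rule lipschitz_on_continuous_on)
qed

lemma integrable_lipschitz_comp:
  fixes f :: "real^'d::finite \<Rightarrow> real" and g :: "real^'n::finite \<Rightarrow> real^'d"
  assumes f: "\<And>y z. \<bar>f y - f z\<bar> \<le> \<Lambda> * norm (y - z)" and g: "integrable TN g"
  shows "integrable TN (\<lambda>x. f (g x))"
proof (rule Bochner_Integration.integrable_bound)
  show "integrable TN (\<lambda>x. \<bar>f 0\<bar> + \<bar>\<Lambda>\<bar> * norm (g x))" using g by simp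
  have "f \<in> borel_measurable borel" by (rule borel_measurable_continuous_onI[OF lipschitz_continuous[OF f]])
  then show "(\<lambda>x. f (g x)) \<in> borel_measurable TN" using borel_measurable_integrable[OF g] by measurable
  have "norm (f (g x)) \<le> norm (\<bar>f 0\<bar> + \<bar>\<Lambda>\<bar> * norm (g x))" for x
  proof -
    have "\<bar>f (g x) - f 0\<bar> \<le> \<bar>\<Lambda>\<bar> * norm (g x)"
      using order_trans[OF f mult_right_mono[of \<Lambda> "\<bar>\<Lambda>\<bar>"], of "g x" 0] by simp
    then show ?thesis by simp
  qed
  then show "AE x in TN. norm (f (g x)) \<le> norm (\<bar>f 0\<bar> + \<bar>\<Lambda>\<bar> * norm (g x))" by simp
qed

text \<open>The step function with values \<open>a i\<close> is in general not A-free, so an A-free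
  \<open>\<phi>0\<close> close to it carries the slow part, at the price of the last term. The
  Lipschitz bound converts the L^1 errors into errors of averages, simultaneously for all of
  \<open>F\<close> and on every cell.\<close>

lemma gluing_functional:
  fixes A :: "'n::finite \<Rightarrow> real^'d::finite^'l::finite" and \<phi> :: "'i \<Rightarrow> real^'n \<Rightarrow> real^'d"
  assumes cr: "constant_rank A" and P: "TNpart I E"
    and \<phi>: "\<And>i. i \<in> I \<Longrightarrow> afree A (\<phi> i)" "\<And>i. i \<in> I \<Longrightarrow> integral\<^sup>L TN (\<phi> i) = 0" and \<phi>0: "afree A \<phi>0"
    and F: "finite F" "\<And>f y z. f \<in> F \<Longrightarrow> \<bar>f y - f z\<bar> \<le> \<Lambda> * norm (y - z)" "\<Lambda> \<ge> 0" and e: "e > 0"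
  shows "\<exists>z. afree A z \<and> integral\<^sup>L TN z = integral\<^sup>L TN \<phi>0 \<and>
     (\<forall>f\<in>F. \<forall>i\<in>I. \<bar>integral\<^sup>L TN (\<lambda>x. indicator (E i) x * f (z x)) - measure TN (E i) * integral\<^sup>L TN (\<lambda>x. f (a i + \<phi> i x))\<bar>
        \<le> e + \<Lambda> * integral\<^sup>L TN (\<lambda>x. indicator (E i) x * norm (\<phi>0 x - a i)))"
proof -
  have I: "finite I" and E: "\<And>i. i \<in> I \<Longrightarrow> E i \<in> sets TN" using P by (auto simp: TNpart_def)
  have t\<phi>: "trig (\<phi> i)" if "i \<in> I" for i using \<phi>(1)[OF that] by (rule trigV_imp_trig)
  have t0: "trig \<phi>0" using \<phi>0 by (rule trigV_imp_trig)
  have cF: "continuous_on UNIV f" if "f \<in> F" for f by (rule lipschitz_continuous[OF F(2)[OF that]])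
  define e' where "e' = e / (2 * (\<Lambda> + 1))"
  have e': "e' > 0" using e F(3) by (simp add: e'_def)
  have Le': "\<Lambda> * e' \<le> e / 2" using e F(3) by (simp add: e'_def field_simps)
  have "\<exists>J. \<forall>j\<ge>J. \<exists>z. afree A z \<and> integral\<^sup>L TN z = 0 \<and>
     integral\<^sup>L TN (\<lambda>x. norm (z x - (\<Sum>i\<in>I. indicator (E i) x *\<^sub>R \<phi> i (real j *\<^sub>R x)))) \<le> e'"
    by (rule gluing[OF cr I E \<phi> e'])
  then obtain J1 where J1: "\<forall>j\<ge>J1. \<exists>z. afree A z \<and> integral\<^sup>L TN z = 0 \<and>
     integral\<^sup>L TN (\<lambda>x. norm (z x - (\<Sum>i\<in>I. indicator (E i) x *\<^sub>R \<phi> i (real j *\<^sub>R x)))) \<le> e'"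
    by (elim exE)
  have "\<forall>\<^sub>F j in sequentially. \<forall>f\<in>F. \<forall>i\<in>I. \<bar>integral\<^sup>L TN (\<lambda>x. indicator (E i) x * f (a i + \<phi> i (real j *\<^sub>R x))) - measure TN (E i) * integral\<^sup>L TN (\<lambda>x. f (a i + \<phi> i x))\<bar> < e / 2"
  proof (intro eventually_ball_finite[OF F(1)] eventually_ball_finite[OF I] ballI)
    fix f i assume fi: "f \<in> F" "i \<in> I"
    show "\<forall>\<^sub>F j in sequentially. \<bar>integral\<^sup>L TN (\<lambda>x. indicator (E i) x * f (a i + \<phi> i (real j *\<^sub>R x))) - measure TN (E i) * integral\<^sup>L TN (\<lambda>x. f (a i + \<phi> i x))\<bar> < e / 2"
      using tendstoD[OF riemann_lebesgue[OF cF[OF fi(1)] t\<phi>[OF fi(2)] E[OF fi(2)]], of "e / 2"] e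
      by (simp add: dist_real_def)
  qed
  then obtain J2 where J2: "\<forall>j\<ge>J2. \<forall>f\<in>F. \<forall>i\<in>I. \<bar>integral\<^sup>L TN (\<lambda>x. indicator (E i) x * f (a i + \<phi> i (real j *\<^sub>R x))) - measure TN (E i) * integral\<^sup>L TN (\<lambda>x. f (a i + \<phi> i x))\<bar> < e / 2"
    unfolding eventually_sequentially by (elim exE)
  define j where "j = max J1 J2"
  obtain z where z: "afree A z" "integral\<^sup>L TN z = 0"
     "integral\<^sup>L TN (\<lambda>x. norm (z x - (\<Sum>i\<in>I. indicator (E i) x *\<^sub>R \<phi> i (real j *\<^sub>R x)))) \<le> e'"
    using J1[rule_format, of j] unfolding j_def by auto
  define \<psi> where "\<psi> i x = \<phi> i (real j *\<^sub>R x)" for i x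
  have t\<psi>: "trig (\<psi> i)" if "i \<in> I" for i
    unfolding \<psi>_def by (rule trigV_rescale[OF t\<phi>[OF that]]) simp
  have tz: "trig z" by (rule trigV_imp_trig[OF z(1)])
  have iz: "integrable TN (\<lambda>x. norm (z x - (\<Sum>i\<in>I. indicator (E i) x *\<^sub>R \<psi> i x)))"
    by (intro integrable_norm Bochner_Integration.integrable_diff Bochner_Integration.integrable_sum trig_integrable tz integrable_indicator_scaleR E t\<psi>)
  show ?thesis
  proof (intro exI[of _ "\<lambda>x. z x + \<phi>0 x"] conjI ballI)
    show "afree A (\<lambda>x. z x + \<phi>0 x)" by (rule trigV.add[OF z(1) \<phi>0])
    show "integral\<^sup>L TN (\<lambda>x. z x + \<phi>0 x) = integral\<^sup>L TN \<phi>0"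
      using z(2) trig_integrable[OF tz] trig_integrable[OF t0] by simp
    fix f i assume f: "f \<in> F" and i: "i \<in> I"
    have i0: "integrable TN (\<lambda>x. indicator (E i) x * norm (\<phi>0 x - a i))"
      by (intro integrable_indicator_mult E i integrable_norm Bochner_Integration.integrable_diff trig_integrable[OF t0] TN.integrable_const)
    have i1: "integrable TN (\<lambda>x. indicator (E i) x * f (z x + \<phi>0 x))"
      by (intro integrable_indicator_mult E i integrable_lipschitz_comp[OF F(2)[OF f]] Bochner_Integration.integrable_add trig_integrable tz t0)
    have i2: "integrable TN (\<lambda>x. indicator (E i) x * f (a i + \<psi> i x))"
      by (intro integrable_indicator_mult E i integrable_lipschitz_comp[OF F(2)[OF f]] Bochner_Integration.integrable_add trig_integrable[OF t\<psi>] TN.integrable_const)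
    have "\<bar>integral\<^sup>L TN (\<lambda>x. indicator (E i) x * f (z x + \<phi>0 x) - indicator (E i) x * f (a i + \<psi> i x))\<bar>
       \<le> integral\<^sup>L TN (\<lambda>x. \<Lambda> * norm (z x - (\<Sum>i\<in>I. indicator (E i) x *\<^sub>R \<psi> i x)) + \<Lambda> * (indicator (E i) x * norm (\<phi>0 x - a i)))"
    proof (rule integral_abs_mono)
      show "integrable TN (\<lambda>x. indicator (E i) x * f (z x + \<phi>0 x) - indicator (E i) x * f (a i + \<psi> i x))"
        using i1 i2 by (rule Bochner_Integration.integrable_diff)
      show "integrable TN (\<lambda>x. \<Lambda> * norm (z x - (\<Sum>i\<in>I. indicator (E i) x *\<^sub>R \<psi> i x)) + \<Lambda> * (indicator (E i) x * norm (\<phi>0 x - a i)))"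
        by (intro Bochner_Integration.integrable_add integrable_mult_right iz i0)
      fix x :: "real^'n"
      show "\<bar>indicator (E i) x * f (z x + \<phi>0 x) - indicator (E i) x * f (a i + \<psi> i x)\<bar>
        \<le> \<Lambda> * norm (z x - (\<Sum>i\<in>I. indicator (E i) x *\<^sub>R \<psi> i x)) + \<Lambda> * (indicator (E i) x * norm (\<phi>0 x - a i))"
      proof (cases "x \<in> E i")
        case True
        have "\<bar>f (z x + \<phi>0 x) - f (a i + \<psi> i x)\<bar> \<le> \<Lambda> * norm ((z x + \<phi>0 x) - (a i + \<psi> i x))" by (rule F(2)[OF f])
        also have "\<dots> \<le> \<Lambda> * (norm (z x - \<psi> i x) + norm (\<phi>0 x - a i))"
          by (intro mult_left_mono F(3)) norm
        finally show ?thesis using True TNpart_sum[OF P i True, of "\<lambda>i. \<psi> i x"] by (simp add: distrib_left)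
      qed (use F(3) in simp)
    qed
    also have "\<dots> = \<Lambda> * integral\<^sup>L TN (\<lambda>x. norm (z x - (\<Sum>i\<in>I. indicator (E i) x *\<^sub>R \<psi> i x))) + \<Lambda> * integral\<^sup>L TN (\<lambda>x. indicator (E i) x * norm (\<phi>0 x - a i))"
      using iz i0 by simp
    also have "\<dots> \<le> e / 2 + \<Lambda> * integral\<^sup>L TN (\<lambda>x. indicator (E i) x * norm (\<phi>0 x - a i))"
      using mult_left_mono[OF z(3) F(3)] Le' unfolding \<psi>_def by linarith
    finally have "\<bar>integral\<^sup>L TN (\<lambda>x. indicator (E i) x * f (z x + \<phi>0 x)) - integral\<^sup>L TN (\<lambda>x. indicator (E i) x * f (a i + \<psi> i x))\<bar> \<le> \<dots>"
      using i1 i2 by simp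
    moreover have "\<bar>integral\<^sup>L TN (\<lambda>x. indicator (E i) x * f (a i + \<psi> i x)) - measure TN (E i) * integral\<^sup>L TN (\<lambda>x. f (a i + \<phi> i x))\<bar> < e / 2"
      unfolding \<psi>_def by (rule J2[rule_format, OF _ f i]) (simp add: j_def)
    ultimately show "\<bar>integral\<^sup>L TN (\<lambda>x. indicator (E i) x * f (z x + \<phi>0 x)) - measure TN (E i) * integral\<^sup>L TN (\<lambda>x. f (a i + \<phi> i x))\<bar>
        \<le> e + \<Lambda> * integral\<^sup>L TN (\<lambda>x. indicator (E i) x * norm (\<phi>0 x - a i))"
      by linarith
  qed
qed

text \<open>Total boundedness covers the range by finitely many small balls; a point is assigned to
  the first ball that contains its value, which makes the preimages disjoint.\<close>

lemma TNpart_small_oscillation: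
  fixes U :: "real^'n::finite \<Rightarrow> 'e::euclidean_space"
  assumes U: "U \<in> borel_measurable TN" and M: "\<And>x. x \<in> cbox 0 1 \<Longrightarrow> norm (U x) \<le> M" and e: "e > 0"
  shows "\<exists>(n::nat) E c. TNpart {..<n} E \<and> (\<forall>i<n. \<forall>x\<in>E i. norm (U x - c i) \<le> e)"
proof -
  have "\<exists>K. finite K \<and> cball (0::'e) M \<subseteq> (\<Union>x\<in>K. ball x e)"
    using compact_cball[of "0::'e" M, unfolded compact_eq_totally_bounded] e by simp
  then obtain K where K: "finite K" "cball (0::'e) M \<subseteq> (\<Union>x\<in>K. ball x e)"
    by (elim exE conjE)
  obtain xs where xs: "set xs = K" using finite_list[OF K(1)] by (elim exE)
  define c where "c i = xs ! i" for i
  define n where "n = length xs"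
  define D where "D i = {x \<in> cbox 0 1. norm (U x - c i) < e}" for i
  define E where "E i = D i - (\<Union>k<i. D k)" for i
  have D: "D i \<in> sets TN" for i
  proof -
    have "{x \<in> space TN. norm (U x - c i) < e} \<in> sets TN" using U by measurable
    then show ?thesis by (simp add: D_def)
  qed
  have "x \<in> (\<Union>i<n. E i)" if x: "x \<in> cbox 0 1" for x
  proof -
    have "U x \<in> cball 0 M" using M[OF x] by simp
    then obtain y where y: "y \<in> set xs" "U x \<in> ball y e" using K(2) xs by auto
    then obtain i where i: "i < n" "U x \<in> ball (c i) e" by (auto simp: in_set_conv_nth c_def n_def)
    then have Di: "x \<in> D i" using x by (simp add: D_def dist_norm norm_minus_commute)
    define k where "k = (LEAST k. x \<in> D k)"
    have "x \<in> D k" unfolding k_def using Di by (rule LeastI)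
    moreover have "k \<le> i" unfolding k_def using Di by (rule Least_le)
    moreover have "x \<notin> D l" if "l < k" for l using that not_less_Least unfolding k_def by blast
    ultimately show ?thesis using i by (auto simp: E_def)
  qed
  then have cov: "(\<Union>i<n. E i) = cbox 0 1" by (auto simp: E_def D_def)
  have disj: "disjoint_family_on E {..<n}"
    unfolding disjoint_family_on_def
  proof (intro ballI impI)
    fix m k assume "m \<noteq> (k::nat)"
    then show "E m \<inter> E k = {}" by (cases "m < k") (auto simp: E_def)
  qed
  have "E i \<in> sets TN" for i unfolding E_def using D by auto
  then have "TNpart {..<n} E" using cov disj by (simp add: TNpart_def)
  moreover have "\<forall>i<n. \<forall>x\<in>E i. norm (U x - c i) \<le> e" by (auto simp: E_def D_def)
  ultimately show ?thesis by blast
qed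

section \<open>The quasiconvex envelope\<close>

definition Phi :: "('n::finite \<Rightarrow> real^'d::finite^'l::finite) \<Rightarrow> (real^'n \<Rightarrow> real^'d) set" where
  "Phi A = {\<phi>. afree A \<phi> \<and> integral\<^sup>L TN \<phi> = 0}"

text \<open>Dacorogna's formula for the quasiconvex envelope, with test fields restricted to
  trigonometric polynomials so that the gluing lemmas apply directly. Smooth test fields are reached
  afterwards by smoothing.\<close>

definition env :: "('n::finite \<Rightarrow> real^'d::finite^'l::finite) \<Rightarrow> (real^'d \<Rightarrow> real) \<Rightarrow> real^'d \<Rightarrow> real" where
  "env A f x = (INF \<phi>\<in>Phi A. integral\<^sup>L TN (\<lambda>y. f (x + \<phi> y)))"

lemma zero_in_Phi: "(\<lambda>_. 0) \<in> Phi A"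
  by (simp add: Phi_def afree_const)

lemma Phi_integrable: "\<phi> \<in> Phi A \<Longrightarrow> integrable TN (\<lambda>y. x + \<phi> y)"
  unfolding Phi_def by (intro Bochner_Integration.integrable_add TN.integrable_const trig_integrable) (auto dest: trigV_imp_trig)

lemma integral_lipschitz_shift:
  fixes f :: "real^'d::finite \<Rightarrow> real"
  assumes f: "\<And>y z. \<bar>f y - f z\<bar> \<le> \<Lambda> * norm (y - z)" and \<phi>: "\<phi> \<in> Phi A"
  shows "\<bar>integral\<^sup>L TN (\<lambda>y. f (x + \<phi> y)) - integral\<^sup>L TN (\<lambda>y. f (x' + \<phi> y))\<bar> \<le> \<Lambda> * norm (x - x')"
proof -
  note i = integrable_lipschitz_comp[OF f Phi_integrable[OF \<phi>, of x]] integrable_lipschitz_comp[OF f Phi_integrable[OF \<phi>, of x']]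
  have "\<bar>integral\<^sup>L TN (\<lambda>y. f (x + \<phi> y) - f (x' + \<phi> y))\<bar> \<le> integral\<^sup>L TN (\<lambda>y::real^'a. \<Lambda> * norm (x - x'))"
  proof (rule integral_abs_mono[OF Bochner_Integration.integrable_diff[OF i] TN.integrable_const])
    show "\<bar>f (x + \<phi> y) - f (x' + \<phi> y)\<bar> \<le> \<Lambda> * norm (x - x')" for y
      using f[of "x + \<phi> y" "x' + \<phi> y"] by simp
  qed
  then show ?thesis using i by simp
qed

text \<open>A lower bound at the single point \<open>a\<close> is what the separation argument
  provides. The Lipschitz bound spreads it to all points, and this keeps the infimum in
  \<open>env\<close> from being taken over a set unbounded below.\<close>

locale lipschitz_env =
  fixes A :: "'n::finite \<Rightarrow> real^'d::finite^'l::finite" and f :: "real^'d \<Rightarrow> real" and \<Lambda> m :: real and a :: "real^'d"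
  assumes cr: "constant_rank A"
    and lip: "\<And>y z. \<bar>f y - f z\<bar> \<le> \<Lambda> * norm (y - z)" and \<Lambda>: "\<Lambda> \<ge> 0"
    and lower: "\<And>\<phi>. \<phi> \<in> Phi A \<Longrightarrow> m \<le> integral\<^sup>L TN (\<lambda>y. f (a + \<phi> y))"
begin

lemma bdd: "bdd_below ((\<lambda>\<phi>. integral\<^sup>L TN (\<lambda>y. f (x + \<phi> y))) ` Phi A)"
proof (rule bdd_belowI2)
  fix \<phi> assume \<phi>: "\<phi> \<in> Phi A"
  show "m - \<Lambda> * norm (x - a) \<le> integral\<^sup>L TN (\<lambda>y. f (x + \<phi> y))"
    using integral_lipschitz_shift[OF lip \<phi>, of x a] lower[OF \<phi>] by linarith
qed

lemma env_le: "\<phi> \<in> Phi A \<Longrightarrow> env A f x \<le> integral\<^sup>L TN (\<lambda>y. f (x + \<phi> y))"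
  unfolding env_def by (rule cINF_lower[OF bdd])

lemma env_le_self: "env A f x \<le> f x"
  using env_le[OF zero_in_Phi, of x] by simp

lemma env_ge: "m \<le> env A f a"
  unfolding env_def using zero_in_Phi by (intro cINF_greatest lower) auto

lemma env_approx:
  assumes "e > 0"
  shows "\<exists>\<phi>\<in>Phi A. integral\<^sup>L TN (\<lambda>y. f (x + \<phi> y)) \<le> env A f x + e"
proof (rule ccontr)
  assume "\<not> ?thesis"
  then have "env A f x + e \<le> env A f x"
    using zero_in_Phi by (subst (2) env_def, intro cINF_greatest) (auto simp: not_le intro: less_imp_le)
  then show False using assms by simp
qed

lemma env_lip: "\<bar>env A f x - env A f y\<bar> \<le> \<Lambda> * norm (x - y)"
proof -
  have "env A f x \<le> env A f y + \<Lambda> * norm (x - y)" for x y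
  proof (rule field_le_epsilon)
    fix e :: real assume "e > 0"
    then obtain \<phi> where \<phi>: "\<phi> \<in> Phi A" "integral\<^sup>L TN (\<lambda>z. f (y + \<phi> z)) \<le> env A f y + e" using env_approx by blast
    then show "env A f x \<le> env A f y + \<Lambda> * norm (x - y) + e"
      using env_le[OF \<phi>(1), of x] integral_lipschitz_shift[OF lip \<phi>(1), of x y] by linarith
  qed
  from this[of x y] this[of y x] show ?thesis by (simp add: norm_minus_commute abs_le_iff)
qed

text \<open>On cells where \<open>\<phi>0\<close> is nearly a constant \<open>c i\<close>, choose an
  almost optimal field for the point \<open>x + c i\<close>. Gluing these onto
  \<open>\<phi>0\<close> yields a single competitor for \<open>env A f x\<close> whose average is
  nearly that of \<open>env A f (x + \<phi>0)\<close>.\<close>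

lemma env_quasiconvex_trig:
  assumes \<phi>0: "\<phi>0 \<in> Phi A"
  shows "env A f x \<le> integral\<^sup>L TN (\<lambda>y. env A f (x + \<phi>0 y))"
proof (rule field_le_epsilon)
  fix \<eta> :: real assume \<eta>: "\<eta> > 0"
  \<comment> \<open>Four errors add up to \<open>\<eta>\<close>: \<open>\<Lambda> * e\<close> from
    the slow part in the gluing, \<open>\<Lambda> * e\<close> from moving the envelope from
    \<open>c i\<close> to \<open>\<phi>0\<close>, \<open>e\<close> from almost optimality and
    \<open>e\<close> from the gluing itself.\<close>
  define e where "e = \<eta> / (2 * \<Lambda> + 2)"
  have e: "e > 0" using \<eta> \<Lambda> by (simp add: e_def)
  have e_eq: "2 * \<Lambda> * e + 2 * e = \<eta>"
  proof -
    have "2 * \<Lambda> * e + 2 * e = (2 * \<Lambda> + 2) * e" by (simp add: algebra_simps)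
    also have "\<dots> = \<eta>" using \<Lambda> by (simp add: e_def)
    finally show ?thesis .
  qed
  have a0: "afree A \<phi>0" and t0: "trig \<phi>0" and m0: "integral\<^sup>L TN \<phi>0 = 0" using \<phi>0 trigV_imp_trig by (auto simp: Phi_def)
  obtain M where M: "\<And>x. norm (\<phi>0 x) \<le> M" using trig_bounded[OF t0] by auto
  obtain n :: nat and E c where P: "TNpart {..<n} E" and osc': "\<forall>i<n. \<forall>y\<in>E i. norm (\<phi>0 y - c i) \<le> e"
    using TNpart_small_oscillation[OF measurable_trig[OF t0] M e] by (elim exE conjE)
  have osc: "\<And>i y. i < n \<Longrightarrow> y \<in> E i \<Longrightarrow> norm (\<phi>0 y - c i) \<le> e" using osc' by simp
  have E: "E i \<in> sets TN" if "i < n" for i using P that by (simp add: TNpart_def)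
  have "\<exists>\<phi>. \<phi> \<in> Phi A \<and> integral\<^sup>L TN (\<lambda>y. f (x + c i + \<phi> y)) \<le> env A f (x + c i) + e" for i
    using env_approx[OF e, of "x + c i"] by blast
  then obtain \<phi> where \<phi>: "\<And>i. \<phi> i \<in> Phi A" "\<And>i. integral\<^sup>L TN (\<lambda>y. f (x + c i + \<phi> i y)) \<le> env A f (x + c i) + e" by metis
  define f' where "f' y = f (x + y)" for y
  have lip': "\<bar>f' y - f' z\<bar> \<le> \<Lambda> * norm (y - z)" for y z unfolding f'_def using lip[of "x + y" "x + z"] by simp
  have n0: "n > 0"
  proof (rule ccontr)
    assume "\<not> n > 0"
    then have "cbox 0 (1::real^'n) = {}" using P by (simp add: TNpart_def)
    then show False by (simp add: interval_eq_empty_cart)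
  qed
  have "\<exists>z. afree A z \<and> integral\<^sup>L TN z = integral\<^sup>L TN \<phi>0 \<and>
     (\<forall>g\<in>{f'}. \<forall>i\<in>{..<n}. \<bar>integral\<^sup>L TN (\<lambda>y. indicator (E i) y * g (z y)) - measure TN (E i) * integral\<^sup>L TN (\<lambda>y. g (c i + \<phi> i y))\<bar>
        \<le> e / real n + \<Lambda> * integral\<^sup>L TN (\<lambda>y. indicator (E i) y * norm (\<phi>0 y - c i)))"
    using \<phi>(1) n0 e by (intro gluing_functional[OF cr P _ _ a0 _ _ \<Lambda>]) (auto simp: Phi_def lip')
  then obtain z where z: "afree A z" "integral\<^sup>L TN z = 0"
    "\<And>i. i < n \<Longrightarrow> \<bar>integral\<^sup>L TN (\<lambda>y. indicator (E i) y * f' (z y)) - measure TN (E i) * integral\<^sup>L TN (\<lambda>y. f' (c i + \<phi> i y))\<bar>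
        \<le> e / real n + \<Lambda> * integral\<^sup>L TN (\<lambda>y. indicator (E i) y * norm (\<phi>0 y - c i))"
    using m0 by auto
  have zPhi: "z \<in> Phi A" using z by (simp add: Phi_def)
  have iz: "integrable TN (\<lambda>y. f' (z y))"
    unfolding f'_def by (rule integrable_lipschitz_comp[OF lip Phi_integrable[OF zPhi]])
  have ienv: "integrable TN (\<lambda>y. env A f (x + \<phi>0 y))"
    by (rule integrable_lipschitz_comp[OF env_lip Phi_integrable[OF \<phi>0]])
  have piece: "integral\<^sup>L TN (\<lambda>y. indicator (E i) y * f' (z y)) \<le>
     integral\<^sup>L TN (\<lambda>y. indicator (E i) y * env A f (x + \<phi>0 y)) + (2 * \<Lambda> * e + e) * measure TN (E i) + e / real n" if i: "i < n" for i
  proof -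
    have iE: "integrable TN (\<lambda>y. indicator (E i) y * c)" for c :: real by (rule integrable_indicator_mult[OF E[OF i]]) simp
    have cE: "integral\<^sup>L TN (\<lambda>y. indicator (E i) y * c) = measure TN (E i) * c" for c :: real
      using integral_indicator_TN[OF E[OF i]] by simp
    have 1: "integral\<^sup>L TN (\<lambda>y. indicator (E i) y * norm (\<phi>0 y - c i)) \<le> measure TN (E i) * e"
      unfolding cE[symmetric]
    proof (rule integral_mono[OF integrable_indicator_mult[OF E[OF i]] iE])
      show "integrable TN (\<lambda>y. norm (\<phi>0 y - c i))"
        by (intro integrable_norm Bochner_Integration.integrable_diff trig_integrable[OF t0] TN.integrable_const)
      show "indicator (E i) y * norm (\<phi>0 y - c i) \<le> indicator (E i) y * e" for y
        using osc[OF i, of y] by (auto simp: indicator_def)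
    qed
    have 2: "measure TN (E i) * env A f (x + c i) \<le> integral\<^sup>L TN (\<lambda>y. indicator (E i) y * env A f (x + \<phi>0 y)) + measure TN (E i) * (\<Lambda> * e)"
    proof -
      have "integral\<^sup>L TN (\<lambda>y. indicator (E i) y * env A f (x + c i)) \<le> integral\<^sup>L TN (\<lambda>y. indicator (E i) y * env A f (x + \<phi>0 y) + indicator (E i) y * (\<Lambda> * e))"
      proof (rule integral_mono[OF iE Bochner_Integration.integrable_add[OF integrable_indicator_mult[OF E[OF i] ienv] iE]])
        fix y
        show "indicator (E i) y * env A f (x + c i) \<le> indicator (E i) y * env A f (x + \<phi>0 y) + indicator (E i) y * (\<Lambda> * e)"
        proof (cases "y \<in> E i")
          case True
          have "\<Lambda> * norm (\<phi>0 y - c i) \<le> \<Lambda> * e" using osc[OF i True] \<Lambda> by (rule mult_left_mono)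
          then show ?thesis using env_lip[of "x + c i" "x + \<phi>0 y"] True by (simp add: norm_minus_commute)
        qed simp
      qed
      also have "\<dots> = integral\<^sup>L TN (\<lambda>y. indicator (E i) y * env A f (x + \<phi>0 y)) + measure TN (E i) * (\<Lambda> * e)"
        unfolding Bochner_Integration.integral_add[OF integrable_indicator_mult[OF E[OF i] ienv] iE] cE ..
      finally show ?thesis by (simp only: cE)
    qed
    have 3: "measure TN (E i) * integral\<^sup>L TN (\<lambda>y. f' (c i + \<phi> i y)) \<le> measure TN (E i) * (env A f (x + c i) + e)"
      using \<phi>(2)[of i] unfolding f'_def by (intro mult_left_mono) (auto simp: add.assoc)
    have 4: "\<Lambda> * integral\<^sup>L TN (\<lambda>y. indicator (E i) y * norm (\<phi>0 y - c i)) \<le> \<Lambda> * (measure TN (E i) * e)"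
      using 1 \<Lambda> by (rule mult_left_mono)
    show ?thesis using z(3)[OF i] 2 3 4 by (simp add: algebra_simps)
  qed
  have mE: "(\<Sum>i<n. measure TN (E i)) = 1"
  proof -
    have "(\<Sum>i<n. integral\<^sup>L TN (\<lambda>y. indicator (E i) y * (1::real))) = 1" using TNpart_integral[OF P, of "\<lambda>_. 1"] by simp
    then show ?thesis using integral_indicator_TN[OF E] by simp
  qed
  have "env A f x \<le> integral\<^sup>L TN (\<lambda>y. f' (z y))" unfolding f'_def by (rule env_le[OF zPhi])
  also have "\<dots> = (\<Sum>i<n. integral\<^sup>L TN (\<lambda>y. indicator (E i) y * f' (z y)))" by (rule TNpart_integral[OF P iz])
  also have "\<dots> \<le> (\<Sum>i<n. integral\<^sup>L TN (\<lambda>y. indicator (E i) y * env A f (x + \<phi>0 y)) + (2 * \<Lambda> * e + e) * measure TN (E i) + e / real n)"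
    by (intro sum_mono piece) simp
  also have "\<dots> = integral\<^sup>L TN (\<lambda>y. env A f (x + \<phi>0 y)) + (2 * \<Lambda> * e + e) + e"
    unfolding sum.distrib TNpart_integral[OF P ienv] sum_distrib_left[symmetric] mE using n0 by simp
  finally show "env A f x \<le> integral\<^sup>L TN (\<lambda>y. env A f (x + \<phi>0 y)) + \<eta>" using e_eq by linarith
qed

text \<open>A smooth test field is the L^1 limit of its smoothings, which belong to
  \<open>Phi A\<close>; the Lipschitz bound of the envelope passes the inequality to the
  limit.\<close>

lemma env_quasiconvex: "A_quasiconvex A (env A f)"
  unfolding A_quasiconvex_def
proof (intro conjI allI impI; (elim conjE)?)
  show "continuous_on UNIV (env A f)" by (rule lipschitz_continuous[OF env_lip])
  fix x and \<phi> :: "real^'n \<Rightarrow> real^'d"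
  assume \<phi>: "smooth \<phi>" "periodic \<phi>" "integral\<^sup>L TN \<phi> = 0" "\<forall>y. (\<Sum>k\<in>UNIV. A k *v partial k \<phi> y) = 0"
  have k: "kerA A \<phi>" using \<phi> by (intro smooth_kerA) auto
  have c: "continuous_on UNIV \<phi>" using \<phi>(1) by (rule smooth_continuous)
  have i: "integrable TN \<phi>" by (rule integrable_TN_continuous[OF c])
  have "compact (\<phi> ` cbox 0 1)" using c by (intro compact_continuous_image continuous_on_subset[OF c]) auto
  then have "bounded (\<phi> ` cbox 0 1)" by (rule compact_imp_bounded)
  then obtain M where M: "\<forall>v\<in>\<phi> ` cbox 0 1. norm v \<le> M" unfolding bounded_iff by (elim exE)
  then have b: "AE x in TN. norm (\<phi> x) \<le> M" by (intro AE_I2) simp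
  have lim: "(\<lambda>m. integral\<^sup>L TN (\<lambda>y. norm (smth m \<phi> y - \<phi> y))) \<longlonglongrightarrow> 0"
    by (rule smth_L1[OF borel_measurable_integrable[OF i] b])
  have sPhi: "smth m \<phi> \<in> Phi A" for m
    unfolding Phi_def using afree_smth[OF k i, of m] integral_conv[OF trig_tker i, of m] \<phi>(3) by (simp add: smth_def)
  have ie: "integrable TN (\<lambda>y. env A f (x + \<phi> y))"
    by (intro integrable_lipschitz_comp[OF env_lip] Bochner_Integration.integrable_add TN.integrable_const i)
  have le: "env A f x \<le> integral\<^sup>L TN (\<lambda>y. env A f (x + \<phi> y)) + \<Lambda> * integral\<^sup>L TN (\<lambda>y. norm (smth m \<phi> y - \<phi> y))" for m
  proof -
    have "integrable TN (smth m \<phi>)" by (rule trig_integrable[OF trig_smth[OF i]])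
    then have in': "integrable TN (\<lambda>y. norm (smth m \<phi> y - \<phi> y))" using i by simp
    have "env A f x \<le> integral\<^sup>L TN (\<lambda>y. env A f (x + smth m \<phi> y))" by (rule env_quasiconvex_trig[OF sPhi])
    also have "\<dots> \<le> integral\<^sup>L TN (\<lambda>y. env A f (x + \<phi> y) + \<Lambda> * norm (smth m \<phi> y - \<phi> y))"
    proof (rule integral_mono)
      show "integrable TN (\<lambda>y. env A f (x + smth m \<phi> y))" by (rule integrable_lipschitz_comp[OF env_lip Phi_integrable[OF sPhi]])
      show "integrable TN (\<lambda>y. env A f (x + \<phi> y) + \<Lambda> * norm (smth m \<phi> y - \<phi> y))" using ie in' by simp
      show "env A f (x + smth m \<phi> y) \<le> env A f (x + \<phi> y) + \<Lambda> * norm (smth m \<phi> y - \<phi> y)" for y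
        using env_lip[of "x + smth m \<phi> y" "x + \<phi> y"] by simp
    qed
    also have "\<dots> = integral\<^sup>L TN (\<lambda>y. env A f (x + \<phi> y)) + \<Lambda> * integral\<^sup>L TN (\<lambda>y. norm (smth m \<phi> y - \<phi> y))"
      using ie in' by simp
    finally show ?thesis .
  qed
  have "(\<lambda>m. integral\<^sup>L TN (\<lambda>y. env A f (x + \<phi> y)) + \<Lambda> * integral\<^sup>L TN (\<lambda>y. norm (smth m \<phi> y - \<phi> y))) \<longlonglongrightarrow> integral\<^sup>L TN (\<lambda>y. env A f (x + \<phi> y)) + \<Lambda> * 0"
    by (intro tendsto_intros lim)
  then have "env A f x \<le> integral\<^sup>L TN (\<lambda>y. env A f (x + \<phi> y)) + \<Lambda> * 0"
    by (rule LIMSEQ_le_const) (use le in blast)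
  then show "env A f x \<le> integral\<^sup>L TN (\<lambda>y. env A f (x + \<phi> y))" by simp
qed

end

section \<open>Convexity of the set of averages\<close>

lemma TN_set_of_measure:
  assumes t: "0 \<le> t" "t \<le> 1"
  shows "\<exists>E\<in>sets (TN :: (real^'n::finite) measure). measure TN E = t"
proof -
  obtain k :: 'n where True by simp
  define b :: "real^'n" where "b = (\<chi> i. if i = k then t else 1)"
  have b1: "b $ i \<le> 1" for i using t by (simp add: b_def)
  have sub: "cbox 0 b \<subseteq> cbox 0 1"
  proof
    fix x assume "x \<in> cbox 0 b"
    then have x: "0 \<le> x $ i" "x $ i \<le> b $ i" for i by (auto simp: mem_box_cart)
    show "x \<in> cbox 0 1" using x order_trans[OF x(2) b1] by (simp add: mem_box_cart)
  qed
  have ne: "cbox 0 b \<noteq> {}" using t unfolding interval_ne_empty_cart b_def by auto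
  have "cbox 0 b \<in> sets TN" unfolding TN_def using sub by (auto simp: sets_restrict_space_iff)
  moreover have "measure TN (cbox 0 b) = measure lebesgue (cbox 0 b)"
    unfolding TN_def using sub by (intro measure_restrict_space) auto
  moreover have "measure lebesgue (cbox 0 b) = t"
  proof -
    have "measure lebesgue (cbox 0 b) = (\<Prod>i\<in>UNIV. b $ i)" using content_cbox_cart[OF ne] by simp
    also have "\<dots> = (\<Prod>i\<in>UNIV. if i = k then t else 1)" by (simp add: b_def)
    also have "\<dots> = t" by simp
    finally show ?thesis .
  qed
  ultimately show ?thesis by auto
qed

text \<open>Let \<open>\<psi>\<close> oscillate on a set of measure \<open>t\<close> and
  \<open>\<phi>\<close> on its complement, and glue. The vectors of averages over \<open>F\<close>
  thus form a set that contains its convex combinations up to arbitrarily small errors.\<close>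

lemma averages_convex:
  fixes A :: "'n::finite \<Rightarrow> real^'d::finite^'l::finite"
  assumes cr: "constant_rank A" and F: "finite F" "\<And>f y z. f \<in> F \<Longrightarrow> \<bar>f y - f z\<bar> \<le> \<Lambda> * norm (y - z)" "\<Lambda> \<ge> 0"
    and \<phi>: "\<phi> \<in> Phi A" and \<psi>: "\<psi> \<in> Phi A" and t: "0 \<le> t" "t \<le> 1" and e: "e > 0"
  shows "\<exists>z\<in>Phi A. \<forall>f\<in>F. \<bar>integral\<^sup>L TN (\<lambda>x. f (a + z x)) -
     ((1 - t) * integral\<^sup>L TN (\<lambda>x. f (a + \<phi> x)) + t * integral\<^sup>L TN (\<lambda>x. f (a + \<psi> x)))\<bar> \<le> e"
proof -
  obtain E1 where E1: "E1 \<in> sets (TN :: (real^'n) measure)" "measure TN E1 = t"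
    using TN_set_of_measure[OF t] by blast
  define E where "E i = (if i then E1 else cbox 0 1 - E1)" for i :: bool
  have sub: "E1 \<subseteq> cbox 0 1" using sets.sets_into_space[OF E1(1)] by simp
  have spc: "cbox 0 1 \<in> sets TN" using sets.top[of TN] by simp
  have P: "TNpart UNIV E"
    using E1(1) sub spc by (auto simp: TNpart_def E_def disjoint_family_on_def UNIV_bool)
  have m0: "measure TN (E False) = 1 - t"
    using TN.finite_measure_compl[OF E1(1)] E1(2) by (simp add: E_def)
  define p where "p i = (if i then \<psi> else \<phi>)" for i :: bool
  have p: "afree A (p i)" "integral\<^sup>L TN (p i) = 0" for i using \<phi> \<psi> by (auto simp: p_def Phi_def)
  \<comment> \<open>Absorbing the constant \<open>a\<close> into the test functions lets the slow
    part be the zero field, for which the oscillation term of the gluing lemma vanishes.\<close>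
  define F' where "F' = (\<lambda>f y. f (a + y)) ` F"
  have F': "\<bar>g y - g z\<bar> \<le> \<Lambda> * norm (y - z)" if g: "g \<in> F'" for g y z
  proof -
    obtain f where "f \<in> F" "g = (\<lambda>y. f (a + y))" using g by (auto simp: F'_def)
    then show "\<bar>g y - g z\<bar> \<le> \<Lambda> * norm (y - z)" using F(2)[of f "a + y" "a + z"] by simp
  qed
  have fF': "finite F'" using F(1) by (simp add: F'_def)
  have "\<exists>z. afree A z \<and> integral\<^sup>L TN z = integral\<^sup>L TN (\<lambda>x::real^'n. 0::real^'d) \<and>
     (\<forall>g\<in>F'. \<forall>i\<in>UNIV. \<bar>integral\<^sup>L TN (\<lambda>y. indicator (E i) y * g (z y)) - measure TN (E i) * integral\<^sup>L TN (\<lambda>y. g (0 + p i y))\<bar>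
        \<le> e / 2 + \<Lambda> * integral\<^sup>L TN (\<lambda>y. indicator (E i) y * norm ((0::real^'d) - 0)))"
    by (rule gluing_functional[OF cr P p afree_const fF' F' F(3)]) (use e in auto)
  then obtain z where z: "afree A z" "integral\<^sup>L TN z = 0"
     "\<forall>g\<in>F'. \<forall>i. \<bar>integral\<^sup>L TN (\<lambda>y. indicator (E i) y * g (z y)) - measure TN (E i) * integral\<^sup>L TN (\<lambda>y. g (p i y))\<bar> \<le> e / 2"
    by auto
  have zPhi: "z \<in> Phi A" using z by (simp add: Phi_def)
  show ?thesis
  proof (intro bexI[of _ z] ballI zPhi)
    fix f assume f: "f \<in> F"
    then have "(\<lambda>y. f (a + y)) \<in> F'" by (simp add: F'_def)
    from z(3)[rule_format, OF this]
    have *: "\<bar>integral\<^sup>L TN (\<lambda>y. indicator (E i) y * f (a + z y)) - measure TN (E i) * integral\<^sup>L TN (\<lambda>y. f (a + p i y))\<bar> \<le> e / 2" for i .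
    have "integral\<^sup>L TN (\<lambda>y. f (a + z y)) = integral\<^sup>L TN (\<lambda>y. indicator (E True) y * f (a + z y)) + integral\<^sup>L TN (\<lambda>y. indicator (E False) y * f (a + z y))"
      using TNpart_integral[OF P integrable_lipschitz_comp[OF F(2)[OF f] Phi_integrable[OF zPhi]], of a] by (simp add: UNIV_bool)
    moreover have "measure TN (E True) = t" using E1(2) by (simp add: E_def)
    moreover have "\<bar>integral\<^sup>L TN (\<lambda>y. indicator (E True) y * f (a + z y)) - t * integral\<^sup>L TN (\<lambda>y. f (a + \<psi> y))\<bar> \<le> e / 2"
      using *[of True] \<open>measure TN (E True) = t\<close> by (simp only: p_def if_True)
    moreover have "\<bar>integral\<^sup>L TN (\<lambda>y. indicator (E False) y * f (a + z y)) - (1 - t) * integral\<^sup>L TN (\<lambda>y. f (a + \<phi> y))\<bar> \<le> e / 2"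
      using *[of False] m0 by (simp only: p_def if_False)
    ultimately show "\<bar>integral\<^sup>L TN (\<lambda>x. f (a + z x)) - ((1 - t) * integral\<^sup>L TN (\<lambda>x. f (a + \<phi> x)) + t * integral\<^sup>L TN (\<lambda>x. f (a + \<psi> x)))\<bar> \<le> e"
      by linarith
  qed
qed

section \<open>Separation of almost convex sets\<close>

text \<open>The number of test functions is not bounded, so that the separation argument is carried
  out in the space of functions on a finite set \<open>L\<close>.\<close>

lemma almost_convex_approx:
  fixes S :: "('k \<Rightarrow> real) set" and p :: "'k \<Rightarrow> real"
  assumes L: "finite L" and S: "S \<noteq> {}" and \<epsilon>: "\<epsilon> \<ge> 0"
    and conv: "\<And>s s' t e. s \<in> S \<Longrightarrow> s' \<in> S \<Longrightarrow> 0 \<le> t \<Longrightarrow> t \<le> 1 \<Longrightarrow> e > 0 \<Longrightarrow>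
       \<exists>r\<in>S. \<forall>l\<in>L. \<bar>r l - ((1 - t) * s l + t * s' l)\<bar> \<le> e"
    and low: "\<And>c \<eta>. \<eta> > 0 \<Longrightarrow> \<exists>s\<in>S. (\<Sum>l\<in>L. c l * s l) \<le> (\<Sum>l\<in>L. c l * p l) + \<epsilon> * (\<Sum>l\<in>L. \<bar>c l\<bar>) + \<eta>"
    and \<eta>: "\<eta> > 0"
  shows "\<exists>s\<in>S. \<forall>l\<in>L. \<bar>s l - p l\<bar> \<le> \<epsilon> * card L + \<eta>"
proof -
  define N where "N s = (\<Sum>l\<in>L. (s l - p l)\<^sup>2)" for s
  define \<rho> where "\<rho> = (INF s\<in>S. N s)"
  have Npos: "N s \<ge> 0" for s by (auto simp: N_def intro: sum_nonneg)
  have bdd: "bdd_below (N ` S)" by (rule bdd_belowI2[of _ 0]) (rule Npos)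
  have \<rho>le: "\<rho> \<le> N s" if "s \<in> S" for s unfolding \<rho>_def using that by (rule cINF_lower[OF bdd])
  have \<rho>0: "\<rho> \<ge> 0" unfolding \<rho>_def using S Npos by (intro cINF_greatest) auto
  have \<rho>ap: "\<exists>s\<in>S. N s < \<rho> + e" if "e > 0" for e
  proof (rule ccontr)
    assume "\<not> ?thesis"
    then have "\<rho> + e \<le> \<rho>" using S by (subst (2) \<rho>_def, intro cINF_greatest) (auto simp: not_less)
    then show False using that by simp
  qed
  \<comment> \<open>Points of a segment are limits, on \<open>L\<close>, of members of
    \<open>S\<close>, so the infimum \<open>\<rho>\<close> is a lower bound for them as
    well.\<close>
  have mid: "\<rho> \<le> N (\<lambda>l. (1 - t) * s l + t * s' l)" if s: "s \<in> S" "s' \<in> S" and t: "0 \<le> t" "t \<le> 1" for s s' t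
  proof -
    have "\<forall>n. \<exists>r\<in>S. \<forall>l\<in>L. \<bar>r l - ((1 - t) * s l + t * s' l)\<bar> \<le> 1 / real (Suc n)"
      using conv[OF s t] by simp
    then obtain r where r: "\<And>n. r n \<in> S" "\<And>n l. l \<in> L \<Longrightarrow> \<bar>r n l - ((1 - t) * s l + t * s' l)\<bar> \<le> 1 / real (Suc n)"
      by metis
    have "(\<lambda>n. r n l) \<longlonglongrightarrow> (1 - t) * s l + t * s' l" if l: "l \<in> L" for l
    proof (rule Lim_transform_bound[where g="\<lambda>n. 1 / real (Suc n)", THEN LIM_zero_cancel])
      show "\<forall>\<^sub>F n in sequentially. norm (r n l - ((1 - t) * s l + t * s' l)) \<le> norm (1 / real (Suc n))"
        using r(2)[OF l] by (intro always_eventually) simp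
      show "(\<lambda>n. 1 / real (Suc n)) \<longlonglongrightarrow> 0" using LIMSEQ_inverse_real_of_nat by (simp add: inverse_eq_divide)
    qed
    then have "(\<lambda>n. N (r n)) \<longlonglongrightarrow> N (\<lambda>l. (1 - t) * s l + t * s' l)"
      unfolding N_def by (intro tendsto_sum tendsto_power tendsto_diff tendsto_const)
    then show ?thesis by (rule LIMSEQ_le_const) (use r(1) \<rho>le in blast)
  qed
  have "\<forall>n. \<exists>s\<in>S. N s < \<rho> + 1 / real (Suc n)" using \<rho>ap by simp
  then obtain s where s: "\<And>n. s n \<in> S" "\<And>n. N (s n) < \<rho> + 1 / real (Suc n)" by metis
  \<comment> \<open>By the parallelogram identity and the lower bound at midpoints, a minimising
    sequence is Cauchy; its limit \<open>q\<close> is the nearest point to \<open>p\<close> in the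
    closure.\<close>
  have par: "(\<Sum>l\<in>L. (s n l - s k l)\<^sup>2) \<le> 2 / real (Suc n) + 2 / real (Suc k)" for n k
  proof -
    have "4 * N (\<lambda>l. (1 - 1/2) * s n l + 1/2 * s k l) = 2 * N (s n) + 2 * N (s k) - (\<Sum>l\<in>L. (s n l - s k l)\<^sup>2)"
      unfolding N_def sum_distrib_left sum.distrib[symmetric] sum_subtractf[symmetric]
      by (intro sum.cong refl) (simp add: power2_eq_square field_simps)
    moreover have "\<rho> \<le> N (\<lambda>l. (1 - 1/2) * s n l + 1/2 * s k l)" by (rule mid[OF s(1) s(1)]) auto
    ultimately show ?thesis using s(2)[of n] s(2)[of k] by argo
  qed
  have "Cauchy (\<lambda>n. s n l)" if l: "l \<in> L" for l
  proof (rule CauchyI)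
    fix e :: real assume e: "e > 0"
    obtain n0 where n0: "real n0 > 4 / e\<^sup>2" using reals_Archimedean2 by blast
    have "norm (s n l - s k l) < e" if "n \<ge> n0" "k \<ge> n0" for n k
    proof -
      have sm: "2 / real (Suc i) < e\<^sup>2 / 2" if "i \<ge> n0" for i
      proof -
        have "real (Suc i) > 4 / e\<^sup>2" using n0 that by linarith
        then show ?thesis using e by (simp add: field_simps)
      qed
      have "(s n l - s k l)\<^sup>2 \<le> (\<Sum>l\<in>L. (s n l - s k l)\<^sup>2)" using L l by (intro member_le_sum) auto
      also have "\<dots> < e\<^sup>2" using par[of n k] sm[OF that(1)] sm[OF that(2)] by linarith
      finally have "\<bar>s n l - s k l\<bar>\<^sup>2 < e\<^sup>2" by simp
      then have "\<bar>s n l - s k l\<bar> < e" by (rule power2_less_imp_less) (use e in simp)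
      then show ?thesis by simp
    qed
    then show "\<exists>M. \<forall>m\<ge>M. \<forall>n\<ge>M. norm (s m l - s n l) < e" by blast
  qed
  then have "\<forall>l. \<exists>q. l \<in> L \<longrightarrow> (\<lambda>n. s n l) \<longlonglongrightarrow> q" by (meson Cauchy_convergent convergent_def)
  then obtain q where q: "\<And>l. l \<in> L \<Longrightarrow> (\<lambda>n. s n l) \<longlonglongrightarrow> q l" by metis
  define c where "c l = q l - p l" for l
  have Nq: "N q = \<rho>"
  proof (rule LIMSEQ_unique)
    show "(\<lambda>n. N (s n)) \<longlonglongrightarrow> N q" unfolding N_def by (intro tendsto_sum tendsto_power tendsto_diff tendsto_const q)
    show "(\<lambda>n. N (s n)) \<longlonglongrightarrow> \<rho>"
    proof (rule tendsto_sandwich[OF _ _ tendsto_const])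
      have "(\<lambda>n. \<rho> + 1 / real (Suc n)) \<longlonglongrightarrow> \<rho> + 0"
        using LIMSEQ_inverse_real_of_nat by (intro tendsto_intros) (simp add: inverse_eq_divide)
      then show "(\<lambda>n. \<rho> + 1 / real (Suc n)) \<longlonglongrightarrow> \<rho>" by simp
    qed (use s \<rho>le in \<open>auto intro!: always_eventually less_imp_le\<close>)
  qed
  have \<rho>c: "\<rho> = (\<Sum>l\<in>L. (c l)\<^sup>2)" unfolding Nq[symmetric] N_def c_def ..
  \<comment> \<open>First variation at \<open>q\<close> in the direction of \<open>s'\<close>: the
    hyperplane with normal \<open>c = q - p\<close> separates \<open>p\<close> from \<open>S\<close>
    with gap \<open>\<rho>\<close>, the squared distance.\<close>
  have var: "(\<Sum>l\<in>L. c l * p l) + \<rho> \<le> (\<Sum>l\<in>L. c l * s' l)" if s': "s' \<in> S" for s'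
  proof -
    define d where "d l = s' l - q l" for l
    have ineq: "- (t * (\<Sum>l\<in>L. (d l)\<^sup>2)) \<le> 2 * (\<Sum>l\<in>L. c l * d l)" if t: "0 < t" "t \<le> 1" for t
    proof -
      have "(\<lambda>n. N (\<lambda>l. (1 - t) * s n l + t * s' l)) \<longlonglongrightarrow> N (\<lambda>l. (1 - t) * q l + t * s' l)"
        unfolding N_def by (intro tendsto_sum tendsto_power tendsto_diff tendsto_add tendsto_mult tendsto_const q)
      then have "\<rho> \<le> N (\<lambda>l. (1 - t) * q l + t * s' l)"
        by (rule LIMSEQ_le_const) (use mid[OF s(1) s'] t in auto)
      also have "N (\<lambda>l. (1 - t) * q l + t * s' l) = \<rho> + t * (2 * (\<Sum>l\<in>L. c l * d l) + t * (\<Sum>l\<in>L. (d l)\<^sup>2))"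
        unfolding \<rho>c N_def sum_distrib_left sum.distrib[symmetric]
        by (intro sum.cong refl) (simp add: c_def d_def power2_eq_square algebra_simps)
      finally have "0 \<le> t * (2 * (\<Sum>l\<in>L. c l * d l) + t * (\<Sum>l\<in>L. (d l)\<^sup>2))" by simp
      then have "0 \<le> 2 * (\<Sum>l\<in>L. c l * d l) + t * (\<Sum>l\<in>L. (d l)\<^sup>2)" using t by (simp add: zero_le_mult_iff)
      then show ?thesis by simp
    qed
    have "(\<lambda>n. - (1 / real (Suc n) * (\<Sum>l\<in>L. (d l)\<^sup>2))) \<longlonglongrightarrow> - (0 * (\<Sum>l\<in>L. (d l)\<^sup>2))"
      using LIMSEQ_inverse_real_of_nat by (intro tendsto_intros) (simp add: inverse_eq_divide)
    then have "- (0 * (\<Sum>l\<in>L. (d l)\<^sup>2)) \<le> 2 * (\<Sum>l\<in>L. c l * d l)"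
      by (rule LIMSEQ_le_const2) (intro exI[of _ 0] allI impI ineq; simp)
    then have "0 \<le> (\<Sum>l\<in>L. c l * d l)" by simp
    also have "\<dots> = (\<Sum>l\<in>L. c l * s' l) - (\<Sum>l\<in>L. c l * p l) - \<rho>"
      unfolding \<rho>c sum_subtractf[symmetric] by (intro sum.cong refl) (simp add: c_def d_def power2_eq_square algebra_simps)
    finally show ?thesis by simp
  qed
  have "\<rho> \<le> \<epsilon> * (\<Sum>l\<in>L. \<bar>c l\<bar>)"
  proof (rule field_le_epsilon)
    fix e :: real assume "e > 0"
    then obtain s' where s': "s' \<in> S" "(\<Sum>l\<in>L. c l * s' l) \<le> (\<Sum>l\<in>L. c l * p l) + \<epsilon> * (\<Sum>l\<in>L. \<bar>c l\<bar>) + e" using low by blast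
    show "\<rho> \<le> \<epsilon> * (\<Sum>l\<in>L. \<bar>c l\<bar>) + e" using var[OF s'(1)] s'(2) by linarith
  qed
  \<comment> \<open>Each entry of the normal is at most the distance \<open>sqrt \<rho>\<close>.
    Dividing the resulting inequality by \<open>sqrt \<rho>\<close> bounds the distance by
    \<open>\<epsilon>\<close> times the number of coordinates.\<close>
  also have "\<dots> \<le> \<epsilon> * (\<Sum>l\<in>L. sqrt \<rho>)"
  proof (intro mult_left_mono \<epsilon> sum_mono)
    fix l assume l: "l \<in> L"
    have "(c l)\<^sup>2 \<le> \<rho>" unfolding \<rho>c using L l by (intro member_le_sum) auto
    then show "\<bar>c l\<bar> \<le> sqrt \<rho>" by (metis real_sqrt_abs real_sqrt_le_iff)
  qed
  finally have "\<rho> \<le> \<epsilon> * card L * sqrt \<rho>" by simp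
  then have le: "sqrt \<rho> * sqrt \<rho> \<le> \<epsilon> * card L * sqrt \<rho>" using \<rho>0 by simp
  have sq: "sqrt \<rho> \<le> \<epsilon> * card L"
  proof (cases "\<rho> = 0")
    case False
    then have "sqrt \<rho> > 0" using \<rho>0 by simp
    then show ?thesis using mult_right_le_imp_le[OF le] by blast
  qed (use \<epsilon> in simp)
  have "\<rho> = (sqrt \<rho>)\<^sup>2" using \<rho>0 by simp
  also have "\<dots> < (sqrt \<rho> + \<eta>)\<^sup>2" using \<eta> \<rho>0 by (intro power_strict_mono) auto
  finally have "(sqrt \<rho> + \<eta>)\<^sup>2 - \<rho> > 0" by simp
  then obtain r where r: "r \<in> S" "N r < \<rho> + ((sqrt \<rho> + \<eta>)\<^sup>2 - \<rho>)" using \<rho>ap by blast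
  show ?thesis
  proof (intro bexI[OF _ r(1)] ballI)
    fix l assume l: "l \<in> L"
    have "(r l - p l)\<^sup>2 \<le> N r" unfolding N_def using L l by (intro member_le_sum) auto
    also have "\<dots> \<le> (sqrt \<rho> + \<eta>)\<^sup>2" using r(2) by simp
    finally have "\<bar>r l - p l\<bar>\<^sup>2 \<le> (sqrt \<rho> + \<eta>)\<^sup>2" by simp
    then have "\<bar>r l - p l\<bar> \<le> sqrt \<rho> + \<eta>" by (rule power2_le_imp_le) (use \<rho>0 \<eta> in auto)
    then show "\<bar>r l - p l\<bar> \<le> \<epsilon> * card L + \<eta>" using sq by linarith
  qed
qed

section \<open>A countable family of test functions\<close>

text \<open>These rational minima of cones approximate the inf-convolutions of a given function.\<close>

fun cones :: "(nat \<Rightarrow> 'e::metric_space) \<Rightarrow> nat \<Rightarrow> nat \<Rightarrow> (rat \<times> nat) list \<Rightarrow> 'e \<Rightarrow> real" where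
  "cones d b k [] y = real b"
| "cones d b k (q # qs) y = min (real_of_rat (fst q) + real k * dist y (d (snd q))) (cones d b k qs y)"

text \<open>The code consists of a bound, a slope and a list of apexes, each given by a rational
  height and the index of its centre. Codes form a countable type, so \<open>from_nat\<close>
  enumerates them; clipping at minus the bound supplies the lower half of the sup bound.\<close>

definition testf :: "(nat \<Rightarrow> 'e::metric_space) \<Rightarrow> nat \<times> nat \<times> (rat \<times> nat) list \<Rightarrow> 'e \<Rightarrow> real" where
  "testf d c y = max (- real (fst c)) (cones d (fst c) (fst (snd c)) (snd (snd c)) y)"

lemma abs_min_max_diff_le:
  fixes a b a' b' L :: real
  assumes "\<bar>a - a'\<bar> \<le> L" "\<bar>b - b'\<bar> \<le> L"
  shows "\<bar>min a b - min a' b'\<bar> \<le> L" "\<bar>max a b - max a' b'\<bar> \<le> L"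
  using assms by (smt (verit))+

lemma cones_lipschitz: "\<bar>cones d b k qs y - cones d b k qs z\<bar> \<le> real k * dist y z"
proof (induction qs)
  case (Cons q qs)
  have "\<bar>dist y (d (snd q)) - dist z (d (snd q))\<bar> \<le> dist y z" by (metis abs_le_iff dist_commute dist_triangle2 abs_dist_diff_le)
  then have "real k * \<bar>dist y (d (snd q)) - dist z (d (snd q))\<bar> \<le> real k * dist y z" by (intro mult_left_mono) auto
  then have "\<bar>real k * dist y (d (snd q)) - real k * dist z (d (snd q))\<bar> \<le> real k * dist y z"
    by (simp add: right_diff_distrib[symmetric] abs_mult)
  then have "\<bar>(real_of_rat (fst q) + real k * dist y (d (snd q))) - (real_of_rat (fst q) + real k * dist z (d (snd q)))\<bar> \<le> real k * dist y z"
    by simp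
  then show ?case unfolding cones.simps using Cons.IH by (rule abs_min_max_diff_le)
qed simp

lemma cones_le: "cones d b k qs y \<le> real b"
  by (induction qs) auto

lemma cones_ge:
  assumes "m \<le> real b" "\<And>q. q \<in> set qs \<Longrightarrow> m \<le> real_of_rat (fst q) + real k * dist y (d (snd q))"
  shows "m \<le> cones d b k qs y"
  using assms by (induction qs) auto

lemma cones_le_member: "q \<in> set qs \<Longrightarrow> cones d b k qs y \<le> real_of_rat (fst q) + real k * dist y (d (snd q))"
  by (induction qs) auto

lemma testf_lipschitz: "\<bar>testf d c y - testf d c z\<bar> \<le> real (fst (snd c)) * dist y z"
  using cones_lipschitz[of d "fst c" "fst (snd c)" "snd (snd c)" y z]
  unfolding testf_def by (intro abs_min_max_diff_le(2)) auto

lemma testf_bounded: "\<bar>testf d c y\<bar> \<le> real (fst c)"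
  using cones_le[of d "fst c" "fst (snd c)" "snd (snd c)" y] by (auto simp: testf_def)

text \<open>An inf-convolution over finitely many centres. A cone with a nearby apex pushes the
  minimum down to at most \<open>f y + 3 * \<epsilon>\<close>. No cone falls below
  \<open>f y - \<epsilon>\<close>: near apexes by uniform continuity, far ones by steepness.\<close>

lemma testf_dense:
  fixes f :: "'e::euclidean_space \<Rightarrow> real"
  assumes d: "closure (range d) = UNIV" and f: "continuous_on UNIV f" and e: "e > 0"
  shows "\<exists>c. \<forall>y\<in>cball 0 R. \<bar>f y - testf d c y\<bar> \<le> e"
proof -
  define \<epsilon> where "\<epsilon> = e / 4"
  have \<epsilon>: "\<epsilon> > 0" using e by (simp add: \<epsilon>_def)
  \<comment> \<open>The ball is enlarged by 1 because the centres used for points near the boundary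
    may lie slightly outside.\<close>
  define B where "B = cball (0::'e) (R + 1)"
  have cB: "compact B" by (simp add: B_def)
  have cf: "continuous_on B f" using f by (rule continuous_on_subset) simp
  obtain \<delta> where \<delta>: "\<delta> > 0" "\<And>y z. y \<in> B \<Longrightarrow> z \<in> B \<Longrightarrow> dist z y < \<delta> \<Longrightarrow> \<bar>f z - f y\<bar> < \<epsilon>"
    using compact_uniformly_continuous[OF cf cB] \<epsilon> unfolding uniformly_continuous_on_def dist_real_def by metis
  have "bounded (f ` B)" by (intro compact_imp_bounded compact_continuous_image cf cB)
  then obtain M where M: "\<And>y. y \<in> B \<Longrightarrow> \<bar>f y\<bar> \<le> M" unfolding bounded_iff by force
  obtain b :: nat where b: "real b \<ge> \<bar>M\<bar> + \<epsilon>" using real_arch_simple by blast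
  \<comment> \<open>With this slope a cone has risen by more than the oscillation of
    \<open>f\<close> at distance \<open>\<delta>\<close> from its apex.\<close>
  obtain k :: nat where k: "real k \<ge> (2 * \<bar>M\<bar> + \<epsilon>) / \<delta>" using real_arch_simple by blast
  have k\<delta>: "real k * \<delta> \<ge> 2 * \<bar>M\<bar> + \<epsilon>" using k \<delta>(1) by (simp add: field_simps)
  \<comment> \<open>The mesh of the centres: small against \<open>\<delta>\<close> for continuity,
    at most 1 to stay in \<open>B\<close>, and small against the slope so that a cone rises by at
    most \<open>\<epsilon>\<close> over one mesh width.\<close>
  define \<gamma> where "\<gamma> = min (min \<delta> 1) (\<epsilon> / (real k + 1))"
  have \<gamma>: "\<gamma> > 0" "\<gamma> \<le> \<delta>" "\<gamma> \<le> 1" using \<delta>(1) \<epsilon> by (auto simp: \<gamma>_def)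
  have k\<gamma>: "real k * \<gamma> \<le> \<epsilon>"
  proof -
    have "real k * \<gamma> \<le> real k * (\<epsilon> / (real k + 1))" by (intro mult_left_mono) (auto simp: \<gamma>_def)
    also have "\<dots> \<le> \<epsilon>" using \<epsilon> by (simp add: field_simps)
    finally show ?thesis .
  qed
  have "cball 0 R \<subseteq> (\<Union>i. ball (d i) \<gamma>)"
  proof
    fix y :: 'e
    have "y \<in> closure (range d)" using d by simp
    then obtain i where "dist (d i) y < \<gamma>" using \<gamma>(1) unfolding closure_approachable by auto
    then show "y \<in> (\<Union>i. ball (d i) \<gamma>)" by auto
  qed
  then obtain T where T: "finite T" "cball 0 R \<subseteq> (\<Union>i\<in>T. ball (d i) \<gamma>)"
    using compactE_image[OF compact_cball, of UNIV "\<lambda>i. ball (d i) \<gamma>" 0 R] by auto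
  define T' where "T' = {i\<in>T. d i \<in> B}"
  have T'B: "\<And>i. i \<in> T' \<Longrightarrow> d i \<in> B" by (simp add: T'_def)
  obtain js where js: "set js = T'" using finite_list[of T'] T(1) by (auto simp: T'_def)
  have "\<exists>r::rat. f (d i) < of_rat r \<and> of_rat r < f (d i) + \<epsilon>" for i
    using \<epsilon> by (intro of_rat_dense) simp
  then obtain r :: "nat \<Rightarrow> rat" where r: "\<And>i. f (d i) < of_rat (r i)" "\<And>i. of_rat (r i) < f (d i) + \<epsilon>" by metis
  define qs where "qs = map (\<lambda>i. (r i, i)) js"
  have qs: "set qs = (\<lambda>i. (r i, i)) ` T'" by (simp add: qs_def js)
  show ?thesis
  proof (intro exI[of _ "(b, k, qs)"] ballI)
    fix y :: 'e assume y: "y \<in> cball 0 R"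
    have yB: "y \<in> B" using y by (simp add: B_def)
    obtain i where i: "i \<in> T" "dist (d i) y < \<gamma>" using T(2) y by auto
    have diB: "d i \<in> B"
      using y i(2) \<gamma>(3) norm_triangle_ineq2[of "d i" y] by (simp add: B_def dist_norm)
    have iT': "i \<in> T'" using i diB by (simp add: T'_def)
    have up: "cones d b k qs y \<le> f y + 3 * \<epsilon>"
    proof -
      have "cones d b k qs y \<le> of_rat (r i) + real k * dist y (d i)"
        using cones_le_member[of "(r i, i)" qs d b k y] iT' qs by auto
      also have "real k * dist y (d i) \<le> \<epsilon>"
        using mult_left_mono[of "dist y (d i)" \<gamma> "real k"] i(2) k\<gamma> by (simp add: dist_commute)
      finally show ?thesis using r(2)[of i] \<delta>(2)[OF yB diB] i(2) \<gamma>(2) by linarith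
    qed
    have lo: "f y - \<epsilon> \<le> cones d b k qs y"
    proof (rule cones_ge)
      show "f y - \<epsilon> \<le> real b" using M[OF yB] b \<epsilon> by linarith
      fix q assume "q \<in> set qs"
      then obtain l where l: "l \<in> T'" "q = (r l, l)" using qs by auto
      have "f y - \<epsilon> \<le> of_rat (r l) + real k * dist y (d l)"
      proof (cases "dist (d l) y < \<delta>")
        case True
        have "0 \<le> real k * dist y (d l)" by simp
        then show ?thesis using \<delta>(2)[OF yB T'B[OF l(1)] True] r(1)[of l] by linarith
      next
        case False
        have "real k * \<delta> \<le> real k * dist y (d l)" using False by (intro mult_left_mono) (auto simp: dist_commute)
        then show ?thesis using k\<delta> r(1)[of l] M[OF yB] M[OF T'B[OF l(1)]] \<epsilon> by linarith
      qed
      then show "f y - \<epsilon> \<le> of_rat (fst q) + real k * dist y (d (snd q))" using l by simp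
    qed
    have "- real b \<le> cones d b k qs y" using lo M[OF yB] b by linarith
    then have "testf d (b, k, qs) y = cones d b k qs y" by (simp add: testf_def)
    then show "\<bar>f y - testf d (b, k, qs) y\<bar> \<le> e" using up lo \<epsilon> unfolding \<epsilon>_def by linarith
  qed
qed

text \<open>Density on balls is enough because the fields and supports to be compared are bounded.
  The Lipschitz property makes the members accessible to gluing and to L^1 comparison, and
  boundedness provides the uniform bounds for weak limits.\<close>

lemma countable_test_family:
  "\<exists>g :: nat \<Rightarrow> 'e::euclidean_space \<Rightarrow> real.
     (\<forall>n. (\<exists>\<Lambda>\<ge>0. \<forall>y z. \<bar>g n y - g n z\<bar> \<le> \<Lambda> * norm (y - z)) \<and> (\<exists>B. \<forall>y. \<bar>g n y\<bar> \<le> B)) \<and>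
     (\<forall>f R e. continuous_on UNIV f \<and> e > 0 \<longrightarrow> (\<exists>n. \<forall>y\<in>cball 0 R. \<bar>f y - g n y\<bar> \<le> e))"
proof -
  obtain D :: "'e set" where D: "countable D" "\<And>X. open X \<Longrightarrow> X \<noteq> {} \<Longrightarrow> \<exists>d\<in>D. d \<in> X"
    using countable_dense_exists by blast
  have "D \<noteq> {}" using D(2)[of UNIV] by auto
  then obtain d :: "nat \<Rightarrow> 'e" where d: "range d = D" using D(1) by (metis range_from_nat_into)
  have "closure D = UNIV"
  proof (rule ccontr)
    assume "closure D \<noteq> UNIV"
    then have "- closure D \<noteq> {}" by auto
    then obtain x where "x \<in> D" "x \<in> - closure D" using D(2)[of "- closure D"] by auto
    then show False using closure_subset[of D] by auto
  qed
  then have cl: "closure (range d) = UNIV" using d by simp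
  show ?thesis
  proof (intro exI[of _ "\<lambda>n. testf d (from_nat n)"] conjI allI impI)
    fix n
    show "\<exists>\<Lambda>\<ge>0. \<forall>y z. \<bar>testf d (from_nat n) y - testf d (from_nat n) z\<bar> \<le> \<Lambda> * norm (y - z)"
      using testf_lipschitz[of d "from_nat n"] by (intro exI[of _ "real (fst (snd (from_nat n :: nat \<times> nat \<times> (rat \<times> nat) list)))"]) (auto simp: dist_norm)
    show "\<exists>B. \<forall>y. \<bar>testf d (from_nat n) y\<bar> \<le> B" using testf_bounded[of d "from_nat n"] by blast
  next
    fix f :: "'e \<Rightarrow> real" and R e :: real assume "continuous_on UNIV f \<and> e > 0"
    then obtain c where "\<forall>y\<in>cball 0 R. \<bar>f y - testf d c y\<bar> \<le> e" using testf_dense[OF cl] by blast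
    then show "\<exists>n. \<forall>y\<in>cball 0 R. \<bar>f y - testf d (from_nat n) y\<bar> \<le> e" by (intro exI[of _ "to_nat c"]) simp
  qed
qed

text \<open>\<open>T x f\<close> abstracts from the integral of \<open>f\<close> with respect to the measure at the point \<open>x\<close>.\<close>

locale jensen_family =
  fixes A :: "'n::finite \<Rightarrow> real^'d::finite^'l::finite" and T :: "real^'n \<Rightarrow> (real^'d \<Rightarrow> real) \<Rightarrow> real"
    and u :: "real^'n \<Rightarrow> real^'d" and M :: real
  assumes cr: "constant_rank A"
    and T_mono: "AE x in TN. \<forall>f g. continuous_on UNIV f \<and> continuous_on UNIV g \<and> (\<forall>y. f y \<le> g y) \<longrightarrow> T x f \<le> T x g"
    and T_lin: "\<And>F c. finite F \<Longrightarrow> (\<And>f. f \<in> F \<Longrightarrow> continuous_on UNIV f) \<Longrightarrow>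
        AE x in TN. T x (\<lambda>y. \<Sum>f\<in>F. c f * f y) = (\<Sum>f\<in>F. c f * T x f)"
    and T_jensen: "AE x in TN. \<forall>f. A_quasiconvex A f \<longrightarrow> f (u x) \<le> T x f"
    and T_int: "\<And>f. continuous_on UNIV f \<Longrightarrow> integrable TN (\<lambda>x. T x f)"
    and u_meas: "u \<in> borel_measurable TN" and u_bd: "AE x in TN. norm (u x) \<le> M" and u_ker: "kerA A u"
begin

text \<open>By separation it suffices to treat one linear combination \<open>H\<close> of the test
  functions. If all averages of \<open>H\<close> at \<open>a\<close> exceeded the average of
  \<open>T\<close> over \<open>E\<close> by too much, then so would the envelope of \<open>H\<close>
  near \<open>a\<close>, contrary to Jensen's inequality for this quasiconvex envelope.\<close>

lemma piece_average:
  assumes F: "finite F" "\<And>f y z. f \<in> F \<Longrightarrow> \<bar>f y - f z\<bar> \<le> \<Lambda> * norm (y - z)" and \<Lambda>: "\<Lambda> \<ge> 0"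
    and E: "E \<in> sets TN" "measure TN E > 0" and \<epsilon>: "\<epsilon> \<ge> 0"
    and osc: "AE x in TN. x \<in> E \<longrightarrow> norm (u x - a) \<le> \<epsilon>" and \<eta>: "\<eta> > 0"
  shows "\<exists>\<phi>\<in>Phi A. \<forall>f\<in>F. \<bar>integral\<^sup>L TN (\<lambda>y. f (a + \<phi> y)) - integral\<^sup>L TN (\<lambda>x. indicator E x * T x f) / measure TN E\<bar>
      \<le> \<Lambda> * \<epsilon> * card F + \<eta>"
proof -
  define p where "p f = integral\<^sup>L TN (\<lambda>x. indicator E x * T x f) / measure TN E" for f
  define S where "S = (\<lambda>\<phi> (f :: real^'d \<Rightarrow> real). integral\<^sup>L TN (\<lambda>y. f (a + \<phi> y))) ` Phi A"
  have cF: "continuous_on UNIV f" if "f \<in> F" for f by (rule lipschitz_continuous[OF F(2)[OF that]])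
  have "\<exists>s\<in>S. \<forall>f\<in>F. \<bar>s f - p f\<bar> \<le> \<Lambda> * \<epsilon> * card F + \<eta>"
  proof (rule almost_convex_approx[OF F(1) _ _ _ _ \<eta>])
    show "S \<noteq> {}" using zero_in_Phi by (auto simp: S_def)
    show "0 \<le> \<Lambda> * \<epsilon>" using \<Lambda> \<epsilon> by simp
  next
    fix s s' :: "(real^'d \<Rightarrow> real) \<Rightarrow> real" and t e :: real
    assume s: "s \<in> S" "s' \<in> S" and t: "0 \<le> t" "t \<le> 1" and e: "0 < e"
    obtain \<phi> where \<phi>: "\<phi> \<in> Phi A" "s = (\<lambda>f. integral\<^sup>L TN (\<lambda>y. f (a + \<phi> y)))" using s(1) by (auto simp: S_def)
    obtain \<psi> where \<psi>: "\<psi> \<in> Phi A" "s' = (\<lambda>f. integral\<^sup>L TN (\<lambda>y. f (a + \<psi> y)))" using s(2) by (auto simp: S_def)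
    obtain z where z: "z \<in> Phi A" "\<forall>f\<in>F. \<bar>integral\<^sup>L TN (\<lambda>x. f (a + z x)) -
     ((1 - t) * integral\<^sup>L TN (\<lambda>x. f (a + \<phi> x)) + t * integral\<^sup>L TN (\<lambda>x. f (a + \<psi> x)))\<bar> \<le> e"
      using averages_convex[OF cr F \<Lambda> \<phi>(1) \<psi>(1) t e] by auto
    show "\<exists>r\<in>S. \<forall>f\<in>F. \<bar>r f - ((1 - t) * s f + t * s' f)\<bar> \<le> e"
      by (rule bexI[of _ "\<lambda>f. integral\<^sup>L TN (\<lambda>y. f (a + z y))"]) (use z \<phi>(2) \<psi>(2) in \<open>auto simp: S_def\<close>)
  next
    fix c :: "(real^'d \<Rightarrow> real) \<Rightarrow> real" and e :: real assume e: "e > 0"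
    define H where "H y = (\<Sum>f\<in>F. c f * f y)" for y
    define \<Lambda>' where "\<Lambda>' = \<Lambda> * (\<Sum>f\<in>F. \<bar>c f\<bar>)"
    have \<Lambda>': "\<Lambda>' \<ge> 0" using \<Lambda> by (auto simp: \<Lambda>'_def intro!: mult_nonneg_nonneg sum_nonneg)
    have lipH: "\<bar>H y - H z\<bar> \<le> \<Lambda>' * norm (y - z)" for y z
    proof -
      have "\<bar>H y - H z\<bar> \<le> (\<Sum>f\<in>F. \<bar>c f * (f y - f z)\<bar>)"
        unfolding H_def sum_subtractf[symmetric] right_diff_distrib[symmetric] by (rule sum_abs)
      also have "\<dots> \<le> (\<Sum>f\<in>F. \<bar>c f\<bar> * (\<Lambda> * norm (y - z)))"
        unfolding abs_mult by (intro sum_mono mult_left_mono F(2)) auto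
      also have "\<dots> = \<Lambda>' * norm (y - z)" by (simp add: \<Lambda>'_def sum_distrib_left sum_distrib_right mult_ac)
      finally show ?thesis .
    qed
    have cH: "continuous_on UNIV H" by (rule lipschitz_continuous[OF lipH])
    have intH: "integral\<^sup>L TN (\<lambda>y. H (a + \<phi> y)) = (\<Sum>f\<in>F. c f * integral\<^sup>L TN (\<lambda>y. f (a + \<phi> y)))" if \<phi>: "\<phi> \<in> Phi A" for \<phi>
    proof -
      have i: "integrable TN (\<lambda>y. c f * f (a + \<phi> y))" if "f \<in> F" for f
        using integrable_lipschitz_comp[OF F(2)[OF that] Phi_integrable[OF \<phi>]] by simp
      show ?thesis unfolding H_def using Bochner_Integration.integral_sum[of F TN "\<lambda>f y. c f * f (a + \<phi> y)", OF i] by simp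
    qed
    \<comment> \<open>\<open>m\<close> is the right-hand side of the claim. Denying the claim makes
      \<open>m\<close> a lower bound for all averages of \<open>H\<close> at \<open>a\<close>, which
      is exactly what the envelope needs in order to be finite.\<close>
    define m where "m = (\<Sum>f\<in>F. c f * p f) + \<Lambda> * \<epsilon> * (\<Sum>f\<in>F. \<bar>c f\<bar>) + e"
    show "\<exists>s\<in>S. (\<Sum>f\<in>F. c f * s f) \<le> (\<Sum>f\<in>F. c f * p f) + \<Lambda> * \<epsilon> * (\<Sum>f\<in>F. \<bar>c f\<bar>) + e"
    proof (rule ccontr)
      assume neg: "\<not> ?thesis"
      have lower: "m \<le> integral\<^sup>L TN (\<lambda>y. H (a + \<phi> y))" if \<phi>: "\<phi> \<in> Phi A" for \<phi>
      proof -
        have "(\<lambda>f. integral\<^sup>L TN (\<lambda>y. f (a + \<phi> y))) \<in> S" using \<phi> by (auto simp: S_def)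
        from bexI[OF _ this, of "\<lambda>s. (\<Sum>f\<in>F. c f * s f) \<le> m"]
        have "\<not> (\<Sum>f\<in>F. c f * integral\<^sup>L TN (\<lambda>y. f (a + \<phi> y))) \<le> m" using neg unfolding m_def by blast
        then show ?thesis unfolding intH[OF \<phi>] by linarith
      qed
      interpret en: lipschitz_env A H \<Lambda>' m a
        by unfold_locales (use cr lipH \<Lambda>' lower in auto)
      have linH: "AE x in TN. T x H = (\<Sum>f\<in>F. c f * T x f)"
        unfolding H_def by (rule T_lin[OF F(1) cF])
      have "AE x in TN. indicator E x * (m - \<Lambda>' * \<epsilon>) \<le> indicator E x * (\<Sum>f\<in>F. c f * T x f)"
        using linH T_mono T_jensen osc
      proof eventually_elim
        case (elim x)
        show ?case
        proof (cases "x \<in> E")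
          case True
          \<comment> \<open>The chain is: lower bound at \<open>a\<close>, Lipschitz transfer to
            \<open>u x\<close>, Jensen's inequality for the envelope, monotonicity of
            \<open>T x\<close> because the envelope lies below \<open>H\<close>.\<close>
          have "m \<le> env A H a" by (rule en.env_ge)
          also have "\<dots> \<le> env A H (u x) + \<Lambda>' * \<epsilon>"
          proof -
            have "\<Lambda>' * norm (u x - a) \<le> \<Lambda>' * \<epsilon>" using elim(4) True \<Lambda>' by (intro mult_left_mono) auto
            then show ?thesis using en.env_lip[of "u x" a] by linarith
          qed
          also have "env A H (u x) \<le> T x (env A H)" using elim(3) en.env_quasiconvex by blast
          also have "T x (env A H) \<le> T x H"
            using elim(2) cH lipschitz_continuous[OF en.env_lip] en.env_le_self by blast
          finally show ?thesis using True elim(1) by simp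
        qed simp
      qed
      moreover have iT: "integrable TN (\<lambda>x. indicator E x * T x f)" if "f \<in> F" for f
        by (rule integrable_indicator_mult[OF E(1) T_int[OF cF[OF that]]])
      moreover have s_eq: "indicator E x * (\<Sum>f\<in>F. c f * T x f) = (\<Sum>f\<in>F. c f * (indicator E x * T x f))" for x
        by (simp add: sum_distrib_left mult_ac)
      ultimately have "integral\<^sup>L TN (\<lambda>x. indicator E x * (m - \<Lambda>' * \<epsilon>)) \<le> integral\<^sup>L TN (\<lambda>x. \<Sum>f\<in>F. c f * (indicator E x * T x f))"
        by (intro integral_mono_AE integrable_indicator_mult[OF E(1) TN.integrable_const] Bochner_Integration.integrable_sum integrable_mult_right)
           auto
      also have "\<dots> = (\<Sum>f\<in>F. c f * (measure TN E * p f))"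
      proof -
        have "integral\<^sup>L TN (\<lambda>x. \<Sum>f\<in>F. c f * (indicator E x * T x f)) = (\<Sum>f\<in>F. c f * integral\<^sup>L TN (\<lambda>x. indicator E x * T x f))"
          using iT by (subst Bochner_Integration.integral_sum) auto
        then show ?thesis using E(2) by (simp add: p_def)
      qed
      also have "\<dots> = measure TN E * (\<Sum>f\<in>F. c f * p f)" by (simp add: sum_distrib_left mult_ac)
      finally have "measure TN E * (m - \<Lambda>' * \<epsilon>) \<le> measure TN E * (\<Sum>f\<in>F. c f * p f)"
        using integral_indicator_TN[OF E(1)] by simp
      then have "m - \<Lambda>' * \<epsilon> \<le> (\<Sum>f\<in>F. c f * p f)" using E(2) by simp
      then show False using e unfolding m_def \<Lambda>'_def by (simp add: mult_ac)
    qed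
  qed
  then obtain \<phi> where "\<phi> \<in> Phi A" "\<forall>f\<in>F. \<bar>integral\<^sup>L TN (\<lambda>y. f (a + \<phi> y)) - p f\<bar> \<le> \<Lambda> * \<epsilon> * card F + \<eta>"
    by (auto simp: S_def)
  then show ?thesis unfolding p_def by blast
qed

text \<open>On each cell of a fine partition the averages of \<open>T\<close> are realised by
  oscillation around the nearly constant value of \<open>u\<close>, and all cells are glued onto a
  smoothing of \<open>u\<close>. Controlling the sum of the cell errors, with cells of small
  diameter, is what weak convergence requires.\<close>

lemma approximate_family:
  assumes F: "finite F" "\<And>f y z. f \<in> F \<Longrightarrow> \<bar>f y - f z\<bar> \<le> \<Lambda> * norm (y - z)" and \<Lambda>: "\<Lambda> \<ge> 0" and e: "e > 0"
  shows "\<exists>z (n::nat) E (c :: nat \<Rightarrow> real^'n). afree A z \<and> TNpart {..<n} E \<and> (\<forall>i<n. \<forall>x\<in>E i. norm (x - c i) \<le> e) \<and>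
    (\<forall>f\<in>F. (\<Sum>i<n. \<bar>integral\<^sup>L TN (\<lambda>x. indicator (E i) x * f (z x)) - integral\<^sup>L TN (\<lambda>x. indicator (E i) x * T x f)\<bar>) \<le> e)"
proof -
  \<comment> \<open>The denominator makes room for the gluing error \<open>\<delta>\<close>, the
    slow-part error \<open>2 * \<Lambda> * \<delta>\<close> and the cell error
    \<open>\<Lambda> * \<delta> * card F + \<delta>\<close>.\<close>
  define \<delta> where "\<delta> = e / (3 + 2 * \<Lambda> + \<Lambda> * card F)"
  have den: "3 + 2 * \<Lambda> + \<Lambda> * card F \<ge> 1" using \<Lambda> by simp
  have \<delta>: "\<delta> > 0" using e den by (simp add: \<delta>_def)
  have \<delta>e: "\<delta> \<le> e" using e den unfolding \<delta>_def by (simp add: divide_le_eq mult_le_cancel_left1)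
  have \<delta>_eq: "2 * \<delta> + 2 * \<Lambda> * \<delta> + \<Lambda> * \<delta> * card F \<le> e"
  proof -
    have "2 * \<delta> + 2 * \<Lambda> * \<delta> + \<Lambda> * \<delta> * card F = (3 + 2 * \<Lambda> + \<Lambda> * card F) * \<delta> - \<delta>" by (simp add: algebra_simps)
    also have "\<dots> = e - \<delta>" using den by (simp add: \<delta>_def)
    finally show ?thesis using \<delta> by simp
  qed
  \<comment> \<open>A representative of \<open>u\<close> that is bounded at every point, as the
    partition lemma demands.\<close>
  define u' where "u' x = (if norm (u x) \<le> M then u x else 0)" for x
  have u'_meas: "u' \<in> borel_measurable TN" unfolding u'_def using u_meas by measurable
  have u'_eq: "AE x in TN. u' x = u x" using u_bd by eventually_elim (simp add: u'_def)
  have u'_bd: "norm (u' x) \<le> \<bar>M\<bar>" for x by (auto simp: u'_def)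
  have u_int: "integrable TN u" by (rule integrable_TN_bounded[OF u_meas u_bd])
  have u'_int: "integrable TN u'" by (rule integrable_TN_bounded[OF u'_meas, of "\<bar>M\<bar>"]) (simp add: u'_bd)
  have id_meas: "(\<lambda>x. x) \<in> borel_measurable (TN :: (real^'n) measure)" by (rule continuous_borel_measurable_TN) (rule continuous_on_id)
  have bcb: "bounded (cbox 0 (1::real^'n))" by simp
  then obtain R where R: "\<forall>x\<in>cbox 0 (1::real^'n). norm x \<le> R" unfolding bounded_iff by (elim exE)
  \<comment> \<open>The partition is fine for \<open>u'\<close> and for the position at once: the
    first is used with Jensen's inequality, the second bounds the diameters of the cells.\<close>
  obtain n :: nat and E d where P: "TNpart {..<n} E" and osc': "\<forall>i<n. \<forall>x\<in>E i. norm ((u' x, x) - d i) \<le> \<delta>"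
  proof -
    have "(\<lambda>x. (u' x, x)) \<in> borel_measurable TN" using u'_meas id_meas by (rule borel_measurable_Pair)
    moreover have "norm (u' x, x) \<le> \<bar>M\<bar> + R" if "x \<in> cbox 0 1" for x
      using norm_Pair_le[of "u' x" x] u'_bd[of x] R that by fastforce
    ultimately have "\<exists>(n::nat) E c. TNpart {..<n} E \<and> (\<forall>i<n. \<forall>x\<in>E i. norm ((u' x, x) - c i) \<le> \<delta>)"
      by (rule TNpart_small_oscillation[OF _ _ \<delta>])
    then show ?thesis using that by (elim exE conjE)
  qed
  define a where "a i = fst (d i)" for i
  define c where "c i = snd (d i)" for i
  have osc: "norm (u' x - a i) \<le> \<delta>" "norm (x - c i) \<le> \<delta>" if "i < n" "x \<in> E i" for i x
  proof -
    have "norm ((u' x, x) - d i) \<le> \<delta>" using osc' that by blast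
    moreover have "(u' x, x) - d i = (u' x - a i, x - c i)" by (simp add: a_def c_def prod_eq_iff)
    ultimately have "norm (u' x - a i, x - c i) \<le> \<delta>" by simp
    then show "norm (u' x - a i) \<le> \<delta>" "norm (x - c i) \<le> \<delta>"
      using norm_fst_le[of "u' x - a i" "x - c i"] norm_snd_le[of "x - c i" "u' x - a i"] by linarith+
  qed
  have Es: "E i \<in> sets TN" if "i < n" for i using P that by (simp add: TNpart_def)
  have oscu: "AE x in TN. x \<in> E i \<longrightarrow> norm (u x - a i) \<le> \<delta>" if "i < n" for i
    using u'_eq
  proof eventually_elim
    case (elim x)
    show ?case using osc(1)[OF that, of x] by (simp add: elim)
  qed
  have "\<exists>\<phi>. \<phi> \<in> Phi A \<and> (i < n \<and> measure TN (E i) > 0 \<longrightarrow> (\<forall>f\<in>F. \<bar>integral\<^sup>L TN (\<lambda>y. f (a i + \<phi> y)) - integral\<^sup>L TN (\<lambda>x. indicator (E i) x * T x f) / measure TN (E i)\<bar>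
      \<le> \<Lambda> * \<delta> * card F + \<delta>))" for i
  proof (cases "i < n \<and> measure TN (E i) > 0")
    case True
    have "\<exists>\<phi>\<in>Phi A. (\<forall>f\<in>F. \<bar>integral\<^sup>L TN (\<lambda>y. f (a i + \<phi> y)) - integral\<^sup>L TN (\<lambda>x. indicator (E i) x * T x f) / measure TN (E i)\<bar>
      \<le> \<Lambda> * \<delta> * card F + \<delta>)"
      by (rule piece_average[OF F \<Lambda> Es[OF True[THEN conjunct1]] True[THEN conjunct2] less_imp_le[OF \<delta>] oscu[OF True[THEN conjunct1]] \<delta>])
    then obtain \<phi> where "\<phi> \<in> Phi A" "(\<forall>f\<in>F. \<bar>integral\<^sup>L TN (\<lambda>y. f (a i + \<phi> y)) - integral\<^sup>L TN (\<lambda>x. indicator (E i) x * T x f) / measure TN (E i)\<bar>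
      \<le> \<Lambda> * \<delta> * card F + \<delta>)"
      by (elim bexE)
    then show ?thesis by (intro exI[of _ \<phi>] conjI impI)
  next
    case False
    then show ?thesis by (intro exI[of _ "\<lambda>_. 0"] conjI impI zero_in_Phi) (erule notE)
  qed
  then have "\<forall>i. \<exists>\<phi>. \<phi> \<in> Phi A \<and> (i < n \<and> measure TN (E i) > 0 \<longrightarrow> (\<forall>f\<in>F. \<bar>integral\<^sup>L TN (\<lambda>y. f (a i + \<phi> y)) - integral\<^sup>L TN (\<lambda>x. indicator (E i) x * T x f) / measure TN (E i)\<bar>
      \<le> \<Lambda> * \<delta> * card F + \<delta>))"
    by (intro allI)
  from choice[OF this] obtain \<phi> where \<phi>': "\<forall>i. \<phi> i \<in> Phi A \<and> (i < n \<and> measure TN (E i) > 0 \<longrightarrow> (\<forall>f\<in>F. \<bar>integral\<^sup>L TN (\<lambda>y. f (a i + \<phi> i y)) - integral\<^sup>L TN (\<lambda>x. indicator (E i) x * T x f) / measure TN (E i)\<bar>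
      \<le> \<Lambda> * \<delta> * card F + \<delta>))"
    by (elim exE)
  have \<phi>: "\<phi> i \<in> Phi A" for i using \<phi>' by simp
  have \<phi>2: "\<bar>integral\<^sup>L TN (\<lambda>y. f (a i + \<phi> i y)) - integral\<^sup>L TN (\<lambda>x. indicator (E i) x * T x f) / measure TN (E i)\<bar> \<le> \<Lambda> * \<delta> * card F + \<delta>"
    if "i < n" "measure TN (E i) > 0" "f \<in> F" for i f
    using \<phi>'[rule_format, of i] that by simp
  have "\<forall>\<^sub>F m in sequentially. integral\<^sup>L TN (\<lambda>x. norm (smth m u x - u x)) < \<delta>"
    using smth_L1[OF u_meas u_bd] \<delta> by (rule order_tendstoD)
  then obtain m where m: "integral\<^sup>L TN (\<lambda>x. norm (smth m u x - u x)) < \<delta>" by (auto simp: eventually_sequentially)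
  \<comment> \<open>The slow part is a smoothing of \<open>u\<close>, hence A-free and close to
    \<open>u\<close> in L^1.\<close>
  define \<phi>0 where "\<phi>0 = smth m u"
  have a0: "afree A \<phi>0" unfolding \<phi>0_def by (rule afree_smth[OF u_ker u_int])
  have i0: "integrable TN \<phi>0" by (rule trig_integrable[OF trigV_imp_trig[OF a0]])
  have n0: "n > 0"
  proof (rule ccontr)
    assume "\<not> n > 0"
    then have "cbox 0 (1::real^'n) = {}" using P by (simp add: TNpart_def)
    then show False by (simp add: interval_eq_empty_cart)
  qed
  have "\<exists>z. afree A z \<and> integral\<^sup>L TN z = integral\<^sup>L TN \<phi>0 \<and>
     (\<forall>f\<in>F. \<forall>i\<in>{..<n}. \<bar>integral\<^sup>L TN (\<lambda>x. indicator (E i) x * f (z x)) - measure TN (E i) * integral\<^sup>L TN (\<lambda>x. f (a i + \<phi> i x))\<bar>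
        \<le> \<delta> / n + \<Lambda> * integral\<^sup>L TN (\<lambda>x. indicator (E i) x * norm (\<phi>0 x - a i)))"
    by (rule gluing_functional[OF cr P _ _ a0 F \<Lambda>]) (use \<phi> n0 \<delta> in \<open>auto simp: Phi_def\<close>)
  then obtain z where z: "afree A z" "\<forall>f\<in>F. \<forall>i\<in>{..<n}. \<bar>integral\<^sup>L TN (\<lambda>x. indicator (E i) x * f (z x)) - measure TN (E i) * integral\<^sup>L TN (\<lambda>x. f (a i + \<phi> i x))\<bar>
        \<le> \<delta> / n + \<Lambda> * integral\<^sup>L TN (\<lambda>x. indicator (E i) x * norm (\<phi>0 x - a i))"
    by (elim exE conjE)
  have mE: "(\<Sum>i<n. measure TN (E i)) = 1"
  proof -
    have "(\<Sum>i<n. integral\<^sup>L TN (\<lambda>y. indicator (E i) y * (1::real))) = 1" using TNpart_integral[OF P, of "\<lambda>_. 1"] by simp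
    then show ?thesis using integral_indicator_TN[OF Es] by simp
  qed
  \<comment> \<open>The L^1 distance of the slow part from the step function: one
    \<open>\<delta>\<close> for smoothing, one for the oscillation on the cells.\<close>
  have base: "(\<Sum>i<n. integral\<^sup>L TN (\<lambda>x. indicator (E i) x * norm (\<phi>0 x - a i))) \<le> 2 * \<delta>"
  proof -
    have iu: "integrable TN (\<lambda>x. norm (\<phi>0 x - u' x))" using i0 u'_int by simp
    have "(\<Sum>i<n. integral\<^sup>L TN (\<lambda>x. indicator (E i) x * norm (\<phi>0 x - a i)))
       \<le> (\<Sum>i<n. integral\<^sup>L TN (\<lambda>x. indicator (E i) x * norm (\<phi>0 x - u' x)) + measure TN (E i) * \<delta>)"
    proof (rule sum_mono)
      fix i assume "i \<in> {..<n}"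
      then have i: "i < n" by simp
      have iE: "integrable TN (\<lambda>x. indicator (E i) x * \<delta>)" by (rule integrable_indicator_mult[OF Es[OF i] TN.integrable_const])
      have "integral\<^sup>L TN (\<lambda>x. indicator (E i) x * norm (\<phi>0 x - a i)) \<le> integral\<^sup>L TN (\<lambda>x. indicator (E i) x * norm (\<phi>0 x - u' x) + indicator (E i) x * \<delta>)"
      proof (rule integral_mono)
        show "integrable TN (\<lambda>x. indicator (E i) x * norm (\<phi>0 x - a i))"
          by (intro integrable_indicator_mult[OF Es[OF i]] integrable_norm Bochner_Integration.integrable_diff i0 TN.integrable_const)
        show "integrable TN (\<lambda>x. indicator (E i) x * norm (\<phi>0 x - u' x) + indicator (E i) x * \<delta>)"
          by (intro Bochner_Integration.integrable_add integrable_indicator_mult[OF Es[OF i] iu] iE)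
        show "indicator (E i) x * norm (\<phi>0 x - a i) \<le> indicator (E i) x * norm (\<phi>0 x - u' x) + indicator (E i) x * \<delta>" for x
        proof (cases "x \<in> E i")
          case True
          have "norm (\<phi>0 x - a i) \<le> norm (\<phi>0 x - u' x) + norm (u' x - a i)" by norm
          then show ?thesis using osc(1)[OF i True] True by simp
        qed simp
      qed
      also have "\<dots> = integral\<^sup>L TN (\<lambda>x. indicator (E i) x * norm (\<phi>0 x - u' x)) + integral\<^sup>L TN (\<lambda>x. indicator (E i) x * \<delta>)"
        by (rule Bochner_Integration.integral_add[OF integrable_indicator_mult[OF Es[OF i] iu] iE])
      also have "integral\<^sup>L TN (\<lambda>x. indicator (E i) x * \<delta>) = measure TN (E i) * \<delta>" using integral_indicator_TN[OF Es[OF i]] by simp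
      finally show "integral\<^sup>L TN (\<lambda>x. indicator (E i) x * norm (\<phi>0 x - a i)) \<le> integral\<^sup>L TN (\<lambda>x. indicator (E i) x * norm (\<phi>0 x - u' x)) + measure TN (E i) * \<delta>" .
    qed
    also have "\<dots> = integral\<^sup>L TN (\<lambda>x. norm (\<phi>0 x - u' x)) + \<delta>"
      unfolding sum.distrib TNpart_integral[OF P iu] sum_distrib_right[symmetric] mE by simp
    also have "integral\<^sup>L TN (\<lambda>x. norm (\<phi>0 x - u' x)) = integral\<^sup>L TN (\<lambda>x. norm (smth m u x - u x))"
      using u'_eq by (intro integral_cong_AE) (use iu i0 u_int in \<open>auto simp: \<phi>0_def\<close>)
    finally show ?thesis using m by linarith
  qed
  have fin: "(\<Sum>i<n. \<bar>integral\<^sup>L TN (\<lambda>x. indicator (E i) x * f (z x)) - integral\<^sup>L TN (\<lambda>x. indicator (E i) x * T x f)\<bar>) \<le> e" if f: "f \<in> F" for f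
  proof -
    have "(\<Sum>i<n. \<bar>integral\<^sup>L TN (\<lambda>x. indicator (E i) x * f (z x)) - integral\<^sup>L TN (\<lambda>x. indicator (E i) x * T x f)\<bar>)
       \<le> (\<Sum>i<n. \<delta> / n + \<Lambda> * integral\<^sup>L TN (\<lambda>x. indicator (E i) x * norm (\<phi>0 x - a i)) + measure TN (E i) * (\<Lambda> * \<delta> * card F + \<delta>))"
    proof (rule sum_mono)
      fix i assume "i \<in> {..<n}"
      then have i: "i < n" by simp
      let ?p = "integral\<^sup>L TN (\<lambda>x. indicator (E i) x * T x f)"
      have "\<bar>measure TN (E i) * integral\<^sup>L TN (\<lambda>x. f (a i + \<phi> i x)) - ?p\<bar> \<le> measure TN (E i) * (\<Lambda> * \<delta> * card F + \<delta>)"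
      proof (cases "measure TN (E i) > 0")
        case True
        then have "measure TN (E i) * integral\<^sup>L TN (\<lambda>x. f (a i + \<phi> i x)) - ?p = measure TN (E i) * (integral\<^sup>L TN (\<lambda>x. f (a i + \<phi> i x)) - ?p / measure TN (E i))"
          by (simp add: field_simps)
        then show ?thesis using \<phi>2[OF i True f] True by (simp add: abs_mult)
      next
        \<comment> \<open>On a null cell the quotient defining the average is meaningless, but both
          quantities to be compared are zero.\<close>
        case False
        then have m0: "measure TN (E i) = 0" using measure_nonneg[of TN "E i"] by linarith
        then have "emeasure TN (E i) = 0" by (simp add: TN.emeasure_eq_measure)
        then have "AE x in TN. x \<notin> E i" using Es[OF i] by (intro AE_not_in) auto
        then have "AE x in TN. indicator (E i) x * T x f = 0" by eventually_elim simp
        then have "?p = 0" by (rule integral_eq_zero_AE)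
        then show ?thesis using m0 by simp
      qed
      moreover have "\<bar>integral\<^sup>L TN (\<lambda>x. indicator (E i) x * f (z x)) - measure TN (E i) * integral\<^sup>L TN (\<lambda>x. f (a i + \<phi> i x))\<bar>
        \<le> \<delta> / n + \<Lambda> * integral\<^sup>L TN (\<lambda>x. indicator (E i) x * norm (\<phi>0 x - a i))" using z(2)[rule_format, OF f, of i] i by simp
      ultimately show "\<bar>integral\<^sup>L TN (\<lambda>x. indicator (E i) x * f (z x)) - ?p\<bar>
        \<le> \<delta> / n + \<Lambda> * integral\<^sup>L TN (\<lambda>x. indicator (E i) x * norm (\<phi>0 x - a i)) + measure TN (E i) * (\<Lambda> * \<delta> * card F + \<delta>)" by linarith
    qed
    also have "\<dots> = \<delta> + \<Lambda> * (\<Sum>i<n. integral\<^sup>L TN (\<lambda>x. indicator (E i) x * norm (\<phi>0 x - a i))) + (\<Lambda> * \<delta> * card F + \<delta>)"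
      unfolding sum.distrib sum_distrib_left[symmetric] sum_distrib_right[symmetric] mE using n0 by simp
    also have "\<dots> \<le> \<delta> + \<Lambda> * (2 * \<delta>) + (\<Lambda> * \<delta> * card F + \<delta>)"
      by (intro add_mono order_refl mult_left_mono base \<Lambda>)
    also have "\<dots> \<le> e" using \<delta>_eq by (simp add: algebra_simps)
    finally show ?thesis .
  qed
  show ?thesis
  proof (intro exI[of _ z] exI[of _ n] exI[of _ E] exI[of _ c] conjI z(1) P allI impI ballI fin)
    fix i x assume "i < n" "x \<in> E i"
    from osc(2)[OF this] \<delta>e show "norm (x - c i) \<le> e" by linarith
  qed
qed

end

section \<open>Weak convergence from continuous test functions and fine partitions\<close>

lemma integrable_approx_continuous:
  fixes \<psi> :: "real^'n::finite \<Rightarrow> real"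
  assumes \<psi>: "integrable TN \<psi>" and e: "e > 0"
  shows "\<exists>\<chi>'. continuous_on UNIV \<chi>' \<and> integral\<^sup>L TN (\<lambda>x. \<bar>\<psi> x - \<chi>' x\<bar>) < e"
proof -
  \<comment> \<open>Truncation at height \<open>k\<close> reduces the claim to bounded functions;
    dominated convergence controls the error.\<close>
  define t where "t k x = max (- real k) (min (real k) (\<psi> x))" for k :: nat and x
  have m: "\<psi> \<in> borel_measurable TN" using \<psi> by (rule borel_measurable_integrable)
  have mt: "t k \<in> borel_measurable TN" for k unfolding t_def using m by measurable
  have tb: "\<bar>t k x\<bar> \<le> real k" for k x unfolding t_def by linarith
  have "(\<lambda>k. integral\<^sup>L TN (\<lambda>x. \<bar>\<psi> x - t k x\<bar>)) \<longlonglongrightarrow> integral\<^sup>L TN (\<lambda>x::real^'n. 0::real)"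
  proof (rule integral_dominated_convergence[where w="\<lambda>x. \<bar>\<psi> x\<bar>"])
    show "AE x in TN. (\<lambda>k. \<bar>\<psi> x - t k x\<bar>) \<longlonglongrightarrow> 0"
    proof (rule AE_I2)
      fix x :: "real^'n"
      obtain k0 :: nat where k0: "\<bar>\<psi> x\<bar> \<le> real k0" using real_arch_simple by blast
      have "\<bar>\<psi> x - t k x\<bar> = 0" if "k \<ge> k0" for k
      proof -
        have "\<bar>\<psi> x\<bar> \<le> real k" using k0 that by linarith
        then show ?thesis unfolding t_def by linarith
      qed
      then show "(\<lambda>k. \<bar>\<psi> x - t k x\<bar>) \<longlonglongrightarrow> 0"
        by (intro tendsto_eventually) (auto simp: eventually_sequentially)
    qed
    show "AE x in TN. norm \<bar>\<psi> x - t k x\<bar> \<le> \<bar>\<psi> x\<bar>" for k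
    proof (rule AE_I2)
      fix x :: "real^'n"
      have "\<bar>\<psi> x - t k x\<bar> \<le> \<bar>\<psi> x\<bar>" unfolding t_def by (smt (verit) of_nat_0_le_iff)
      then show "norm \<bar>\<psi> x - t k x\<bar> \<le> \<bar>\<psi> x\<bar>" by simp
    qed
  qed (use \<psi> mt in auto)
  then have "(\<lambda>k. integral\<^sup>L TN (\<lambda>x. \<bar>\<psi> x - t k x\<bar>)) \<longlonglongrightarrow> 0" by simp
  then have "\<forall>\<^sub>F k in sequentially. integral\<^sup>L TN (\<lambda>x. \<bar>\<psi> x - t k x\<bar>) < e / 2"
    using e by (intro order_tendstoD(2)[where y=0]) auto
  then obtain k where k: "integral\<^sup>L TN (\<lambda>x. \<bar>\<psi> x - t k x\<bar>) < e / 2" by (auto simp: eventually_sequentially)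
  have it: "integrable TN (t k)" by (rule integrable_TN_bounded[OF mt, of k "real k"]) (simp add: tb)
  obtain g where g: "continuous_on UNIV g" "integral\<^sup>L TN (\<lambda>x. norm (t k x - g x)) < e / 2"
    using bounded_approx_continuous[OF mt, of k "real k" "e / 2"] tb e by auto
  have ig: "integrable TN g" by (rule integrable_TN_continuous[OF g(1)])
  have "integral\<^sup>L TN (\<lambda>x. \<bar>\<psi> x - g x\<bar>) \<le> integral\<^sup>L TN (\<lambda>x. \<bar>\<psi> x - t k x\<bar> + norm (t k x - g x))"
    using \<psi> it ig by (intro integral_mono) auto
  also have "\<dots> = integral\<^sup>L TN (\<lambda>x. \<bar>\<psi> x - t k x\<bar>) + integral\<^sup>L TN (\<lambda>x. norm (t k x - g x))"
    using \<psi> it ig by simp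
  finally show ?thesis using g k by (intro exI[of _ g]) auto
qed

lemma integrable_bounded_mult_AE:
  fixes h \<psi> :: "real^'n::finite \<Rightarrow> real"
  assumes "h \<in> borel_measurable TN" "AE x in TN. \<bar>h x\<bar> \<le> B" "integrable TN \<psi>"
  shows "integrable TN (\<lambda>x. h x * \<psi> x)"
proof (rule Bochner_Integration.integrable_bound)
  show "integrable TN (\<lambda>x. B * \<psi> x)" using assms(3) by simp
  show "(\<lambda>x. h x * \<psi> x) \<in> borel_measurable TN" using assms by simp
  show "AE x in TN. norm (h x * \<psi> x) \<le> norm (B * \<psi> x)"
    using assms(2) by eventually_elim (auto simp: abs_mult intro!: mult_right_mono)
qed

lemma integral_bounded_mult_le:
  fixes h \<psi> :: "real^'n::finite \<Rightarrow> real"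
  assumes "h \<in> borel_measurable TN" "AE x in TN. \<bar>h x\<bar> \<le> B" "integrable TN \<psi>"
  shows "\<bar>integral\<^sup>L TN (\<lambda>x. h x * \<psi> x)\<bar> \<le> B * integral\<^sup>L TN (\<lambda>x. \<bar>\<psi> x\<bar>)"
proof -
  have "\<bar>integral\<^sup>L TN (\<lambda>x. h x * \<psi> x)\<bar> \<le> integral\<^sup>L TN (\<lambda>x. \<bar>h x * \<psi> x\<bar>)" by (rule integral_abs_bound)
  also have "\<dots> \<le> integral\<^sup>L TN (\<lambda>x. B * \<bar>\<psi> x\<bar>)"
  proof (rule integral_mono_AE)
    show "AE x in TN. \<bar>h x * \<psi> x\<bar> \<le> B * \<bar>\<psi> x\<bar>"
      using assms(2) by eventually_elim (auto simp: abs_mult intro!: mult_right_mono)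
  qed (use integrable_bounded_mult_AE[OF assms] assms(3) in auto)
  finally show ?thesis by simp
qed

text \<open>A uniform bound on the sequence and the limit makes the pairings equicontinuous in the
  L^1 norm of the test function, and continuous functions are dense there.\<close>

lemma weak_conv_extend:
  fixes h :: "nat \<Rightarrow> real^'n::finite \<Rightarrow> real"
  assumes h: "\<And>j. h j \<in> borel_measurable TN" "\<And>j. AE x in TN. \<bar>h j x\<bar> \<le> B"
    and k: "k \<in> borel_measurable TN" "AE x in TN. \<bar>k x\<bar> \<le> B"
    and conv: "\<And>g. continuous_on UNIV g \<Longrightarrow> (\<lambda>j. integral\<^sup>L TN (\<lambda>x. h j x * g x)) \<longlonglongrightarrow> integral\<^sup>L TN (\<lambda>x. k x * g x)"
    and \<psi>: "integrable TN \<psi>"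
  shows "(\<lambda>j. integral\<^sup>L TN (\<lambda>x. h j x * \<psi> x)) \<longlonglongrightarrow> integral\<^sup>L TN (\<lambda>x. k x * \<psi> x)"
proof (rule LIMSEQ_I)
  fix e :: real assume e: "e > 0"
  define e' where "e' = e / (4 * (\<bar>B\<bar> + 1))"
  have e': "e' > 0" using e by (simp add: e'_def)
  have Be': "\<bar>B\<bar> * e' \<le> e / 4" using e by (simp add: e'_def field_simps)
  obtain g where g: "continuous_on UNIV g" "integral\<^sup>L TN (\<lambda>x. \<bar>\<psi> x - g x\<bar>) < e'"
    using integrable_approx_continuous[OF \<psi> e'] by blast
  have ig: "integrable TN g" by (rule integrable_TN_continuous[OF g(1)])
  have close: "\<bar>integral\<^sup>L TN (\<lambda>x. f x * \<psi> x) - integral\<^sup>L TN (\<lambda>x. f x * g x)\<bar> \<le> e / 4"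
    if f: "f \<in> borel_measurable TN" "AE x in TN. \<bar>f x\<bar> \<le> B" for f
  proof -
    have f': "AE x in TN. \<bar>f x\<bar> \<le> \<bar>B\<bar>" using f(2) by eventually_elim simp
    have "integral\<^sup>L TN (\<lambda>x. f x * \<psi> x) - integral\<^sup>L TN (\<lambda>x. f x * g x) = integral\<^sup>L TN (\<lambda>x. f x * (\<psi> x - g x))"
      using integrable_bounded_mult_AE[OF f \<psi>] integrable_bounded_mult_AE[OF f ig] by (simp add: right_diff_distrib)
    then have "\<bar>integral\<^sup>L TN (\<lambda>x. f x * \<psi> x) - integral\<^sup>L TN (\<lambda>x. f x * g x)\<bar> \<le> \<bar>B\<bar> * integral\<^sup>L TN (\<lambda>x. \<bar>\<psi> x - g x\<bar>)"
      using integral_bounded_mult_le[OF f(1) f' Bochner_Integration.integrable_diff[OF \<psi> ig]] by simp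
    also have "\<dots> \<le> \<bar>B\<bar> * e'" using g(2) by (intro mult_left_mono) auto
    finally show ?thesis using Be' by linarith
  qed
  obtain J where J: "\<And>j. j \<ge> J \<Longrightarrow> \<bar>integral\<^sup>L TN (\<lambda>x. h j x * g x) - integral\<^sup>L TN (\<lambda>x. k x * g x)\<bar> < e / 4"
    using LIMSEQ_D[OF conv[OF g(1)], of "e / 4"] e by auto
  show "\<exists>no. \<forall>j\<ge>no. norm (integral\<^sup>L TN (\<lambda>x. h j x * \<psi> x) - integral\<^sup>L TN (\<lambda>x. k x * \<psi> x)) < e"
  proof (intro exI[of _ J] allI impI)
    fix j assume "j \<ge> J"
    from J[OF this] close[OF h, of j] close[OF k] e
    show "norm (integral\<^sup>L TN (\<lambda>x. h j x * \<psi> x) - integral\<^sup>L TN (\<lambda>x. k x * \<psi> x)) < e" unfolding real_norm_def by linarith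
  qed
qed

text \<open>On each cell \<open>g\<close> is replaced by its value at \<open>c j i\<close>. What
  remains is the cell integral of \<open>q j\<close>, summable to \<open>e j\<close> by assumption,
  and an error governed by the modulus of continuity of \<open>g\<close> on cells of shrinking
  diameter.\<close>

lemma weak_conv_partition:
  fixes q :: "nat \<Rightarrow> real^'n::finite \<Rightarrow> real"
  assumes q: "\<And>j. q j \<in> borel_measurable TN" "\<And>j. AE x in TN. \<bar>q j x\<bar> \<le> B" and B: "B \<ge> 0"
    and P: "\<And>j. TNpart {..<n j} (E j)" and diam: "\<And>j i x. i < n j \<Longrightarrow> x \<in> E j i \<Longrightarrow> norm (x - c j i) \<le> e j"
    and small: "\<forall>\<^sub>F j in sequentially. (\<Sum>i<n j. \<bar>integral\<^sup>L TN (\<lambda>x. indicator (E j i) x * q j x)\<bar>) \<le> e j"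
    and e: "e \<longlonglongrightarrow> 0" "\<And>j. e j \<le> 1" and g: "continuous_on UNIV g"
  shows "(\<lambda>j. integral\<^sup>L TN (\<lambda>x. q j x * g x)) \<longlonglongrightarrow> 0"
proof (rule LIMSEQ_I)
  fix \<eta> :: real assume \<eta>: "\<eta> > 0"
  have "bounded (cbox 0 (1::real^'n))" by simp
  then obtain R where R: "\<forall>x\<in>cbox 0 (1::real^'n). norm x \<le> R" unfolding bounded_iff by (elim exE)
  \<comment> \<open>The centres need not lie in the cube, but for nonempty cells they are within
    distance \<open>e j \<le> 1\<close> of it.\<close>
  define D where "D = cball (0::real^'n) (R + 1)"
  define \<epsilon> where "\<epsilon> = \<eta> / (2 * (B + 1))"
  have \<epsilon>: "\<epsilon> > 0" using \<eta> B by (simp add: \<epsilon>_def)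
  have B\<epsilon>: "B * \<epsilon> \<le> \<eta> / 2" using \<eta> B by (simp add: \<epsilon>_def field_simps)
  obtain C where C: "C \<ge> 0" "\<forall>y\<in>cball 0 (R + 1). \<forall>z\<in>cball 0 (R + 1). \<bar>g y - g z\<bar> \<le> \<epsilon> + C * norm (y - z)"
    using continuous_modulus[OF g \<epsilon>, of "R + 1"] by (elim exE conjE)
  have "bounded (g ` D)"
    by (intro compact_imp_bounded compact_continuous_image continuous_on_subset[OF g]) (auto simp: D_def)
  then obtain G where G: "\<forall>y\<in>g ` D. norm y \<le> G" unfolding bounded_iff by (elim exE)
  have ig: "integrable TN g" by (rule integrable_TN_continuous[OF g])
  have iq: "integrable TN (q j)" for j using integrable_TN_bounded[OF q(1), of j B] q(2)[of j] by simp
  have iqg: "integrable TN (\<lambda>x. q j x * g x)" for j by (rule integrable_bounded_mult_AE[OF q ig])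
  have bound: "\<bar>integral\<^sup>L TN (\<lambda>x. q j x * g x)\<bar> \<le> \<bar>G\<bar> * (\<Sum>i<n j. \<bar>integral\<^sup>L TN (\<lambda>x. indicator (E j i) x * q j x)\<bar>) + B * (\<epsilon> + C * e j)" for j
  proof -
    have Es: "E j i \<in> sets TN" if "i < n j" for i using P[of j] that by (simp add: TNpart_def)
    have mE: "(\<Sum>i<n j. measure TN (E j i)) = 1"
    proof -
      have "(\<Sum>i<n j. integral\<^sup>L TN (\<lambda>y. indicator (E j i) y * (1::real))) = 1" using TNpart_integral[OF P[of j], of "\<lambda>_. 1"] by simp
      then show ?thesis using integral_indicator_TN[OF Es] by simp
    qed
    have piece: "\<bar>integral\<^sup>L TN (\<lambda>x. indicator (E j i) x * (q j x * g x))\<bar> \<le> \<bar>G\<bar> * \<bar>integral\<^sup>L TN (\<lambda>x. indicator (E j i) x * q j x)\<bar> + B * (\<epsilon> + C * e j) * measure TN (E j i)" if i: "i < n j" for i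
    \<comment> \<open>For an empty cell nothing is known about the centre, so it is treated
      separately; its integral vanishes.\<close>
    proof (cases "E j i = {}")
      case False
      then obtain x0 where x0: "x0 \<in> E j i" by auto
      have Ein: "x \<in> cbox 0 1" if "x \<in> E j i" for x using sets.sets_into_space[OF Es[OF i]] that by auto
      have cD: "c j i \<in> cball 0 (R + 1)"
      proof -
        have "norm (c j i) \<le> norm x0 + norm (x0 - c j i)" by norm
        then show ?thesis using diam[OF i x0] R[rule_format, OF Ein[OF x0]] e(2)[of j] by simp
      qed
      have i1: "integrable TN (\<lambda>x. indicator (E j i) x * (q j x * g x))" by (rule integrable_indicator_mult[OF Es[OF i] iqg])
      have i2: "integrable TN (\<lambda>x. g (c j i) * (indicator (E j i) x * q j x))" using integrable_indicator_mult[OF Es[OF i] iq] by simp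
      have iE: "integrable TN (\<lambda>x. indicator (E j i) x * (B * (\<epsilon> + C * e j)))" by (rule integrable_indicator_mult[OF Es[OF i] TN.integrable_const])
      have "\<bar>integral\<^sup>L TN (\<lambda>x. indicator (E j i) x * (q j x * g x) - g (c j i) * (indicator (E j i) x * q j x))\<bar>
         \<le> integral\<^sup>L TN (\<lambda>x. \<bar>indicator (E j i) x * (q j x * g x) - g (c j i) * (indicator (E j i) x * q j x)\<bar>)" by (rule integral_abs_bound)
      also have "\<dots> \<le> integral\<^sup>L TN (\<lambda>x. indicator (E j i) x * (B * (\<epsilon> + C * e j)))"
      proof (rule integral_mono_AE)
        show "integrable TN (\<lambda>x. \<bar>indicator (E j i) x * (q j x * g x) - g (c j i) * (indicator (E j i) x * q j x)\<bar>)" using i1 i2 by simp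
        show "integrable TN (\<lambda>x. indicator (E j i) x * (B * (\<epsilon> + C * e j)))" by (rule iE)
        show "AE x in TN. \<bar>indicator (E j i) x * (q j x * g x) - g (c j i) * (indicator (E j i) x * q j x)\<bar> \<le> indicator (E j i) x * (B * (\<epsilon> + C * e j))"
          using q(2)[of j]
        proof eventually_elim
          case (elim x)
          show ?case
          proof (cases "x \<in> E j i")
            case True
            have "x \<in> cball 0 (R + 1)" using R[rule_format, OF Ein[OF True]] by simp
            then have "\<bar>g x - g (c j i)\<bar> \<le> \<epsilon> + C * norm (x - c j i)" using C(2) cD by blast
            also have "\<dots> \<le> \<epsilon> + C * e j" using diam[OF i True] C(1) by (intro add_left_mono mult_left_mono)
            finally have "\<bar>q j x\<bar> * \<bar>g x - g (c j i)\<bar> \<le> B * (\<epsilon> + C * e j)" using elim by (intro mult_mono) (auto simp: B)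
            moreover have "indicator (E j i) x * (q j x * g x) - g (c j i) * (indicator (E j i) x * q j x) = q j x * (g x - g (c j i))"
              using True by (simp add: algebra_simps)
            ultimately show ?thesis using True by (simp add: abs_mult)
          qed simp
        qed
      qed
      also have "\<dots> = B * (\<epsilon> + C * e j) * measure TN (E j i)" using integral_indicator_TN[OF Es[OF i]] by simp
      finally have *: "\<bar>integral\<^sup>L TN (\<lambda>x. indicator (E j i) x * (q j x * g x)) - g (c j i) * integral\<^sup>L TN (\<lambda>x. indicator (E j i) x * q j x)\<bar> \<le> B * (\<epsilon> + C * e j) * measure TN (E j i)"
        using i1 i2 by simp
      have "\<bar>g (c j i)\<bar> \<le> G" using G cD by (auto simp: D_def)
      then have "\<bar>g (c j i)\<bar> * \<bar>integral\<^sup>L TN (\<lambda>x. indicator (E j i) x * q j x)\<bar> \<le> \<bar>G\<bar> * \<bar>integral\<^sup>L TN (\<lambda>x. indicator (E j i) x * q j x)\<bar>"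
        by (intro mult_right_mono) auto
      then show ?thesis using * abs_mult[of "g (c j i)" "integral\<^sup>L TN (\<lambda>x. indicator (E j i) x * q j x)"] by linarith
    qed simp
    have "\<bar>integral\<^sup>L TN (\<lambda>x. q j x * g x)\<bar> \<le> (\<Sum>i<n j. \<bar>integral\<^sup>L TN (\<lambda>x. indicator (E j i) x * (q j x * g x))\<bar>)"
      unfolding TNpart_integral[OF P[of j] iqg] by (rule sum_abs)
    also have "\<dots> \<le> (\<Sum>i<n j. \<bar>G\<bar> * \<bar>integral\<^sup>L TN (\<lambda>x. indicator (E j i) x * q j x)\<bar> + B * (\<epsilon> + C * e j) * measure TN (E j i))"
      by (intro sum_mono piece) simp
    also have "\<dots> = \<bar>G\<bar> * (\<Sum>i<n j. \<bar>integral\<^sup>L TN (\<lambda>x. indicator (E j i) x * q j x)\<bar>) + B * (\<epsilon> + C * e j)"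
      unfolding sum.distrib sum_distrib_left[symmetric] mE by simp
    finally show ?thesis .
  qed
  have "(\<lambda>j. \<bar>G\<bar> * e j + B * (\<epsilon> + C * e j)) \<longlonglongrightarrow> \<bar>G\<bar> * 0 + B * (\<epsilon> + C * 0)" by (intro tendsto_intros e)
  then have "\<forall>\<^sub>F j in sequentially. \<bar>G\<bar> * e j + B * (\<epsilon> + C * e j) < \<eta>"
    using B\<epsilon> \<eta> by (intro order_tendstoD(2)[where y="\<bar>G\<bar> * 0 + B * (\<epsilon> + C * 0)"]) auto
  with small have "\<forall>\<^sub>F j in sequentially. \<bar>integral\<^sup>L TN (\<lambda>x. q j x * g x)\<bar> < \<eta>"
  proof eventually_elim
    case (elim j)
    have "\<bar>G\<bar> * (\<Sum>i<n j. \<bar>integral\<^sup>L TN (\<lambda>x. indicator (E j i) x * q j x)\<bar>) \<le> \<bar>G\<bar> * e j" by (intro mult_left_mono elim(1)) simp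
    then show ?case using bound[of j] elim(2) by linarith
  qed
  then show "\<exists>no. \<forall>j\<ge>no. norm (integral\<^sup>L TN (\<lambda>x. q j x * g x) - 0) < \<eta>"
    by (simp add: eventually_sequentially)
qed

section \<open>Signed measures\<close>

lemma valid_sm_facts:
  assumes "valid_sm \<mu>"
  shows "sets (fst \<mu>) = sets borel" "space (fst \<mu>) = UNIV" "finite_measure (fst \<mu>)"
    "sets (snd \<mu>) = sets borel" "space (snd \<mu>) = UNIV" "finite_measure (snd \<mu>)"
  using assms sets_eq_imp_space_eq[of "fst \<mu>" borel] sets_eq_imp_space_eq[of "snd \<mu>" borel]
  by (auto simp: valid_sm_def)

text \<open>On the complement of the Hahn set \<open>S\<close> the positive part vanishes, so
  nonnegativity forces the negative part to vanish there; on \<open>S\<close> it vanishes by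
  singularity. Hence the negative part is the zero measure.\<close>

lemma sm_nonneg_int:
  fixes \<mu> :: "'a::euclidean_space smeasure" and f :: "'a \<Rightarrow> 'b::{banach,second_countable_topology}"
  assumes v: "valid_sm \<mu>" and n: "sm_nonneg \<mu>"
  shows "sm_int \<mu> f = integral\<^sup>L (fst \<mu>) f"
proof -
  note vf = valid_sm_facts[OF v]
  interpret s: finite_measure "snd \<mu>" by (rule vf(6))
  interpret f: finite_measure "fst \<mu>" by (rule vf(3))
  obtain S where S: "S \<in> sets borel" "emeasure (fst \<mu>) (UNIV - S) = 0" "emeasure (snd \<mu>) S = 0"
    using v unfolding valid_sm_def by blast
  have "0 \<le> sm_val \<mu> (UNIV - S)" using n S(1) unfolding sm_nonneg_def by (metis sets.compl_sets space_borel)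
  then have "measure (snd \<mu>) (UNIV - S) \<le> 0" using S(2) by (simp add: sm_val_def measure_def)
  then have "emeasure (snd \<mu>) (UNIV - S) = 0" using measure_nonneg[of "snd \<mu>" "UNIV - S"] by (simp add: s.emeasure_eq_measure)
  then have "UNIV - S \<in> null_sets (snd \<mu>)" "S \<in> null_sets (snd \<mu>)" using S vf by auto
  from this[THEN AE_not_in] have "AE y in snd \<mu>. f y = 0" by eventually_elim simp
  then have "integral\<^sup>L (snd \<mu>) f = 0" by (rule integral_eq_zero_AE)
  then show ?thesis by (simp add: sm_int_def)
qed

text \<open>The complement of the support is a possibly uncountable union of open null sets; by the
  Lindelof property a countable subfamily has the same union.\<close>

lemma sm_support_AE:
  fixes \<mu> :: "'a::euclidean_space smeasure"
  assumes v: "valid_sm \<mu>" and K: "sm_support \<mu> \<subseteq> K"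
  shows "AE y in fst \<mu>. y \<in> K"
proof -
  define \<F> where "\<F> = {U. open U \<and> emeasure (fst \<mu>) U = 0 \<and> emeasure (snd \<mu>) U = 0}"
  obtain \<F>' where F': "\<F>' \<subseteq> \<F>" "countable \<F>'" "\<Union>\<F>' = \<Union>\<F>"
    using Lindelof[of \<F>] by (auto simp: \<F>_def)
  have "(\<Union>U\<in>\<F>'. U) \<in> null_sets (fst \<mu>)"
  proof (rule null_sets_UN'[OF F'(2)])
    fix U assume "U \<in> \<F>'"
    then have "open U" "emeasure (fst \<mu>) U = 0" using F'(1) by (auto simp: \<F>_def)
    then show "U \<in> null_sets (fst \<mu>)" using valid_sm_facts(1)[OF v] by auto
  qed
  then have "\<Union>\<F> \<in> null_sets (fst \<mu>)" using F'(3) by simp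
  then have ae: "AE y in fst \<mu>. y \<notin> \<Union>\<F>" by (rule AE_not_in)
  have sub: "UNIV - \<Union>\<F> \<subseteq> K" using K by (simp add: sm_support_def \<F>_def)
  show ?thesis using ae by eventually_elim (use sub in blast)
qed

text \<open>Weak* measurability and generation only speak of functions that vanish at infinity.
  Multiplication by \<open>cutoff R\<close> brings coordinates, constants and quasiconvex functions
  into their scope without changing them on the ball that carries the measures.\<close>

definition cutoff :: "real \<Rightarrow> 'a::euclidean_space \<Rightarrow> real" where
  "cutoff R y = max 0 (min 1 (R + 1 - norm y))"

lemma cutoff_bounds: "0 \<le> cutoff R y" "cutoff R y \<le> 1"
  by (auto simp: cutoff_def)

lemma cutoff_eq_1: "norm y \<le> R \<Longrightarrow> cutoff R y = 1"
  by (simp add: cutoff_def)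

lemma cutoff_eq_0: "norm y \<ge> R + 1 \<Longrightarrow> cutoff R y = 0"
  by (simp add: cutoff_def)

lemma continuous_cutoff: "continuous_on UNIV (cutoff R)"
  unfolding cutoff_def by (intro continuous_intros)

lemma Cc_cutoff:
  fixes f :: "'a::euclidean_space \<Rightarrow> real"
  assumes "continuous_on UNIV f"
  shows "Cc (\<lambda>y. cutoff R y * f y)"
  unfolding Cc_def
  by (intro conjI exI[of _ "cball 0 (R + 1)"] continuous_intros continuous_cutoff assms) (auto simp: cutoff_eq_0)

lemma Cc_C0:
  fixes f :: "'a::euclidean_space \<Rightarrow> real"
  assumes "Cc f"
  shows "C0 f"
proof -
  obtain K where K: "compact K" "\<forall>y. y \<notin> K \<longrightarrow> f y = 0" and c: "continuous_on UNIV f" using assms unfolding Cc_def by auto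
  obtain B where B: "\<forall>y\<in>K. norm y \<le> B" using compact_imp_bounded[OF K(1)] unfolding bounded_iff by (elim exE)
  have "f y = 0" if "norm y \<ge> B + 1" for y
  proof -
    have "y \<notin> K" using B that by force
    then show ?thesis using K(2) by simp
  qed
  then have "\<forall>\<^sub>F y in at_infinity. f y = 0" unfolding eventually_at_infinity by blast
  then have "(f \<longlongrightarrow> 0) at_infinity" by (rule tendsto_eventually)
  then show ?thesis using c by (simp add: C0_def)
qed

lemma C0_bounded:
  fixes f :: "'a::euclidean_space \<Rightarrow> real"
  assumes "C0 f"
  shows "\<exists>B\<ge>0. \<forall>y. \<bar>f y\<bar> \<le> B"
proof -
  have c: "continuous_on UNIV f" and l: "(f \<longlongrightarrow> 0) at_infinity" using assms by (auto simp: C0_def)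
  have "\<forall>\<^sub>F y in at_infinity. \<bar>f y\<bar> < 1" using tendstoD[OF l, of 1] by (simp add: dist_real_def)
  then obtain r where r: "\<And>y. norm y \<ge> r \<Longrightarrow> \<bar>f y\<bar> < 1" unfolding eventually_at_infinity by blast
  have "bounded (f ` cball 0 r)"
    by (intro compact_imp_bounded compact_continuous_image continuous_on_subset[OF c]) auto
  then obtain B where B: "\<forall>z\<in>f ` cball 0 r. norm z \<le> B" unfolding bounded_iff by (elim exE)
  have "\<bar>f y\<bar> \<le> max B 1" for y
  proof (cases "norm y \<le> r")
    case True
    then have "\<bar>f y\<bar> \<le> B" using B by auto
    then show ?thesis by simp
  qed (use r[of y] in auto)
  then show ?thesis by (intro exI[of _ "max B 1"]) auto
qed

lemma measurable_fst_sm: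
  assumes "valid_sm \<mu>" "continuous_on UNIV f"
  shows "f \<in> borel_measurable (fst \<mu>)" "f \<in> borel_measurable (snd \<mu>)"
  using borel_measurable_continuous_onI[OF assms(2)] valid_sm_facts[OF assms(1)] by (simp_all cong: measurable_cong_sets)

text \<open>Measurability is assumed for compactly supported functions only. Cut-offs with growing
  radius converge pointwise and boundedly to \<open>f\<close>, so the integrals against each
  \<open>\<nu> x\<close> converge.\<close>

lemma sm_int_C0_measurable:
  fixes \<nu> :: "real^'n::finite \<Rightarrow> (real^'d::finite) smeasure"
  assumes \<nu>: "wstar_measurable \<nu>" and f: "C0 f"
  shows "(\<lambda>x. sm_int (\<nu> x) f) \<in> borel_measurable TN"
proof -
  have c: "continuous_on UNIV f" using f by (simp add: C0_def)
  obtain B where B: "\<And>y. \<bar>f y\<bar> \<le> B" using C0_bounded[OF f] by auto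
  have v: "valid_sm (\<nu> x)" for x using \<nu> by (simp add: wstar_measurable_def)
  have lim: "(\<lambda>k. sm_int (\<nu> x) (\<lambda>y. cutoff (real k) y * f y)) \<longlonglongrightarrow> sm_int (\<nu> x) f" for x
    unfolding sm_int_def
  proof (intro tendsto_diff)
    have ev: "(\<lambda>k. cutoff (real k) y * f y) \<longlonglongrightarrow> f y" for y :: "real^'d"
    proof -
      obtain k0 :: nat where k0: "norm y \<le> real k0" using real_arch_simple by blast
      have "cutoff (real k) y * f y = f y" if "k \<ge> k0" for k using k0 that by (simp add: cutoff_eq_1)
      then show ?thesis by (intro tendsto_eventually) (auto simp: eventually_sequentially)
    qed
    have bd: "norm (cutoff (real k) y * f y) \<le> B" for k and y :: "real^'d"
      using mult_mono[of "cutoff (real k) y" 1 "\<bar>f y\<bar>" B] cutoff_bounds[of "real k" y] B[of y] by (simp add: abs_mult)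
    have mc: "continuous_on UNIV (\<lambda>y::real^'d. cutoff (real k) y * f y)" for k by (intro continuous_intros continuous_cutoff c)
    interpret p: finite_measure "fst (\<nu> x)" by (rule valid_sm_facts[OF v])
    interpret q: finite_measure "snd (\<nu> x)" by (rule valid_sm_facts[OF v])
    show "(\<lambda>k. integral\<^sup>L (fst (\<nu> x)) (\<lambda>y. cutoff (real k) y * f y)) \<longlonglongrightarrow> integral\<^sup>L (fst (\<nu> x)) f"
      by (rule integral_dominated_convergence[where w="\<lambda>_. B"]) (use measurable_fst_sm[OF v c] measurable_fst_sm[OF v mc] ev bd in auto)
    show "(\<lambda>k. integral\<^sup>L (snd (\<nu> x)) (\<lambda>y. cutoff (real k) y * f y)) \<longlonglongrightarrow> integral\<^sup>L (snd (\<nu> x)) f"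
      by (rule integral_dominated_convergence[where w="\<lambda>_. B"]) (use measurable_fst_sm[OF v c] measurable_fst_sm[OF v mc] ev bd in auto)
  qed
  show ?thesis
  proof (rule borel_measurable_LIMSEQ_real[OF lim])
    show "(\<lambda>x. sm_int (\<nu> x) (\<lambda>y. cutoff (real k) y * f y)) \<in> borel_measurable TN" for k
      using \<nu> Cc_cutoff[OF c, of "real k"] unfolding wstar_measurable_def by blast
  qed
qed

section \<open>Probability measures carried by a ball\<close>

definition prob_on :: "real \<Rightarrow> (real^'d::finite) smeasure \<Rightarrow> bool" where
  "prob_on R \<mu> \<longleftrightarrow> valid_sm \<mu> \<and> (\<forall>f::real^'d \<Rightarrow> real. sm_int \<mu> f = integral\<^sup>L (fst \<mu>) f) \<and>
     (AE y in fst \<mu>. norm y \<le> R) \<and> measure (fst \<mu>) UNIV = 1"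

lemma prob_on_integrable:
  fixes f :: "real^'d::finite \<Rightarrow> real"
  assumes p: "prob_on R \<mu>" and f: "continuous_on UNIV f"
  shows "integrable (fst \<mu>) f"
proof -
  have v: "valid_sm \<mu>" and ae: "AE y in fst \<mu>. norm y \<le> R" using p by (auto simp: prob_on_def)
  interpret finite_measure "fst \<mu>" by (rule valid_sm_facts[OF v])
  have "bounded (f ` cball 0 R)"
    by (intro compact_imp_bounded compact_continuous_image continuous_on_subset[OF f]) auto
  then obtain B where B: "\<forall>z\<in>f ` cball 0 R. norm z \<le> B" unfolding bounded_iff by (elim exE)
  have "AE y in fst \<mu>. norm (f y) \<le> B" using ae by eventually_elim (use B in auto)
  then show ?thesis by (rule integrable_const_bound) (rule measurable_fst_sm[OF v f])
qed

lemma prob_on_cong: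
  fixes f g :: "real^'d::finite \<Rightarrow> real"
  assumes p: "prob_on R \<mu>" and f: "continuous_on UNIV f" and g: "continuous_on UNIV g"
    and eq: "\<And>y. norm y \<le> R \<Longrightarrow> f y = g y"
  shows "sm_int \<mu> f = sm_int \<mu> g"
proof -
  have v: "valid_sm \<mu>" and ae: "AE y in fst \<mu>. norm y \<le> R" using p by (auto simp: prob_on_def)
  have "AE y in fst \<mu>. f y = g y" using ae by eventually_elim (rule eq)
  then have "integral\<^sup>L (fst \<mu>) f = integral\<^sup>L (fst \<mu>) g"
    by (rule integral_cong_AE[OF measurable_fst_sm(1)[OF v f] measurable_fst_sm(1)[OF v g]])
  then show ?thesis using p by (simp add: prob_on_def)
qed

lemma prob_on_mono:
  fixes f g :: "real^'d::finite \<Rightarrow> real"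
  assumes p: "prob_on R \<mu>" and f: "continuous_on UNIV f" and g: "continuous_on UNIV g"
    and le: "\<And>y. norm y \<le> R \<Longrightarrow> f y \<le> g y"
  shows "sm_int \<mu> f \<le> sm_int \<mu> g"
proof -
  have ae: "AE y in fst \<mu>. norm y \<le> R" using p by (auto simp: prob_on_def)
  have "AE y in fst \<mu>. f y \<le> g y" using ae by eventually_elim (rule le)
  then have "integral\<^sup>L (fst \<mu>) f \<le> integral\<^sup>L (fst \<mu>) g"
    by (rule integral_mono_AE[OF prob_on_integrable[OF p f] prob_on_integrable[OF p g]])
  then show ?thesis using p by (simp add: prob_on_def)
qed

lemma prob_on_const:
  assumes p: "prob_on R \<mu>"
  shows "sm_int \<mu> (\<lambda>_. c :: real) = c"
proof -
  have "space (fst \<mu>) = UNIV" using p valid_sm_facts(2)[of \<mu>] by (simp add: prob_on_def)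
  then show ?thesis using p by (simp add: prob_on_def)
qed

lemma prob_on_abs_le:
  fixes f :: "real^'d::finite \<Rightarrow> real"
  assumes p: "prob_on R \<mu>" and f: "continuous_on UNIV f" and B: "\<And>y. norm y \<le> R \<Longrightarrow> \<bar>f y\<bar> \<le> B"
  shows "\<bar>sm_int \<mu> f\<bar> \<le> B"
proof -
  have "sm_int \<mu> f \<le> sm_int \<mu> (\<lambda>_. B)" using B by (intro prob_on_mono[OF p f]) (auto simp: abs_le_iff)
  moreover have "sm_int \<mu> (\<lambda>_. - B) \<le> sm_int \<mu> f" using B by (intro prob_on_mono[OF p _ f]) (auto simp: abs_le_iff minus_le_iff)
  ultimately show ?thesis using prob_on_const[OF p] by (simp add: abs_le_iff)
qed

lemma prob_on_sum:
  assumes p: "prob_on R \<mu>" and F: "finite F" "\<And>f. f \<in> F \<Longrightarrow> continuous_on UNIV (h f)"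
  shows "sm_int \<mu> (\<lambda>y. \<Sum>f\<in>F. c f * h f y) = (\<Sum>f\<in>F. c f * sm_int \<mu> (h f :: real^'d::finite \<Rightarrow> real))"
proof -
  have "integrable (fst \<mu>) (\<lambda>y. c f * h f y)" if "f \<in> F" for f using prob_on_integrable[OF p F(2)[OF that]] by simp
  from Bochner_Integration.integral_sum[of F "fst \<mu>" "\<lambda>f y. c f * h f y", OF this]
  show ?thesis using p by (simp add: prob_on_def)
qed

lemma prob_on_diff:
  fixes f g :: "real^'d::finite \<Rightarrow> real"
  assumes p: "prob_on R \<mu>" and f: "continuous_on UNIV f" and g: "continuous_on UNIV g"
    and le: "\<And>y. norm y \<le> R \<Longrightarrow> \<bar>f y - g y\<bar> \<le> e"
  shows "\<bar>sm_int \<mu> f - sm_int \<mu> g\<bar> \<le> e"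
proof -
  have "\<bar>sm_int \<mu> (\<lambda>y. f y - g y)\<bar> \<le> e" by (rule prob_on_abs_le[OF p _ le]) (intro continuous_intros f g)
  moreover have "sm_int \<mu> (\<lambda>y. f y - g y) = sm_int \<mu> f - sm_int \<mu> g"
    using p prob_on_integrable[OF p f] prob_on_integrable[OF p g] by (simp add: prob_on_def)
  ultimately show ?thesis by simp
qed

section \<open>Sufficiency\<close>

lemma A_quasiconvex_const: "A_quasiconvex A (\<lambda>_. c)"
  by (simp add: A_quasiconvex_def)

text \<open>The approximating fields match finitely many test functions at a time, and the list
  grows with \<open>j\<close>. Truncation by (ZL) then changes them by a null sequence in L^1, which
  the Lipschitz test functions do not notice in the limit.\<close>

theorem sufficiency:
  fixes A :: "'n::finite \<Rightarrow> real^'d::finite^'l::finite" and \<nu> :: "real^'n \<Rightarrow> (real^'d) smeasure"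
  assumes cr: "constant_rank A" and ZL: "property_ZL A" and w: "wstar_measurable \<nu>"
    and nn: "AE x in TN. sm_nonneg (\<nu> x)" and K: "compact K" and u: "LinfT u" "kerA A u"
    and sup: "AE x in TN. sm_support (\<nu> x) \<subseteq> K" and bar: "AE x in TN. sm_int (\<nu> x) (\<lambda>y. y) = u x"
    and jen: "AE x in TN. \<forall>f. A_quasiconvex A f \<longrightarrow> sm_int (\<nu> x) f \<ge> f (sm_int (\<nu> x) (\<lambda>y. y))"
  shows "A_infty_YM A \<nu>"
proof -
  have v: "valid_sm (\<nu> x)" for x using w by (simp add: wstar_measurable_def)
  have per: "periodic \<nu>" using w by (simp add: wstar_measurable_def)
  obtain R0 where R0: "\<forall>y\<in>K. norm y \<le> R0" using compact_imp_bounded[OF K] unfolding bounded_iff by (elim exE)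
  define R where "R = \<bar>R0\<bar>"
  have R: "norm y \<le> R" if "y \<in> K" for y using R0 that by (force simp: R_def)
  have prob: "AE x in TN. prob_on R (\<nu> x)"
    using nn sup jen
  proof eventually_elim
    case (elim x)
    have i: "sm_int (\<nu> x) f = integral\<^sup>L (fst (\<nu> x)) f" for f :: "real^'d \<Rightarrow> real" by (rule sm_nonneg_int[OF v elim(1)])
    have "AE y in fst (\<nu> x). y \<in> K" by (rule sm_support_AE[OF v elim(2)])
    then have s: "AE y in fst (\<nu> x). norm y \<le> R" by eventually_elim (rule R)
    have sp: "space (fst (\<nu> x)) = UNIV" by (rule valid_sm_facts[OF v])
    \<comment> \<open>Jensen's inequality for the quasiconvex constants 1 and -1 bounds the total
      mass from both sides.\<close>
    have "(1::real) \<le> sm_int (\<nu> x) (\<lambda>_. 1)" "(- 1::real) \<le> sm_int (\<nu> x) (\<lambda>_. - 1)"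
      using elim(3)[rule_format, OF A_quasiconvex_const, of 1] elim(3)[rule_format, OF A_quasiconvex_const, of "- 1"] by simp_all
    then have "measure (fst (\<nu> x)) UNIV = 1" unfolding i using sp by simp
    then show ?case using i s v by (simp add: prob_on_def)
  qed
  \<comment> \<open>The cut-off makes \<open>T x f\<close> measurable in \<open>x\<close> for every
    continuous \<open>f\<close>; for almost every \<open>x\<close> it does not change the
    integral.\<close>
  define T where "T x f = sm_int (\<nu> x) (\<lambda>y. cutoff R y * f y)" for x f
  have cc: "continuous_on UNIV (\<lambda>y. cutoff R y * f y)" if "continuous_on UNIV f" for f :: "real^'d \<Rightarrow> real"
    by (intro continuous_intros continuous_cutoff that)
  have Teq: "AE x in TN. \<forall>f. continuous_on UNIV f \<longrightarrow> T x f = sm_int (\<nu> x) f"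
    using prob
  proof eventually_elim
    case (elim x)
    show ?case unfolding T_def by (intro allI impI prob_on_cong[OF elim] cc) (auto simp: cutoff_eq_1)
  qed
  have Tmeas: "(\<lambda>x. T x f) \<in> borel_measurable TN" if "continuous_on UNIV f" for f
    using w Cc_cutoff[OF that, of R] unfolding wstar_measurable_def T_def by blast
  have Tbd: "AE x in TN. \<bar>T x f\<bar> \<le> B" if f: "continuous_on UNIV f" and B: "\<And>y. norm y \<le> R \<Longrightarrow> \<bar>f y\<bar> \<le> B" for f B
    using prob Teq by eventually_elim (use f B prob_on_abs_le in fastforce)
  obtain M where uM: "AE x in TN. norm (u x) \<le> M" and um: "u \<in> borel_measurable TN" using u(1) unfolding LinfT_def by auto
  interpret J: jensen_family A T u M
  proof
    show "constant_rank A" by (rule cr)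
    show "AE x in TN. \<forall>f g. continuous_on UNIV f \<and> continuous_on UNIV g \<and> (\<forall>y. f y \<le> g y) \<longrightarrow> T x f \<le> T x g"
      using prob Teq
    proof eventually_elim
      case (elim x)
      show ?case
      proof (intro allI impI, elim conjE)
        fix f g :: "real^'d \<Rightarrow> real" assume fg: "continuous_on UNIV f" "continuous_on UNIV g" "\<forall>y. f y \<le> g y"
        show "T x f \<le> T x g" using prob_on_mono[OF elim(1) fg(1,2)] fg elim(2) by simp
      qed
    qed
    show "AE x in TN. T x (\<lambda>y. \<Sum>f\<in>F. c f * f y) = (\<Sum>f\<in>F. c f * T x f)"
      if F: "finite F" "\<And>f. f \<in> F \<Longrightarrow> continuous_on UNIV f" for F c
      using prob
    proof eventually_elim
      case (elim x)
      have "T x (\<lambda>y. \<Sum>f\<in>F. c f * f y) = sm_int (\<nu> x) (\<lambda>y. \<Sum>f\<in>F. c f * (cutoff R y * f y))"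
        unfolding T_def by (simp add: sum_distrib_left mult_ac)
      also have "\<dots> = (\<Sum>f\<in>F. c f * T x f)" unfolding T_def by (rule prob_on_sum[OF elim F(1) cc[OF F(2)]])
      finally show ?case .
    qed
    show "AE x in TN. \<forall>f. A_quasiconvex A f \<longrightarrow> f (u x) \<le> T x f"
      using jen bar Teq
    proof eventually_elim
      case (elim x)
      show ?case
      proof (intro allI impI)
        fix f :: "real^'d \<Rightarrow> real" assume f: "A_quasiconvex A f"
        then have c: "continuous_on UNIV f" by (simp add: A_quasiconvex_def)
        have "f (sm_int (\<nu> x) (\<lambda>y. y)) \<le> sm_int (\<nu> x) f" using elim(1) f by simp
        then show "f (u x) \<le> T x f" using elim(2) elim(3)[rule_format, OF c] by simp
      qed
    qed
    show "integrable TN (\<lambda>x. T x f)" if f: "continuous_on UNIV f" for f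
    proof -
      have "bounded (f ` cball 0 R)"
        by (intro compact_imp_bounded compact_continuous_image continuous_on_subset[OF f]) auto
      then obtain B where B: "\<forall>z\<in>f ` cball 0 R. norm z \<le> B" unfolding bounded_iff by (elim exE)
      have "AE x in TN. norm (T x f) \<le> B" using Tbd[OF f, of B] B by simp
      then show ?thesis by (rule integrable_TN_bounded[OF Tmeas[OF f]])
    qed
  qed (use um uM u(2) in auto)
  obtain g :: "nat \<Rightarrow> real^'d \<Rightarrow> real" where
    g1: "\<forall>n. (\<exists>\<Lambda>\<ge>0. \<forall>y z. \<bar>g n y - g n z\<bar> \<le> \<Lambda> * norm (y - z)) \<and> (\<exists>B. \<forall>y. \<bar>g n y\<bar> \<le> B)"
    and g2: "\<forall>f R e. continuous_on UNIV f \<and> e > 0 \<longrightarrow> (\<exists>n. \<forall>y\<in>cball 0 R. \<bar>f y - g n y\<bar> \<le> e)"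
    using countable_test_family by (elim exE conjE)
  have "\<forall>n. \<exists>\<Lambda>\<ge>0. \<forall>y z. \<bar>g n y - g n z\<bar> \<le> \<Lambda> * norm (y - z)" using g1 by simp
  then obtain lg where lg: "\<And>n. lg n \<ge> 0" "\<And>n y z. \<bar>g n y - g n z\<bar> \<le> lg n * norm (y - z)" by metis
  \<comment> \<open>The distance to the ball of radius \<open>R\<close> belongs to every list
    \<open>F n\<close>. Its integral against the measures is zero, so its averages along the
    approximating fields tend to zero: there is no concentration.\<close>
  define f0 where "f0 y = max 0 (norm y - R)" for y :: "real^'d"
  have lip0: "\<bar>f0 y - f0 z\<bar> \<le> 1 * norm (y - z)" for y z
    unfolding f0_def using norm_triangle_ineq3[of y z] norm_ge_zero[of "y - z"] by (smt (verit))
  define F where "F n = insert f0 (g ` {..<n})" for n :: nat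
  define \<Lambda> where "\<Lambda> n = 1 + (\<Sum>l<n. lg l)" for n :: nat
  have \<Lambda>0: "\<Lambda> n \<ge> 0" for n unfolding \<Lambda>_def using lg(1) by (intro add_nonneg_nonneg sum_nonneg) auto
  have lipF: "\<bar>f y - f z\<bar> \<le> \<Lambda> n * norm (y - z)" if f: "f \<in> F n" for f n y z
  proof (cases "f = f0")
    case True
    have "1 * norm (y - z) \<le> \<Lambda> n * norm (y - z)" using sum_nonneg[of "{..<n}" lg] lg(1) by (intro mult_right_mono) (auto simp: \<Lambda>_def)
    then show ?thesis unfolding True using lip0[of y z] by linarith
  next
    case False
    then obtain l where l: "l < n" "f = g l" using f by (auto simp: F_def)
    have "lg l \<le> (\<Sum>l<n. lg l)" using l lg(1) by (intro member_le_sum) auto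
    then have "lg l * norm (y - z) \<le> \<Lambda> n * norm (y - z)" by (intro mult_right_mono) (auto simp: \<Lambda>_def)
    then show ?thesis unfolding l(2) using lg(2)[of l y z] by linarith
  qed
  define e where "e n = 1 / real (Suc n)" for n
  have e: "e n > 0" "e n \<le> 1" for n by (auto simp: e_def)
  have e0: "e \<longlonglongrightarrow> 0" unfolding e_def using LIMSEQ_inverse_real_of_nat by (simp add: inverse_eq_divide)
  have "\<forall>j. \<exists>z (n::nat) E (c :: nat \<Rightarrow> real^'n). afree A z \<and> TNpart {..<n} E \<and> (\<forall>i<n. \<forall>x\<in>E i. norm (x - c i) \<le> e j) \<and>
    (\<forall>f\<in>F j. (\<Sum>i<n. \<bar>integral\<^sup>L TN (\<lambda>x. indicator (E i) x * f (z x)) - integral\<^sup>L TN (\<lambda>x. indicator (E i) x * T x f)\<bar>) \<le> e j)"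
  proof
    fix j
    show "\<exists>z (n::nat) E (c :: nat \<Rightarrow> real^'n). afree A z \<and> TNpart {..<n} E \<and> (\<forall>i<n. \<forall>x\<in>E i. norm (x - c i) \<le> e j) \<and>
    (\<forall>f\<in>F j. (\<Sum>i<n. \<bar>integral\<^sup>L TN (\<lambda>x. indicator (E i) x * f (z x)) - integral\<^sup>L TN (\<lambda>x. indicator (E i) x * T x f)\<bar>) \<le> e j)"
      by (rule J.approximate_family[OF _ lipF \<Lambda>0 e(1)]) (simp add: F_def)
  qed
  from choice[OF this] obtain z where z1: "\<forall>j. \<exists>(n::nat) E (c :: nat \<Rightarrow> real^'n). afree A (z j) \<and> TNpart {..<n} E \<and> (\<forall>i<n. \<forall>x\<in>E i. norm (x - c i) \<le> e j) \<and>
    (\<forall>f\<in>F j. (\<Sum>i<n. \<bar>integral\<^sup>L TN (\<lambda>x. indicator (E i) x * f (z j x)) - integral\<^sup>L TN (\<lambda>x. indicator (E i) x * T x f)\<bar>) \<le> e j)" by (elim exE)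
  from choice[OF z1] obtain n where z2: "\<forall>j. \<exists>E (c :: nat \<Rightarrow> real^'n). afree A (z j) \<and> TNpart {..<n j :: nat} E \<and> (\<forall>i<n j. \<forall>x\<in>E i. norm (x - c i) \<le> e j) \<and>
    (\<forall>f\<in>F j. (\<Sum>i<n j. \<bar>integral\<^sup>L TN (\<lambda>x. indicator (E i) x * f (z j x)) - integral\<^sup>L TN (\<lambda>x. indicator (E i) x * T x f)\<bar>) \<le> e j)" by (elim exE)
  from choice[OF z2] obtain E where z3: "\<forall>j. \<exists>(c :: nat \<Rightarrow> real^'n). afree A (z j) \<and> TNpart {..<n j :: nat} (E j) \<and> (\<forall>i<n j. \<forall>x\<in>E j i. norm (x - c i) \<le> e j) \<and>
    (\<forall>f\<in>F j. (\<Sum>i<n j. \<bar>integral\<^sup>L TN (\<lambda>x. indicator (E j i) x * f (z j x)) - integral\<^sup>L TN (\<lambda>x. indicator (E j i) x * T x f)\<bar>) \<le> e j)" by (elim exE)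
  from choice[OF z3] obtain c where z4: "\<forall>j. afree A (z j) \<and> TNpart {..<n j :: nat} (E j) \<and> (\<forall>i<n j. \<forall>x\<in>E j i. norm (x - c j i) \<le> e j) \<and>
    (\<forall>f\<in>F j. (\<Sum>i<n j. \<bar>integral\<^sup>L TN (\<lambda>x. indicator (E j i) x * f (z j x)) - integral\<^sup>L TN (\<lambda>x. indicator (E j i) x * T x f)\<bar>) \<le> e j)" by (elim exE)
  have az: "afree A (z j)" and P: "TNpart {..<n j} (E j)" for j using z4 by auto
  have diam: "norm (x - c j i) \<le> e j" if "i < n j" "x \<in> E j i" for i j x using z4 that by blast
  have appr: "(\<Sum>i<n j. \<bar>integral\<^sup>L TN (\<lambda>x. indicator (E j i) x * f (z j x)) - integral\<^sup>L TN (\<lambda>x. indicator (E j i) x * T x f)\<bar>) \<le> e j" if "f \<in> F j" for f j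
    using z4 that by blast
  have Es: "E j i \<in> sets TN" if "i < n j" for i j using P[of j] that by (simp add: TNpart_def)
  have tz: "trig (z j)" for j by (rule trigV_imp_trig[OF az])
  have iz: "integrable TN (z j)" for j by (rule trig_integrable[OF tz])
  have c0: "continuous_on UNIV f0" by (rule lipschitz_continuous[OF lip0])
  have if0: "integrable TN (\<lambda>x. f0 (z j x))" for j by (rule integrable_lipschitz_comp[OF lip0 iz])
  \<comment> \<open>Since \<open>f0\<close> is nonnegative and \<open>T x f0\<close> vanishes almost
    everywhere, the summed cell errors bound its whole integral.\<close>
  have pen: "integral\<^sup>L TN (\<lambda>x. f0 (z j x)) \<le> e j" for j
  proof -
    have "AE x in TN. T x f0 = 0"
      using prob Teq
    proof eventually_elim
      case (elim x)
      have "T x f0 = sm_int (\<nu> x) f0" using elim(2) c0 by simp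
      also have "\<dots> = sm_int (\<nu> x) (\<lambda>_. 0)" by (rule prob_on_cong[OF elim(1) c0]) (auto simp: f0_def)
      finally show ?case using prob_on_const[OF elim(1), of 0] by simp
    qed
    then have "integral\<^sup>L TN (\<lambda>x. indicator (E j i) x * T x f0) = 0" for i
      by (intro integral_eq_zero_AE) (auto elim: AE_mp)
    then have "(\<Sum>i<n j. \<bar>integral\<^sup>L TN (\<lambda>x. indicator (E j i) x * f0 (z j x))\<bar>) \<le> e j" using appr[of f0 j] by (simp add: F_def)
    moreover have "integral\<^sup>L TN (\<lambda>x. f0 (z j x)) \<le> (\<Sum>i<n j. \<bar>integral\<^sup>L TN (\<lambda>x. indicator (E j i) x * f0 (z j x))\<bar>)"
      by (subst TNpart_integral[OF P[of j] if0[of j]]) (intro sum_mono abs_ge_self)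
    ultimately show ?thesis by linarith
  qed
  \<comment> \<open>Beyond this level \<open>norm z\<close> is at most
    \<open>2 * (norm z - R)\<close>, so twice the penalty dominates the tail required by
    (ZL).\<close>
  define L where "L = 2 * R + 1"
  have R0': "R \<ge> 0" by (simp add: R_def)
  have Lpos: "L > 0" using R0' by (simp add: L_def)
  obtain C where C: "\<forall>(u::nat \<Rightarrow> real^'n \<Rightarrow> real^'d) (L::real).
        (\<forall>n. L1T (u n) \<and> kerA A (u n)) \<and> L > 0 \<and>
        (\<lambda>n. integral\<^sup>L TN (\<lambda>x. if norm (u n x) > L then norm (u n x) else 0)) \<longlonglongrightarrow> 0
        \<longrightarrow> (\<exists>v::nat \<Rightarrow> real^'n \<Rightarrow> real^'d.
               (\<forall>n. L1T (v n) \<and> kerA A (v n) \<and> (AE x in TN. norm (v n x) \<le> C * L)) \<and>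
               (\<lambda>n. integral\<^sup>L TN (\<lambda>x. norm (v n x - u n x))) \<longlonglongrightarrow> 0)"
    using ZL unfolding property_ZL_def by (elim exE)
  have tail: "(\<lambda>j. integral\<^sup>L TN (\<lambda>x. if norm (z j x) > L then norm (z j x) else 0)) \<longlonglongrightarrow> 0"
  proof (rule tendsto_sandwich[OF _ _ tendsto_const])
    show "\<forall>\<^sub>F j in sequentially. 0 \<le> integral\<^sup>L TN (\<lambda>x. if norm (z j x) > L then norm (z j x) else 0)"
      by (intro always_eventually allI integral_nonneg_AE) auto
    show "\<forall>\<^sub>F j in sequentially. integral\<^sup>L TN (\<lambda>x. if norm (z j x) > L then norm (z j x) else 0) \<le> 2 * e j"
    proof (intro always_eventually allI)
      fix j
      have mz: "z j \<in> borel_measurable TN" using iz by (rule borel_measurable_integrable)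
      have "integral\<^sup>L TN (\<lambda>x. if norm (z j x) > L then norm (z j x) else 0) \<le> integral\<^sup>L TN (\<lambda>x. 2 * f0 (z j x))"
      proof (rule integral_mono)
        show "integrable TN (\<lambda>x. if norm (z j x) > L then norm (z j x) else 0)"
          by (rule Bochner_Integration.integrable_bound[OF integrable_norm[OF iz[of j]]]) (use mz in auto)
        show "integrable TN (\<lambda>x. 2 * f0 (z j x))" using if0 by simp
        show "(if norm (z j x) > L then norm (z j x) else 0) \<le> 2 * f0 (z j x)" for x
          unfolding f0_def L_def using R0' by auto
      qed
      then show "integral\<^sup>L TN (\<lambda>x. if norm (z j x) > L then norm (z j x) else 0) \<le> 2 * e j" using pen[of j] by simp
    qed
    have "(\<lambda>j. 2 * e j) \<longlonglongrightarrow> 2 * 0" by (intro tendsto_intros e0)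
    then show "(\<lambda>j. 2 * e j) \<longlonglongrightarrow> 0" by simp
  qed
  have "\<forall>j. L1T (z j) \<and> kerA A (z j)" using iz trig_periodic[OF tz] afree_kerA[OF az] by (simp add: L1T_def)
  from C[rule_format, OF conjI[OF this conjI[OF Lpos tail]]]
  obtain V where V: "\<forall>j. L1T (V j) \<and> kerA A (V j) \<and> (AE x in TN. norm (V j x) \<le> C * L)"
     and Vz: "(\<lambda>j. integral\<^sup>L TN (\<lambda>x. norm (V j x - z j x))) \<longlonglongrightarrow> 0" by (elim exE conjE)
  have iV: "integrable TN (V j)" and kV: "kerA A (V j)" and bV: "AE x in TN. norm (V j x) \<le> C * L" and pV: "periodic (V j)" for j
    using V by (auto simp: L1T_def)
  have mV: "V j \<in> borel_measurable TN" for j using iV by (rule borel_measurable_integrable)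
  have fV: "(\<lambda>x. f (V j x)) \<in> borel_measurable TN" if "continuous_on UNIV f" for f :: "real^'d \<Rightarrow> real" and j
    using borel_measurable_continuous_onI[OF that] mV[of j] by measurable
  have convg: "(\<lambda>j. integral\<^sup>L TN (\<lambda>x. g l (V j x) * \<psi> x)) \<longlonglongrightarrow> integral\<^sup>L TN (\<lambda>x. T x (g l) * \<psi> x)"
    if \<psi>: "continuous_on UNIV \<psi>" for l \<psi>
  proof -
    obtain B0 where B0: "\<forall>y. \<bar>g l y\<bar> \<le> B0" using g1 by blast
    define B where "B = \<bar>B0\<bar>"
    have B: "B \<ge> 0" "\<bar>g l y\<bar> \<le> B" for y using B0[rule_format, of y] unfolding B_def by linarith+
    have cg: "continuous_on UNIV (g l)" by (rule lipschitz_continuous[OF lg(2)])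
    have i\<psi>: "integrable TN \<psi>" by (rule integrable_TN_continuous[OF \<psi>])
    have mgz: "(\<lambda>x. g l (z j x)) \<in> borel_measurable TN" for j
      by (rule borel_measurable_integrable[OF integrable_lipschitz_comp[OF lg(2) iz]])
    have bT: "AE x in TN. \<bar>T x (g l)\<bar> \<le> B" by (rule Tbd[OF cg B(2)])
    define q where "q j x = g l (z j x) - T x (g l)" for j x
    \<comment> \<open>Before truncation the cell averages match by construction, which is the input
      of the partition lemma.\<close>
    have lim1: "(\<lambda>j. integral\<^sup>L TN (\<lambda>x. q j x * \<psi> x)) \<longlonglongrightarrow> 0"
    proof (rule weak_conv_partition[OF _ _ _ P diam _ e0 e(2) \<psi>])
      show "q j \<in> borel_measurable TN" for j unfolding q_def using mgz Tmeas[OF cg] by simp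
      show "AE x in TN. \<bar>q j x\<bar> \<le> 2 * B" for j
        using bT
      proof eventually_elim
        case (elim x)
        show ?case unfolding q_def using B(2)[of "z j x"] elim by linarith
      qed
      show "0 \<le> 2 * B" using B by simp
      show "\<forall>\<^sub>F j in sequentially. (\<Sum>i<n j. \<bar>integral\<^sup>L TN (\<lambda>x. indicator (E j i) x * q j x)\<bar>) \<le> e j"
        \<comment> \<open>\<open>g l\<close> is guaranteed to be in the list \<open>F j\<close> only
          when \<open>l < j\<close>.\<close>
        using eventually_gt_at_top[of l]
      proof eventually_elim
        case (elim j)
        have gF: "g l \<in> F j" using elim by (simp add: F_def)
        have "integral\<^sup>L TN (\<lambda>x. indicator (E j i) x * q j x) = integral\<^sup>L TN (\<lambda>x. indicator (E j i) x * g l (z j x)) - integral\<^sup>L TN (\<lambda>x. indicator (E j i) x * T x (g l))" if "i < n j" for i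
          unfolding q_def right_diff_distrib
          by (intro Bochner_Integration.integral_diff integrable_indicator_mult Es[OF that] integrable_lipschitz_comp[OF lg(2) iz] J.T_int cg)
        then show ?case using appr[OF gF] by simp
      qed
    qed
    have "bounded (\<psi> ` cbox 0 1)"
      by (intro compact_imp_bounded compact_continuous_image continuous_on_subset[OF \<psi>]) auto
    then obtain G where G: "\<forall>y\<in>\<psi> ` cbox 0 1. norm y \<le> G" unfolding bounded_iff by (elim exE)
    \<comment> \<open>Truncation moves the fields by a null sequence in L^1; the Lipschitz bound of
      \<open>g l\<close> and the bound \<open>G\<close> of \<open>\<psi>\<close> transfer this to
      the integrals.\<close>
    have lim2: "(\<lambda>j. integral\<^sup>L TN (\<lambda>x. (g l (V j x) - g l (z j x)) * \<psi> x)) \<longlonglongrightarrow> 0"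
    proof (rule Lim_null_comparison)
      show "\<forall>\<^sub>F j in sequentially. norm (integral\<^sup>L TN (\<lambda>x. (g l (V j x) - g l (z j x)) * \<psi> x)) \<le> lg l * \<bar>G\<bar> * integral\<^sup>L TN (\<lambda>x. norm (V j x - z j x))"
      proof (intro always_eventually allI)
        fix j
        have "\<bar>integral\<^sup>L TN (\<lambda>x. (g l (V j x) - g l (z j x)) * \<psi> x)\<bar> \<le> integral\<^sup>L TN (\<lambda>x. lg l * \<bar>G\<bar> * norm (V j x - z j x))"
        proof (rule integral_abs_mono)
          have "(\<lambda>x. g l (V j x) - g l (z j x)) \<in> borel_measurable TN" using fV[OF cg] mgz by simp
          moreover have "AE x in TN. \<bar>g l (V j x) - g l (z j x)\<bar> \<le> 2 * B"
          proof (rule AE_I2)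
            fix x show "\<bar>g l (V j x) - g l (z j x)\<bar> \<le> 2 * B" using B(2)[of "V j x"] B(2)[of "z j x"] by linarith
          qed
          ultimately show "integrable TN (\<lambda>x. (g l (V j x) - g l (z j x)) * \<psi> x)" using i\<psi> by (rule integrable_bounded_mult_AE)
          show "integrable TN (\<lambda>x. lg l * \<bar>G\<bar> * norm (V j x - z j x))" using iV iz by simp
          fix x :: "real^'n" assume "x \<in> space TN"
          then have "\<bar>\<psi> x\<bar> \<le> \<bar>G\<bar>" using G by force
          then have "\<bar>g l (V j x) - g l (z j x)\<bar> * \<bar>\<psi> x\<bar> \<le> (lg l * norm (V j x - z j x)) * \<bar>G\<bar>"
            using lg by (intro mult_mono) auto
          then show "\<bar>(g l (V j x) - g l (z j x)) * \<psi> x\<bar> \<le> lg l * \<bar>G\<bar> * norm (V j x - z j x)" by (simp add: abs_mult mult_ac)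
        qed
        then show "norm (integral\<^sup>L TN (\<lambda>x. (g l (V j x) - g l (z j x)) * \<psi> x)) \<le> lg l * \<bar>G\<bar> * integral\<^sup>L TN (\<lambda>x. norm (V j x - z j x))" by simp
      qed
      have "(\<lambda>j. lg l * \<bar>G\<bar> * integral\<^sup>L TN (\<lambda>x. norm (V j x - z j x))) \<longlonglongrightarrow> lg l * \<bar>G\<bar> * 0" by (intro tendsto_intros Vz)
      then show "(\<lambda>j. lg l * \<bar>G\<bar> * integral\<^sup>L TN (\<lambda>x. norm (V j x - z j x))) \<longlonglongrightarrow> 0" by simp
    qed
    have eq: "integral\<^sup>L TN (\<lambda>x. g l (V j x) * \<psi> x) = integral\<^sup>L TN (\<lambda>x. (g l (V j x) - g l (z j x)) * \<psi> x) + integral\<^sup>L TN (\<lambda>x. q j x * \<psi> x) + integral\<^sup>L TN (\<lambda>x. T x (g l) * \<psi> x)" for j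
    proof -
      have j1: "integrable TN (\<lambda>x. g l (V j x) * \<psi> x)" by (rule integrable_bounded_mult_AE[OF fV[OF cg] _ i\<psi>, where B=B]) (simp add: B)
      have j2: "integrable TN (\<lambda>x. g l (z j x) * \<psi> x)" by (rule integrable_bounded_mult_AE[OF mgz _ i\<psi>, where B=B]) (simp add: B)
      have j3: "integrable TN (\<lambda>x. T x (g l) * \<psi> x)" by (rule integrable_bounded_mult_AE[OF Tmeas[OF cg] bT i\<psi>])
      show ?thesis unfolding q_def left_diff_distrib using j1 j2 j3 by simp
    qed
    have "(\<lambda>j. integral\<^sup>L TN (\<lambda>x. g l (V j x) * \<psi> x)) \<longlonglongrightarrow> 0 + 0 + integral\<^sup>L TN (\<lambda>x. T x (g l) * \<psi> x)"
      unfolding eq by (intro tendsto_add lim1 lim2 tendsto_const)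
    then show ?thesis by simp
  qed
  have gen: "generates \<nu> V"
    unfolding generates_def weakstar_Linf_def
  proof (intro allI impI conjI)
    fix f :: "real^'d \<Rightarrow> real" assume f: "C0 f"
    have cf: "continuous_on UNIV f" using f by (simp add: C0_def)
    obtain B where B: "B \<ge> 0" "\<And>y. \<bar>f y\<bar> \<le> B" using C0_bounded[OF f] by auto
    have ms: "(\<lambda>x. sm_int (\<nu> x) f) \<in> borel_measurable TN" by (rule sm_int_C0_measurable[OF w f])
    have bs: "AE x in TN. \<bar>sm_int (\<nu> x) f\<bar> \<le> B" using prob by eventually_elim (rule prob_on_abs_le[OF _ cf B(2)])
    show "LinfT (\<lambda>x. sm_int (\<nu> x) f)" unfolding LinfT_def
      using ms bs per by (auto simp: periodic_def)
    fix \<psi> :: "real^'n \<Rightarrow> real" assume "L1T \<psi>"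
    then have i\<psi>: "integrable TN \<psi>" by (simp add: L1T_def)
    show "(\<lambda>j. integral\<^sup>L TN (\<lambda>x. f (V j x) * \<psi> x)) \<longlonglongrightarrow> integral\<^sup>L TN (\<lambda>x. sm_int (\<nu> x) f * \<psi> x)"
    proof (rule weak_conv_extend[OF fV[OF cf] _ ms bs _ i\<psi>])
      show "AE x in TN. \<bar>f (V j x)\<bar> \<le> B" for j using B by simp
      fix \<chi>' :: "real^'n \<Rightarrow> real" assume c: "continuous_on UNIV \<chi>'"
      have i: "integrable TN \<chi>'" by (rule integrable_TN_continuous[OF c])
      define G where "G = integral\<^sup>L TN (\<lambda>x. \<bar>\<chi>' x\<bar>)"
      have G0: "G \<ge> 0" by (simp add: G_def)
      show "(\<lambda>j. integral\<^sup>L TN (\<lambda>x. f (V j x) * \<chi>' x)) \<longlonglongrightarrow> integral\<^sup>L TN (\<lambda>x. sm_int (\<nu> x) f * \<chi>' x)"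
      proof (rule LIMSEQ_I)
        fix r :: real assume r: "r > 0"
        define \<epsilon> where "\<epsilon> = r / (3 * (G + 1))"
        have \<epsilon>: "\<epsilon> > 0" using r G0 by (simp add: \<epsilon>_def)
        have \<epsilon>G: "\<epsilon> * G \<le> r / 3" using r G0 by (simp add: \<epsilon>_def field_simps)
        \<comment> \<open>This ball contains both the supports of the measures and, almost
          everywhere, the values of the truncated fields; only there has \<open>f\<close> to be
          approximated.\<close>
        define R2 where "R2 = max R (C * L)"
        obtain l where l: "\<forall>y\<in>cball 0 R2. \<bar>f y - g l y\<bar> \<le> \<epsilon>" using g2[rule_format, OF conjI[OF cf \<epsilon>], of R2] by (elim exE)
        have cg: "continuous_on UNIV (g l)" by (rule lipschitz_continuous[OF lg(2)])
        obtain Bg where Bg: "\<forall>y. \<bar>g l y\<bar> \<le> Bg" using g1 by blast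
        have k1: "integrable TN (\<lambda>x. f (V j x) * \<chi>' x)" "integrable TN (\<lambda>x. g l (V j x) * \<chi>' x)" for j
          by (rule integrable_bounded_mult_AE[OF fV[OF cf] _ i, where B=B], simp add: B, rule integrable_bounded_mult_AE[OF fV[OF cg] _ i, where B=Bg], simp add: Bg)
        have k2: "integrable TN (\<lambda>x. sm_int (\<nu> x) f * \<chi>' x)" by (rule integrable_bounded_mult_AE[OF ms bs i])
        have k3: "integrable TN (\<lambda>x. T x (g l) * \<chi>' x)" by (rule integrable_bounded_mult_AE[OF Tmeas[OF cg] Tbd[OF cg, of Bg] i]) (simp add: Bg)
        have d1: "\<bar>integral\<^sup>L TN (\<lambda>x. f (V j x) * \<chi>' x) - integral\<^sup>L TN (\<lambda>x. g l (V j x) * \<chi>' x)\<bar> \<le> r / 3" for j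
        proof -
          have "AE x in TN. \<bar>f (V j x) - g l (V j x)\<bar> \<le> \<epsilon>" using bV[of j] by eventually_elim (use l in \<open>simp add: R2_def\<close>)
          then have "\<bar>integral\<^sup>L TN (\<lambda>x. (f (V j x) - g l (V j x)) * \<chi>' x)\<bar> \<le> \<epsilon> * G"
            unfolding G_def by (intro integral_bounded_mult_le i borel_measurable_diff fV cf cg)
          then show ?thesis using k1[of j] \<epsilon>G by (simp add: left_diff_distrib)
        qed
        have d2: "\<bar>integral\<^sup>L TN (\<lambda>x. sm_int (\<nu> x) f * \<chi>' x) - integral\<^sup>L TN (\<lambda>x. T x (g l) * \<chi>' x)\<bar> \<le> r / 3"
        proof -
          have "AE x in TN. \<bar>sm_int (\<nu> x) f - T x (g l)\<bar> \<le> \<epsilon>"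
            using prob Teq
          proof eventually_elim
            case (elim x)
            have "\<bar>sm_int (\<nu> x) f - sm_int (\<nu> x) (g l)\<bar> \<le> \<epsilon>" by (rule prob_on_diff[OF elim(1) cf cg]) (use l in \<open>simp add: R2_def\<close>)
            then show ?case using elim(2) cg by simp
          qed
          then have "\<bar>integral\<^sup>L TN (\<lambda>x. (sm_int (\<nu> x) f - T x (g l)) * \<chi>' x)\<bar> \<le> \<epsilon> * G"
            unfolding G_def by (intro integral_bounded_mult_le i borel_measurable_diff ms Tmeas cg)
          then show ?thesis using k2 k3 \<epsilon>G by (simp add: left_diff_distrib)
        qed
        obtain J0 where J0: "\<forall>j\<ge>J0. norm (integral\<^sup>L TN (\<lambda>x. g l (V j x) * \<chi>' x) - integral\<^sup>L TN (\<lambda>x. T x (g l) * \<chi>' x)) < r / 3"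
          using LIMSEQ_D[OF convg[OF c], of "r / 3"] r by auto
        show "\<exists>no. \<forall>j\<ge>no. norm (integral\<^sup>L TN (\<lambda>x. f (V j x) * \<chi>' x) - integral\<^sup>L TN (\<lambda>x. sm_int (\<nu> x) f * \<chi>' x)) < r"
        proof (intro exI[of _ J0] allI impI)
          fix j assume "j \<ge> J0"
          with J0 have "norm (integral\<^sup>L TN (\<lambda>x. g l (V j x) * \<chi>' x) - integral\<^sup>L TN (\<lambda>x. T x (g l) * \<chi>' x)) < r / 3" by blast
          then show "norm (integral\<^sup>L TN (\<lambda>x. f (V j x) * \<chi>' x) - integral\<^sup>L TN (\<lambda>x. sm_int (\<nu> x) f * \<chi>' x)) < r"
            using d1[of j] d2 unfolding real_norm_def by linarith
        qed
      qed
    qed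
  qed
  have "\<forall>j. LinfT (V j) \<and> kerA A (V j)" using mV bV pV kV unfolding LinfT_def by blast
  then show ?thesis unfolding A_infty_YM_def using bV gen by blast
qed

section \<open>Necessity: Jensen's inequality on a measurable set\<close>

lemma Phi_norm_integrable:
  assumes "\<phi> \<in> Phi A"
  shows "integrable TN \<phi>"
  using assms unfolding Phi_def by (auto intro: trig_integrable dest: trigV_imp_trig)

lemma smth_approx:
  fixes b :: "real^'n::finite \<Rightarrow> 'b::euclidean_space"
  assumes "b \<in> borel_measurable TN" "AE x in TN. norm (b x) \<le> B" "e > 0"
  shows "\<exists>m. integral\<^sup>L TN (\<lambda>x. norm (smth m b x - b x)) < e"
proof -
  have "\<forall>\<^sub>F m in sequentially. integral\<^sup>L TN (\<lambda>x. norm (smth m b x - b x)) < e"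
    using smth_L1[OF assms(1,2)] assms(3) by (rule order_tendstoD)
  then show ?thesis by (auto simp: eventually_sequentially)
qed

text \<open>After smoothing, \<open>b j\<close> is multiplied by a trigonometric approximation of
  the indicator of \<open>E\<close>, projected, truncated, smoothed again and freed of its mean. The
  result is an admissible test field close in L^1 to \<open>b j\<close> on \<open>E\<close> and to
  zero elsewhere. In the quasiconvexity inequality the part outside \<open>E\<close> reproduces
  \<open>f a\<close> and cancels against the left-hand side.\<close>

lemma local_jensen:
  fixes A :: "'n::finite \<Rightarrow> real^'d::finite^'l::finite" and b :: "nat \<Rightarrow> real^'n \<Rightarrow> real^'d"
  assumes cr: "constant_rank A" and ZL: "property_ZL A" and f: "A_quasiconvex A f"
    and b: "\<And>j. b j \<in> borel_measurable TN" "\<And>j. AE x in TN. norm (b j x) \<le> B" "\<And>j. kerA A (b j)" and B: "B \<ge> 0"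
    and weak: "\<And>\<psi>. continuous_on UNIV \<psi> \<Longrightarrow> (\<lambda>j. integral\<^sup>L TN (\<lambda>x. \<psi> x *\<^sub>R b j x)) \<longlonglongrightarrow> 0"
    and E: "E \<in> sets TN" and \<eta>: "\<eta> > 0"
  shows "\<forall>\<^sub>F j in sequentially. measure TN E * f a \<le> integral\<^sup>L TN (\<lambda>x. indicator E x * f (a + b j x)) + \<eta>"
proof -
  have cf: "continuous_on UNIV f" using f by (simp add: A_quasiconvex_def)
  obtain C where C: "\<forall>(u::nat \<Rightarrow> real^'n \<Rightarrow> real^'d) (L::real).
        (\<forall>n. L1T (u n) \<and> kerA A (u n)) \<and> L > 0 \<and>
        (\<lambda>n. integral\<^sup>L TN (\<lambda>x. if norm (u n x) > L then norm (u n x) else 0)) \<longlonglongrightarrow> 0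
        \<longrightarrow> (\<exists>v::nat \<Rightarrow> real^'n \<Rightarrow> real^'d.
               (\<forall>n. L1T (v n) \<and> kerA A (v n) \<and> (AE x in TN. norm (v n x) \<le> C * L)) \<and>
               (\<lambda>n. integral\<^sup>L TN (\<lambda>x. norm (v n x - u n x))) \<longlonglongrightarrow> 0)"
    using ZL unfolding property_ZL_def by (elim exE)
  \<comment> \<open>As \<open>norm w \<le> B\<close>, any \<open>z\<close> beyond this level
    satisfies \<open>norm z \<le> 2 * norm (w - z)\<close>; so L^1 closeness to \<open>w j\<close>
    gives the tail condition of (ZL).\<close>
  define L where "L = 2 * B + 1"
  have Lpos: "L > 0" using B by (simp add: L_def)
  define D where "D = \<bar>C * L\<bar>"
  \<comment> \<open>The ball contains \<open>a + p\<close> for the final test field, bounded by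
    \<open>2 * D\<close> after subtraction of its mean, and \<open>a + b\<close>, bounded through
    \<open>B\<close>.\<close>
  define Rb where "Rb = norm a + 2 * D + B"
  obtain C1 where C1: "C1 \<ge> 0" "\<forall>y\<in>cball 0 Rb. \<forall>z\<in>cball 0 Rb. \<bar>f y - f z\<bar> \<le> \<eta> / 3 + C1 * norm (y - z)"
    using continuous_modulus[OF cf, of "\<eta> / 3" Rb] \<eta> by auto
  \<comment> \<open>Tolerance for the indicator: its contribution \<open>C1 * (B * \<delta>)\<close>
    stays below \<open>\<eta> / 6\<close>, and the terms \<open>+ 1\<close> exclude zero
    denominators.\<close>
  define \<delta> where "\<delta> = \<eta> / (6 * (C1 + 1) * (B + 1))"
  have \<delta>: "\<delta> > 0" unfolding \<delta>_def using \<eta> C1(1) B by (intro divide_pos_pos mult_pos_pos) auto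
  have C1B\<delta>: "C1 * (B * \<delta>) \<le> \<eta> / 6"
  proof -
    have "C1 * (B * \<delta>) = \<eta> / 6 * ((C1 / (C1 + 1)) * (B / (B + 1)))" by (simp add: \<delta>_def algebra_simps)
    also have "\<dots> \<le> \<eta> / 6 * (1 * 1)"
      using \<eta> C1(1) B by (intro mult_left_mono mult_mono) auto
    finally show ?thesis by simp
  qed
  obtain h :: "real^'n \<Rightarrow> real" where h: "trig h" "\<forall>x. \<bar>h x\<bar> \<le> 1" "integral\<^sup>L TN (\<lambda>x. \<bar>h x - indicator E x\<bar>) < \<delta>"
    using indicator_approx[OF E \<delta>] by (elim exE conjE)
  have hb: "\<bar>h x\<bar> \<le> 1" for x using h(2) by blast
  define e where "e j = 1 / real (Suc j)" for j
  have e: "e j > 0" for j by (simp add: e_def)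
  have e0: "e \<longlonglongrightarrow> 0" unfolding e_def using LIMSEQ_inverse_real_of_nat by (simp add: inverse_eq_divide)
  have ib: "integrable TN (b j)" for j by (rule integrable_TN_bounded[OF b(1,2)])
  \<comment> \<open>Smoothing within \<open>e j\<close> turns \<open>b j\<close> into an A-free
    trigonometric polynomial, to which the product rule and the projection apply.\<close>
  have "\<forall>j. \<exists>m. integral\<^sup>L TN (\<lambda>x. norm (smth m (b j) x - b j x)) < e j"
    by (intro allI smth_approx[OF b(1,2) e])
  from choice[OF this] obtain m where m: "\<forall>j. integral\<^sup>L TN (\<lambda>x. norm (smth (m j) (b j) x - b j x)) < e j" by (elim exE)
  define b' where "b' j = smth (m j) (b j)" for j
  have ab': "afree A (b' j)" for j unfolding b'_def by (rule afree_smth[OF b(3) ib])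
  have tb': "trig (b' j)" for j by (rule trigV_imp_trig[OF ab'])
  have ib': "integrable TN (b' j)" for j by (rule trig_integrable[OF tb'])
  have bb': "norm (b' j x) \<le> B" for j x unfolding b'_def by (rule norm_smth_bound[OF ib b(2)])
  have close: "integral\<^sup>L TN (\<lambda>x. norm (b' j x - b j x)) < e j" for j using m by (simp add: b'_def)
  have ibb: "integrable TN (\<lambda>x. norm (b' j x - b j x))" for j using ib ib' by simp
  define w where "w j x = h x *\<^sub>R b' j x" for j x
  have tw: "trig (w j)" for j unfolding w_def by (rule trig_mult[OF h(1) tb'])
  have iw: "integrable TN (w j)" for j by (rule trig_integrable[OF tw])
  have bw: "norm (w j x) \<le> B" for j x
    unfolding w_def norm_scaleR using mult_mono[of "\<bar>h x\<bar>" 1 "norm (b' j x)" B] hb[of x] bb'[of j x] by simp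
  obtain G where G: "\<forall>\<psi>. afree A \<psi> \<and> (\<forall>x. norm (\<psi> x) \<le> B) \<longrightarrow> (\<forall>x. norm (Aop A (\<lambda>x. h x *\<^sub>R \<psi> x) x) \<le> G)"
    using Aop_mult_bound[OF h(1) B, of A] by (elim exE conjE)
  have Gw: "norm (Aop A (w j) x) \<le> G" for j x
    unfolding w_def using G ab' bb' by blast
  have weak': "(\<lambda>j. integral\<^sup>L TN (\<lambda>x. \<psi> x *\<^sub>R w j x)) \<longlonglongrightarrow> 0" if \<psi>: "continuous_on UNIV \<psi>" and \<psi>1: "\<And>x. \<bar>\<psi> x\<bar> \<le> 1" for \<psi>
  proof -
    have c: "continuous_on UNIV (\<lambda>x. \<psi> x * h x)" by (intro continuous_on_mult \<psi> trig_continuous h)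
    have b1: "\<bar>\<psi> x * h x\<bar> \<le> 1" for x using mult_mono[of "\<bar>\<psi> x\<bar>" 1 "\<bar>h x\<bar>" 1] \<psi>1[of x] hb[of x] by (simp add: abs_mult)
    have cm: "(\<lambda>x. \<psi> x * h x) \<in> borel_measurable TN" by (rule continuous_borel_measurable_TN[OF c])
    have i1: "integrable TN (\<lambda>x. (\<psi> x * h x) *\<^sub>R b j x)" for j by (rule integrable_bounded_scaleR[OF cm b1 ib])
    have i2: "integrable TN (\<lambda>x. (\<psi> x * h x) *\<^sub>R (b' j x - b j x))" for j
      by (rule integrable_bounded_scaleR[OF cm b1 Bochner_Integration.integrable_diff[OF ib' ib]])
    have eq: "integral\<^sup>L TN (\<lambda>x. \<psi> x *\<^sub>R w j x) = integral\<^sup>L TN (\<lambda>x. (\<psi> x * h x) *\<^sub>R b j x) + integral\<^sup>L TN (\<lambda>x. (\<psi> x * h x) *\<^sub>R (b' j x - b j x))" for j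
    proof -
      have "integral\<^sup>L TN (\<lambda>x. \<psi> x *\<^sub>R w j x) = integral\<^sup>L TN (\<lambda>x. (\<psi> x * h x) *\<^sub>R b j x + (\<psi> x * h x) *\<^sub>R (b' j x - b j x))"
        by (intro Bochner_Integration.integral_cong refl) (simp add: w_def scaleR_diff_right)
      also have "\<dots> = integral\<^sup>L TN (\<lambda>x. (\<psi> x * h x) *\<^sub>R b j x) + integral\<^sup>L TN (\<lambda>x. (\<psi> x * h x) *\<^sub>R (b' j x - b j x))"
        by (rule Bochner_Integration.integral_add[OF i1 i2])
      finally show ?thesis .
    qed
    have l2: "(\<lambda>j. integral\<^sup>L TN (\<lambda>x. (\<psi> x * h x) *\<^sub>R (b' j x - b j x))) \<longlonglongrightarrow> 0"
    proof (rule Lim_null_comparison[OF _ e0], intro always_eventually allI)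
      fix j
      have "norm (integral\<^sup>L TN (\<lambda>x. (\<psi> x * h x) *\<^sub>R (b' j x - b j x))) \<le> integral\<^sup>L TN (\<lambda>x. norm ((\<psi> x * h x) *\<^sub>R (b' j x - b j x)))" by (rule integral_norm_bound)
      also have "\<dots> \<le> integral\<^sup>L TN (\<lambda>x. norm (b' j x - b j x))"
      proof (rule integral_mono[OF integrable_norm[OF i2] ibb])
        show "norm ((\<psi> x * h x) *\<^sub>R (b' j x - b j x)) \<le> norm (b' j x - b j x)" for x
          unfolding norm_scaleR using mult_right_mono[OF b1[of x], of "norm (b' j x - b j x)"] by simp
      qed
      finally show "norm (integral\<^sup>L TN (\<lambda>x. (\<psi> x * h x) *\<^sub>R (b' j x - b j x))) \<le> e j" using close[of j] by linarith
    qed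
    have "(\<lambda>j. integral\<^sup>L TN (\<lambda>x. \<psi> x *\<^sub>R w j x)) \<longlonglongrightarrow> 0 + 0" unfolding eq by (intro tendsto_add weak[OF c] l2)
    then show ?thesis by simp
  qed
  have low: "(\<lambda>j. cco k (w j)) \<longlonglongrightarrow> 0" "(\<lambda>j. sco k (w j)) \<longlonglongrightarrow> 0" for k
  proof -
    have "continuous_on UNIV (\<lambda>x. tcos k x)" "continuous_on UNIV (\<lambda>x. tsin k x)" by (intro continuous_intros)+
    then show "(\<lambda>j. cco k (w j)) \<longlonglongrightarrow> 0" "(\<lambda>j. sco k (w j)) \<longlonglongrightarrow> 0"
      unfolding cco_def sco_def by (intro weak'; simp)+
  qed
  define dst where "dst j z = integral\<^sup>L TN (\<lambda>x. norm (w j x - z x))" for j z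
  have dst0: "dst j z \<ge> 0" for j z by (simp add: dst_def)
  \<comment> \<open>The projection lemma gives, for each tolerance, only a threshold for
    \<open>j\<close>. Almost minimisers of the distance to \<open>Phi A\<close> form one sequence
    that is eventually good for every tolerance.\<close>
  define d where "d j = (INF z\<in>Phi A. dst j z)" for j
  have bdd: "bdd_below (dst j ` Phi A)" for j by (rule bdd_belowI2[of _ 0]) (rule dst0)
  have ne: "Phi A \<noteq> {}" using zero_in_Phi by blast
  have d0: "d j \<ge> 0" for j unfolding d_def using ne dst0 by (intro cINF_greatest) auto
  have "\<forall>j. \<exists>z. z \<in> Phi A \<and> dst j z < d j + e j"
  proof
    fix j
    have "d j < d j + e j" using e[of j] by simp
    then show "\<exists>z. z \<in> Phi A \<and> dst j z < d j + e j" using cINF_less_iff[OF ne bdd] unfolding d_def by blast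
  qed
  from choice[OF this] obtain z where z: "\<forall>j. z j \<in> Phi A \<and> dst j (z j) < d j + e j" by (elim exE)
  have zPhi: "z j \<in> Phi A" for j using z by blast
  have dlim: "d \<longlonglongrightarrow> 0"
  proof (rule LIMSEQ_I)
    fix r :: real assume r: "r > 0"
    obtain J where J: "\<forall>j\<ge>J. \<exists>z. afree A z \<and> integral\<^sup>L TN z = 0 \<and> integral\<^sup>L TN (\<lambda>x. norm (w j x - z x)) \<le> r / 2"
      using afree_projection_small[OF cr _ tw Gw low, of "r / 2"] r by auto
    show "\<exists>no. \<forall>j\<ge>no. norm (d j - 0) < r"
    proof (intro exI[of _ J] allI impI)
      fix j assume "j \<ge> J"
      with J obtain z' where z': "afree A z'" "integral\<^sup>L TN z' = 0" "integral\<^sup>L TN (\<lambda>x. norm (w j x - z' x)) \<le> r / 2" by blast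
      then have "d j \<le> dst j z'" unfolding d_def by (intro cINF_lower[OF bdd]) (simp add: Phi_def)
      then show "norm (d j - 0) < r" using z'(3) d0[of j] r by (simp add: dst_def)
    qed
  qed
  have zw: "(\<lambda>j. integral\<^sup>L TN (\<lambda>x. norm (w j x - z j x))) \<longlonglongrightarrow> 0"
  proof (rule tendsto_sandwich[OF _ _ tendsto_const])
    have "(\<lambda>j. d j + e j) \<longlonglongrightarrow> 0 + 0" by (intro tendsto_add dlim e0)
    then show "(\<lambda>j. d j + e j) \<longlonglongrightarrow> 0" by simp
    show "\<forall>\<^sub>F j in sequentially. 0 \<le> integral\<^sup>L TN (\<lambda>x. norm (w j x - z j x))" by (intro always_eventually allI) simp
    show "\<forall>\<^sub>F j in sequentially. integral\<^sup>L TN (\<lambda>x. norm (w j x - z j x)) \<le> d j + e j"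
      using z by (intro always_eventually allI) (auto simp: dst_def intro: less_imp_le)
  qed
  have az: "afree A (z j)" and mz: "integral\<^sup>L TN (z j) = 0" for j using zPhi[of j] by (auto simp: Phi_def)
  have iz: "integrable TN (z j)" for j by (rule Phi_norm_integrable[OF zPhi])
  have izw: "integrable TN (\<lambda>x. norm (w j x - z j x))" for j using iw iz by simp
  have tail: "(\<lambda>j. integral\<^sup>L TN (\<lambda>x. if norm (z j x) > L then norm (z j x) else 0)) \<longlonglongrightarrow> 0"
  proof (rule tendsto_sandwich[OF _ _ tendsto_const])
    show "\<forall>\<^sub>F j in sequentially. 0 \<le> integral\<^sup>L TN (\<lambda>x. if norm (z j x) > L then norm (z j x) else 0)"
      by (intro always_eventually allI integral_nonneg_AE) auto
    show "\<forall>\<^sub>F j in sequentially. integral\<^sup>L TN (\<lambda>x. if norm (z j x) > L then norm (z j x) else 0) \<le> 2 * integral\<^sup>L TN (\<lambda>x. norm (w j x - z j x))"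
    proof (intro always_eventually allI)
      fix j
      have mz: "z j \<in> borel_measurable TN" using iz by (rule borel_measurable_integrable)
      have "integral\<^sup>L TN (\<lambda>x. if norm (z j x) > L then norm (z j x) else 0) \<le> integral\<^sup>L TN (\<lambda>x. 2 * norm (w j x - z j x))"
      proof (rule integral_mono)
        show "integrable TN (\<lambda>x. if norm (z j x) > L then norm (z j x) else 0)"
          by (rule Bochner_Integration.integrable_bound[OF integrable_norm[OF iz[of j]]]) (use mz in auto)
        show "integrable TN (\<lambda>x. 2 * norm (w j x - z j x))" using izw by simp
        fix x
        have "norm (z j x) \<le> norm (w j x) + norm (w j x - z j x)" by norm
        then show "(if norm (z j x) > L then norm (z j x) else 0) \<le> 2 * norm (w j x - z j x)"
          unfolding L_def using bw[of j x] by auto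
      qed
      then show "integral\<^sup>L TN (\<lambda>x. if norm (z j x) > L then norm (z j x) else 0) \<le> 2 * integral\<^sup>L TN (\<lambda>x. norm (w j x - z j x))" by simp
    qed
    have "(\<lambda>j. 2 * integral\<^sup>L TN (\<lambda>x. norm (w j x - z j x))) \<longlonglongrightarrow> 2 * 0" by (intro tendsto_intros zw)
    then show "(\<lambda>j. 2 * integral\<^sup>L TN (\<lambda>x. norm (w j x - z j x))) \<longlonglongrightarrow> 0" by simp
  qed
  have "\<forall>j. L1T (z j) \<and> kerA A (z j)" using iz trig_periodic[OF trigV_imp_trig[OF az]] afree_kerA[OF az] by (simp add: L1T_def)
  from C[rule_format, OF conjI[OF this conjI[OF Lpos tail]]]
  obtain y where y: "\<forall>j. L1T (y j) \<and> kerA A (y j) \<and> (AE x in TN. norm (y j x) \<le> C * L)"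
     and yz: "(\<lambda>j. integral\<^sup>L TN (\<lambda>x. norm (y j x - z j x))) \<longlonglongrightarrow> 0" by (elim exE conjE)
  have iy: "integrable TN (y j)" and ky: "kerA A (y j)" and by': "AE x in TN. norm (y j x) \<le> C * L" for j
    using y by (auto simp: L1T_def)
  have byD: "AE x in TN. norm (y j x) \<le> D" for j using by'[of j] unfolding D_def by eventually_elim linarith
  have my: "y j \<in> borel_measurable TN" for j using iy by (rule borel_measurable_integrable)
  have "\<forall>j. \<exists>m. integral\<^sup>L TN (\<lambda>x. norm (smth m (y j) x - y j x)) < e j"
    by (intro allI smth_approx[OF my byD e])
  from choice[OF this] obtain m' where m': "\<forall>j. integral\<^sup>L TN (\<lambda>x. norm (smth (m' j) (y j) x - y j x)) < e j" by (elim exE)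
  define y' where "y' j = smth (m' j) (y j)" for j
  have ay': "afree A (y' j)" for j unfolding y'_def by (rule afree_smth[OF ky iy])
  have iy': "integrable TN (y' j)" for j by (rule trig_integrable[OF trigV_imp_trig[OF ay']])
  have by2: "norm (y' j x) \<le> D" for j x unfolding y'_def by (rule norm_smth_bound[OF iy byD])
  define \<mu> where "\<mu> j = integral\<^sup>L TN (y' j)" for j
  \<comment> \<open>Truncation and smoothing may have created a mean, so it is removed; it tends to
    zero because the \<open>z j\<close> have mean zero.\<close>
  define p where "p j x = y' j x - \<mu> j" for j x
  have D0: "D \<ge> 0" by (simp add: D_def)
  have b\<mu>: "norm (\<mu> j) \<le> D" for j
  proof -
    have "norm (\<mu> j) \<le> integral\<^sup>L TN (\<lambda>x. norm (y' j x))" unfolding \<mu>_def by (rule integral_norm_bound)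
    also have "\<dots> \<le> integral\<^sup>L TN (\<lambda>x::real^'n. D)" using iy' by2 by (intro integral_mono) auto
    finally show ?thesis by simp
  qed
  have pPhi: "p j \<in> Phi A" for j
  proof -
    have "afree A (p j)" unfolding p_def by (rule afree_diff[OF ay' afree_const])
    moreover have "integral\<^sup>L TN (p j) = 0" unfolding p_def using iy' by (simp add: \<mu>_def)
    ultimately show ?thesis by (simp add: Phi_def)
  qed
  have ap: "afree A (p j)" and mp: "integral\<^sup>L TN (p j) = 0" for j using pPhi[of j] by (auto simp: Phi_def)
  have tp: "trig (p j)" for j by (rule trigV_imp_trig[OF ap])
  have bp: "norm (p j x) \<le> 2 * D" for j x
    using norm_triangle_ineq4[of "y' j x" "\<mu> j"] by2[of j x] b\<mu>[of j] unfolding p_def by linarith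
  define s where "s j = e j + integral\<^sup>L TN (\<lambda>x. norm (y j x - z j x))" for j
  \<comment> \<open>The total L^1 effect of truncation and second smoothing, collected in the null
    sequence \<open>s\<close>.\<close>
  have y'z: "integral\<^sup>L TN (\<lambda>x. norm (y' j x - z j x)) \<le> s j" for j
  proof -
    have "integral\<^sup>L TN (\<lambda>x. norm (y' j x - z j x)) \<le> integral\<^sup>L TN (\<lambda>x. norm (y' j x - y j x) + norm (y j x - z j x))"
    proof (rule integral_mono)
      show "norm (y' j x - z j x) \<le> norm (y' j x - y j x) + norm (y j x - z j x)" for x by norm
    qed (use iy' iy iz in auto)
    also have "\<dots> = integral\<^sup>L TN (\<lambda>x. norm (y' j x - y j x)) + integral\<^sup>L TN (\<lambda>x. norm (y j x - z j x))" using iy' iy iz by simp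
    finally show ?thesis using m'[rule_format, of j] unfolding s_def y'_def by linarith
  qed
  have \<mu>s: "norm (\<mu> j) \<le> s j" for j
  proof -
    have "\<mu> j = integral\<^sup>L TN (\<lambda>x. y' j x - z j x)" unfolding \<mu>_def using iy' iz mz by simp
    then have "norm (\<mu> j) \<le> integral\<^sup>L TN (\<lambda>x. norm (y' j x - z j x))" by (simp only: integral_norm_bound)
    then show ?thesis using y'z[of j] by linarith
  qed
  have slim: "s \<longlonglongrightarrow> 0"
  proof -
    have "s \<longlonglongrightarrow> 0 + 0" unfolding s_def by (intro tendsto_add e0 yz)
    then show ?thesis by simp
  qed
  have iEb: "integrable TN (\<lambda>x. indicator E x *\<^sub>R b j x)" for j by (rule integrable_indicator_scaleR[OF E ib])
  define t where "t j = 2 * s j + integral\<^sup>L TN (\<lambda>x. norm (w j x - z j x)) + e j" for j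
  have tlim: "t \<longlonglongrightarrow> 0"
  proof -
    have "t \<longlonglongrightarrow> 2 * 0 + 0 + 0" unfolding t_def by (intro tendsto_intros slim zw e0)
    then show ?thesis by simp
  qed
  have tri: "norm (Y - m - q) \<le> norm (Y - Z) + norm m + norm (W - Z) + norm (W - q)" for Y m q Z W :: "real^'d"
    by norm
  have pE: "integral\<^sup>L TN (\<lambda>x. norm (p j x - indicator E x *\<^sub>R b j x)) \<le> t j + B * \<delta>" for j
  proof -
    have ih: "integrable TN (\<lambda>x. B * \<bar>h x - indicator E x\<bar>)"
      using trig_integrable[OF h(1)] integrable_indicator_mult[OF E, of "\<lambda>_. 1"] by simp
    have "integral\<^sup>L TN (\<lambda>x. norm (p j x - indicator E x *\<^sub>R b j x)) \<le> integral\<^sup>L TN (\<lambda>x. norm (y' j x - z j x) + norm (\<mu> j) + norm (w j x - z j x) + B * \<bar>h x - indicator E x\<bar> + norm (b' j x - b j x))"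
    proof (rule integral_mono)
      show "integrable TN (\<lambda>x. norm (p j x - indicator E x *\<^sub>R b j x))"
        by (intro integrable_norm Bochner_Integration.integrable_diff Phi_norm_integrable[OF pPhi] iEb)
      show "integrable TN (\<lambda>x. norm (y' j x - z j x) + norm (\<mu> j) + norm (w j x - z j x) + B * \<bar>h x - indicator E x\<bar> + norm (b' j x - b j x))"
        by (intro Bochner_Integration.integrable_add ih ibb izw TN.integrable_const integrable_norm Bochner_Integration.integrable_diff iy' iz)
      fix x
      have 1: "norm (p j x - indicator E x *\<^sub>R b j x) \<le> norm (y' j x - z j x) + norm (\<mu> j) + norm (w j x - z j x) + norm (w j x - indicator E x *\<^sub>R b j x)"
        unfolding p_def by (rule tri)
      have "w j x - indicator E x *\<^sub>R b j x = (h x - indicator E x) *\<^sub>R b' j x + indicator E x *\<^sub>R (b' j x - b j x)"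
        by (simp add: w_def algebra_simps)
      then have "norm (w j x - indicator E x *\<^sub>R b j x) \<le> \<bar>h x - indicator E x\<bar> * norm (b' j x) + \<bar>indicator E x\<bar> * norm (b' j x - b j x)"
        using norm_triangle_ineq[of "(h x - indicator E x) *\<^sub>R b' j x" "indicator E x *\<^sub>R (b' j x - b j x)"] by simp
      also have "\<dots> \<le> \<bar>h x - indicator E x\<bar> * B + 1 * norm (b' j x - b j x)"
        by (intro add_mono mult_left_mono mult_right_mono bb') (auto simp: indicator_def)
      finally show "norm (p j x - indicator E x *\<^sub>R b j x) \<le> norm (y' j x - z j x) + norm (\<mu> j) + norm (w j x - z j x) + B * \<bar>h x - indicator E x\<bar> + norm (b' j x - b j x)"
        using 1 by (simp add: mult.commute)
    qed
    also have "\<dots> = integral\<^sup>L TN (\<lambda>x. norm (y' j x - z j x)) + norm (\<mu> j) + integral\<^sup>L TN (\<lambda>x. norm (w j x - z j x)) + integral\<^sup>L TN (\<lambda>x. B * \<bar>h x - indicator E x\<bar>) + integral\<^sup>L TN (\<lambda>x. norm (b' j x - b j x))"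
    proof -
      have i1: "integrable TN (\<lambda>x. norm (y' j x - z j x))" using iy' iz by simp
      have i2: "integrable TN (\<lambda>x. norm (y' j x - z j x) + norm (\<mu> j))" using i1 by simp
      have i3: "integrable TN (\<lambda>x. norm (y' j x - z j x) + norm (\<mu> j) + norm (w j x - z j x))" using i2 izw by (rule Bochner_Integration.integrable_add)
      have i4: "integrable TN (\<lambda>x. norm (y' j x - z j x) + norm (\<mu> j) + norm (w j x - z j x) + B * \<bar>h x - indicator E x\<bar>)" using i3 ih by (rule Bochner_Integration.integrable_add)
      show ?thesis
        unfolding Bochner_Integration.integral_add[OF i4 ibb] Bochner_Integration.integral_add[OF i3 ih] Bochner_Integration.integral_add[OF i2 izw]
          Bochner_Integration.integral_add[OF i1 TN.integrable_const] integral_TN_const ..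
    qed
    also have "\<dots> \<le> t j + B * \<delta>"
    proof -
      have "integral\<^sup>L TN (\<lambda>x. B * \<bar>h x - indicator E x\<bar>) \<le> B * \<delta>" using h(3) B by (simp add: mult_left_mono less_imp_le)
      then show ?thesis using y'z[of j] \<mu>s[of j] close[of j] unfolding t_def by linarith
    qed
    finally show ?thesis .
  qed
  have main: "measure TN E * f a \<le> integral\<^sup>L TN (\<lambda>x. indicator E x * f (a + b j x)) + \<eta> / 3 + C1 * (t j + B * \<delta>)" for j
  proof -
    have "f a \<le> integral\<^sup>L TN (\<lambda>x. f (a + p j x))"
    proof -
      have "smooth (p j) \<and> periodic (p j) \<and> integral\<^sup>L TN (p j) = 0 \<and> (\<forall>y. (\<Sum>k\<in>UNIV. A k *v partial k (p j) y) = 0)"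
        using trig_smooth[OF tp] trig_periodic[OF tp] mp afree_pointwise[OF ap] by simp
      then show ?thesis using f unfolding A_quasiconvex_def by blast
    qed
    also have "\<dots> \<le> integral\<^sup>L TN (\<lambda>x. f (a + indicator E x *\<^sub>R b j x) + (\<eta> / 3 + C1 * norm (p j x - indicator E x *\<^sub>R b j x)))"
    proof (rule integral_mono_AE)
      show "integrable TN (\<lambda>x. f (a + p j x))"
        by (intro integrable_TN_continuous continuous_on_compose2[OF cf] continuous_on_add continuous_on_const trig_continuous[OF tp]) auto
      have fb: "integrable TN (\<lambda>x. f (a + indicator E x *\<^sub>R b j x))"
      proof (rule integrable_TN_bounded)
        have "f \<in> borel_measurable borel" by (rule borel_measurable_continuous_onI[OF cf])
        then show "(\<lambda>x. f (a + indicator E x *\<^sub>R b j x)) \<in> borel_measurable TN" using borel_measurable_integrable[OF iEb[of j]] by measurable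
        show "AE x in TN. norm (f (a + indicator E x *\<^sub>R b j x)) \<le> \<bar>f 0\<bar> + (\<eta> / 3 + C1 * Rb)"
          using b(2)[of j]
        proof eventually_elim
          case (elim x)
          have "norm (indicator E x *\<^sub>R b j x) \<le> B" using elim B by (auto simp: indicator_def)
          then have n: "norm (a + indicator E x *\<^sub>R b j x) \<le> Rb" using norm_triangle_ineq[of a "indicator E x *\<^sub>R b j x"] D0 unfolding Rb_def by linarith
          have "0 \<le> Rb" using n norm_ge_zero order_trans by blast
          then have "\<bar>f (a + indicator E x *\<^sub>R b j x) - f 0\<bar> \<le> \<eta> / 3 + C1 * norm (a + indicator E x *\<^sub>R b j x)" using C1(2)[rule_format, of "a + indicator E x *\<^sub>R b j x" 0] n by simp
          also have "\<dots> \<le> \<eta> / 3 + C1 * Rb" using n C1(1) by (intro add_left_mono mult_left_mono)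
          finally show ?case unfolding real_norm_def by linarith
        qed
      qed
      show "integrable TN (\<lambda>x. f (a + indicator E x *\<^sub>R b j x) + (\<eta> / 3 + C1 * norm (p j x - indicator E x *\<^sub>R b j x)))"
        by (intro Bochner_Integration.integrable_add fb TN.integrable_const integrable_mult_right integrable_norm Bochner_Integration.integrable_diff Phi_norm_integrable[OF pPhi] iEb)
      show "AE x in TN. f (a + p j x) \<le> f (a + indicator E x *\<^sub>R b j x) + (\<eta> / 3 + C1 * norm (p j x - indicator E x *\<^sub>R b j x))"
        using b(2)[of j]
      proof eventually_elim
        case (elim x)
        have "norm (indicator E x *\<^sub>R b j x) \<le> B" using elim B by (auto simp: indicator_def)
        then have n1: "a + indicator E x *\<^sub>R b j x \<in> cball 0 Rb" using norm_triangle_ineq[of a "indicator E x *\<^sub>R b j x"] D0 unfolding Rb_def mem_cball_0 by linarith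
        have n2: "a + p j x \<in> cball 0 Rb" using norm_triangle_ineq[of a "p j x"] bp[of j x] B unfolding Rb_def mem_cball_0 by linarith
        have "\<bar>f (a + p j x) - f (a + indicator E x *\<^sub>R b j x)\<bar> \<le> \<eta> / 3 + C1 * norm ((a + p j x) - (a + indicator E x *\<^sub>R b j x))"
          using C1(2) n1 n2 by blast
        then show ?case by simp
      qed
    qed
    also have "\<dots> = integral\<^sup>L TN (\<lambda>x. indicator E x * f (a + b j x)) + (1 - measure TN E) * f a + (\<eta> / 3 + C1 * integral\<^sup>L TN (\<lambda>x. norm (p j x - indicator E x *\<^sub>R b j x)))"
    proof -
      have iE: "integrable TN (\<lambda>x. indicator E x * f a)" by (rule integrable_indicator_mult[OF E TN.integrable_const])
      have fbj: "integrable TN (\<lambda>x. f (a + b j x))"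
      proof (rule integrable_TN_bounded)
        have "f \<in> borel_measurable borel" by (rule borel_measurable_continuous_onI[OF cf])
        then show "(\<lambda>x. f (a + b j x)) \<in> borel_measurable TN" using b(1)[of j] by measurable
        show "AE x in TN. norm (f (a + b j x)) \<le> \<bar>f 0\<bar> + (\<eta> / 3 + C1 * Rb)"
          using b(2)[of j]
        proof eventually_elim
          case (elim x)
          have n: "norm (a + b j x) \<le> Rb" using norm_triangle_ineq[of a "b j x"] elim D0 unfolding Rb_def by linarith
          have "0 \<le> Rb" using n norm_ge_zero order_trans by blast
          then have "\<bar>f (a + b j x) - f 0\<bar> \<le> \<eta> / 3 + C1 * norm (a + b j x)" using C1(2)[rule_format, of "a + b j x" 0] n by simp
          also have "\<dots> \<le> \<eta> / 3 + C1 * Rb" using n C1(1) by (intro add_left_mono mult_left_mono)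
          finally show ?case unfolding real_norm_def by linarith
        qed
      qed
      have ifE: "integrable TN (\<lambda>x. indicator E x * f (a + b j x))" by (rule integrable_indicator_mult[OF E fbj])
      have q: "integrable TN (\<lambda>x. norm (p j x - indicator E x *\<^sub>R b j x))"
        by (intro integrable_norm Bochner_Integration.integrable_diff Phi_norm_integrable[OF pPhi] iEb)
      \<comment> \<open>Outside \<open>E\<close> the integrand is the constant \<open>f a\<close>,
        which contributes \<open>(1 - measure TN E) * f a\<close>.\<close>
      have split: "f (a + indicator E x *\<^sub>R b j x) = indicator E x * f (a + b j x) + (f a - indicator E x * f a)" for x
        by (auto simp: indicator_def)
      have "integral\<^sup>L TN (\<lambda>x. indicator E x * f a) = measure TN E * f a" using integral_indicator_TN[OF E] by simp
      then show ?thesis unfolding split using ifE iE q by (simp add: left_diff_distrib)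
    qed
    finally have "measure TN E * f a \<le> integral\<^sup>L TN (\<lambda>x. indicator E x * f (a + b j x)) + \<eta> / 3 + C1 * integral\<^sup>L TN (\<lambda>x. norm (p j x - indicator E x *\<^sub>R b j x))"
      by (simp add: left_diff_distrib)
    then show ?thesis using mult_left_mono[OF pE[of j] C1(1)] by linarith
  qed
  have "(\<lambda>j. C1 * (t j + B * \<delta>)) \<longlonglongrightarrow> C1 * (0 + B * \<delta>)" by (intro tendsto_intros tlim)
  then have "\<forall>\<^sub>F j in sequentially. C1 * (t j + B * \<delta>) < \<eta> / 2"
    using C1B\<delta> \<eta> by (intro order_tendstoD(2)[where y="C1 * (0 + B * \<delta>)"]) auto
  then show ?thesis
  proof eventually_elim
    case (elim j)
    then show ?case using main[of j] \<eta> by linarith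
  qed
qed

section \<open>From generating sequences to almost every measure\<close>

lemma periodize:
  fixes \<psi> :: "real^'n::finite \<Rightarrow> real"
  assumes \<psi>: "integrable TN \<psi>"
  shows "\<exists>\<psi>'. L1T \<psi>' \<and> (AE x in TN. \<psi>' x = \<psi> x)"
proof -
  \<comment> \<open>Test functions for weak* convergence must be periodic, so values are pulled back
    by the fractional part. A boundary point of the cube gets a coordinate 0 and receives the value
    0, consistently on opposite faces; these points form a null set.\<close>
  define r :: "real^'n \<Rightarrow> real^'n" where "r x = (\<chi> i. frac (x $ i))" for x
  define \<psi>' where "\<psi>' x = (if r x \<in> box 0 1 then \<psi> (r x) else 0)" for x
  have "r (x + axis i 1) = r x" for x i
  proof -
    have "frac (x $ k + axis i 1 $ k) = frac (x $ k)" for k by (simp add: axis_def frac_def)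
    then show ?thesis by (simp add: r_def)
  qed
  then have per: "periodic \<psi>'" by (simp add: periodic_def \<psi>'_def)
  have rid: "r x = x" if "x \<in> box 0 1" for x
  proof -
    have "frac (x $ i) = x $ i" for i using that by (simp add: mem_box_cart frac_eq less_imp_le)
    then show ?thesis by (simp add: r_def vec_eq_iff)
  qed
  have eq: "\<psi>' x = indicator (box 0 1) x * \<psi> x" if x: "x \<in> cbox 0 1" for x
  proof (cases "x \<in> box 0 1")
    case True
    then show ?thesis using rid[OF True] by (simp add: \<psi>'_def)
  next
    case False
    then obtain i where i: "\<not> (0 < x $ i \<and> x $ i < 1)" by (auto simp: mem_box_cart)
    have "0 \<le> x $ i" "x $ i \<le> 1" using x by (auto simp: mem_box_cart)
    then have "x $ i = 0 \<or> x $ i = 1" using i by auto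
    then have "frac (x $ i) = 0" by auto
    then have "r x $ i = 0" by (simp add: r_def)
    then have "r x \<notin> box 0 1" by (auto simp: mem_box_cart intro!: exI[of _ i])
    then show ?thesis using False by (simp add: \<psi>'_def)
  qed
  have bx: "box 0 (1::real^'n) \<in> sets TN" unfolding TN_def using box_subset_cbox by (auto simp: sets_restrict_space_iff)
  have "integrable TN \<psi>' \<longleftrightarrow> integrable TN (\<lambda>x. indicator (box 0 1) x * \<psi> x)"
    by (rule Bochner_Integration.integrable_cong) (simp_all add: eq)
  then have "integrable TN \<psi>'" using integrable_indicator_mult[OF bx \<psi>] by simp
  moreover have "AE x in TN. \<psi>' x = \<psi> x"
    using AE_TN_box AE_space by eventually_elim (simp add: eq)
  ultimately show ?thesis using per by (auto simp: L1T_def)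
qed

lemma LinfT_integrable:
  fixes f :: "real^'n::finite \<Rightarrow> real"
  assumes "LinfT f"
  shows "integrable TN f"
proof -
  obtain M where "f \<in> borel_measurable TN" "AE x in TN. norm (f x) \<le> M" using assms unfolding LinfT_def by (elim exE conjE)
  then show ?thesis by (rule integrable_TN_bounded)
qed

lemma generates_conv:
  fixes \<nu> :: "real^'n::finite \<Rightarrow> (real^'d::finite) smeasure"
  assumes g: "generates \<nu> v" and m: "\<And>j. v j \<in> borel_measurable TN" and f: "C0 f" and \<psi>: "integrable TN \<psi>"
  shows "(\<lambda>j. integral\<^sup>L TN (\<lambda>x. f (v j x) * \<psi> x)) \<longlonglongrightarrow> integral\<^sup>L TN (\<lambda>x. sm_int (\<nu> x) f * \<psi> x)"
proof -
  obtain \<psi>' where p: "L1T \<psi>'" and ae: "AE x in TN. \<psi>' x = \<psi> x" using periodize[OF \<psi>] by (elim exE conjE)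
  have ws: "LinfT (\<lambda>x. sm_int (\<nu> x) f)" "(\<lambda>j. integral\<^sup>L TN (\<lambda>x. f (v j x) * \<psi>' x)) \<longlonglongrightarrow> integral\<^sup>L TN (\<lambda>x. sm_int (\<nu> x) f * \<psi>' x)"
    using g f p unfolding generates_def weakstar_Linf_def by blast+
  have mp: "\<psi>' \<in> borel_measurable TN" "\<psi> \<in> borel_measurable TN" using p \<psi> by (auto simp: L1T_def)
  have cf: "f \<in> borel_measurable borel" using f by (intro borel_measurable_continuous_onI) (simp add: C0_def)
  have mf: "(\<lambda>x. f (v j x)) \<in> borel_measurable TN" for j using cf m[of j] by measurable
  have ms: "(\<lambda>x. sm_int (\<nu> x) f) \<in> borel_measurable TN" using ws(1) by (simp add: LinfT_def)
  have "integral\<^sup>L TN (\<lambda>x. f (v j x) * \<psi>' x) = integral\<^sup>L TN (\<lambda>x. f (v j x) * \<psi> x)" for j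
    by (rule integral_cong_AE) (use mf mp ae in \<open>auto elim: AE_mp\<close>)
  moreover have "integral\<^sup>L TN (\<lambda>x. sm_int (\<nu> x) f * \<psi>' x) = integral\<^sup>L TN (\<lambda>x. sm_int (\<nu> x) f * \<psi> x)"
    by (rule integral_cong_AE) (use ms mp ae in \<open>auto elim: AE_mp\<close>)
  ultimately show ?thesis using ws(2) by simp
qed

text \<open>Asymptotic inequalities for the integrals over every measurable set become a pointwise
  inequality: the set where the pointwise one fails is itself admissible as \<open>E\<close>, and
  its indicator can be used as a weak* test function.\<close>

lemma generates_lower:
  fixes \<nu> :: "real^'n::finite \<Rightarrow> (real^'d::finite) smeasure"
  assumes g: "generates \<nu> v" and m: "\<And>j. v j \<in> borel_measurable TN" and f: "C0 f" and k: "integrable TN k"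
    and low: "\<And>E \<eta>. E \<in> sets TN \<Longrightarrow> \<eta> > 0 \<Longrightarrow> \<forall>\<^sub>F j in sequentially.
       integral\<^sup>L TN (\<lambda>x. indicator E x * k x) \<le> integral\<^sup>L TN (\<lambda>x. indicator E x * f (v j x)) + \<eta>"
  shows "AE x in TN. k x \<le> sm_int (\<nu> x) f"
proof -
  define N where "N x = sm_int (\<nu> x) f" for x
  have "LinfT N" using g f unfolding generates_def weakstar_Linf_def N_def by blast
  then have iN: "integrable TN N" by (rule LinfT_integrable)
  define E where "E = {x \<in> space TN. N x < k x}"
  have E: "E \<in> sets TN" unfolding E_def using borel_measurable_integrable[OF iN] borel_measurable_integrable[OF k] by measurable
  have iE: "integrable TN (indicator E :: _ \<Rightarrow> real)" using integrable_indicator_mult[OF E, of "\<lambda>_. 1"] by simp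
  have lim: "(\<lambda>j. integral\<^sup>L TN (\<lambda>x. indicator E x * f (v j x))) \<longlonglongrightarrow> integral\<^sup>L TN (\<lambda>x. indicator E x * N x)"
    using generates_conv[OF g m f iE] unfolding N_def by (simp add: mult.commute)
  have "integral\<^sup>L TN (\<lambda>x. indicator E x * k x) \<le> integral\<^sup>L TN (\<lambda>x. indicator E x * N x)"
  proof (rule field_le_epsilon)
    fix \<eta> :: real assume "\<eta> > 0"
    from low[OF E this] have "\<forall>\<^sub>F j in sequentially. integral\<^sup>L TN (\<lambda>x. indicator E x * k x) - \<eta> \<le> integral\<^sup>L TN (\<lambda>x. indicator E x * f (v j x))"
      by eventually_elim simp
    from tendsto_lowerbound[OF lim this] show "integral\<^sup>L TN (\<lambda>x. indicator E x * k x) \<le> integral\<^sup>L TN (\<lambda>x. indicator E x * N x) + \<eta>" by simp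
  qed
  moreover have i: "integrable TN (\<lambda>x. indicator E x * k x)" "integrable TN (\<lambda>x. indicator E x * N x)"
    by (rule integrable_indicator_mult[OF E k], rule integrable_indicator_mult[OF E iN])
  ultimately have le: "integral\<^sup>L TN (\<lambda>x. indicator E x * k x - indicator E x * N x) \<le> 0" by simp
  have nn: "AE x in TN. 0 \<le> indicator E x * k x - indicator E x * N x" by (auto simp: E_def indicator_def)
  then have "integral\<^sup>L TN (\<lambda>x. indicator E x * k x - indicator E x * N x) = 0" using le integral_nonneg_AE[OF nn] by linarith
  then have "AE x in TN. indicator E x * k x - indicator E x * N x = 0"
    using integral_nonneg_eq_0_iff_AE[OF Bochner_Integration.integrable_diff[OF i] nn] by simp
  then show ?thesis using AE_space unfolding N_def[symmetric]
  proof eventually_elim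
    case (elim x)
    show ?case
    proof (rule ccontr)
      assume "\<not> k x \<le> N x"
      then have "x \<in> E" using elim(2) by (simp add: E_def)
      then show False using elim(1) \<open>\<not> k x \<le> N x\<close> by simp
    qed
  qed
qed

lemma generates_const_lower:
  fixes \<nu> :: "real^'n::finite \<Rightarrow> (real^'d::finite) smeasure"
  assumes g: "generates \<nu> v" and m: "\<And>j. v j \<in> borel_measurable TN" and f: "C0 f"
    and ge: "\<And>j. AE x in TN. c \<le> f (v j x)"
  shows "AE x in TN. c \<le> sm_int (\<nu> x) f"
proof (rule generates_lower[OF g m f TN.integrable_const])
  fix E :: "(real^'n) set" and \<eta> :: real assume E: "E \<in> sets TN" and \<eta>: "\<eta> > 0"
  obtain B where B: "\<And>y. \<bar>f y\<bar> \<le> B" using C0_bounded[OF f] by auto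
  have cf: "f \<in> borel_measurable borel" using f by (intro borel_measurable_continuous_onI) (simp add: C0_def)
  have "integral\<^sup>L TN (\<lambda>x. indicator E x * c) \<le> integral\<^sup>L TN (\<lambda>x. indicator E x * f (v j x))" for j
  proof (rule integral_mono_AE)
    have "(\<lambda>x. f (v j x)) \<in> borel_measurable TN" using cf m[of j] by measurable
    then have "integrable TN (\<lambda>x. f (v j x))" by (rule integrable_TN_bounded[where M=B]) (simp add: B)
    then show "integrable TN (\<lambda>x. indicator E x * f (v j x))" by (rule integrable_indicator_mult[OF E])
    show "AE x in TN. indicator E x * c \<le> indicator E x * f (v j x)" using ge[of j] by eventually_elim (auto simp: indicator_def)
  qed (rule integrable_indicator_mult[OF E TN.integrable_const])
  then show "\<forall>\<^sub>F j in sequentially. integral\<^sup>L TN (\<lambda>x. indicator E x * c) \<le> integral\<^sup>L TN (\<lambda>x. indicator E x * f (v j x)) + \<eta>"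
    using \<eta> by (intro always_eventually allI) (simp add: add_increasing2)
qed

text \<open>The indicator of a compact set is the bounded limit of nonnegative functions of compact
  support, so the negative part is dominated by the positive part on compact sets. Inner regularity
  extends this to all Borel sets.\<close>

lemma sm_nonneg_from_Cc:
  fixes \<mu> :: "(real^'d::finite) smeasure"
  assumes v: "valid_sm \<mu>" and pos: "\<And>f. Cc f \<Longrightarrow> (\<And>y. 0 \<le> f y) \<Longrightarrow> 0 \<le> sm_int \<mu> f"
  shows "sm_nonneg \<mu>"
proof -
  note vf = valid_sm_facts[OF v]
  interpret p: finite_measure "fst \<mu>" by (rule vf(3))
  interpret q: finite_measure "snd \<mu>" by (rule vf(6))
  have comp: "measure (snd \<mu>) C \<le> measure (fst \<mu>) C" if C: "compact C" for C
  proof (cases "C = {}")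
    case False
    define f where "f m y = max 0 (1 - real (Suc m) * infdist y C)" for m :: nat and y
    have cf: "continuous_on UNIV (f m)" for m unfolding f_def by (intro continuous_intros)
    have cl: "closed C" using C by (rule compact_imp_closed)
    obtain B where B: "\<forall>y\<in>C. norm y \<le> B" using compact_imp_bounded[OF C] unfolding bounded_iff by (elim exE)
    have fC: "Cc (f m)" for m
      unfolding Cc_def
    proof (intro conjI cf exI[of _ "cball 0 (B + 1)"] allI impI compact_cball)
      fix y :: "real^'d" assume "y \<notin> cball 0 (B + 1)"
      then have y: "norm y > B + 1" by simp
      have "1 \<le> infdist y C"
        unfolding infdist_notempty[OF False]
      proof (rule cINF_greatest[OF False])
        fix c assume "c \<in> C"
        then have "norm c \<le> B" using B by blast
        then show "1 \<le> dist y c" using y norm_triangle_ineq2[of y c] by (simp add: dist_norm)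
      qed
      then have "1 \<le> real (Suc m) * infdist y C" using mult_mono[of 1 "real (Suc m)" 1 "infdist y C"] by simp
      then show "f m y = 0" by (simp add: f_def)
    qed
    have f01: "0 \<le> f m y" "f m y \<le> 1" for m y using infdist_nonneg[of y C] by (auto simp: f_def)
    have lim: "(\<lambda>m. f m y) \<longlonglongrightarrow> indicator C y" for y
    proof (cases "y \<in> C")
      case True
      then have "f m y = 1" for m by (simp add: f_def)
      then show ?thesis using True by simp
    next
      case F: False
      then have d: "infdist y C > 0" using in_closed_iff_infdist_zero[OF cl False] infdist_nonneg[of y C] by force
      obtain k :: nat where k: "1 / infdist y C \<le> real k" using real_arch_simple by blast
      have "f m y = 0" if "m \<ge> k" for m
      proof -
        have "1 / infdist y C \<le> real (Suc m)" using k that by linarith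
        then have "1 \<le> real (Suc m) * infdist y C" using d by (simp add: field_simps)
        then show ?thesis by (simp add: f_def)
      qed
      then show ?thesis using F by (intro tendsto_eventually) (auto simp: eventually_sequentially)
    qed
    have Cb: "C \<in> sets borel" using cl by simp
    have l1: "(\<lambda>m. integral\<^sup>L (fst \<mu>) (f m)) \<longlonglongrightarrow> integral\<^sup>L (fst \<mu>) (indicator C)"
      by (rule integral_dominated_convergence[where w="\<lambda>_. 1"]) (use lim f01 measurable_fst_sm[OF v cf] Cb vf in \<open>auto simp: abs_of_nonneg\<close>)
    have l2: "(\<lambda>m. integral\<^sup>L (snd \<mu>) (f m)) \<longlonglongrightarrow> integral\<^sup>L (snd \<mu>) (indicator C)"
      by (rule integral_dominated_convergence[where w="\<lambda>_. 1"]) (use lim f01 measurable_fst_sm[OF v cf] Cb vf in \<open>auto simp: abs_of_nonneg\<close>)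
    have "integral\<^sup>L (snd \<mu>) (f m) \<le> integral\<^sup>L (fst \<mu>) (f m)" for m using pos[OF fC f01(1), of m] by (simp add: sm_int_def)
    then have "integral\<^sup>L (snd \<mu>) (indicator C :: _ \<Rightarrow> real) \<le> integral\<^sup>L (fst \<mu>) (indicator C)" by (intro LIMSEQ_le[OF l2 l1]) auto
    then show ?thesis using vf by simp
  qed simp
  have "measure (snd \<mu>) B \<le> measure (fst \<mu>) B" if B: "B \<in> sets borel" for B
  proof -
    \<comment> \<open>Approximation from inside is needed for the negative part only; monotonicity
      suffices for the positive one.\<close>
    have "emeasure (snd \<mu>) B = (SUP K\<in>{K. K \<subseteq> B \<and> compact K}. emeasure (snd \<mu>) K)"
      by (rule inner_regular) (use vf B q.emeasure_finite in auto)
    also have "\<dots> \<le> emeasure (fst \<mu>) B"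
    proof (rule SUP_least)
      fix K assume "K \<in> {K. K \<subseteq> B \<and> compact K}"
      then have K: "K \<subseteq> B" "compact K" by auto
      have "emeasure (snd \<mu>) K \<le> emeasure (fst \<mu>) K"
        using comp[OF K(2)] by (simp add: p.emeasure_eq_measure q.emeasure_eq_measure)
      also have "\<dots> \<le> emeasure (fst \<mu>) B" using K B vf by (intro emeasure_mono) auto
      finally show "emeasure (snd \<mu>) K \<le> emeasure (fst \<mu>) B" .
    qed
    finally show ?thesis by (simp add: p.emeasure_eq_measure q.emeasure_eq_measure)
  qed
  then show ?thesis by (simp add: sm_nonneg_def sm_val_def)
qed

text \<open>Each test function yields a pointwise inequality outside its own null set. Positivity,
  support and mass are therefore all encoded in countably many compactly supported functions, and
  the measure is recovered afterwards at each remaining point.\<close>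

lemma generates_prob_on:
  fixes \<nu> :: "real^'n::finite \<Rightarrow> (real^'d::finite) smeasure"
  assumes w: "wstar_measurable \<nu>" and g: "generates \<nu> v" and m: "\<And>j. v j \<in> borel_measurable TN"
    and b: "\<And>j. AE x in TN. norm (v j x) \<le> M"
  shows "AE x in TN. sm_nonneg (\<nu> x) \<and> prob_on M (\<nu> x) \<and> emeasure (fst (\<nu> x)) {y. norm y > M} = 0 \<and> emeasure (snd (\<nu> x)) {y. norm y > M} = 0"
proof -
  have v: "valid_sm (\<nu> x)" for x using w by (simp add: wstar_measurable_def)
  obtain h :: "nat \<Rightarrow> real^'d \<Rightarrow> real" where
    h1: "\<forall>n. (\<exists>\<Lambda>\<ge>0. \<forall>y z. \<bar>h n y - h n z\<bar> \<le> \<Lambda> * norm (y - z)) \<and> (\<exists>B. \<forall>y. \<bar>h n y\<bar> \<le> B)"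
    and h2: "\<forall>f R e. continuous_on UNIV f \<and> e > 0 \<longrightarrow> (\<exists>n. \<forall>y\<in>cball 0 R. \<bar>f y - h n y\<bar> \<le> e)"
    using countable_test_family by (elim exE conjE)
  have ch: "continuous_on UNIV (h n)" for n
  proof -
    obtain \<Lambda> where "\<forall>y z. \<bar>h n y - h n z\<bar> \<le> \<Lambda> * norm (y - z)" using h1 by blast
    then show ?thesis by (intro lipschitz_continuous[of _ \<Lambda>]) blast
  qed
  \<comment> \<open>Positive parts keep the functions nonnegative and the cut-off makes their
    support compact; they approximate every nonnegative compactly supported function
    uniformly.\<close>
  define p where "p n k y = cutoff (real k) y * max 0 (h n y)" for n k :: nat and y
  have cp: "continuous_on UNIV (p n k)" for n k unfolding p_def by (intro continuous_intros continuous_cutoff ch)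
  have Cp: "Cc (p n k)" for n k unfolding p_def by (rule Cc_cutoff) (intro continuous_intros ch)
  have p0: "0 \<le> p n k y" for n k y unfolding p_def by (intro mult_nonneg_nonneg cutoff_bounds max.cobounded1)
  have a1: "AE x in TN. \<forall>n k. 0 \<le> sm_int (\<nu> x) (p n k)"
    unfolding AE_all_countable
    by (intro allI generates_const_lower[OF g m Cc_C0[OF Cp]]) (simp add: p0)
  \<comment> \<open>Positive exactly where \<open>norm y\<close> exceeds \<open>M\<close> inside the
    cut-off. It vanishes along the sequence, so its integrals must vanish, which excludes mass
    outside the ball.\<close>
  define q where "q k y = cutoff (real k) y * max 0 (norm y - M)" for k :: nat and y :: "real^'d"
  have cq: "continuous_on UNIV (q k)" for k unfolding q_def by (intro continuous_intros continuous_cutoff)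
  have Cq: "Cc (q k)" "Cc (\<lambda>y. - q k y)" for k
  proof -
    show "Cc (q k)" unfolding q_def by (rule Cc_cutoff) (intro continuous_intros)
    have "Cc (\<lambda>y. cutoff (real k) y * (- max 0 (norm y - M)))" by (rule Cc_cutoff) (intro continuous_intros)
    then show "Cc (\<lambda>y. - q k y)" by (simp add: q_def)
  qed
  have a2: "AE x in TN. \<forall>k. 0 \<le> sm_int (\<nu> x) (\<lambda>y. - q k y)"
    unfolding AE_all_countable
  proof (intro allI generates_const_lower[OF g m Cc_C0[OF Cq(2)]])
    fix k j
    show "AE x in TN. 0 \<le> - q k (v j x)" using b[of j] by eventually_elim (simp add: q_def)
  qed
  have Cc1: "Cc (\<lambda>y::real^'d. cutoff M y * c)" for c by (rule Cc_cutoff) (rule continuous_on_const)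
  \<comment> \<open>The cut-off equals 1 on the values of the sequence; this and the next inequality
    will give total mass at least and at most one.\<close>
  have a3: "AE x in TN. 1 \<le> sm_int (\<nu> x) (\<lambda>y. cutoff M y * 1)"
  proof (rule generates_const_lower[OF g m Cc_C0[OF Cc1]])
    fix j
    show "AE x in TN. 1 \<le> cutoff M (v j x) * 1" using b[of j] by eventually_elim (simp add: cutoff_eq_1)
  qed
  have a4: "AE x in TN. - 1 \<le> sm_int (\<nu> x) (\<lambda>y. cutoff M y * - 1)"
  proof (rule generates_const_lower[OF g m Cc_C0[OF Cc1]])
    fix j
    show "AE x in TN. - 1 \<le> cutoff M (v j x) * - 1" using b[of j] by eventually_elim (simp add: cutoff_eq_1)
  qed
  show ?thesis using a1 a2 a3 a4
  proof eventually_elim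
    case (elim x)
    define \<mu> where "\<mu> = \<nu> x"
    have vm: "valid_sm \<mu>" by (simp add: \<mu>_def v)
    note vf = valid_sm_facts[OF vm]
    interpret P: finite_measure "fst \<mu>" by (rule vf(3))
    interpret Q: finite_measure "snd \<mu>" by (rule vf(6))
    have nn: "sm_nonneg \<mu>"
    proof (rule sm_nonneg_from_Cc[OF vm])
      fix f :: "real^'d \<Rightarrow> real" assume f: "Cc f" and f0: "\<And>y. 0 \<le> f y"
      have cf: "continuous_on UNIV f" using f by (simp add: Cc_def)
      obtain K where K: "compact K" "\<forall>y. y \<notin> K \<longrightarrow> f y = 0" using f unfolding Cc_def by (elim exE conjE)
      obtain B where B: "\<forall>y\<in>K. norm y \<le> B" using compact_imp_bounded[OF K(1)] unfolding bounded_iff by (elim exE)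
      obtain k :: nat where k: "B \<le> real k" using real_arch_simple by blast
      obtain Bf where Bf: "\<And>y. \<bar>f y\<bar> \<le> Bf" using C0_bounded[OF Cc_C0[OF f]] by auto
      define m where "m = measure (fst \<mu>) UNIV + measure (snd \<mu>) UNIV"
      have m0: "m \<ge> 0" by (simp add: m_def)
      have "0 \<le> sm_int \<mu> f + e" if e: "e > 0" for e
      proof -
        define e' where "e' = e / (m + 1)"
        have e': "e' > 0" using e m0 by (simp add: e'_def)
        have em: "e' * m \<le> e" using e m0 by (simp add: e'_def field_simps)
        obtain n where n: "\<forall>y\<in>cball 0 (real k + 1). \<bar>f y - h n y\<bar> \<le> e'" using h2[rule_format, OF conjI[OF cf e'], of "real k + 1"] by (elim exE)
        have close: "\<bar>f y - p n k y\<bar> \<le> e'" for y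
        proof -
          have fc: "f y = cutoff (real k) y * f y"
          proof (cases "y \<in> K")
            case True
            then have "norm y \<le> real k" using B k by force
            then show ?thesis by (simp add: cutoff_eq_1)
          qed (use K(2) in simp)
          have "f y - p n k y = cutoff (real k) y * f y - cutoff (real k) y * max 0 (h n y)" using fc by (simp add: p_def)
          also have "\<dots> = cutoff (real k) y * (f y - max 0 (h n y))" by (simp add: right_diff_distrib)
          finally have *: "\<bar>f y - p n k y\<bar> = cutoff (real k) y * \<bar>f y - max 0 (h n y)\<bar>" using cutoff_bounds(1)[of "real k" y] by (simp add: abs_mult)
          show ?thesis
          proof (cases "norm y \<le> real k + 1")
            case True
            then have "\<bar>f y - h n y\<bar> \<le> e'" using n by simp
            then have "\<bar>f y - max 0 (h n y)\<bar> \<le> e'" using f0[of y] by linarith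
            then have "cutoff (real k) y * \<bar>f y - max 0 (h n y)\<bar> \<le> 1 * e'" using e' by (intro mult_mono cutoff_bounds) auto
            then show ?thesis using * by simp
          next
            case False
            then show ?thesis using * e' by (simp add: cutoff_eq_0)
          qed
        qed
        obtain Bp where Bp: "\<And>y. \<bar>p n k y\<bar> \<le> Bp" using C0_bounded[OF Cc_C0[OF Cp[of n k]]] by auto
        have if1: "integrable (fst \<mu>) f" "integrable (snd \<mu>) f"
          by (rule P.integrable_const_bound[where B=Bf], simp add: Bf, rule measurable_fst_sm[OF vm cf], rule Q.integrable_const_bound[where B=Bf], simp add: Bf, rule measurable_fst_sm[OF vm cf])
        have ip1: "integrable (fst \<mu>) (p n k)" "integrable (snd \<mu>) (p n k)"
          by (rule P.integrable_const_bound[where B=Bp], simp add: Bp, rule measurable_fst_sm[OF vm cp], rule Q.integrable_const_bound[where B=Bp], simp add: Bp, rule measurable_fst_sm[OF vm cp])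
        have "\<bar>integral\<^sup>L (fst \<mu>) (\<lambda>y. f y - p n k y)\<bar> \<le> integral\<^sup>L (fst \<mu>) (\<lambda>y. e')"
          using if1 ip1 close by (intro integral_abs_mono) auto
        then have 1: "\<bar>integral\<^sup>L (fst \<mu>) f - integral\<^sup>L (fst \<mu>) (p n k)\<bar> \<le> e' * measure (fst \<mu>) UNIV"
          using if1 ip1 vf by (simp add: mult.commute)
        have "\<bar>integral\<^sup>L (snd \<mu>) (\<lambda>y. f y - p n k y)\<bar> \<le> integral\<^sup>L (snd \<mu>) (\<lambda>y. e')"
          using if1 ip1 close by (intro integral_abs_mono) auto
        then have 2: "\<bar>integral\<^sup>L (snd \<mu>) f - integral\<^sup>L (snd \<mu>) (p n k)\<bar> \<le> e' * measure (snd \<mu>) UNIV"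
          using if1 ip1 vf by (simp add: mult.commute)
        have 3: "0 \<le> integral\<^sup>L (fst \<mu>) (p n k) - integral\<^sup>L (snd \<mu>) (p n k)"
          using elim(1) unfolding \<mu>_def sm_int_def by blast
        have "e' * measure (fst \<mu>) UNIV + e' * measure (snd \<mu>) UNIV \<le> e" using em by (simp add: m_def distrib_left)
        then show ?thesis unfolding sm_int_def using 1 2 3 by linarith
      qed
      then show "0 \<le> sm_int \<mu> f" by (rule field_le_epsilon)
    qed
    have si: "sm_int \<mu> f = integral\<^sup>L (fst \<mu>) f" for f :: "real^'d \<Rightarrow> real" by (rule sm_nonneg_int[OF vm nn])
    have "AE y in fst \<mu>. q k y = 0" for k
    proof -
      have q0: "AE y in fst \<mu>. 0 \<le> q k y" unfolding q_def by (intro AE_I2 mult_nonneg_nonneg cutoff_bounds max.cobounded1)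
      obtain B where B: "\<And>y. \<bar>q k y\<bar> \<le> B" using C0_bounded[OF Cc_C0[OF Cq(1)[of k]]] by auto
      have i: "integrable (fst \<mu>) (q k)" by (rule P.integrable_const_bound[where B=B]) (simp_all add: B measurable_fst_sm[OF vm cq])
      have "0 \<le> sm_int \<mu> (\<lambda>y. - q k y)" using elim(2) by (simp add: \<mu>_def)
      then have "integral\<^sup>L (fst \<mu>) (q k) \<le> 0" unfolding si by simp
      then have "integral\<^sup>L (fst \<mu>) (q k) = 0" using integral_nonneg_AE[OF q0] by linarith
      then show ?thesis using integral_nonneg_eq_0_iff_AE[OF i q0] by simp
    qed
    then have "AE y in fst \<mu>. \<forall>k. q k y = 0" by (simp add: AE_all_countable)
    then have s: "AE y in fst \<mu>. norm y \<le> M"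
    proof eventually_elim
      case (elim y)
      obtain k :: nat where "norm y \<le> real k" using real_arch_simple by blast
      then have "max 0 (norm y - M) = 0" using elim[rule_format, of k] by (simp add: q_def cutoff_eq_1)
      then show ?case by simp
    qed
    have mc: "sm_int \<mu> (\<lambda>y. cutoff M y * c) = c * measure (fst \<mu>) UNIV" for c
    proof -
      have "integral\<^sup>L (fst \<mu>) (\<lambda>y. cutoff M y * c) = integral\<^sup>L (fst \<mu>) (\<lambda>y. c)"
      proof (rule integral_cong_AE)
        show "AE y in fst \<mu>. cutoff M y * c = c" using s by eventually_elim (simp add: cutoff_eq_1)
      qed (auto intro!: measurable_fst_sm[OF vm] continuous_intros continuous_cutoff)
      then show ?thesis unfolding si using vf by (simp add: mult.commute)
    qed
    have m1: "measure (fst \<mu>) UNIV = 1"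
      using elim(3)[folded \<mu>_def, unfolded mc] elim(4)[folded \<mu>_def, unfolded mc] by simp
    have pr: "prob_on M \<mu>" using vm si s m1 by (simp add: prob_on_def)
    have Us: "{y :: real^'d. norm y > M} \<in> sets borel"
      by (intro borel_open open_Collect_less continuous_intros)
    have e1: "emeasure (fst \<mu>) {y. norm y > M} = 0"
    proof -
      have "{y \<in> space (fst \<mu>). \<not> norm y \<le> M} = {y. norm y > M}" using vf by auto
      moreover have "{y \<in> space (fst \<mu>). \<not> norm y \<le> M} \<in> sets (fst \<mu>)" using Us vf by (simp add: not_le)
      ultimately show ?thesis using AE_iff_measurable[OF _ refl, of "fst \<mu>" "\<lambda>y. norm y \<le> M"] s by simp
    qed
    have e2: "emeasure (snd \<mu>) {y. norm y > M} = 0"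
    proof -
      have "0 \<le> sm_val \<mu> {y. norm y > M}" using nn Us by (simp add: sm_nonneg_def)
      then have "measure (snd \<mu>) {y. norm y > M} \<le> 0" using e1 by (simp add: sm_val_def measure_def)
      then show ?thesis using measure_nonneg[of "snd \<mu>" "{y. norm y > M}"] by (simp add: Q.emeasure_eq_measure)
    qed
    show ?case using nn pr e1 e2 by (simp add: \<mu>_def)
  qed
qed

text \<open>The barycentre \<open>u\<close> is the weak limit of the sequence, so it inherits the
  bound and the equation, and the differences \<open>v j - u\<close> are bounded, A-free and weakly
  null. This is the setting of the localised Jensen inequality, which is stated for a constant
  \<open>a\<close> and must still be transferred to the variable \<open>u x\<close>.\<close>

theorem necessity:
  fixes A :: "'n::finite \<Rightarrow> real^'d::finite^'l::finite" and \<nu> :: "real^'n \<Rightarrow> (real^'d) smeasure"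
  assumes cr: "constant_rank A" and ZL: "property_ZL A" and w: "wstar_measurable \<nu>" and ym: "A_infty_YM A \<nu>"
  shows "(AE x in TN. sm_nonneg (\<nu> x)) \<and>
    (\<exists>K u. compact K \<and> LinfT u \<and> kerA A u \<and>
       (AE x in TN. sm_support (\<nu> x) \<subseteq> K) \<and>
       (AE x in TN. sm_int (\<nu> x) (\<lambda>y. y) = u x) \<and>
       (AE x in TN. \<forall>f. A_quasiconvex A f \<longrightarrow> sm_int (\<nu> x) f \<ge> f (sm_int (\<nu> x) (\<lambda>y. y))))"
proof -
  obtain v M0 where v: "\<forall>j. LinfT (v j) \<and> kerA A (v j)" and M0: "\<forall>j. AE x in TN. norm (v j x) \<le> M0" and g: "generates \<nu> v"
    using ym unfolding A_infty_YM_def by (elim exE conjE)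
  have mv: "v j \<in> borel_measurable TN" and kv: "kerA A (v j)" for j using v by (auto simp: LinfT_def)
  define M where "M = \<bar>M0\<bar>"
  have M: "M \<ge> 0" by (simp add: M_def)
  have bv: "AE x in TN. norm (v j x) \<le> M" for j using M0[rule_format, of j] unfolding M_def by eventually_elim linarith
  have iv: "integrable TN (v j)" for j by (rule integrable_TN_bounded[OF mv bv])
  have valid: "valid_sm (\<nu> x)" for x using w by (simp add: wstar_measurable_def)
  have per: "periodic \<nu>" using w by (simp add: wstar_measurable_def)
  have good: "AE x in TN. sm_nonneg (\<nu> x) \<and> prob_on M (\<nu> x) \<and> emeasure (fst (\<nu> x)) {y. norm y > M} = 0 \<and> emeasure (snd (\<nu> x)) {y. norm y > M} = 0"
    by (rule generates_prob_on[OF w g mv bv])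
  have prob: "AE x in TN. prob_on M (\<nu> x)" using good by eventually_elim simp
  \<comment> \<open>Coordinate functions cut off outside the relevant ball: they give a barycentre
    that is defined and measurable everywhere.\<close>
  define comp where "comp i y = cutoff M y * y $ i" for i and y :: "real^'d"
  have Ccomp: "Cc (comp i)" for i unfolding comp_def by (rule Cc_cutoff) (intro continuous_intros)
  define u :: "real^'n \<Rightarrow> real^'d" where "u x = (\<chi> i. sm_int (\<nu> x) (comp i))" for x
  have mu_i: "(\<lambda>x. u x $ i) \<in> borel_measurable TN" for i
    using w Ccomp[of i] unfolding u_def wstar_measurable_def by simp
  have mu: "u \<in> borel_measurable TN"
  proof (rule borel_measurable_euclidean_space[THEN iffD2], intro ballI)
    fix b :: "real^'d" assume "b \<in> Basis"
    then obtain i where "b = axis i 1" by (auto simp: Basis_vec_def)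
    then show "(\<lambda>x. u x \<bullet> b) \<in> borel_measurable TN" using mu_i[of i] by (simp add: inner_axis)
  qed
  have bar: "AE x in TN. sm_int (\<nu> x) (\<lambda>y. y) = u x \<and> norm (u x) \<le> M"
    using good
  proof eventually_elim
    case (elim x)
    define \<mu> where "\<mu> = fst (\<nu> x)"
    have p: "prob_on M (\<nu> x)" using elim by simp
    have sp: "space \<mu> = UNIV" and st: "sets \<mu> = sets borel" unfolding \<mu>_def using valid_sm_facts[OF valid] by auto
    interpret P: finite_measure \<mu> unfolding \<mu>_def by (rule valid_sm_facts[OF valid])
    have ae: "AE y in \<mu>. norm y \<le> M" using p unfolding prob_on_def \<mu>_def by blast
    have mid: "(\<lambda>y::real^'d. y) \<in> borel_measurable \<mu>" by (rule measurable_ident_sets[OF st])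
    have iid: "integrable \<mu> (\<lambda>y::real^'d. y)" by (rule P.integrable_const_bound[OF ae mid])
    have eq: "sm_int (\<nu> x) (\<lambda>y. y) = integral\<^sup>L \<mu> (\<lambda>y. y)" unfolding \<mu>_def using elim by (intro sm_nonneg_int valid) simp
    have "(integral\<^sup>L \<mu> (\<lambda>y. y)) $ i = u x $ i" for i
    proof -
      have "(integral\<^sup>L \<mu> (\<lambda>y. y)) $ i = integral\<^sup>L \<mu> (\<lambda>y. y $ i)"
        using integral_bounded_linear[OF bounded_linear_vec_nth iid, of i] by simp
      also have "\<dots> = sm_int (\<nu> x) (\<lambda>y. y $ i)" using p unfolding prob_on_def \<mu>_def by metis
      also have "\<dots> = sm_int (\<nu> x) (comp i)"
      proof (rule prob_on_cong[OF p])
        show "continuous_on UNIV (\<lambda>y::real^'d. y $ i)" by (intro continuous_intros)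
        show "continuous_on UNIV (comp i)" using Ccomp[of i] by (simp add: Cc_def)
        show "y $ i = comp i y" if "norm y \<le> M" for y using that by (simp add: comp_def cutoff_eq_1)
      qed
      finally show ?thesis by (simp add: u_def)
    qed
    then have 1: "integral\<^sup>L \<mu> (\<lambda>y. y) = u x" by (simp add: vec_eq_iff)
    have "norm (integral\<^sup>L \<mu> (\<lambda>y. y)) \<le> integral\<^sup>L \<mu> (\<lambda>y. norm y)" by (rule integral_norm_bound)
    also have "\<dots> \<le> integral\<^sup>L \<mu> (\<lambda>y. M)" by (rule integral_mono_AE[OF integrable_norm[OF iid] P.integrable_const ae])
    also have "\<dots> = M"
    proof -
      have "measure \<mu> UNIV = 1" using p unfolding prob_on_def \<mu>_def by (elim conjE)
      then show ?thesis using sp by simp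
    qed
    finally show ?case using 1 eq by simp
  qed
  have bu: "AE x in TN. norm (u x) \<le> M" using bar by eventually_elim simp
  have iu: "integrable TN u" by (rule integrable_TN_bounded[OF mu bu])
  have "periodic u" using per by (simp add: periodic_def u_def)
  then have Lu: "LinfT u" unfolding LinfT_def using mu bu by blast
  have weak_i: "(\<lambda>j. integral\<^sup>L TN (\<lambda>x. v j x $ i * \<psi> x)) \<longlonglongrightarrow> integral\<^sup>L TN (\<lambda>x. u x $ i * \<psi> x)" if \<psi>: "integrable TN \<psi>" for i \<psi>
  proof -
    have "integral\<^sup>L TN (\<lambda>x. comp i (v j x) * \<psi> x) = integral\<^sup>L TN (\<lambda>x. v j x $ i * \<psi> x)" for j
    proof (rule integral_cong_AE)
      have c: "continuous_on UNIV (comp i)" using Ccomp[of i] by (simp add: Cc_def)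
      show "(\<lambda>x. comp i (v j x) * \<psi> x) \<in> borel_measurable TN"
        using borel_measurable_continuous_onI[OF c] mv[of j] borel_measurable_integrable[OF \<psi>] by measurable
      have "(\<lambda>x. v j x $ i) \<in> borel_measurable TN"
        using borel_measurable_integrable[OF integrable_bounded_linear[OF bounded_linear_vec_nth iv]] .
      then show "(\<lambda>x. v j x $ i * \<psi> x) \<in> borel_measurable TN" using borel_measurable_integrable[OF \<psi>] by simp
      show "AE x in TN. comp i (v j x) * \<psi> x = v j x $ i * \<psi> x" using bv[of j] by eventually_elim (simp add: comp_def cutoff_eq_1)
    qed
    then show ?thesis using generates_conv[OF g mv Cc_C0[OF Ccomp] \<psi>, of i] by (simp add: u_def)
  qed
  \<comment> \<open>Weak convergence of \<open>v j\<close> to \<open>u\<close>, read off from the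
    coordinate functions one at a time.\<close>
  have weak_q: "(\<lambda>j. integral\<^sup>L TN (\<lambda>x. v j x \<bullet> q x)) \<longlonglongrightarrow> integral\<^sup>L TN (\<lambda>x. u x \<bullet> q x)" if q: "continuous_on UNIV q" for q :: "real^'n \<Rightarrow> real^'d"
  proof -
    have qi: "integrable TN (\<lambda>x. q x $ i)" for i by (intro integrable_TN_continuous continuous_on_component q)
    have eq: "integral\<^sup>L TN (\<lambda>x. z x \<bullet> q x) = (\<Sum>i\<in>UNIV. integral\<^sup>L TN (\<lambda>x. z x $ i * q x $ i))"
      if z: "z \<in> borel_measurable TN" "AE x in TN. norm (z x) \<le> M" for z :: "real^'n \<Rightarrow> real^'d"
    proof -
      have iz: "integrable TN z" by (rule integrable_TN_bounded[OF z])
      have "integrable TN (\<lambda>x. z x $ i * q x $ i)" for i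
      proof (rule integrable_bounded_mult_AE[OF _ _ qi])
        show "(\<lambda>x. z x $ i) \<in> borel_measurable TN" using borel_measurable_integrable[OF integrable_bounded_linear[OF bounded_linear_vec_nth iz]] .
        show "AE x in TN. \<bar>z x $ i\<bar> \<le> M" using z(2) by eventually_elim (use component_le_norm_cart order_trans in blast)
      qed
      then show ?thesis unfolding inner_vec_def by (subst Bochner_Integration.integral_sum) auto
    qed
    show ?thesis unfolding eq[OF mv bv] eq[OF mu bu] by (intro tendsto_sum weak_i qi)
  qed
  \<comment> \<open>Transposition moves the matrices onto the test function, so the equation becomes
    a pairing with one continuous vector field, to which weak convergence applies.\<close>
  have adj: "(\<Sum>k\<in>UNIV. (A k *v z) \<bullet> p k) = z \<bullet> (\<Sum>k\<in>UNIV. transpose (A k) *v p k)" for z and p :: "'n \<Rightarrow> real^'l"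
    unfolding inner_sum_right
  proof (intro sum.cong refl)
    fix k
    have "(A k *v z) \<bullet> p k = p k \<bullet> (A k *v z)" by (rule inner_commute)
    also have "\<dots> = (transpose (A k) *v p k) \<bullet> z" by (simp only: dot_lmul_matrix[symmetric] transpose_matrix_vector)
    finally show "(A k *v z) \<bullet> p k = z \<bullet> (transpose (A k) *v p k)" by (simp only: inner_commute)
  qed
  have ku: "kerA A u"
    unfolding kerA_def
  proof (intro allI impI)
    fix \<phi> :: "real^'n \<Rightarrow> real^'l" assume \<phi>: "smooth \<phi> \<and> periodic \<phi>"
    define q where "q x = (\<Sum>k\<in>UNIV. transpose (A k) *v partial k \<phi> x)" for x
    have "continuous_on UNIV (\<lambda>x. transpose (A k) *v partial k \<phi> x)" for k
      by (rule bounded_linear.continuous_on[OF matrix_vector_mul_bounded_linear smooth_partial_continuous[OF conjunct1[OF \<phi>]]])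
    then have q: "continuous_on UNIV q" unfolding q_def by (intro continuous_on_sum)
    have "integral\<^sup>L TN (\<lambda>x. v j x \<bullet> q x) = 0" for j
      unfolding q_def by (rule kv[of j, unfolded kerA_def adj, rule_format, OF \<phi>])
    then have "(\<lambda>j::nat. 0) \<longlonglongrightarrow> integral\<^sup>L TN (\<lambda>x. u x \<bullet> q x)" using weak_q[OF q] by simp
    from LIMSEQ_unique[OF this tendsto_const] have "integral\<^sup>L TN (\<lambda>x. u x \<bullet> q x) = 0" .
    then show "integral\<^sup>L TN (\<lambda>x. \<Sum>k\<in>UNIV. (A k *v u x) \<bullet> partial k \<phi> x) = 0" unfolding adj q_def .
  qed
  define b where "b j x = v j x - u x" for j x
  have mb: "b j \<in> borel_measurable TN" for j unfolding b_def using mv mu by simp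
  have bb: "AE x in TN. norm (b j x) \<le> 2 * M" for j
    using bv[of j] bu
  proof eventually_elim
    case (elim x)
    then show ?case unfolding b_def using norm_triangle_ineq4[of "v j x" "u x"] by linarith
  qed
  have kb: "kerA A (b j)" for j
    unfolding kerA_def
  proof (intro allI impI)
    fix \<phi> :: "real^'n \<Rightarrow> real^'l" assume \<phi>: "smooth \<phi> \<and> periodic \<phi>"
    define q where "q x = (\<Sum>k\<in>UNIV. transpose (A k) *v partial k \<phi> x)" for x
    have "continuous_on UNIV (\<lambda>x. transpose (A k) *v partial k \<phi> x)" for k
      by (rule bounded_linear.continuous_on[OF matrix_vector_mul_bounded_linear smooth_partial_continuous[OF conjunct1[OF \<phi>]]])
    then have q: "continuous_on UNIV q" unfolding q_def by (intro continuous_on_sum)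
    have int: "integrable TN (\<lambda>x. z x \<bullet> q x)" if z: "z \<in> borel_measurable TN" "AE x in TN. norm (z x) \<le> M" for z :: "real^'n \<Rightarrow> real^'d"
    proof (rule Bochner_Integration.integrable_bound)
      show "integrable TN (\<lambda>x. M * norm (q x))" by (intro integrable_TN_continuous continuous_intros q)
      show "(\<lambda>x. z x \<bullet> q x) \<in> borel_measurable TN" using z(1) continuous_borel_measurable_TN[OF q] by simp
      show "AE x in TN. norm (z x \<bullet> q x) \<le> norm (M * norm (q x))"
        using z(2)
      proof eventually_elim
        case (elim x)
        have "\<bar>z x \<bullet> q x\<bar> \<le> norm (z x) * norm (q x)" by (rule Cauchy_Schwarz_ineq2)
        also have "\<dots> \<le> M * norm (q x)" using elim by (intro mult_right_mono) auto
        finally show ?case using M by simp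
      qed
    qed
    have z: "integral\<^sup>L TN (\<lambda>x. v j x \<bullet> q x) = 0" "integral\<^sup>L TN (\<lambda>x. u x \<bullet> q x) = 0"
      unfolding q_def by (rule kv[of j, unfolded kerA_def adj, rule_format, OF \<phi>], rule ku[unfolded kerA_def adj, rule_format, OF \<phi>])
    show "integral\<^sup>L TN (\<lambda>x. \<Sum>k\<in>UNIV. (A k *v b j x) \<bullet> partial k \<phi> x) = 0"
      unfolding adj q_def[symmetric] b_def inner_diff_left
      using z int[OF mv bv, of j] int[OF mu bu] by simp
  qed
  have weakb: "(\<lambda>j. integral\<^sup>L TN (\<lambda>x. \<psi> x *\<^sub>R b j x)) \<longlonglongrightarrow> 0" if \<psi>: "continuous_on UNIV \<psi>" for \<psi>
  proof (rule vec_tendstoI)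
    fix i :: 'd
    have i\<psi>: "integrable TN \<psi>" by (rule integrable_TN_continuous[OF \<psi>])
    have vi: "integrable TN (\<lambda>x. z x $ i * \<psi> x)" if z: "z \<in> borel_measurable TN" "AE x in TN. norm (z x) \<le> B" for z :: "real^'n \<Rightarrow> real^'d" and B
    proof (rule integrable_bounded_mult_AE[OF _ _ i\<psi>])
      have iz: "integrable TN z" by (rule integrable_TN_bounded[OF z])
      show "(\<lambda>x. z x $ i) \<in> borel_measurable TN" using borel_measurable_integrable[OF integrable_bounded_linear[OF bounded_linear_vec_nth iz]] .
      show "AE x in TN. \<bar>z x $ i\<bar> \<le> B" using z(2) by eventually_elim (use component_le_norm_cart order_trans in blast)
    qed
    have ib: "integrable TN (\<lambda>x. \<psi> x *\<^sub>R b j x)" for j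
    proof -
      have "bounded (\<psi> ` cbox 0 1)" by (intro compact_imp_bounded compact_continuous_image continuous_on_subset[OF \<psi>]) auto
      then obtain G where G: "\<forall>y\<in>\<psi> ` cbox 0 1. norm y \<le> G" unfolding bounded_iff by (elim exE)
      have G': "AE x in TN. \<bar>\<psi> x\<bar> \<le> G" using G by (intro AE_I2) auto
      show ?thesis
      proof (rule integrable_TN_bounded)
        show "(\<lambda>x. \<psi> x *\<^sub>R b j x) \<in> borel_measurable TN" using mb borel_measurable_integrable[OF i\<psi>] by simp
        show "AE x in TN. norm (\<psi> x *\<^sub>R b j x) \<le> G * (2 * M)" using G' bb[of j]
        proof eventually_elim
          case (elim x)
          then show ?case unfolding norm_scaleR by (intro mult_mono) auto
        qed
      qed
    qed
    have eq: "integral\<^sup>L TN (\<lambda>x. \<psi> x *\<^sub>R b j x) $ i = integral\<^sup>L TN (\<lambda>x. v j x $ i * \<psi> x) - integral\<^sup>L TN (\<lambda>x. u x $ i * \<psi> x)" for j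
    proof -
      have "integral\<^sup>L TN (\<lambda>x. \<psi> x *\<^sub>R b j x) $ i = integral\<^sup>L TN (\<lambda>x. v j x $ i * \<psi> x - u x $ i * \<psi> x)"
        using integral_bounded_linear[OF bounded_linear_vec_nth[of i] ib[of j]] by (simp add: b_def algebra_simps)
      then show ?thesis using vi[OF mv bv, of j] vi[OF mu bu] by simp
    qed
    have "(\<lambda>j. integral\<^sup>L TN (\<lambda>x. v j x $ i * \<psi> x) - integral\<^sup>L TN (\<lambda>x. u x $ i * \<psi> x)) \<longlonglongrightarrow> integral\<^sup>L TN (\<lambda>x. u x $ i * \<psi> x) - integral\<^sup>L TN (\<lambda>x. u x $ i * \<psi> x)"
      by (intro tendsto_diff weak_i i\<psi> tendsto_const)
    then show "(\<lambda>j. integral\<^sup>L TN (\<lambda>x. \<psi> x *\<^sub>R b j x) $ i) \<longlonglongrightarrow> (0 :: real^'d) $ i" unfolding eq by simp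
  qed
  have jensen1: "AE x in TN. f (u x) \<le> sm_int (\<nu> x) f" if f: "A_quasiconvex A f" for f
  proof -
    have cf: "continuous_on UNIV f" using f by (simp add: A_quasiconvex_def)
    \<comment> \<open>The cut-off version vanishes at infinity, so the generation hypothesis applies
      to it, and it agrees with \<open>f\<close> along the sequence.\<close>
    define f' where "f' y = cutoff M y * f y" for y
    have C0f': "C0 f'" unfolding f'_def by (rule Cc_C0[OF Cc_cutoff[OF cf]])
    have f'v: "AE x in TN. f' (v j x) = f (v j x)" for j using bv[of j] by eventually_elim (simp add: f'_def cutoff_eq_1)
    have mfv: "(\<lambda>x. h (v j x)) \<in> borel_measurable TN" if "continuous_on UNIV h" for h :: "real^'d \<Rightarrow> real" and j
      using borel_measurable_continuous_onI[OF that] mv[of j] by measurable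
    obtain D :: "(real^'d) set" where D: "countable D" "\<And>X. open X \<Longrightarrow> X \<noteq> {} \<Longrightarrow> \<exists>d\<in>D. d \<in> X"
      using countable_dense_exists by blast
    \<comment> \<open>Sum of the bounds \<open>M + 1\<close> for \<open>a\<close> and
      \<open>2 * M\<close> for \<open>v j - u\<close>.\<close>
    define Rb where "Rb = 3 * M + 1"
    have "\<forall>r::nat. \<exists>C. C \<ge> 0 \<and> (\<forall>y\<in>cball 0 Rb. \<forall>z\<in>cball 0 Rb. \<bar>f y - f z\<bar> \<le> 1 / real (Suc r) + C * norm (y - z))"
      by (intro allI continuous_modulus[OF cf]) simp
    from choice[OF this] obtain C where C: "\<forall>r::nat. C r \<ge> 0 \<and> (\<forall>y\<in>cball 0 Rb. \<forall>z\<in>cball 0 Rb. \<bar>f y - f z\<bar> \<le> 1 / real (Suc r) + C r * norm (y - z))" by (elim exE)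
    have C0: "C r \<ge> 0" for r by (rule C[rule_format, of r, THEN conjunct1])
    \<comment> \<open>Freezing \<open>u x\<close> at a constant \<open>a\<close> shifts the argument
      from \<open>v j x\<close> by \<open>a - u x\<close>; the affine modulus of \<open>f\<close>
      pays for this with \<open>1 / Suc r\<close> and a term proportional to
      \<open>norm (u x - a)\<close>.\<close>
    have key: "AE x in TN. f a - 1 / real (Suc r) - C r * norm (u x - a) \<le> sm_int (\<nu> x) f'" if a: "norm a \<le> M + 1" for a r
    proof (rule generates_lower[OF g mv C0f'])
      show ik: "integrable TN (\<lambda>x. f a - 1 / real (Suc r) - C r * norm (u x - a))" using iu by simp
      fix E :: "(real^'n) set" and \<eta> :: real assume E: "E \<in> sets TN" and \<eta>: "\<eta> > 0"
      have "\<forall>\<^sub>F j in sequentially. measure TN E * f a \<le> integral\<^sup>L TN (\<lambda>x. indicator E x * f (a + b j x)) + \<eta>"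
        by (rule local_jensen[OF cr ZL f mb bb kb _ weakb E \<eta>]) (use M in simp)
      then show "\<forall>\<^sub>F j in sequentially. integral\<^sup>L TN (\<lambda>x. indicator E x * (f a - 1 / real (Suc r) - C r * norm (u x - a))) \<le> integral\<^sup>L TN (\<lambda>x. indicator E x * f' (v j x)) + \<eta>"
      proof eventually_elim
        case (elim j)
        obtain Bf where Bf: "\<And>y. \<bar>f' y\<bar> \<le> Bf" using C0_bounded[OF C0f'] by auto
        have cf': "continuous_on UNIV f'" using C0f' by (simp add: C0_def)
        have if': "integrable TN (\<lambda>x. f' (v j x))" by (rule integrable_TN_bounded[OF mfv[OF cf'], where M=Bf]) (simp add: Bf)
        have ae: "AE x in TN. f (a + b j x) \<le> f' (v j x) + (1 / real (Suc r) + C r * norm (u x - a)) \<and> norm (f (a + b j x)) \<le> \<bar>f 0\<bar> + (1 / real (Suc r) + C r * Rb)"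
          using f'v[of j] bv[of j] bu
        proof eventually_elim
          case (elim x)
          have n: "norm (a + b j x) \<le> Rb"
            unfolding b_def Rb_def using elim a norm_triangle_ineq[of a "v j x - u x"] norm_triangle_ineq4[of "v j x" "u x"] by linarith
          then have 1: "a + b j x \<in> cball 0 Rb" by simp
          have 2: "v j x \<in> cball 0 Rb" using elim M by (simp add: Rb_def)
          have R0: "Rb \<ge> 0" using M by (simp add: Rb_def)
          have "\<bar>f (a + b j x) - f (v j x)\<bar> \<le> 1 / real (Suc r) + C r * norm ((a + b j x) - v j x)" by (rule C[rule_format, of r, THEN conjunct2, rule_format, OF 1 2])
          moreover have "(a + b j x) - v j x = - (u x - a)" by (simp add: b_def)
          ultimately have A1: "f (a + b j x) \<le> f' (v j x) + (1 / real (Suc r) + C r * norm (u x - a))" using elim(1) by (simp only: norm_minus_cancel)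
          have "\<bar>f (a + b j x) - f 0\<bar> \<le> 1 / real (Suc r) + C r * norm (a + b j x - 0)" by (rule C[rule_format, of r, THEN conjunct2, rule_format, OF 1]) (use R0 in simp)
          also have "\<dots> \<le> 1 / real (Suc r) + C r * Rb" using n C0 by (intro add_left_mono mult_left_mono) auto
          finally show ?case using A1 unfolding real_norm_def by linarith
        qed
        have ifa: "integrable TN (\<lambda>x. f (a + b j x))"
        proof (rule integrable_TN_bounded)
          show "(\<lambda>x. f (a + b j x)) \<in> borel_measurable TN" using borel_measurable_continuous_onI[OF cf] mb[of j] by measurable
          show "AE x in TN. norm (f (a + b j x)) \<le> \<bar>f 0\<bar> + (1 / real (Suc r) + C r * Rb)" using ae by eventually_elim simp
        qed
        define k where "k x = 1 / real (Suc r) + C r * norm (u x - a)" for x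
        have ikk: "integrable TN k" unfolding k_def using iu by simp
        have "integral\<^sup>L TN (\<lambda>x. indicator E x * f (a + b j x)) \<le> integral\<^sup>L TN (\<lambda>x. indicator E x * f' (v j x) + indicator E x * k x)"
        proof (rule integral_mono_AE)
          show "AE x in TN. indicator E x * f (a + b j x) \<le> indicator E x * f' (v j x) + indicator E x * k x"
            using ae by eventually_elim (auto simp: indicator_def k_def)
        qed (intro Bochner_Integration.integrable_add integrable_indicator_mult[OF E] ifa if' ikk)+
        also have "\<dots> = integral\<^sup>L TN (\<lambda>x. indicator E x * f' (v j x)) + integral\<^sup>L TN (\<lambda>x. indicator E x * k x)"
          by (intro Bochner_Integration.integral_add integrable_indicator_mult[OF E] if' ikk)
        finally have "measure TN E * f a - integral\<^sup>L TN (\<lambda>x. indicator E x * k x) \<le> integral\<^sup>L TN (\<lambda>x. indicator E x * f' (v j x)) + \<eta>" using elim by linarith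
        moreover have "integral\<^sup>L TN (\<lambda>x. indicator E x * (f a - 1 / real (Suc r) - C r * norm (u x - a))) = measure TN E * f a - integral\<^sup>L TN (\<lambda>x. indicator E x * k x)"
        proof -
          have "integral\<^sup>L TN (\<lambda>x. indicator E x * (f a - 1 / real (Suc r) - C r * norm (u x - a))) = integral\<^sup>L TN (\<lambda>x. indicator E x * f a - indicator E x * k x)"
            by (intro Bochner_Integration.integral_cong refl) (simp add: k_def algebra_simps)
          also have "\<dots> = integral\<^sup>L TN (\<lambda>x. indicator E x * f a) - integral\<^sup>L TN (\<lambda>x. indicator E x * k x)"
            by (intro Bochner_Integration.integral_diff integrable_indicator_mult[OF E] TN.integrable_const ikk)
          also have "integral\<^sup>L TN (\<lambda>x. indicator E x * f a) = measure TN E * f a" using integral_indicator_TN[OF E] by simp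
          finally show ?thesis .
        qed
        ultimately show ?case by simp
      qed
    qed
    have cD: "countable (D \<inter> cball 0 (M + 1))" using D(1) by simp
    \<comment> \<open>Only countably many \<open>a\<close> and \<open>r\<close> occur, so one null
      set serves all of them, and \<open>a\<close> may then be chosen depending on
      \<open>x\<close>.\<close>
    have "AE x in TN. \<forall>a\<in>D \<inter> cball 0 (M + 1). \<forall>r. f a - 1 / real (Suc r) - C r * norm (u x - a) \<le> sm_int (\<nu> x) f'"
      by (intro AE_ball_countable[THEN iffD2, OF cD] ballI AE_all_countable[THEN iffD2] allI key) auto
    then show ?thesis using bu prob
    proof eventually_elim
      case (elim x)
      have eqf: "sm_int (\<nu> x) f' = sm_int (\<nu> x) f"
        by (rule prob_on_cong[OF elim(3)]) (auto simp: f'_def cutoff_eq_1 cf intro!: continuous_intros continuous_cutoff)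
      show ?case
      proof (rule field_le_epsilon)
        fix e :: real assume e: "e > 0"
        obtain r :: nat where r: "1 / real (Suc r) < e / 3" using nat_approx_posE[of "e / 3"] e by auto
        have "isCont f (u x)" using cf by (simp add: continuous_on_eq_continuous_at)
        then obtain \<delta> where \<delta>: "\<delta> > 0" "\<And>y. dist y (u x) < \<delta> \<Longrightarrow> dist (f y) (f (u x)) < e / 3"
          using e unfolding continuous_at_eps_delta by (metis zero_less_divide_iff zero_less_numeral)
        \<comment> \<open>\<open>r\<close> is fixed first because the slope \<open>C r\<close>
          depends on it. The radius keeps \<open>f a\<close> close to \<open>f (u x)\<close>, keeps
          \<open>a\<close> in the admissible ball, and makes the slope term at most
          \<open>e / 3\<close>.\<close>
        define \<rho> where "\<rho> = min (min \<delta> 1) (e / (3 * (C r + 1)))"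
        have \<rho>: "\<rho> > 0" "\<rho> \<le> \<delta>" "\<rho> \<le> 1" using \<delta>(1) e C0[of r] by (auto simp: \<rho>_def)
        have "C r * \<rho> \<le> C r * (e / (3 * (C r + 1)))" using C0[of r] by (intro mult_left_mono) (auto simp: \<rho>_def)
        also have "\<dots> \<le> e / 3" using e C0[of r] by (simp add: field_simps)
        finally have C\<rho>: "C r * \<rho> \<le> e / 3" .
        obtain a where a: "a \<in> D" "a \<in> ball (u x) \<rho>" using D(2)[of "ball (u x) \<rho>"] \<rho>(1) by auto
        have na: "norm (u x - a) < \<rho>" using a(2) by (simp add: dist_norm)
        have "norm a \<le> norm (u x) + norm (u x - a)" by norm
        then have "a \<in> D \<inter> cball 0 (M + 1)" using a(1) na \<rho>(3) elim(2) by simp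
        then have 1: "f a - 1 / real (Suc r) - C r * norm (u x - a) \<le> sm_int (\<nu> x) f'" using elim(1) by blast
        have "C r * norm (u x - a) \<le> C r * \<rho>" using na C0[of r] by (intro mult_left_mono) auto
        moreover have "\<bar>f a - f (u x)\<bar> < e / 3" using \<delta>(2)[of a] na \<rho>(2) by (simp add: dist_norm norm_minus_commute)
        ultimately show "f (u x) \<le> sm_int (\<nu> x) f + e" using 1 r C\<rho> unfolding eqf by linarith
      qed
    qed
  qed
  obtain h :: "nat \<Rightarrow> real^'d \<Rightarrow> real" where
    h2: "\<forall>f R e. continuous_on UNIV f \<and> e > 0 \<longrightarrow> (\<exists>n. \<forall>y\<in>cball 0 R. \<bar>f y - h n y\<bar> \<le> e)"
    using countable_test_family by (elim exE conjE)
  \<comment> \<open>There are uncountably many quasiconvex functions and the dense family need not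
    contain any. Choosing one quasiconvex function near each member, where possible, gives a
    countable family that approximates every quasiconvex function on the ball of radius
    \<open>M\<close>.\<close>
  define near where "near n r f \<longleftrightarrow> A_quasiconvex A f \<and> (\<forall>y\<in>cball 0 M. \<bar>f y - h n y\<bar> \<le> 1 / real (Suc r))" for n r :: nat and f
  \<comment> \<open>The default 0 is quasiconvex too, so Jensen's inequality may be invoked for
    every pair of indices without a case distinction.\<close>
  define F where "F n r = (if \<exists>f. near n r f then (SOME f. near n r f) else (\<lambda>_. 0))" for n r
  have F1: "near n r (F n r)" if "near n r f" for n r f
  proof -
    have ex: "\<exists>f. near n r f" by (rule exI[where x=f], rule that)
    then have "F n r = (SOME f. near n r f)" unfolding F_def by (rule if_P)
    then show ?thesis using someI_ex[OF ex] by simp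
  qed
  have Fq: "A_quasiconvex A (F n r)" for n r
  proof (cases "\<exists>f. near n r f")
    case True
    then obtain f where "near n r f" by (elim exE)
    from F1[OF this] show ?thesis by (simp add: near_def)
  next
    case False
    then have "F n r = (\<lambda>_. 0)" unfolding F_def by (rule if_not_P)
    then show ?thesis using A_quasiconvex_const[of A 0] by simp
  qed
  have "AE x in TN. \<forall>n r. F n r (u x) \<le> sm_int (\<nu> x) (F n r)"
    unfolding AE_all_countable by (intro allI jensen1 Fq)
  then have jen: "AE x in TN. \<forall>f. A_quasiconvex A f \<longrightarrow> sm_int (\<nu> x) f \<ge> f (sm_int (\<nu> x) (\<lambda>y. y))"
    using bar prob
  proof eventually_elim
    case (elim x)
    have ub: "u x \<in> cball 0 M" using elim(2) by simp
    show ?case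
    proof (intro allI impI)
      fix f assume f: "A_quasiconvex A f"
      then have cf: "continuous_on UNIV f" by (simp add: A_quasiconvex_def)
      have "f (u x) \<le> sm_int (\<nu> x) f"
      proof (rule field_le_epsilon)
        fix e :: real assume e: "e > 0"
        obtain r :: nat where r: "1 / real (Suc r) < e / 4" using nat_approx_posE[of "e / 4"] e by auto
        have r0: "0 < 1 / real (Suc r)" by simp
        obtain n where n: "\<forall>y\<in>cball 0 M. \<bar>f y - h n y\<bar> \<le> 1 / real (Suc r)" using h2[rule_format, OF conjI[OF cf r0], of M] by (elim exE)
        then have "near n r f" using f by (simp add: near_def)
        from F1[OF this] have Fn: "\<forall>y\<in>cball 0 M. \<bar>F n r y - h n y\<bar> \<le> 1 / real (Suc r)" by (simp add: near_def)
        have cF: "continuous_on UNIV (F n r)" using Fq[of n r] by (simp add: A_quasiconvex_def)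
        \<comment> \<open>Both functions are within \<open>1 / Suc r < e / 4\<close> of the same
          \<open>h n\<close>. The resulting \<open>e / 2\<close> is spent twice, once under the
          integral and once at \<open>u x\<close>.\<close>
        have close: "\<bar>F n r y - f y\<bar> \<le> e / 2" if "norm y \<le> M" for y
        proof -
          have "\<bar>f y - h n y\<bar> \<le> 1 / real (Suc r)" "\<bar>F n r y - h n y\<bar> \<le> 1 / real (Suc r)" using n Fn that by simp_all
          then show ?thesis using r by linarith
        qed
        have "\<bar>sm_int (\<nu> x) (F n r) - sm_int (\<nu> x) f\<bar> \<le> e / 2" by (rule prob_on_diff[OF elim(3) cF cf close])
        moreover have "\<bar>F n r (u x) - f (u x)\<bar> \<le> e / 2" using ub by (intro close) simp
        moreover have "F n r (u x) \<le> sm_int (\<nu> x) (F n r)" using elim(1) by blast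
        ultimately show "f (u x) \<le> sm_int (\<nu> x) f + e" by linarith
      qed
      then show "sm_int (\<nu> x) f \<ge> f (sm_int (\<nu> x) (\<lambda>y. y))" using elim(2) by simp
    qed
  qed
  have supp: "AE x in TN. sm_support (\<nu> x) \<subseteq> cball 0 M"
    using good
  proof eventually_elim
    case (elim x)
    have "open {y :: real^'d. norm y > M}" by (intro open_Collect_less continuous_intros)
    then have "{y. norm y > M} \<subseteq> \<Union>{U. open U \<and> emeasure (fst (\<nu> x)) U = 0 \<and> emeasure (snd (\<nu> x)) U = 0}" using elim by blast
    then show ?case unfolding sm_support_def by (auto simp: not_le[symmetric])
  qed
  have "AE x in TN. sm_nonneg (\<nu> x)" using good by eventually_elim simp
  moreover have "AE x in TN. sm_int (\<nu> x) (\<lambda>y. y) = u x" using bar by eventually_elim simp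
  ultimately show ?thesis using Lu ku supp jen by (intro conjI exI[of _ "cball 0 M"] exI[of _ u] compact_cball)
qed

theorem theorem5p15:
  fixes A :: "'n::finite \<Rightarrow> real^'d::finite^'l::finite"
    and \<nu> :: "real^'n \<Rightarrow> (real^'d) smeasure"
  assumes "constant_rank A"
    and "property_ZL A"
    and "wstar_measurable \<nu>"
  shows "A_infty_YM A \<nu> \<longleftrightarrow>
    (AE x in TN. sm_nonneg (\<nu> x)) \<and>
    (\<exists>K u. compact K \<and> LinfT u \<and> kerA A u \<and>
       (AE x in TN. sm_support (\<nu> x) \<subseteq> K) \<and>
       (AE x in TN. sm_int (\<nu> x) (\<lambda>y. y) = u x) \<and>
       (AE x in TN. \<forall>f. A_quasiconvex A f \<longrightarrow> sm_int (\<nu> x) f \<ge> f (sm_int (\<nu> x) (\<lambda>y. y))))"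
  by (rule iffI, erule necessity[OF assms], elim conjE exE, rule sufficiency[OF assms])

end
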